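(* Assume $\epsilon\ll d\ll\lambda$. Let $u_\epsilon$ be the solution of the PEC-PMC cavity scattering problem and let $Q_{\boldsymbol E}$, $Q_{\boldsymbol H}$ be the electric and magnetic field enhancement factors in the cavity $D_\epsilon$. There exists a constant $\epsilon_0>0$ depending on $\lambda$ and $d$ such that for all $0<\epsilon<\epsilon_0$, $$C_1\,(\lambda/d)\le Q_{\boldsymbol E}\le C_2\,(\lambda/d),\qquad C_1\le Q_{\boldsymbol H}\le C_2,$$ where $C_1$ and $C_2$ are positive constants independent of $\lambda,\epsilon_0,\epsilon,d$.
   Context: Geometry: for $\epsilon,d>0$ let $D_\epsilon=\{\boldsymbol x=(x_1,x_2)\in\mathbb R^2:0<x_1<\epsilon,\,-d<x_2<0\}$ (the cavity), $\Gamma_\epsilon^+=\{0<x_1<\epsilon,\ x_2=0\}$ (open aperture), $\Gamma_\epsilon^-=\{0<x_1<\epsilon,\ x_2=-d\}$ (bottom), $\mathbb R^2_+=\{x_2>0\}$, and let $\Omega$ be the union of $\mathbb R^2_+$ and $D_\epsilon$ joined through the aperture $\Gamma_\epsilon^+$; $\nu$ is the unit outward normal on $\partial\Omega$. Incident field: $\kappa>0$ is the wavenumber, $\lambda=2\pi/\kappa$ the wavelength, $\theta\in(-\pi/2,\pi/2)$ the incident angle, $u^{\rm inc}(\boldsymbol x)=e^{{\rm i}\kappa(x_1\sin\theta-x_2\cos\theta)}$, $u^{\rm ref}(\boldsymbol x)=e^{{\rm i}\kappa(x_1\sin\theta+x_2\cos\theta)}$. PEC-PMC problem: $u_\epsilon$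 satisfies $\Delta u_\epsilon+\kappa^2u_\epsilon=0$ in $\Omega$, $\partial_\nu u_\epsilon=0$ on $\partial\Omega\setminus\Gamma_\epsilon^-$, $u_\epsilon=0$ on $\Gamma_\epsilon^-$, and the scattered field $u^{\rm sc}_\epsilon=u_\epsilon-(u^{\rm inc}+u^{\rm ref})$ in $\mathbb R^2_+$ satisfies $\lim_{r\to\infty}\sqrt r(\partial_ru^{\rm sc}_\epsilon-{\rm i}\kappa u^{\rm sc}_\epsilon)=0$, $r=|\boldsymbol x|$. The magnetic fields are $\boldsymbol H_\epsilon=(0,0,u_\epsilon)$, $\boldsymbol H^{\rm inc}=(0,0,u^{\rm inc})$, and the electric fields are given by Ampere's law $\nabla\times\boldsymbol H=-{\rm i}\omega\varepsilon\boldsymbol E$, where the angular frequency $\omega>0$ and permittivity $\varepsilon>0$ are constants. The enhancement factors are $$Q_{\boldsymbol E}=\frac{\|\boldsymbol E_\epsilon\|_{L^2(D_\epsilon)}}{\|\boldsymbol E^{\rm inc}\|_{L^2(D_\epsilon)}}=\frac{\|\nabla u_\epsilon\|_{L^2(D_\epsilon)}}{\|\nabla u^{\rm inc}\|_{L^2(D_\epsilon)}},\qquad Q_{\boldsymbol H}=\frac{\|\boldsymbol H_\epsilon\|_{L^2(D_\epsilon)}}{\|\boldsymbol H^{\rm inc}\|_{L^2(D_\epsilon)}}=\frac{\|u_\epsilon\|_{L^2(D_\epsilon)}}{\|u^{\rm inc}\|_{L^2(D_\epsilon)}}.$$ Convention: $\epsilon\ll d\ll\lambda$ means that $d/\lambda$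 is sufficiently small (below an absolute constant) and $\epsilon$ is sufficiently small compared with $d$ and $\lambda$ (below a threshold that may depend on $d$ and $\lambda$). *)

theory Defs
  imports "HOL-Analysis.Analysis"
begin

definition cavity :: "real \<Rightarrow> real \<Rightarrow> (real^2) set" where
  "cavity \<epsilon> d = {x. 0 < x $ 1 \<and> x $ 1 < \<epsilon> \<and> - d < x $ 2 \<and> x $ 2 < 0}"

definition aperture :: "real \<Rightarrow> (real^2) set" where
  "aperture \<epsilon> = {x. 0 < x $ 1 \<and> x $ 1 < \<epsilon> \<and> x $ 2 = 0}"

definition bottom :: "real \<Rightarrow> real \<Rightarrow> (real^2) set" where
  "bottom \<epsilon> d = {x. 0 < x $ 1 \<and> x $ 1 < \<epsilon> \<and> x $ 2 = - d}"

definition upper_half_plane :: "(real^2) set" where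
  "upper_half_plane = {x. 0 < x $ 2}"

definition Omega :: "real \<Rightarrow> real \<Rightarrow> (real^2) set" where
  "Omega \<epsilon> d = upper_half_plane \<union> aperture \<epsilon> \<union> cavity \<epsilon> d"

definition corners :: "real \<Rightarrow> real \<Rightarrow> (real^2) set" where
  "corners \<epsilon> d = {vector [0, 0], vector [\<epsilon>, 0], vector [0, - d], vector [\<epsilon>, - d]}"

text \<open>Unit outward normal at the points of the frontier of \<open>Omega \<epsilon> d\<close> other than the four corners,
  where it is undefined. The case analysis is meaningful only at those points: the horizontal pieces
  are \<open>x $ 2 = 0\<close> (outside the aperture) and the bottom, the vertical ones the two cavity walls.\<close>

definition outward_normal :: "real \<Rightarrow> real^2 \<Rightarrow> real^2" where
  "outward_normal d x =
     (if x $ 2 = 0 \<or> x $ 2 = - d then vector [0, - 1]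
      else if x $ 1 = 0 then vector [- 1, 0]
      else vector [1, 0])"

definition dir_deriv :: "(real^2 \<Rightarrow> complex) \<Rightarrow> real^2 \<Rightarrow> real^2 \<Rightarrow> complex" where
  "dir_deriv f v x = vector_derivative (\<lambda>t. f (x + t *\<^sub>R v)) (at 0)"

abbreviation partial :: "2 \<Rightarrow> (real^2 \<Rightarrow> complex) \<Rightarrow> real^2 \<Rightarrow> complex" where
  "partial i f x \<equiv> dir_deriv f (axis i 1) x"

definition C2_on :: "(real^2) set \<Rightarrow> (real^2 \<Rightarrow> complex) \<Rightarrow> bool" where
  "C2_on S f \<longleftrightarrow> f differentiable_on S \<and> (\<forall>i. partial i f differentiable_on S) \<and>
     (\<forall>i j. continuous_on S (partial j (partial i f)))"

definition laplacian :: "(real^2 \<Rightarrow> complex) \<Rightarrow> real^2 \<Rightarrow> complex" where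
  "laplacian f x = (\<Sum>i\<in>UNIV. partial i (partial i f) x)"

definition u_inc :: "real \<Rightarrow> real \<Rightarrow> real^2 \<Rightarrow> complex" where
  "u_inc \<kappa> \<theta> x = exp (\<i> * complex_of_real (\<kappa> * (x $ 1 * sin \<theta> - x $ 2 * cos \<theta>)))"

definition u_ref :: "real \<Rightarrow> real \<Rightarrow> real^2 \<Rightarrow> complex" where
  "u_ref \<kappa> \<theta> x = exp (\<i> * complex_of_real (\<kappa> * (x $ 1 * sin \<theta> + x $ 2 * cos \<theta>)))"

definition wavelength :: "real \<Rightarrow> real" where
  "wavelength \<kappa> = 2 * pi / \<kappa>"

text \<open>The Sommerfeld condition for a field on the upper half-plane, uniformly in the direction.
  Here \<open>sgn x\<close> is the unit radial vector, so \<open>dir_deriv v (sgn x) x\<close> is the radial derivative.\<close>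

definition sommerfeld :: "real \<Rightarrow> (real^2 \<Rightarrow> complex) \<Rightarrow> bool" where
  "sommerfeld \<kappa> v \<longleftrightarrow>
     ((\<lambda>x. complex_of_real (sqrt (norm x)) * (dir_deriv v (sgn x) x - \<i> * complex_of_real \<kappa> * v x))
        \<longlongrightarrow> 0) (inf at_infinity (principal upper_half_plane))"

text \<open>Finite energy on bounded parts of the domain is the usual edge condition; it excludes
  the singular behaviour of order \<open>r powr (- 2/3)\<close> at the re-entrant corners, without which
  the solution is not unique.\<close>

definition finite_energy :: "(real^2) set \<Rightarrow> (real^2 \<Rightarrow> complex) \<Rightarrow> bool" where
  "finite_energy S u \<longleftrightarrow>
     (\<forall>R>0. set_integrable lborel (S \<inter> ball 0 R)
        (\<lambda>x. (norm (u x))\<^sup>2 + (\<Sum>i\<in>UNIV. (norm (partial i u x))\<^sup>2)))"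

text \<open>Boundary values of \<open>u\<close> and of its normal derivative are limits from inside \<open>Omega \<epsilon> d\<close>.\<close>

definition pec_pmc_solution ::
  "real \<Rightarrow> real \<Rightarrow> real \<Rightarrow> real \<Rightarrow> (real^2 \<Rightarrow> complex) \<Rightarrow> bool" where
  "pec_pmc_solution \<epsilon> d \<kappa> \<theta> u \<longleftrightarrow>
     C2_on (Omega \<epsilon> d) u \<and>
     finite_energy (Omega \<epsilon> d) u \<and>
     (\<forall>x\<in>Omega \<epsilon> d. laplacian u x + complex_of_real (\<kappa>\<^sup>2) * u x = 0) \<and>
     (\<forall>x\<in>frontier (Omega \<epsilon> d) - bottom \<epsilon> d - corners \<epsilon> d.
        ((\<lambda>y. dir_deriv u (outward_normal d x) y) \<longlongrightarrow> 0) (at x within Omega \<epsilon> d)) \<and>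
     (\<forall>x\<in>bottom \<epsilon> d. (u \<longlongrightarrow> 0) (at x within Omega \<epsilon> d)) \<and>
     sommerfeld \<kappa> (\<lambda>x. u x - (u_inc \<kappa> \<theta> x + u_ref \<kappa> \<theta> x))"

text \<open>Fields with three components that do not depend on the third coordinate are functions
  of \<open>real^2\<close>; in \<open>planar_curl\<close> the derivatives in the third coordinate therefore vanish.\<close>

definition planar_curl :: "(real^2 \<Rightarrow> complex^3) \<Rightarrow> real^2 \<Rightarrow> complex^3" where
  "planar_curl F x = vector
     [partial 2 (\<lambda>y. F y $ 3) x,
      - partial 1 (\<lambda>y. F y $ 3) x,
      partial 1 (\<lambda>y. F y $ 2) x - partial 2 (\<lambda>y. F y $ 1) x]"

definition H_field :: "(real^2 \<Rightarrow> complex) \<Rightarrow> real^2 \<Rightarrow> complex^3" where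
  "H_field u x = vector [0, 0, u x]"

text \<open>Ampere's law \<open>curl H = - \<i> \<omega> \<eta> E\<close>, solved for \<open>E\<close>; \<open>\<eta>\<close> is the permittivity.\<close>

definition E_field :: "real \<Rightarrow> real \<Rightarrow> (real^2 \<Rightarrow> complex) \<Rightarrow> real^2 \<Rightarrow> complex^3" where
  "E_field \<omega> \<eta> u x = (1 / (- \<i> * complex_of_real (\<omega> * \<eta>))) *s planar_curl (H_field u) x"

definition L2_norm_on :: "(real^2) set \<Rightarrow> (real^2 \<Rightarrow> complex^3) \<Rightarrow> real" where
  "L2_norm_on S F = sqrt (set_lebesgue_integral lborel S (\<lambda>x. (norm (F x))\<^sup>2))"

definition Q_E :: "real \<Rightarrow> real \<Rightarrow> real \<Rightarrow> real \<Rightarrow> real \<Rightarrow> real \<Rightarrow> (real^2 \<Rightarrow> complex) \<Rightarrow> real" where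
  "Q_E \<omega> \<eta> \<epsilon> d \<kappa> \<theta> u =
     L2_norm_on (cavity \<epsilon> d) (E_field \<omega> \<eta> u) /
     L2_norm_on (cavity \<epsilon> d) (E_field \<omega> \<eta> (u_inc \<kappa> \<theta>))"

definition Q_H :: "real \<Rightarrow> real \<Rightarrow> real \<Rightarrow> real \<Rightarrow> (real^2 \<Rightarrow> complex) \<Rightarrow> real" where
  "Q_H \<epsilon> d \<kappa> \<theta> u =
     L2_norm_on (cavity \<epsilon> d) (H_field u) /
     L2_norm_on (cavity \<epsilon> d) (H_field (u_inc \<kappa> \<theta>))"

end

theory Submission
  imports Defs "HOL-Real_Asymp.Real_Asymp"
begin

text \<open>Let G be the sum of the incident and reflected waves and Ph = u - h, where h is G above the aperture and is
damped to 0 towards the bottom. Testing the equation with the conjugate of Ph, cut off at a radius comparable to the wavelength and near the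
walls and corners, yields an energy identity whose source lives in the cavity and has size sqrt (ep / d) times the
energy norm. In the logarithmic polar coordinates t = ln (kp r), the scattered field expands in
modes V n t * cos (n p) with V n'' = (n^2 - exp (2 t)) V n. Radiation makes the flux Im (V n' * cnj (V n)) nonnegative,
and a Rellich type monotone quantity then bounds Re (V n' * cnj (V n)), so the radial cutoff term of the energy
identity has a favourable sign up to a multiple of the flux, which the imaginary part of the same identity controls.
With the Poincare inequality from the bottom this gives energies of order ep / d, hence the upper bounds.
For the lower bounds, G is close to 2 at the aperture while Ph is small just above it: integrating along vertical
segments through the aperture, u cannot be small in the cavity, and the Poincare inequality transfers this to grad u.\<close>

text \<open>The obstacle is that \<open>u\<close> has no known regularity at the corners and that
  its Neumann condition is a pointwise limit away from them. Every integration by parts up to the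
  boundary is therefore done with cutoffs and a passage to the limit: \<open>weak_form\<close> in
  the plane, \<open>V_ode\<close> for the angular modes. Logarithmic coordinates are used because
  the Dirichlet integral is conformally invariant, while the Helmholtz term only acquires the weight
  \<open>exp (2 * t)\<close>, small where kp r is small. The values -4, -2, -1 of t at which the
  cutoff is anchored are absolute, hence so are the constants; smallness of \<open>kp * d\<close>
  serves to absorb the Helmholtz term of the cavity. The mode n = 0 has no angular energy to pay for
  its cutoff term, so it alone is estimated by the flux. The subtlest condition on ep comes from the
  lower bound: in two dimensions, going from radius \<open>exp (-4) / kp\<close> down to a radius
  comparable to ep costs a logarithm, and \<open>ep / d\<close> times this logarithm tends to 0 with
  ep, but not uniformly in d and kp.\<close>

abbreviation sint :: "'a::euclidean_space set \<Rightarrow> ('a \<Rightarrow> 'b::{banach, second_countable_topology}) \<Rightarrow> bool" where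
  "sint \<equiv> set_integrable lborel"

abbreviation nsq :: "complex \<Rightarrow> real" where "nsq z \<equiv> (cmod z)\<^sup>2"

notation scaleR (infixr "*R" 75)

abbreviation tends_to (infix "---->" 60) where "tends_to X L \<equiv> X \<longlonglongrightarrow> L"

abbreviation ind where "ind \<equiv> indicator"

lemmas sint_def = set_integrable_def and int_def = set_lebesgue_integral_def

syntax "_lint" :: "pttrn \<Rightarrow> 'a set \<Rightarrow> real \<Rightarrow> real" ("(3SINT _:_./ _)" [0, 60, 10] 10)
translations "SINT x:A. f" \<rightharpoonup> "CONST set_lebesgue_integral (CONST lborel) A (\<lambda>x. f)"


section \<open>Radiating solutions of the mode equation\<close>

text \<open>\<open>p\<close> and \<open>q\<close> are the real and imaginary parts of V,
  \<open>p1\<close> and \<open>q1\<close> those of V'. The hypothesis \<open>radiation\<close> is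
  |V' - i exp t V|^2 / exp t -> 0, Sommerfeld's condition rewritten with d/dt = r d/dr.\<close>

locale bessel_mode =
 fixes p p1 q q1 :: "real => real" and n :: nat and t0 :: real
 assumes dp: "!!t. t > t0 ==> (p has_real_derivative p1 t) (at t)"
  and dq: "!!t. t > t0 ==> (q has_real_derivative q1 t) (at t)"
  and dp1: "!!t. t > t0 ==> (p1 has_real_derivative ((real n)^2 - (exp t)^2) * p t) (at t)"
  and dq1: "!!t. t > t0 ==> (q1 has_real_derivative ((real n)^2 - (exp t)^2) * q t) (at t)"
  and radiation: "((%t. ((p1 t + exp t * q t)^2 + (q1 t - exp t * p t)^2) / exp t) \<longlongrightarrow> 0) at_top"
begin

definition flux where "flux t = q1 t * p t - p1 t * q t"

text \<open>With r = exp t, the function y = sqrt r V satisfies y'' + (1 - (n^2 - 1/4) / r^2) y = 0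
  in r, Bessel's equation in Liouville normal form. This is its energy |y'|^2 + (1 - (n^2 - 1/4) /
  r^2) |y|^2, whose derivative has the sign of n^2 - 1/4.\<close>

definition rellich where
 "rellich t = ((p1 t + p t / 2)^2 + (q1 t + q t / 2)^2
   + ((exp t)^2 - ((real n)^2 - 1/4)) * ((p t)^2 + (q t)^2)) / exp t"

text \<open>Up to a constant factor this is the Wronskian of V and its conjugate, which solve the
  same equation because the coefficient is real.\<close>

lemma flux_const: "s > t0 ==> t > t0 ==> flux s = flux t"
proof -
 have *: "(flux has_real_derivative 0) (at t)" if "t > t0" for t
  unfolding flux_def
  by (auto intro!: derivative_eq_intros dp dq dp1 dq1 that simp: algebra_simps)
 assume "s > t0" "t > t0"
 thus ?thesis
  by (intro DERIV_isconst3[of t0 "max s t + 1"] *) auto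
qed

lemma rellich_deriv:
 assumes "t > t0"
 shows "(rellich has_real_derivative
   2 * ((real n)^2 - 1/4) * ((p t)^2 + (q t)^2) / exp t) (at t)"
proof -
 let ?m = "(real n)^2 - 1/4"
 let ?N = "%t. (p1 t + p t / 2)^2 + (q1 t + q t / 2)^2 + ((exp t)^2 - ?m) * ((p t)^2 + (q t)^2)"
 have "(?N has_real_derivative ?N t + 2 * ?m * ((p t)^2 + (q t)^2)) (at t)"
  by (auto intro!: derivative_eq_intros dp dq dp1 dq1 assms simp: algebra_simps power2_eq_square)
 from DERIV_divide[OF this DERIV_exp]
 show ?thesis
  unfolding rellich_def by (rule DERIV_cong) (simp_all add: divide_simps algebra_simps)
qed

text \<open>Expanding the squares in \<open>radiation\<close> gives this energy minus
  \<open>2 * flux\<close>, and the flux is constant.\<close>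

lemma energy_limit:
 assumes "s > t0"
 shows "((%t. ((p1 t)^2 + (q1 t)^2) / exp t + exp t * ((p t)^2 + (q t)^2)) \<longlongrightarrow> 2 * flux s) at_top"
proof -
 have "((%t. ((p1 t + exp t * q t)^2 + (q1 t - exp t * p t)^2) / exp t + 2 * flux s) \<longlongrightarrow> 0 + 2 * flux s) at_top"
  by (intro tendsto_intros radiation)
 moreover have "\<forall>\<^sub>F t in at_top. ((p1 t + exp t * q t)^2 + (q1 t - exp t * p t)^2) / exp t + 2 * flux s
   = ((p1 t)^2 + (q1 t)^2) / exp t + exp t * ((p t)^2 + (q t)^2)"
  using eventually_gt_at_top[of t0]
 proof eventually_elim
  case (elim t)
  have "flux s = flux t" using flux_const assms elim by blast
  thus ?case
   unfolding \<open>flux s = flux t\<close> by (simp add: flux_def field_simps power2_eq_square)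
 qed
 ultimately show ?thesis
  by (simp add: filterlim_cong[OF refl refl])
qed

lemma flux_nonneg: "s > t0 ==> flux s >= 0"
proof -
 assume s: "s > t0"
 have "2 * flux s >= 0"
  by (rule tendsto_lowerbound[OF energy_limit[OF s]]) (auto intro!: always_eventually)
 thus ?thesis by simp
qed

text \<open>The cross terms V' cnj V and the terms in |V|^2 by which \<open>rellich\<close> differs
  from the energy of \<open>energy_limit\<close> carry an extra factor \<open>exp (- t)\<close>
  relative to that energy.\<close>

lemma rellich_limit:
 assumes "s > t0"
 shows "(rellich \<longlongrightarrow> 2 * flux s) at_top"
proof -
 let ?e = "%t. ((p1 t)^2 + (q1 t)^2) / exp t + exp t * ((p t)^2 + (q t)^2)"
 let ?m = "(real n)^2 - 1/4"
 have bnd: "\<bar>rellich t - ?e t\<bar> <= (1 + \<bar>?m\<bar>) * (?e t * exp (- t))" if "t > 0" for t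
 proof -
  have e: "exp t > 1" using that by simp
  have A: "rellich t - ?e t = (p1 t * p t + q1 t * q t) / exp t + (1/4 - ?m) * ((p t)^2 + (q t)^2) / exp t"
  proof -
   have "exp t * ((p t)^2 + (q t)^2) = (exp t)^2 * ((p t)^2 + (q t)^2) / exp t"
    by (simp add: power2_eq_square)
   thus ?thesis
    unfolding rellich_def add_divide_distrib[symmetric] diff_divide_distrib[symmetric]
    by (simp only: add_divide_distrib[symmetric] diff_divide_distrib[symmetric])
      (rule arg_cong2[where f = "(/)"], simp_all add: algebra_simps power2_eq_square)
  qed
  have ab: "\<bar>x * y\<bar> <= (x^2 / exp t + exp t * y^2) / 2" for x y
  proof -
   have "0 <= (\<bar>x\<bar> - exp t * \<bar>y\<bar>)^2 / exp t" by simp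
   thus ?thesis by (simp add: power2_eq_square field_simps abs_mult)
  qed
  have ar: "\<bar>x + y\<bar> <= (1 + M) * e" if "\<bar>y\<bar> <= (1/4 + M) * e" "e >= 0" "\<bar>x\<bar> <= e / 2" for x y M e :: real
   by (rule order_trans[OF abs_triangle_ineq]) (use that in \<open>simp add: algebra_simps\<close>)
  have 1: "\<bar>p1 t * p t + q1 t * q t\<bar> <= ?e t / 2"
   using ab[of "p1 t" "p t"] ab[of "q1 t" "q t"] abs_triangle_ineq[of "p1 t * p t" "q1 t * q t"]
   by (simp add: add_divide_distrib distrib_left)
  have "(p t)^2 + (q t)^2 <= exp t * ((p t)^2 + (q t)^2)"
   using e mult_right_mono[of 1 "exp t" "(p t)^2 + (q t)^2"] by simp
  also have "... <= ?e t" by simp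
  finally have 2: "(p t)^2 + (q t)^2 <= ?e t" .
  have "\<bar>(1/4 - ?m) * ((p t)^2 + (q t)^2)\<bar> <= (1/4 + \<bar>?m\<bar>) * ?e t"
   unfolding abs_mult using 2 by (intro mult_mono) auto
  moreover have "?e t >= 0" by simp
  ultimately have 3: "\<bar>p1 t * p t + q1 t * q t + (1/4 - ?m) * ((p t)^2 + (q t)^2)\<bar> <= (1 + \<bar>?m\<bar>) * ?e t"
   using 1 by (rule ar)
  have "rellich t - ?e t = ((p1 t * p t + q1 t * q t) + (1/4 - ?m) * ((p t)^2 + (q t)^2)) * exp (- t)"
   unfolding A by (simp only: exp_minus divide_inverse distrib_right)
  hence "\<bar>rellich t - ?e t\<bar> = \<bar>(p1 t * p t + q1 t * q t) + (1/4 - ?m) * ((p t)^2 + (q t)^2)\<bar> * exp (- t)"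
   by (simp add: abs_mult)
  also have "... <= ((1 + \<bar>?m\<bar>) * ?e t) * exp (- t)"
   by (rule mult_right_mono[OF 3]) simp
  finally show ?thesis unfolding mult.assoc .
 qed
 have z: "((%t::real. exp (- t)) \<longlongrightarrow> 0) at_top"
  by (rule filterlim_compose[OF exp_at_bot filterlim_uminus_at_bot_at_top])
 have "((%t. (1 + \<bar>?m\<bar>) * (?e t * exp (- t))) \<longlongrightarrow> (1 + \<bar>?m\<bar>) * (2 * flux s * 0)) at_top"
  by (intro tendsto_mult tendsto_const energy_limit[OF assms] z)
 hence lim: "((%t. (1 + \<bar>?m\<bar>) * (?e t * exp (- t))) \<longlongrightarrow> 0) at_top"
  by (simp only: mult_zero_right)
 have "((%t. rellich t - ?e t) \<longlongrightarrow> 0) at_top"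
 proof (rule Lim_null_comparison[OF _ lim])
  show "\<forall>\<^sub>F t in at_top. norm (rellich t - ?e t) <= (1 + \<bar>?m\<bar>) * (?e t * exp (- t))"
   using eventually_gt_at_top[of 0] by eventually_elim (use bnd in \<open>simp only: real_norm_def\<close>)
 qed
 from tendsto_add[OF this energy_limit[OF assms]] show ?thesis by simp
qed

text \<open>For n >= 1 the quantity \<open>rellich\<close> increases, so it is bounded by its limit
  \<open>2 * flux\<close>. The resulting bound on the logarithmic derivative of |V| is what the n^2
  in the angular energy can pay for.\<close>

lemma mode_ratio:
 assumes n: "n >= 1" and t: "t > t0"
 shows "p1 t * p t + q1 t * q t <= (real n - 1/2) * ((p t)^2 + (q t)^2)"
proof -
 let ?P = "(p t)^2 + (q t)^2"
 let ?m = "(real n)^2 - 1/4"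
 have n1: "real n >= 1" using n by simp
 have m: "?m >= 0" using power_mono[OF n1, of 2] by simp
 have "rellich t <= 2 * flux t"
 proof (rule tendsto_lowerbound[OF rellich_limit[OF t]])
  show "\<forall>\<^sub>F x in at_top. rellich t <= rellich x"
   using eventually_gt_at_top[of t]
  proof eventually_elim
   case (elim x)
   show ?case
   proof (rule DERIV_nonneg_imp_nondecreasing[where f = rellich])
    show "t <= x" using elim by simp
    fix s assume "t <= s"
    hence "s > t0" using t by simp
    thus "\<exists>y. DERIV rellich s :> y \<and> y >= 0"
     using rellich_deriv[of s] m by (intro exI conjI) auto
   qed
  qed
 qed simp
 hence R: "(p1 t + p t / 2)^2 + (q1 t + q t / 2)^2 + ((exp t)^2 - ?m) * ?P <= 2 * flux t * exp t"
  unfolding rellich_def by (simp add: field_simps)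
 \<comment> \<open>x + i y = V' + V/2 - i exp t V. The flux is the cross term of its square, so the
   bound on \<open>rellich\<close> says |x + i y|^2 <= (n^2 - 1/4) |V|^2; pairing with cnj V removes
   the imaginary term i exp t |V|^2.\<close>
 define x y where "x = p1 t + p t / 2 + exp t * q t" and "y = q1 t + q t / 2 - exp t * p t"
 have S: "x^2 + y^2 <= ?m * ?P"
 proof -
  have "x^2 + y^2 = (p1 t + p t / 2)^2 + (q1 t + q t / 2)^2 + (exp t)^2 * ?P - 2 * flux t * exp t"
   unfolding x_def y_def flux_def by (simp add: power2_eq_square field_simps)
  also have "... <= ?m * ?P" using R by (simp add: algebra_simps)
  finally show ?thesis .
 qed
 have E: "p1 t * p t + q1 t * q t + ?P / 2 = x * p t + y * q t"
  unfolding x_def y_def by (simp add: power2_eq_square field_simps)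
 have "2 * (x * p t) <= x^2 / real n + real n * (p t)^2" for x p
 proof -
  have "0 <= (x - real n * p t)^2 / real n" by simp
  thus ?thesis using n1 by (simp add: power2_eq_square field_simps)
 qed
 from this[of x p] this[of y q]
 have "2 * (x * p t + y * q t) <= (x^2 + y^2) / real n + real n * ?P"
  by (simp add: add_divide_distrib algebra_simps)
 also have "... <= ?m * ?P / real n + real n * ?P"
  using S n1 by (simp add: divide_right_mono)
 also have "... <= 2 * real n * ?P"
 proof -
  have "?m / real n <= real n" using n1 by (simp add: field_simps power2_eq_square)
  hence "?m / real n * ?P <= real n * ?P" by (intro mult_right_mono) auto
  thus ?thesis by (simp add: algebra_simps)
 qed
 finally have "2 * (p1 t * p t + q1 t * q t + ?P / 2) <= 2 * (real n * ?P)"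
  unfolding E by simp
 hence "p1 t * p t + q1 t * q t + ?P / 2 <= real n * ?P"
  by (rule mult_left_le_imp_le) simp
 thus ?thesis by (simp add: left_diff_distrib)
qed

text \<open>For n = 0 the quantity \<open>rellich\<close> decreases, but it dominates exp t |V|^2,
  so its relative rate of decrease is at most \<open>exp (- 2 * t) / 2\<close>. The integrating
  factor in \<open>g\<close> compensates exactly this rate: \<open>g\<close> is nondecreasing and
  has the same limit \<open>2 * flux\<close>.\<close>

lemma zero_mode_bound:
 assumes n: "n = 0" and t: "t > t0"
 shows "((p1 t + p t / 2)^2 + (q1 t + q t / 2)^2 + ((exp t)^2 + 1/4) * ((p t)^2 + (q t)^2))
   <= 2 * exp t * exp (exp (- 2 * t) / 4) * flux t"
proof -
 define g where "g s = rellich s * exp (- exp (- 2 * s) / 4)" for s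
 let ?P = "%s. (p s)^2 + (q s)^2"
 have dg: "\<exists>y\<ge>0. (g has_real_derivative y) (at s)" if "s > t0" for s
 proof -
  have "(exp s)^2 * ?P s / exp s <= rellich s"
   unfolding rellich_def using n by (intro divide_right_mono) (auto simp: algebra_simps)
  hence r: "exp s * ?P s <= rellich s" by (simp add: power2_eq_square)
  have e2: "exp (- (2 * s)) * (exp s)^2 = 1"
   by (simp add: exp_minus power2_eq_square mult_exp_exp)
  let ?y = "(- ?P s / (2 * exp s) + rellich s * (exp (- 2 * s) / 2)) * exp (- exp (- 2 * s) / 4)"
  have d2: "((%s. exp (- exp (- 2 * s) / 4)) has_real_derivative
    exp (- exp (- 2 * s) / 4) * (exp (- 2 * s) / 2)) (at s)"
   by (auto intro!: derivative_eq_intros)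
  have "(g has_real_derivative ?y) (at s)"
   unfolding g_def
   by (rule DERIV_cong[OF DERIV_mult[OF rellich_deriv[OF that] d2]]) (simp add: n algebra_simps diff_divide_distrib)
  moreover have "?P s / (2 * exp s) <= rellich s * (exp (- 2 * s) / 2)"
  proof -
   have "?P s / (2 * exp s) = (exp s * ?P s) * (exp (- 2 * s) / 2)"
   proof -
    have "?P s / (2 * exp s) = (exp (- (2 * s)) * (exp s)^2) * ?P s / (2 * exp s)"
     unfolding e2 by simp
    also have "... = (exp s * ?P s) * (exp (- 2 * s) / 2)"
     by (simp add: power2_eq_square)
    finally show ?thesis .
   qed
   also have "... <= rellich s * (exp (- 2 * s) / 2)"
    by (rule mult_right_mono[OF r]) simp
   finally show ?thesis .
  qed
  hence "- ?P s / (2 * exp s) + rellich s * (exp (- 2 * s) / 2) >= 0"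
   unfolding minus_divide_left[symmetric] by linarith
  hence "?y >= 0" by (rule mult_nonneg_nonneg) simp
  ultimately show ?thesis by blast
 qed
 have z: "((%s::real. exp (- 2 * s)) \<longlongrightarrow> 0) at_top"
 proof (rule filterlim_compose[OF exp_at_bot])
  show "filterlim (%x::real. - 2 * x) at_bot at_top"
   by (rule filterlim_tendsto_neg_mult_at_bot[of _ "-2"]) (auto intro: filterlim_ident)
 qed
 have "(g \<longlongrightarrow> 2 * flux t * exp (- 0 / 4)) at_top"
  unfolding g_def by (intro tendsto_mult tendsto_exp tendsto_divide tendsto_minus tendsto_const rellich_limit[OF t] z) simp 
 hence "(g \<longlongrightarrow> 2 * flux t) at_top" by simp
 hence "g t <= 2 * flux t"
 proof (rule tendsto_lowerbound)
  show "\<forall>\<^sub>F x in at_top. g t <= g x"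
   using eventually_gt_at_top[of t]
  proof eventually_elim
   case (elim x)
   show ?case
   proof (rule DERIV_nonneg_imp_nondecreasing[where f = g])
    show "t <= x" using elim by simp
    fix s assume "t <= s"
    thus "\<exists>y. (g has_real_derivative y) (at s) \<and> 0 <= y"
     using dg[of s] t by auto
   qed
  qed
 qed simp
 hence "rellich t <= 2 * flux t * exp (exp (- 2 * t) / 4)"
  unfolding g_def by (simp add: exp_minus field_simps)
 thus ?thesis
  unfolding rellich_def using n by (simp add: field_simps)
qed

end

section \<open>Square-integrable functions\<close>

definition sq_int :: "'a measure => ('a => complex) => bool" where
 "sq_int m f \<longleftrightarrow> f : borel_measurable m \<and> integrable m (%x. nsq (f x))"

lemma borel_measurable_cnj [measurable]:
 "f : borel_measurable m ==> (%x. cnj (f x)) : borel_measurable m"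
 by (rule borel_measurable_continuous_on[where f = cnj]) (auto intro: continuous_intros)

lemma norm_le_sq: "cmod z <= 1 + nsq z"
proof -
 have "0 <= (cmod z - 1/2)^2" by simp
 thus ?thesis by (simp add: power2_eq_square field_simps)
qed

lemma (in finite_measure) sq_int_integrable: "sq_int M f ==> integrable M f"
 unfolding sq_int_def
 by (rule Bochner_Integration.integrable_bound[of _ "%x. 1 + nsq (f x)"])
   (auto intro!: AE_I2 order_trans[OF norm_le_sq])

lemma sq_int_prod:
 assumes "sq_int m f" "sq_int m g"
 shows "integrable m (%x. f x * cnj (g x))"
proof (rule Bochner_Integration.integrable_bound[of _ "%x. nsq (f x) + nsq (g x)"])
 show "integrable m (%x. nsq (f x) + nsq (g x))"
  using assms by (auto simp: sq_int_def)
 show "(%x. f x * cnj (g x)) : borel_measurable m"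
  using assms by (auto simp: sq_int_def intro!: borel_measurable_times borel_measurable_cnj)
 have "a * b <= a^2 + b^2" if "a >= 0" "b >= 0" for a b :: real
  using sum_squares_bound[of a b] mult_nonneg_nonneg[OF that] unfolding mult.assoc by linarith
 thus "AE x in m. norm (f x * cnj (g x)) <= norm (nsq (f x) + nsq (g x))"
  by (auto simp: norm_mult intro!: AE_I2)
qed

lemma sq_add: "nsq (a + b) <= 2 * nsq a + 2 * nsq b"
proof -
 have "nsq (a + b) <= (cmod a + cmod b)^2" by (intro power_mono norm_triangle_ineq) simp
 thus ?thesis using sum_squares_bound[of "cmod a" "cmod b"] by (simp add: power2_sum)
qed

lemma sq_int_lin:
 assumes "sq_int m f" "sq_int m g"
 shows "sq_int m (%x. f x + a * g x)"
proof -
 have [measurable]: "f : borel_measurable m" "g : borel_measurable m"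
  using assms by (auto simp: sq_int_def)
 have i: "integrable m (%x. 2 * nsq (f x) + 2 * nsq a * nsq (g x))"
  using assms by (auto simp: sq_int_def)
 have bd: "nsq (f x + a * g x) <= 2 * nsq (f x) + 2 * nsq a * nsq (g x)" for x
  using sq_add[of "f x" "a * g x"] by (simp add: norm_mult power_mult_distrib)
 have "integrable m (%x. nsq (f x + a * g x))"
  by (rule Bochner_Integration.integrable_bound[OF i]) (auto intro!: AE_I2 simp: bd)
 thus ?thesis by (simp add: sq_int_def)
qed

section \<open>Sine and cosine series\<close>

text \<open>Stated for a general system because two are used: the cosines expand the field and its
  derivative in t, the sines expand its angular derivative.\<close>

locale orthogonal_family = finite_measure M for M :: "'a measure" +
 fixes e :: "nat => 'a => real" and c :: "nat => real"
 assumes e_meas [measurable]: "!!n. e n : borel_measurable M"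
  and e_bound: "!!n x. \<bar>e n x\<bar> <= 1"
  and c_pos: "!!n. c n > 0"
  and orth: "!!i j. (LINT x|M. e i x * e j x) = (if i = j then c i else 0)"
begin

definition coef :: "('a => complex) => nat => complex" where
 "coef f n = (LINT x|M. f x * of_real (e n x))"

definition psum :: "(nat => complex) => nat => 'a => complex" where
 "psum a N x = (\<Sum>n<N. a n * of_real (e n x))"

lemma sq_int_e: "sq_int M (%x. of_real (e n x))"
 unfolding sq_int_def
 by (auto intro!: integrable_const_bound[of _ 1] AE_I2 power_le_one e_bound simp: abs_square_le_1)

lemma sq_int_psum: "sq_int M (psum a N)"
proof (induction N)
 case 0
 thus ?case by (simp add: psum_def sq_int_def)
next
 case (Suc N)
 have "psum a (Suc N) = (%x. psum a N x + a N * of_real (e N x))"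
  by (auto simp: psum_def)
 thus ?case using sq_int_lin[OF Suc sq_int_e] by simp
qed

lemma pair_psum:
 assumes "sq_int M f"
 shows "(LINT x|M. f x * cnj (psum a N x)) = (\<Sum>n<N. coef f n * cnj (a n))"
proof -
 have i: "integrable M (%x. f x * of_real (e n x))" for n
  using sq_int_prod[OF assms sq_int_e[of n]] by simp
 have "(LINT x|M. f x * cnj (psum a N x)) = (LINT x|M. (\<Sum>n<N. f x * of_real (e n x) * cnj (a n)))"
  by (simp add: psum_def sum_distrib_left mult_ac)
 also have "... = (\<Sum>n<N. coef f n * cnj (a n))"
  unfolding coef_def by (subst Bochner_Integration.integral_sum) (auto intro: i)
 finally show ?thesis .
qed

lemma coef_psum: "coef (psum a N) k = (if k < N then of_real (c k) * a k else 0)"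
proof -
 have i: "integrable M (%x. e n x * e k x)" for n
  by (rule integrable_const_bound[of _ 1])
   (auto intro!: AE_I2 mult_le_one e_bound simp: abs_mult)
 have "coef (psum a N) k = (LINT x|M. (\<Sum>n<N. a n * of_real (e n x * e k x)))"
  by (simp add: coef_def psum_def sum_distrib_right mult.assoc)
 also have "... = (\<Sum>n<N. a n * of_real (LINT x|M. e n x * e k x))"
 proof (subst Bochner_Integration.integral_sum)
  show "complex_integrable M (%x. a n * of_real (e n x * e k x))" for n
   by (intro integrable_mult_right integrable_of_real i)
 qed (simp only: integral_mult_right_zero integral_complex_of_real)
 also have "... = (\<Sum>n<N. if n = k then of_real (c k) * a k else 0)"
  by (intro sum.cong) (auto simp: orth)
 also have "... = (if k < N then of_real (c k) * a k else 0)" by simp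
 finally show ?thesis .
qed

lemma norm_diff_sq: "nsq (z - w) = nsq z - 2 * Re (z * cnj w) + nsq w"
 by (simp only: cmod_power2) (simp add: power2_eq_square algebra_simps)

text \<open>Completing the square in each coefficient. Bessel's inequality and the optimality of the
  Fourier coefficients are both read off from the last sum.\<close>

lemma psum_distance:
 assumes f: "sq_int M f"
 shows "(LINT x|M. nsq (f x - psum a N x)) =
   (LINT x|M. nsq (f x)) - (\<Sum>n<N. nsq (coef f n) / c n)
    + (\<Sum>n<N. c n * nsq (a n - coef f n / of_real (c n)))"
proof -
 note P = sq_int_psum[of a N]
 have iP: "integrable M (%x. nsq (psum a N x))" "integrable M (%x. nsq (f x))"
  using P f by (auto simp: sq_int_def)
 note ip = sq_int_prod[OF f P]
 have "(LINT x|M. psum a N x * cnj (psum a N x)) = (\<Sum>n<N. of_real (c n) * a n * cnj (a n))"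
  by (subst pair_psum[OF P]) (auto simp: coef_psum intro!: sum.cong)
 also have "... = of_real (\<Sum>n<N. c n * nsq (a n))"
  unfolding of_real_sum of_real_mult complex_norm_square by (simp add: mult_ac)
 finally have PP: "(LINT x|M. nsq (psum a N x)) = (\<Sum>n<N. c n * nsq (a n))"
  unfolding complex_norm_square[symmetric] integral_complex_of_real of_real_eq_iff .
 have "(LINT x|M. Re (f x * cnj (psum a N x))) = Re (\<Sum>n<N. coef f n * cnj (a n))"
  using pair_psum[OF f, of a N] integral_Re[OF ip] by simp
 hence fP: "(LINT x|M. Re (f x * cnj (psum a N x))) = (\<Sum>n<N. Re (coef f n * cnj (a n)))"
  by simp
 have "(LINT x|M. nsq (f x - psum a N x)) = (LINT x|M. nsq (f x)) -
   2 * (\<Sum>n<N. Re (coef f n * cnj (a n))) + (\<Sum>n<N. c n * nsq (a n))"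
  unfolding norm_diff_sq fP[symmetric] PP[symmetric]
 proof (subst Bochner_Integration.integral_add)
  show "integrable M (%x. nsq (f x) - 2 * Re (f x * cnj (psum a N x)))"
   by (intro Bochner_Integration.integrable_diff integrable_mult_right integrable_Re iP ip)
  show "(LINT x|M. nsq (f x) - 2 * Re (f x * cnj (psum a N x))) + (LINT x|M. nsq (psum a N x))
   = (LINT x|M. nsq (f x)) - 2 * (LINT x|M. Re (f x * cnj (psum a N x))) + (LINT x|M. nsq (psum a N x))"
  proof (subst Bochner_Integration.integral_diff)
   show "integrable M (%x. 2 * Re (f x * cnj (psum a N x)))"
    by (intro integrable_mult_right integrable_Re ip)
  qed (rule iP, simp only: integral_mult_right_zero)
 qed (rule iP)
 moreover have "c n * nsq (a n - coef f n / of_real (c n)) =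
   c n * nsq (a n) - 2 * Re (coef f n * cnj (a n)) + nsq (coef f n) / c n" for n
 proof -
  have r: "Re (a n * cnj (coef f n)) = Re (coef f n * cnj (a n))" by simp
  have "nsq (a n - coef f n / of_real (c n)) =
   nsq (a n) - 2 * (Re (coef f n * cnj (a n)) / c n) + nsq (coef f n) / (c n)^2"
   unfolding norm_diff_sq r[symmetric] by (simp add: norm_divide power_divide)
  thus ?thesis
   using c_pos[of n] by (simp only: distrib_left right_diff_distrib) (simp add: power2_eq_square)
 qed
 ultimately show ?thesis
  by (simp add: sum.distrib sum_subtractf sum_distrib_left)
qed

lemma bessel:
 assumes f: "sq_int M f"
 shows "(\<Sum>n<N. nsq (coef f n) / c n) <= (LINT x|M. nsq (f x))"
proof -
 have "0 <= (LINT x|M. nsq (f x - psum (%n. coef f n / of_real (c n)) N x))" by simp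
 also have "... = (LINT x|M. nsq (f x)) - (\<Sum>n<N. nsq (coef f n) / c n)"
  by (subst psum_distance[OF f]) simp
 finally show ?thesis by simp
qed

text \<open>Completeness is a property of one function, not of the family: it is established for the
  cosines and bounded continuous functions, which is the regularity of a slice of the field.\<close>

definition complete_for :: "('a => complex) => bool" where
 "complete_for g \<longleftrightarrow> sq_int M g \<and>
   (\<forall>et>0. \<exists>a N. (LINT x|M. nsq (g x - psum a N x)) < et)"

lemma parseval_norm:
 assumes "complete_for g"
 shows "(%N. LINT x|M. nsq (g x - psum (%n. coef g n / of_real (c n)) N x)) ----> 0"
  and "(%N. \<Sum>n<N. nsq (coef g n) / c n) ----> (LINT x|M. nsq (g x))"
proof -
 have g: "sq_int M g" using assms by (simp add: complete_for_def)
 let ?d = "%N. LINT x|M. nsq (g x - psum (%n. coef g n / of_real (c n)) N x)"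
 have d: "?d N = (LINT x|M. nsq (g x)) - (\<Sum>n<N. nsq (coef g n) / c n)" for N
  by (subst psum_distance[OF g]) simp
 show lim: "?d ----> 0"
 proof (rule LIMSEQ_I)
  fix et :: real assume "et > 0"
  then obtain a N where N: "(LINT x|M. nsq (g x - psum a N x)) < et"
   using assms by (auto simp: complete_for_def)
  have "norm (?d k - 0) < et" if "k >= N" for k
  proof -
   have "?d k <= ?d N"
    unfolding d using that c_pos
    by (simp add: sum_mono2 less_imp_le)
   also have "?d N <= (LINT x|M. nsq (g x - psum a N x))"
    unfolding d psum_distance[OF g, of a] using c_pos by (simp add: sum_nonneg less_imp_le)
   finally show ?thesis using N by simp
  qed
  thus "\<exists>N. \<forall>k\<ge>N. norm (?d k - 0) < et" by blast
 qed
 have "(%N. (LINT x|M. nsq (g x)) - ?d N) ----> (LINT x|M. nsq (g x)) - 0"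
  by (intro tendsto_intros lim)
 thus "(%N. \<Sum>n<N. nsq (coef g n) / c n) ----> (LINT x|M. nsq (g x))"
  by (simp add: d)
qed

text \<open>The Cauchy-Schwarz inequality in its weighted arithmetic-geometric form; the weight
  \<open>s\<close> is left free for the limit argument in \<open>parseval_pair\<close>.\<close>

lemma pair_bound:
 assumes "sq_int M f" "sq_int M g" "s > 0"
 shows "cmod (LINT x|M. f x * cnj (g x)) <=
   s * (LINT x|M. nsq (f x)) + (LINT x|M. nsq (g x)) / s"
proof -
 have i: "integrable M (%x. nsq (f x))" "integrable M (%x. nsq (g x))"
  using assms by (auto simp: sq_int_def intro!: borel_measurable_times borel_measurable_cnj)
 have "a * b <= s * a^2 + b^2 / s" for a b :: real
 proof -
  have "0 <= (s * a - b/2)^2 / s + (3/4) * b^2 / s" using assms by simp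
  also have "... = s * a^2 + b^2 / s - a * b"
   using assms by (simp add: power2_eq_square field_simps)
  finally show ?thesis by simp
 qed
 hence "(LINT x|M. cmod (f x * cnj (g x))) <= (LINT x|M. s * nsq (f x) + nsq (g x) / s)"
  using i sq_int_prod[OF assms(1,2)]
  by (intro integral_mono integrable_norm) (simp_all add: norm_mult)
 also have "... = s * (LINT x|M. nsq (f x)) + (LINT x|M. nsq (g x)) / s"
  using i by simp
 finally show ?thesis
  by (rule order_trans[OF integral_norm_bound])
qed

text \<open>The error after N terms is \<open>f\<close> paired with the tail of \<open>g\<close>, so
  only \<open>g\<close> has to lie in the closed span. This asymmetry is used with \<open>f\<close>
  the derivative in t, merely square integrable, and \<open>g\<close> the field itself.\<close>

lemma parseval_pair:
 assumes f: "sq_int M f" and g: "complete_for g"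
 shows "(%N. \<Sum>n<N. coef f n * cnj (coef g n) / of_real (c n)) ----> (LINT x|M. f x * cnj (g x))"
proof -
 have g': "sq_int M g" using g by (simp add: complete_for_def)
 let ?S = "%N. psum (%n. coef g n / of_real (c n)) N"
 let ?F = "LINT x|M. nsq (f x)"
 have Fnn: "?F >= 0" by simp
 have gS: "sq_int M (%x. g x - ?S N x)" for N
  using sq_int_lin[OF g' sq_int_psum, of "-1"] by simp
 have eq: "(LINT x|M. f x * cnj (g x)) - (\<Sum>n<N. coef f n * cnj (coef g n) / of_real (c n))
   = (LINT x|M. f x * cnj (g x - ?S N x))" for N
 proof -
  have "(LINT x|M. f x * cnj (g x - ?S N x)) = (LINT x|M. f x * cnj (g x) - f x * cnj (?S N x))"
   by (simp add: algebra_simps)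
  also have "... = (LINT x|M. f x * cnj (g x)) - (LINT x|M. f x * cnj (?S N x))"
   by (intro Bochner_Integration.integral_diff sq_int_prod f g' sq_int_psum)
  finally show ?thesis by (simp add: pair_psum[OF f])
 qed
 show ?thesis
 proof (rule LIMSEQ_I)
  fix et :: real assume "et > 0"
  define s where "s = et / (2 * (?F + 1))"
  have s: "s > 0" using \<open>et > 0\<close> Fnn by (simp add: s_def add_nonneg_pos)
  have "\<forall>\<^sub>F N in sequentially. (LINT x|M. nsq (g x - ?S N x)) < s * et / 2"
   using parseval_norm(1)[OF g] s \<open>et > 0\<close> by (intro order_tendstoD) auto
  then obtain N where N: "!!k. k >= N ==> (LINT x|M. nsq (g x - ?S k x)) < s * et / 2"
   by (auto simp: eventually_sequentially)
  have "norm ((\<Sum>n<k. coef f n * cnj (coef g n) / of_real (c n)) - (LINT x|M. f x * cnj (g x))) < et"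
   if "k >= N" for k
  proof -
   have "norm ((\<Sum>n<k. coef f n * cnj (coef g n) / of_real (c n)) - (LINT x|M. f x * cnj (g x)))
     = cmod (LINT x|M. f x * cnj (g x - ?S k x))"
    unfolding eq[symmetric] by (rule norm_minus_commute)
   also have "... <= s * ?F + (LINT x|M. nsq (g x - ?S k x)) / s"
    by (rule pair_bound[OF f gS s])
   also have "... < s * ?F + (s * et / 2) / s"
    using N[OF that] s by (intro add_strict_left_mono divide_strict_right_mono)
   also have "... = s * ?F + et / 2" using s by simp
   also have "s * ?F <= et / 2"
   proof -
    have "s * ?F <= s * (?F + 1)" using s by simp
    also have "... = et / 2" unfolding s_def using add_nonneg_pos[OF Fnn zero_less_one] by (auto simp add: divide_simps)
    finally show ?thesis .
   qed
   finally show ?thesis by simp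
  qed
  thus "\<exists>N. \<forall>k\<ge>N. norm ((\<Sum>n<k. coef f n * cnj (coef g n) / of_real (c n)) - (LINT x|M. f x * cnj (g x))) < et"
   by blast
 qed
qed

end

section \<open>The measure on (0, pi) and the two trigonometric systems\<close>

definition mpi :: "real measure" where "mpi = restrict_space lborel {0<..<pi}"

lemma space_mpi [simp]: "space mpi = {0<..<pi}"
 by (simp add: mpi_def space_restrict_space)

lemma finite_mpi: "finite_measure mpi"
 by (rule finite_measureI) (simp add: mpi_def space_restrict_space emeasure_restrict_space)

lemma measure_mpi: "measure mpi {0<..<pi} = pi"
 by (simp add: mpi_def measure_restrict_space)

lemma integrable_mpi_iff:
 fixes f :: "real => 'b::{banach, second_countable_topology}"
 shows "integrable mpi f \<longleftrightarrow> sint {0<..<pi} f"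
 by (simp add: mpi_def integrable_restrict_space sint_def)

lemma integral_mpi:
 fixes f :: "real => 'b::{banach, second_countable_topology}"
 shows "(LINT x|mpi. f x) = (SINT x:{0<..<pi}. f x)"
 by (simp add: mpi_def integral_restrict_space int_def)

lemma borel_measurable_mpiI:
 assumes "continuous_on {0<..<pi} f"
 shows "f : borel_measurable mpi"
 unfolding mpi_def using borel_measurable_continuous_on_restrict[OF assms]
 by (simp cong: measurable_cong_sets sets_restrict_space_cong)

lemma integral_mpi_continuous:
 fixes f :: "real => real"
 assumes "continuous_on {0..pi} f"
 shows "(LINT x|mpi. f x) = integral {0..pi} f"
proof -
 have "sint {0..pi} f"
  using assms borel_integrable_atLeastAtMost'[of 0 pi f] by simp
 hence i: "sint {0<..<pi} f"
  by (rule set_integrable_subset) auto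
 show ?thesis
  unfolding integral_mpi set_borel_integral_eq_integral(2)[OF i]
  using integral_open_interval[of "0::real" pi f] by (simp add: box_real)
qed

lemma integral_cos_multiple: "integral {0..pi} (%x. cos (of_int k * x)) = (if k = 0 then pi else 0)"
proof (cases "k = 0")
 case False
 have "((%x. cos (of_int k * x)) has_integral (sin (of_int k * pi) / of_int k - sin (of_int k * 0) / of_int k)) {0..pi}"
  by (rule fundamental_theorem_of_calculus)
    (use False in \<open>auto intro!: derivative_eq_intros simp flip: has_real_derivative_iff_has_vector_derivative\<close>)
 thus ?thesis using False
  by (simp add: integral_unique sin_times_pi_eq_0)
qed simp

text \<open>Integer frequencies treat all cases at once: for i = j = 0 both summands contribute,
  which gives the exceptional norm pi of the constant cosine.\<close>

lemma product_cos_integral: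
 "integral {0..pi} (%x. cos (of_int i * x) * cos (of_int j * x)) =
   (if i = j then pi / 2 else 0) + (if i = - j then pi / 2 else 0)" for i j :: int
proof -
 have "(%x::real. cos (of_int i * x) * cos (of_int j * x)) =
  (%x. (cos (of_int (i - j) * x) + cos (of_int (i + j) * x)) / 2)"
  by (auto simp: cos_times_cos algebra_simps)
 hence "integral {0..pi} (%x::real. cos (of_int i * x) * cos (of_int j * x)) =
  (integral {0..pi} (%x. cos (of_int (i - j) * x)) + integral {0..pi} (%x. cos (of_int (i + j) * x))) / 2"
  by (subst integral_add[symmetric]) (auto intro!: integrable_continuous_interval continuous_intros)
 thus ?thesis unfolding integral_cos_multiple by auto
qed

lemma product_sin_integral:
 "integral {0..pi} (%x. sin (of_int i * x) * sin (of_int j * x)) =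
   (if i = j then pi / 2 else 0) - (if i = - j then pi / 2 else 0)" for i j :: int
proof -
 have "(%x::real. sin (of_int i * x) * sin (of_int j * x)) =
  (%x. (cos (of_int (i - j) * x) - cos (of_int (i + j) * x)) / 2)"
  by (auto simp: sin_times_sin algebra_simps)
 hence "integral {0..pi} (%x::real. sin (of_int i * x) * sin (of_int j * x)) =
  (integral {0..pi} (%x. cos (of_int (i - j) * x)) - integral {0..pi} (%x. cos (of_int (i + j) * x))) / 2"
  by (subst integral_diff[symmetric]) (auto intro!: integrable_continuous_interval continuous_intros)
 thus ?thesis unfolding integral_cos_multiple by auto
qed

interpretation cosine: orthogonal_family mpi "%n x. cos (real n * x)" "%n. if n = 0 then pi else pi / 2"
proof -
 interpret finite_measure mpi by (rule finite_mpi)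
 show "orthogonal_family mpi (%n x. cos (real n * x)) (%n. if n = 0 then pi else pi / 2)"
 proof
  fix i j :: nat
  show "(LINT x|mpi. cos (real i * x) * cos (real j * x)) = (if i = j then if i = 0 then pi else pi / 2 else 0)"
   using product_cos_integral[of "int i" "int j"]
   by (subst integral_mpi_continuous) (auto intro!: continuous_intros)
 qed (auto intro!: borel_measurable_mpiI continuous_intros)
qed

text \<open>The index is shifted by one because the sine of frequency 0 has norm 0, which
  \<open>c_pos\<close> excludes.\<close>

interpretation sine: orthogonal_family mpi "%n x. sin (real (Suc n) * x)" "%n. pi / 2"
proof -
 interpret finite_measure mpi by (rule finite_mpi)
 show "orthogonal_family mpi (%n x. sin (real (Suc n) * x)) (%n. pi / 2)"
 proof
  fix i j :: nat
  show "(LINT x|mpi. sin (real (Suc i) * x) * sin (real (Suc j) * x)) = (if i = j then pi / 2 else 0)"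
   using product_sin_integral[of "int (Suc i)" "int (Suc j)"]
   by (subst integral_mpi_continuous) (auto intro!: continuous_intros)
 qed (auto intro!: borel_measurable_mpiI continuous_intros)
qed

definition trig :: "(real => real) => bool" where
 "trig f \<longleftrightarrow> (\<exists>N a. \<forall>x. f x = (\<Sum>n<N. a n * cos (real n * x)))"

lemma trig_cos: "trig (%x. k * cos (real n * x))"
 unfolding trig_def
 by (intro exI[of _ "Suc n"] exI[of _ "%i. if i = n then k else 0"]) simp

lemma trig_add:
 assumes "trig f" "trig g" shows "trig (%x. f x + g x)"
proof -
 obtain N a where f: "!!x. f x = (\<Sum>n<N. a n * cos (real n * x))" using assms(1) unfolding trig_def by blast
 obtain M b where g: "!!x. g x = (\<Sum>n<M. b n * cos (real n * x))" using assms(2) unfolding trig_def by blast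
 have ext: "(\<Sum>n<L. c n * cos (real n * x)) = (\<Sum>n<L + K. (if n < L then c n else 0) * cos (real n * x))"
  for L K :: nat and c :: "nat => real" and x
  by (rule sum.mono_neutral_cong_left) auto
 have "f x + g x = (\<Sum>n<N + M. ((if n < N then a n else 0) + (if n < M then b n else 0)) * cos (real n * x))" for x
  unfolding f g ext[where c = a and L = N and K = M] ext[where c = b and L = M and K = N]
  by (simp add: sum.distrib[symmetric] distrib_right add.commute)
 thus ?thesis
  unfolding trig_def
  by (intro exI[of _ "N + M"] exI[of _ "%n. (if n < N then a n else 0) + (if n < M then b n else 0)"] allI)
qed

lemma trig_sum: "(!!i. i : I ==> trig (f i)) ==> trig (%x. \<Sum>i\<in>I. f i x)"
proof (induction I rule: infinite_finite_induct)
 case (insert i I)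
 thus ?case using trig_add[of "f i" "%x. \<Sum>i\<in>I. f i x"] by simp
qed (use trig_cos[of 0 0] in simp_all)

lemma trig_mult:
 assumes "trig f" "trig g" shows "trig (%x. f x * g x)"
proof -
 obtain N a where f: "!!x. f x = (\<Sum>n<N. a n * cos (real n * x))" using assms(1) unfolding trig_def by blast
 obtain M b where g: "!!x. g x = (\<Sum>n<M. b n * cos (real n * x))" using assms(2) unfolding trig_def by blast
 have c: "trig (%x. a n * cos (real n * x) * (b m * cos (real m * x)))" for n m
 proof -
  define k where "k = (if m <= n then n - m else m - n)"
  have k: "cos (real n * x - real m * x) = cos (real k * x)" for x
   using cos_minus[of "real n * x - real m * x"]
   by (simp add: k_def of_nat_diff left_diff_distrib)
  have cc: "cos (real n * x) * cos (real m * x) = (cos (real k * x) + cos (real (n + m) * x)) / 2" for x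
   unfolding cos_times_cos k by (simp add: distrib_right)
  have "a n * cos (real n * x) * (b m * cos (real m * x)) =
   (a n * b m / 2) * cos (real k * x) + (a n * b m / 2) * cos (real (n + m) * x)" for x
  proof -
   have "a n * cos (real n * x) * (b m * cos (real m * x)) = a n * b m * (cos (real n * x) * cos (real m * x))"
    by (simp only: mult_ac)
   thus ?thesis unfolding cc by (simp add: algebra_simps)
  qed
  thus ?thesis using trig_add[OF trig_cos trig_cos] by presburger
 qed
 have "(%x. f x * g x) = (%x. \<Sum>n<N. \<Sum>m<M. a n * cos (real n * x) * (b m * cos (real m * x)))"
  by (auto simp: f g sum_product)
 thus ?thesis by (simp add: trig_sum c)
qed

lemma trig_polynomial_cos: "real_polynomial_function p ==> trig (%x. p (cos x))"
proof (induction p rule: real_polynomial_function.induct)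
 case (linear f)
 hence "f y = f 1 * y" for y
  using linear_scale[OF bounded_linear.linear[OF linear], of y 1] by simp
 thus ?case using trig_cos[of "f 1" 1] by (metis (no_types, lifting) ext mult_1 of_nat_1)
next
 case (const c)
 thus ?case using trig_cos[of c 0] by simp
qed (auto intro: trig_add trig_mult)

text \<open>The substitution y = cos x reduces this to the Weierstrass theorem on [-1, 1];
  polynomials in cos x are cosine sums because products of cosines are.\<close>

lemma trig_uniform_approx:
 assumes "continuous_on {0..pi} f" "et > 0"
 obtains N a where "!!x. x : {0..pi} ==> \<bar>f x - (\<Sum>n<N. a n * cos (real n * x))\<bar> < et"
proof -
 have "continuous_on {-1..1} (%y. f (arccos y))"
  by (rule continuous_on_compose2[OF assms(1)]) (auto intro!: continuous_intros arccos_lbound arccos_ubound)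
 then obtain p where p: "real_polynomial_function p" "!!y. y : {-1..1} ==> \<bar>f (arccos y) - p y\<bar> < et"
  using Stone_Weierstrass_real_polynomial_function[of "{-1..1::real}" "%y. f (arccos y)" et] assms(2) by auto
 obtain N a where N: "!!x. p (cos x) = (\<Sum>n<N. a n * cos (real n * x))"
  using trig_polynomial_cos[OF p(1)] unfolding trig_def by blast
 show ?thesis
 proof (rule that)
  fix x assume "x : {0..pi}"
  thus "\<bar>f x - (\<Sum>n<N. a n * cos (real n * x))\<bar> < et"
   using p(2)[of "cos x"] N[of x] by (simp add: arccos_cos)
 qed
qed

lemma complex_trig_approx:
 assumes "continuous_on {0..pi} f" "et > 0"
 obtains N a where "!!x. x : {0..pi} ==> cmod (f x - cosine.psum a N x) < et"
proof -
 have cont: "continuous_on {0..pi} (%x. Re (f x))" "continuous_on {0..pi} (%x. Im (f x))"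
  using assms by (auto intro!: continuous_intros)
 obtain N a where N: "!!x. x : {0..pi} ==> \<bar>Re (f x) - (\<Sum>n<N. a n * cos (real n * x))\<bar> < et / 2"
  by (rule trig_uniform_approx[OF cont(1), of "et / 2"]) (use assms(2) in auto)
 obtain M b where M: "!!x. x : {0..pi} ==> \<bar>Im (f x) - (\<Sum>n<M. b n * cos (real n * x))\<bar> < et / 2"
  by (rule trig_uniform_approx[OF cont(2), of "et / 2"]) (use assms(2) in auto)
 have ext: "(\<Sum>n<L. c n * cos (real n * x)) = (\<Sum>n<L + K. (if n < L then c n else 0) * cos (real n * x))"
  for L K :: nat and c :: "nat => real" and x
  by (rule sum.mono_neutral_cong_left) auto
 define d where "d n = Complex (if n < N then a n else 0) (if n < M then b n else 0)" for n
 have re: "Re (cosine.psum d (N + M) x) = (\<Sum>n<N. a n * cos (real n * x))" for x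
  unfolding ext[where c = a and L = N and K = M] by (simp add: cosine.psum_def d_def)
 have im: "Im (cosine.psum d (N + M) x) = (\<Sum>n<M. b n * cos (real n * x))" for x
  unfolding ext[where c = b and L = M and K = N] by (simp add: cosine.psum_def d_def add.commute)
 show ?thesis
 proof (rule that)
  fix x assume x: "x : {0..pi}"
  have "cmod (f x - cosine.psum d (N + M) x) <= \<bar>Re (f x - cosine.psum d (N + M) x)\<bar> + \<bar>Im (f x - cosine.psum d (N + M) x)\<bar>"
   by (rule cmod_le)
  also have "... < et" using N[OF x] M[OF x] by (simp add: re im)
  finally show "cmod (f x - cosine.psum d (N + M) x) < et" .
 qed
qed

lemma cosine_complete:
 assumes cont: "continuous_on {0<..<pi} g" and bd: "!!x. x : {0<..<pi} ==> cmod (g x) <= B"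
 shows "cosine.complete_for g"
 unfolding cosine.complete_for_def
proof (intro conjI allI impI)
 interpret finite_measure mpi by (rule finite_mpi)
 have m: "g : borel_measurable mpi" by (rule borel_measurable_mpiI[OF cont])
 have B: "B >= 0" using bd[of "pi / 2"] by (simp add: order_trans[OF norm_ge_zero])
 show g: "sq_int mpi g"
  unfolding sq_int_def using m bd
  by (auto intro!: finite_measure.integrable_const_bound[OF finite_mpi, of _ "B^2"] AE_I2 power_mono)
 fix et :: real assume eta: "et > 0"
 define d where "d k = pi / (real k + 2)" for k
 have d: "0 < d k" "d k <= pi - d k" for k
  by (auto simp: d_def field_simps add_pos_nonneg)
 define cl where "cl k x = max (d k) (min (pi - d k) x)" for k x
 have cl: "cl k x : {0<..<pi}" for k x
  using d[of k] by (auto simp: cl_def min_def max_def)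
 define h where "h k x = g (cl k x)" for k x
 have hc: "continuous_on UNIV (h k)" for k
  unfolding h_def by (rule continuous_on_compose2[OF cont])
   (use cl in \<open>auto simp: cl_def[abs_def] intro!: continuous_intros\<close>)
 have hm: "h k : borel_measurable mpi" for k
  by (rule borel_measurable_mpiI[OF continuous_on_subset[OF hc]]) simp
 have hb: "cmod (h k x) <= B" for k x unfolding h_def by (rule bd[OF cl])
 have gh: "sq_int mpi (h k)" for k
  unfolding sq_int_def using hm hb B
  by (auto intro!: finite_measure.integrable_const_bound[OF finite_mpi, of _ "B^2"] AE_I2 power_mono)
 have "(%k. LINT x|mpi. nsq (g x - h k x)) ----> (LINT x|mpi. 0)"
 proof (rule integral_dominated_convergence[where w = "%x. (2 * B)^2"])
  show "AE x in mpi. (%k. nsq (g x - h k x)) ----> 0"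
  proof (rule AE_I2)
   fix x assume "x : space mpi"
   hence x: "0 < x" "x < pi" by auto
   have "(%k. d k) ----> 0"
    unfolding d_def using LIMSEQ_ignore_initial_segment[OF lim_const_over_n[of pi], of 2]
    by (simp add: add.commute)
   hence "\<forall>\<^sub>F k in sequentially. d k < min x (pi - x)"
    using x by (intro order_tendstoD) auto
   hence "\<forall>\<^sub>F k in sequentially. nsq (g x - h k x) = 0"
    by eventually_elim (auto simp: h_def cl_def)
   thus "(%k. nsq (g x - h k x)) ----> 0"
    by (rule tendsto_eventually)
  qed
  show "AE x in mpi. norm (nsq (g x - h k x)) <= (2 * B)^2" for k
  proof (rule AE_I2)
   fix x assume x: "x : space mpi"
   have "cmod (g x - h k x) <= 2 * B"
    using norm_triangle_ineq4[of "g x" "h k x"] bd[of x] hb[of k x] x by simp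
   thus "norm (nsq (g x - h k x)) <= (2 * B)^2"
    using power_mono[of "cmod (g x - h k x)" "2 * B" 2] by simp
  qed
 qed (use m hm in auto)
 hence "\<forall>\<^sub>F k in sequentially. (LINT x|mpi. nsq (g x - h k x)) < et / 4"
  using eta by (intro order_tendstoD) auto
 then obtain k where k: "(LINT x|mpi. nsq (g x - h k x)) < et / 4"
  by (auto simp: eventually_sequentially)
 \<comment> \<open>The uniform error then contributes \<open>2 * et'^2 * pi = et / 4\<close>; the
   freezing error, doubled when the square is split, contributes less than
   \<open>et / 2\<close>.\<close>
 define et' where "et' = sqrt (et / (8 * pi))"
 have e': "et' > 0" using eta by (simp add: et'_def)
 obtain N a where N: "!!x. x : {0..pi} ==> cmod (h k x - cosine.psum a N x) < et'"
  by (rule complex_trig_approx[OF continuous_on_subset[OF hc] e']) auto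
 have "(LINT x|mpi. nsq (g x - cosine.psum a N x)) <= (LINT x|mpi. 2 * nsq (g x - h k x) + 2 * et'^2)"
 proof (rule integral_mono)
  show "integrable mpi (%x. nsq (g x - cosine.psum a N x))"
   using sq_int_lin[OF g cosine.sq_int_psum, of "-1" a N] by (simp add: sq_int_def)
  show "integrable mpi (%x. 2 * nsq (g x - h k x) + 2 * et'^2)"
   using sq_int_lin[OF g gh, of "-1" k] by (simp add: sq_int_def)
  fix x assume "x : space mpi"
  hence "cmod (h k x - cosine.psum a N x) <= et'" using N[of x] by (simp add: less_imp_le)
  hence n: "cmod (g x - cosine.psum a N x) <= cmod (g x - h k x) + et'"
   using norm_triangle_ineq[of "g x - h k x" "h k x - cosine.psum a N x"] by simp
  have "nsq (g x - cosine.psum a N x) <= (cmod (g x - h k x) + et')^2"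
   by (rule power_mono[OF n]) simp
  also have "... <= 2 * nsq (g x - h k x) + 2 * et'^2"
   using sum_squares_bound[of "cmod (g x - h k x)" et'] by (simp add: power2_sum)
  finally show "nsq (g x - cosine.psum a N x) <= 2 * nsq (g x - h k x) + 2 * et'^2" .
 qed
 also have "... = 2 * (LINT x|mpi. nsq (g x - h k x)) + 2 * et'^2 * pi"
  using sq_int_lin[OF g gh, of "-1" k]
  by (subst Bochner_Integration.integral_add)
    (auto simp: sq_int_def measure_mpi)
 also have "2 * et'^2 * pi = et / 4"
  using eta by (simp add: et'_def)
 finally have "(LINT x|mpi. nsq (g x - cosine.psum a N x)) < et" using k eta by linarith
 thus "\<exists>a N. (LINT x|mpi. nsq (g x - cosine.psum a N x)) < et" by blast
qed

section \<open>A cutoff profile of class C^1\<close>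

definition step :: "real => real" where
 "step x = (if x <= 0 then 0 else if x >= 1 then 1 else 3 * x^2 - 2 * x ^ 3)"

definition step' :: "real => real" where
 "step' x = (if x <= 0 then 0 else if x >= 1 then 0 else 6 * x * (1 - x))"

lemma step_eqs [simp]:
 "x <= 0 ==> step x = 0" "x >= 1 ==> step x = 1"
 "x <= 0 ==> step' x = 0" "x >= 1 ==> step' x = 0"
 by (auto simp: step_def step'_def)

lemma has_real_derivative_zeroI:
 fixes f :: "real => real"
 assumes "!!y. \<bar>y - a\<bar> < 1 ==> \<bar>f y - f a\<bar> <= C * (y - a)^2"
 shows "(f has_real_derivative 0) (at a)"
 unfolding has_field_derivative_iff
proof (rule Lim_null_comparison)
 show "\<forall>\<^sub>F y in at a. norm ((f y - f a) / (y - a)) <= C * \<bar>y - a\<bar>"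
  unfolding eventually_at
 proof (intro exI[of _ 1] conjI ballI impI)
  fix y assume y: "y ~= a \<and> dist y a < 1"
  hence "\<bar>f y - f a\<bar> / \<bar>y - a\<bar> <= C * (y - a)^2 / \<bar>y - a\<bar>"
   using assms[of y] by (intro divide_right_mono) (auto simp: dist_real_def)
  also have "... = C * \<bar>y - a\<bar>"
  proof -
   have sq: "(y - a)^2 = \<bar>y - a\<bar> * \<bar>y - a\<bar>" by (simp add: power2_eq_square)
   show ?thesis
    unfolding sq mult.assoc[symmetric] by (rule nonzero_mult_div_cancel_right) (use y in simp)
  qed
  finally show "norm ((f y - f a) / (y - a)) <= C * \<bar>y - a\<bar>" by simp
 qed simp
 show "((%y. C * \<bar>y - a\<bar>) \<longlongrightarrow> 0) (at a)"
  by (auto intro!: tendsto_eq_intros)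
qed

text \<open>The cubic is tangent to the constants at 0 and 1, and at these two points quadratic
  contact gives the derivative 0. One continuous derivative suffices since cutoffs are
  differentiated only once; the maximal slope is 3/2.\<close>

lemma step_deriv: "(step has_real_derivative step' x) (at x)"
proof -
 have b: "\<bar>3 * y^2 - 2 * y ^ 3\<bar> <= 3 * y^2" "\<bar>3 * y^2 - 2 * y ^ 3 - 1\<bar> <= 3 * (y - 1)^2"
  if "0 < y" "y < 1" for y :: real
 proof -
  have "3 * y^2 - 2 * y ^ 3 = y^2 * (3 - 2 * y)" by (simp add: power2_eq_square power3_eq_cube algebra_simps)
  moreover have "y^2 * (3 - 2 * y) <= y^2 * 3" "0 <= y^2 * (3 - 2 * y)" using that by (auto intro!: mult_left_mono)
  ultimately show "\<bar>3 * y^2 - 2 * y ^ 3\<bar> <= 3 * y^2" by simp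
  have "3 * y^2 - 2 * y ^ 3 - 1 = - ((y - 1)^2 * (1 + 2 * y))"
   by (simp add: power2_eq_square power3_eq_cube algebra_simps)
  moreover have "(y - 1)^2 * (1 + 2 * y) <= (y - 1)^2 * 3" "0 <= (y - 1)^2 * (1 + 2 * y)"
   using that by (auto intro!: mult_left_mono)
  ultimately show "\<bar>3 * y^2 - 2 * y ^ 3 - 1\<bar> <= 3 * (y - 1)^2" by simp
 qed
 consider "x < 0" | "x = 0" | "0 < x" "x < 1" | "x = 1" | "x > 1" by linarith
 thus ?thesis
 proof cases
  case 1
  have "((%x. 0) has_real_derivative 0) (at x)" by simp
  hence "(step has_real_derivative 0) (at x)"
   by (rule has_field_derivative_transform_within_open[of _ _ _ "{..<0}"]) (use 1 in auto)
  thus ?thesis using 1 by simp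
 next
  case 2
  have "(step has_real_derivative 0) (at 0)"
   by (rule has_real_derivative_zeroI[of _ _ 3]) (use b in \<open>auto simp: step_def\<close>)
  thus ?thesis using 2 by simp
 next
  case 3
  have "((%x. 3 * x^2 - 2 * x ^ 3) has_real_derivative 6 * x * (1 - x)) (at x)"
   by (auto intro!: derivative_eq_intros simp: power2_eq_square algebra_simps)
  hence "(step has_real_derivative 6 * x * (1 - x)) (at x)"
   by (rule has_field_derivative_transform_within_open[of _ _ _ "{0<..<1}"])
    (use 3 in \<open>auto simp: step_def\<close>)
  thus ?thesis using 3 by (simp add: step'_def)
 next
  case 4
  have "(step has_real_derivative 0) (at 1)"
   by (rule has_real_derivative_zeroI[of _ _ 3]) (use b in \<open>auto simp: step_def\<close>)
  thus ?thesis using 4 by simp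
 next
  case 5
  have "((%x. 1) has_real_derivative 0) (at x)" by simp
  hence "(step has_real_derivative 0) (at x)"
   by (rule has_field_derivative_transform_within_open[of _ _ _ "{1<..}"]) (use 5 in auto)
  thus ?thesis using 5 by simp
 qed
qed

lemma step'_cont: "continuous_on UNIV step'"
proof -
 have eq: "step' = (%x. 6 * max 0 (min 1 x) * (1 - max 0 (min 1 x)))"
  by (auto simp: step'_def fun_eq_iff min_def max_def)
 show ?thesis unfolding eq by (intro continuous_intros)
qed

lemma step_bounds: "0 <= step x" "step x <= 1" "\<bar>step' x\<bar> <= 3/2" "0 <= step' x"
proof -
 have "0 <= 3 * x^2 - 2 * x ^ 3 \<and> 3 * x^2 - 2 * x ^ 3 <= 1" if "0 < x" "x < 1"
 proof
  have "3 * x^2 - 2 * x ^ 3 = x^2 * (3 - 2 * x)" by (simp add: power2_eq_square power3_eq_cube algebra_simps)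
  thus "0 <= 3 * x^2 - 2 * x ^ 3" using that by simp
  have "1 - (3 * x^2 - 2 * x ^ 3) = (1 - x)^2 * (1 + 2 * x)"
   by (simp add: power2_eq_square power3_eq_cube algebra_simps)
  moreover have "... >= 0" using that by simp
  ultimately show "3 * x^2 - 2 * x ^ 3 <= 1" by linarith
 qed
 thus "0 <= step x" "step x <= 1" by (auto simp: step_def)
 have "6 * x * (1 - x) <= 3/2"
  using zero_le_power2[of "x - 1/2"] by (simp add: power2_eq_square algebra_simps)
 moreover have "0 <= 6 * x * (1 - x)" if "0 < x" "x < 1" using that by simp
 ultimately show "\<bar>step' x\<bar> <= 3/2" "0 <= step' x" by (auto simp: step'_def)
qed

section \<open>Fubini on product sets and stability of linear second-order equations\<close>

lemma set_Fubini:
 fixes f :: "real => real => 'b::{banach, second_countable_topology}"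
 assumes "sint (A \<times> B) (%(t, p). f t p)"
 shows "AE t in lborel. t : A \<longrightarrow> sint B (f t)"
  and "sint A (%t. SINT p:B. f t p)"
  and "(SINT t:A. SINT p:B. f t p) = (SINT z:A \<times> B. (case z of (t, p) => f t p))"
proof -
 let ?F = "%(t, p). ind A t *R (ind B p *R f t p)"
 have eq: "(%z. ind (A \<times> B) z *R (case z of (t, p) => f t p)) = ?F"
  by (auto simp: fun_eq_iff indicator_def)
 have i: "integrable (lborel \<Otimes>\<^sub>M lborel) ?F"
  using assms unfolding sint_def eq by (simp add: lborel_prod)
 show "AE t in lborel. t : A \<longrightarrow> sint B (f t)"
  using lborel_pair.AE_integrable_fst'[OF i] by eventually_elim (auto simp: sint_def)
 have s: "(LINT p|lborel. ?F (t, p)) = ind A t *R (SINT p:B. f t p)" for t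
  unfolding int_def integral_scaleR_right[symmetric] by simp
 show "sint A (%t. SINT p:B. f t p)"
  using lborel_pair.integrable_fst'[OF i] unfolding s by (simp add: sint_def)
 show "(SINT t:A. SINT p:B. f t p) = (SINT z:A \<times> B. (case z of (t, p) => f t p))"
  using lborel_pair.integral_fst'[OF i, unfolded s]
  unfolding int_def eq by (simp add: lborel_prod)
qed

text \<open>Uniform convergence of \<open>f k\<close> says nothing about its derivative
  \<open>g k\<close>, which is recovered from the equation: the increments of \<open>g k\<close>
  converge because \<open>q * f k + r k\<close> can be integrated, and the value
  \<open>g k a\<close> because the increment of \<open>f k\<close> over [a, b] is known. Smallness
  of \<open>r k\<close> in the mean is what the angular cutoffs will provide.\<close>

lemma ode_limit:
 fixes f g r :: "nat => real => complex" and q :: "real => complex"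
 assumes ab: "a < b"
  and df: "!!k t. t : {a..b} ==> (f k has_vector_derivative g k t) (at t within {a..b})"
  and dg: "!!k t. t : {a..b} ==> (g k has_vector_derivative q t * f k t + r k t) (at t within {a..b})"
  and q: "continuous_on {a..b} q" and r: "!!k. continuous_on {a..b} (r k)"
  and lim: "uniform_limit {a..b} f F sequentially"
  and lim0: "(%k. integral {a..b} (%t. cmod (r k t))) ----> 0"
 obtains G where "!!t. t : {a..b} ==> (F has_vector_derivative G t) (at t within {a..b})"
  "!!t. t : {a..b} ==> (G has_vector_derivative q t * F t) (at t within {a..b})"
  "!!t. t : {a..b} ==> (%k. g k t) ----> G t"
proof -
 have fc: "continuous_on {a..b} (f k)" for k
  by (rule continuous_on_vector_derivative[OF df])
 have Fc: "continuous_on {a..b} F"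
  by (rule uniform_limit_theorem[OF _ lim]) (auto intro!: always_eventually fc)
 have qb: "bounded (q ` {a..b})" by (intro compact_imp_bounded compact_continuous_image q) auto
 define H where "H t = integral {a..t} (%s. q s * F s)" for t
 have gint: "g k t - g k a = integral {a..t} (%s. q s * f k s + r k s)" if "t : {a..b}" for k t
  using that
  by (intro integral_unique[symmetric] fundamental_theorem_of_calculus has_vector_derivative_within_subset[OF dg]) auto
 have Gu: "uniform_limit {a..b} (%k t. g k t - g k a) H sequentially"
 proof (rule uniform_limitI)
  fix e :: real assume e: "e > 0"
  have "uniform_limit {a..b} (%k t. q t * f k t) (%t. q t * F t) sequentially"
   by (rule uniform_lim_mult[OF uniform_limit_const lim qb])
     (intro compact_imp_bounded compact_continuous_image Fc; simp)
  hence "\<forall>\<^sub>F k in sequentially. \<forall>t\<in>{a..b}. dist (q t * f k t) (q t * F t) < e / (2 * (b - a))"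
   using e ab by (intro uniform_limitD) auto
  moreover have "\<forall>\<^sub>F k in sequentially. integral {a..b} (%t. cmod (r k t)) < e / 2"
   using lim0 e by (intro order_tendstoD) auto
  ultimately show "\<forall>\<^sub>F k in sequentially. \<forall>t\<in>{a..b}. dist (g k t - g k a) (H t) < e"
  proof eventually_elim
   case (elim k)
   show ?case
   proof
    fix t assume t: "t : {a..b}"
    have sub: "{a..t} \<subseteq> {a..b}" using t by auto
    note [continuous_intros] = continuous_on_subset[OF q sub] continuous_on_subset[OF Fc sub]
     continuous_on_subset[OF fc sub] continuous_on_subset[OF r sub]
    have "g k t - g k a - H t = integral {a..t} (%s. q s * f k s + r k s - q s * F s)"
     unfolding gint[OF t] H_def
     by (rule integral_diff[symmetric]) (auto intro!: integrable_continuous_interval continuous_intros)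
    also have "cmod ... <= integral {a..t} (%s. e / (2 * (b - a)) + cmod (r k s))"
    proof (rule integral_norm_bound_integral)
     fix s assume "s : {a..t}"
     hence "dist (q s * f k s) (q s * F s) < e / (2 * (b - a))" using elim(1) sub by blast
     moreover have "cmod (q s * f k s + r k s - q s * F s) <= cmod (q s * f k s - q s * F s) + cmod (r k s)"
      by (metis add_diff_eq diff_add_eq norm_triangle_ineq)
     ultimately show "cmod (q s * f k s + r k s - q s * F s) <= e / (2 * (b - a)) + cmod (r k s)"
      by (simp add: dist_norm)
    qed (auto intro!: integrable_continuous_interval continuous_intros)
    also have "... = e / (2 * (b - a)) * (t - a) + integral {a..t} (%s. cmod (r k s))"
     using t by (subst integral_add) (auto intro!: integrable_continuous_interval continuous_intros)
    also have "... <= e / 2 + integral {a..b} (%s. cmod (r k s))"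
    proof (rule add_mono)
     have "e / (2 * (b - a)) * (t - a) <= e / (2 * (b - a)) * (b - a)"
      using t ab e by (intro mult_left_mono) auto
     also have "... = e / 2" using ab by (simp add: divide_simps)
     finally show "e / (2 * (b - a)) * (t - a) <= e / 2" .
     show "integral {a..t} (%s. cmod (r k s)) <= integral {a..b} (%s. cmod (r k s))"
      by (rule integral_subset_le[OF sub])
        (auto intro!: integrable_continuous_interval continuous_intros continuous_on_subset[OF r])
    qed
    also have "... < e" using elim(2) by simp
    finally show "dist (g k t - g k a) (H t) < e" by (simp add: dist_norm)
   qed
  qed
 qed
 \<comment> \<open>The value at \<open>a\<close> of the limit derivative, forced by integrating
   \<open>g k t - g k a\<close> over [a, b].\<close>
 define \<gamma> where "\<gamma> = (F b - F a - integral {a..b} H) / of_real (b - a)"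
 have gc: "continuous_on {a..b} (g k)" for k by (rule continuous_on_vector_derivative[OF dg])
 have ga: "(%k. g k a) ----> \<gamma>"
 proof -
  have "g k a = (f k b - f k a - integral {a..b} (%t. g k t - g k a)) / of_real (b - a)" for k
  proof -
   have "integral {a..b} (g k) = f k b - f k a"
    using ab by (intro integral_unique fundamental_theorem_of_calculus df) auto
   moreover have "integral {a..b} (%t. g k t - g k a) = integral {a..b} (g k) - of_real (b - a) * g k a"
    using ab by (subst integral_diff) (auto intro!: integrable_continuous_interval gc simp: scaleR_conv_of_real)
   ultimately show ?thesis using ab by (simp add: field_simps)
  qed
  moreover have "(%k. (f k b - f k a - integral {a..b} (%t. g k t - g k a)) / of_real (b - a)) ----> \<gamma>"
  proof -
   obtain I J where I: "!!k. ((%t. g k t - g k a) has_integral I k) {a..b}" "(H has_integral J) {a..b}" "I ----> J"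
    by (rule uniform_limit_integral[OF Gu]) (auto intro!: continuous_intros gc)
   have "(%k. integral {a..b} (%t. g k t - g k a)) ----> integral {a..b} H"
    using I(3) unfolding integral_unique[OF I(1)] integral_unique[OF I(2)] .
   thus ?thesis
    unfolding \<gamma>_def using ab by (intro tendsto_intros tendsto_uniform_limitI[OF lim]) auto
  qed
  ultimately show ?thesis by simp
 qed
 define G where "G t = \<gamma> + H t" for t
 have gu: "uniform_limit {a..b} g G sequentially"
 proof -
  have "uniform_limit {a..b} (%k t. g k a + (g k t - g k a)) (%t. \<gamma> + H t) sequentially"
   by (intro uniform_limit_add Gu) (use ga in \<open>simp add: uniform_limit_iff tendsto_iff\<close>)
  thus ?thesis by (simp add: G_def[abs_def])
 qed
 show ?thesis
 proof (rule that)
  fix t assume t: "t : {a..b}"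
  show "(%k. g k t) ----> G t" by (rule tendsto_uniform_limitI[OF gu t])
  have "(H has_vector_derivative q t * F t) (at t within {a..b})"
   unfolding H_def by (rule integral_has_vector_derivative[OF _ t]) (auto intro!: continuous_intros q Fc)
  thus "(G has_vector_derivative q t * F t) (at t within {a..b})"
   unfolding G_def by (auto intro!: derivative_eq_intros)
  show "(F has_vector_derivative G t) (at t within {a..b})"
  proof -
   have Fint: "F s = F a + integral {a..s} G" if s: "s : {a..b}" for s
   proof -
    have sub: "{a..s} \<subseteq> {a..b}" using s by auto
    have gi: "(g k has_integral (f k s - f k a)) {a..s}" for k
     using s by (intro fundamental_theorem_of_calculus has_vector_derivative_within_subset[OF df]) auto
    obtain I J where I: "!!k. (g k has_integral I k) {a..s}" "(G has_integral J) {a..s}" "I ----> J"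
     by (rule uniform_limit_integral[OF uniform_limit_on_subset[OF gu sub]])
      (auto intro!: continuous_on_subset[OF gc sub])
    have "I = (%k. f k s - f k a)" using has_integral_unique[OF I(1) gi] by auto
    moreover have "(%k. f k s - f k a) ----> F s - F a"
     using s ab by (intro tendsto_intros tendsto_uniform_limitI[OF lim]) auto
    ultimately have "J = F s - F a" using I(3) LIMSEQ_unique by blast
    thus ?thesis using integral_unique[OF I(2)] by simp
   qed
   have Gc: "continuous_on {a..b} G"
    by (rule uniform_limit_theorem[OF _ gu]) (auto intro!: always_eventually gc)
   have "((%s. F a + integral {a..s} G) has_vector_derivative G t) (at t within {a..b})"
    using integral_has_vector_derivative[OF Gc t] by (auto intro!: derivative_eq_intros)
   from has_vector_derivative_transform[OF t Fint this] show ?thesis .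
  qed
 qed
qed

section \<open>Estimates and limits of set integrals\<close>

lemma set_integrable_eq:
 "set_integrable M S f ==> (!!x. x : S ==> f x = g x) ==> set_integrable M S g"
 by (subst set_integrable_cong[OF refl refl, of _ _ f]) auto

lemma set_integrable_superset:
 "set_integrable M S f ==> S \<subseteq> T ==> (!!x. x : T ==> x \<notin> S ==> f x = 0) ==> set_integrable M T f"
 unfolding sint_def
 by (rule back_subst[where P = "integrable M"], assumption, rule ext) (auto simp: indicator_def)

lemma set_integral_eq:
 "(!!x. x : S ==> f x = g x) ==> (LINT x:S|M. f x) = (LINT x:S|M. g x)"
 unfolding int_def by (intro Bochner_Integration.integral_cong) (auto simp: indicator_def)

lemma set_integrable_const:
 assumes "S : sets lborel" "bounded S"
 shows "sint S (%_. c :: real)" "(SINT x:S. c) = measure lborel S * c"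
 unfolding sint_def int_def using assms emeasure_bounded_finite[OF assms(2)]
 by (auto intro!: integrable_mult_left integrable_real_indicator)

lemma integral_open_box:
 fixes g :: "real => real"
 assumes "continuous_on {a..b} g"
 shows "sint {a<..<b} g" "(SINT t:{a<..<b}. g t) = integral {a..b} g"
proof -
 show i: "sint {a<..<b} g"
  by (rule set_integrable_subset[OF borel_integrable_atLeastAtMost'[OF assms]]) auto
 show "(SINT t:{a<..<b}. g t) = integral {a..b} g"
  unfolding set_borel_integral_eq_integral(2)[OF i] using integral_open_interval[of a b g] by (simp add: box_real)
qed

lemma set_integral_nonneg':
 "(!!x. x : S ==> 0 <= f x) ==> 0 <= (LINT x:S|M. f x :: real)"
 unfolding int_def by (intro integral_nonneg_AE AE_I2) (simp add: indicator_def)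

lemma set_integral_mono_subset:
 fixes f g :: "'a => real"
 assumes "set_integrable M S f" "set_integrable M T g" "S \<subseteq> T" "!!x. x : S ==> f x <= g x" "!!x. x : T ==> 0 <= g x"
 shows "(LINT x:S|M. f x) <= (LINT x:T|M. g x)"
 unfolding int_def
 by (rule integral_mono[OF assms(1,2)[unfolded sint_def]]) (use assms(3-5) in \<open>auto simp: indicator_def\<close>)

lemma set_integral_norm_le:
 fixes f :: "'a => 'b::{banach, second_countable_topology}"
 assumes "set_integrable M S f" "set_integrable M S g" "!!x. x : S ==> norm (f x) <= g x"
 shows "norm (LINT x:S|M. f x) <= (LINT x:S|M. g x)"
 by (rule order_trans[OF set_integral_norm_bound[OF assms(1)] set_integral_mono[OF set_integrable_norm[OF assms(1)] assms(2,3)]])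

lemma set_dominated_convergence_AE:
 fixes f :: "nat => 'a => 'b::{banach, second_countable_topology}"
 assumes "!!j. set_integrable M S (f j)" "set_integrable M S F" "set_integrable M S g"
  and "!!j. AE x in M. x : S \<longrightarrow> norm (f j x) <= g x" "AE x in M. x : S \<longrightarrow> (%j. f j x) ----> F x"
 shows "(%j. LINT x:S|M. f j x) ----> (LINT x:S|M. F x)"
 unfolding int_def
proof (rule integral_dominated_convergence[OF _ _ assms(3)[unfolded sint_def]])
 show "(%x. ind S x *R F x) : borel_measurable M" "(%x. ind S x *R f j x) : borel_measurable M" for j
  using assms(1,2) unfolding sint_def by (blast intro: borel_measurable_integrable)+
 show "AE x in M. (%j. ind S x *R f j x) ----> ind S x *R F x"
  using assms(5) by eventually_elim (simp add: indicator_def)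
 show "AE x in M. norm (ind S x *R f j x) <= ind S x *R g x" for j
  using assms(4)[of j] by eventually_elim (simp add: indicator_def)
qed

lemma set_borel_measurable_open:
 fixes f :: "'a::euclidean_space => 'b::{banach, second_countable_topology}"
 assumes "open S" "continuous_on S f"
 shows "set_borel_measurable lborel S f"
 unfolding set_borel_measurable_def
 using borel_measurable_continuous_on_indicator[OF _ assms(2)] assms(1) by simp

lemma set_dominated_convergence:
 fixes f :: "nat => 'a::euclidean_space => 'b::{banach, second_countable_topology}"
 assumes S: "open S" and c: "!!j. continuous_on S (f j)" "continuous_on S F" and g: "sint S g"
  and b: "!!j x. x : S ==> norm (f j x) <= g x" and lim: "!!x. x : S ==> (%j. f j x) ----> F x"
 shows "sint S (f j)" "sint S F" "(%j. SINT x:S. f j x) ----> (SINT x:S. F x)"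
proof -
 have "norm (f j x) <= norm (g x)" if "x : S" for j x using b[OF that, of j] by simp
 thus i: "sint S (f j)" for j
  by (intro set_integrable_bound[OF g set_borel_measurable_open[OF S c(1)]] AE_I2) simp
 have "norm (F x) <= norm (g x)" if "x : S" for x
  by (rule order_trans[OF LIMSEQ_le_const2[OF tendsto_norm[OF lim[OF that]], of "g x"]]) (use b[OF that] in auto)
 thus "sint S F"
  by (intro set_integrable_bound[OF g set_borel_measurable_open[OF S c(2)]] AE_I2) simp
 thus "(%j. SINT x:S. f j x) ----> (SINT x:S. F x)"
  by (intro set_dominated_convergence_AE[OF i _ g] AE_I2) (use b lim in auto)
qed

lemma set_integral_weight:
 fixes f :: "'a::euclidean_space => 'b::{banach, second_countable_topology}" and w :: "'a => real"
 assumes f: "sint S f" and w: "w : borel_measurable borel" "!!x. x : S ==> \<bar>w x\<bar> <= B"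
 shows "sint S (%x. w x *R f x)"
 unfolding sint_def
proof (rule Bochner_Integration.integrable_bound)
 have i: "integrable lborel (%x. ind S x *R f x)" using f unfolding sint_def .
 thus "integrable lborel (%x. B *R (ind S x *R f x))" by (rule integrable_scaleR_right)
 have "(%x. w x *R (ind S x *R f x)) : borel_measurable lborel"
  by (rule borel_measurable_scaleR[OF _ borel_measurable_integrable[OF i]]) (use w(1) in simp)
 thus "(%x. ind S x *R w x *R f x) : borel_measurable lborel" by (simp only: scaleR_left_commute)
 have "norm (w x *R f x) <= norm (B *R f x)" if "x : S" for x
  using w(2)[OF that] by (simp add: mult_right_mono)
 thus "AE x in lborel. norm (ind S x *R w x *R f x) <= norm (B *R (ind S x *R f x))"
  by (intro AE_I2) (simp add: indicator_def)
qed

lemma set_integral_weight_limit: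
 fixes f :: "'a::euclidean_space => 'b::{banach, second_countable_topology}" and w :: "nat => 'a => real"
 assumes f: "sint S f" and w: "!!j. w j : borel_measurable borel" "!!j x. x : S ==> \<bar>w j x\<bar> <= 1"
  and l: "!!x. x : S ==> \<forall>\<^sub>F j in sequentially. w j x = c"
 shows "(%j. SINT x:S. w j x *R f x) ----> c *R (SINT x:S. f x)"
proof -
 have "(%j. SINT x:S. w j x *R f x) ----> (SINT x:S. c *R f x)"
 proof (rule set_dominated_convergence_AE[OF set_integral_weight[OF f w] set_integrable_scaleR_right[OF f] set_integrable_norm[OF f]])
  show "AE x in lborel. x : S \<longrightarrow> norm (w j x *R f x) <= norm (f x)" for j
   using w(2) by (intro AE_I2) (simp add: mult_left_le_one_le)
  have "(%j. w j x *R f x) ----> c *R f x" if "x : S" for x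
   by (rule tendsto_eventually) (use l[OF that] in eventually_elim, simp)
  thus "AE x in lborel. x : S \<longrightarrow> (%j. w j x *R f x) ----> c *R f x" by simp
 qed
 thus ?thesis by (simp only: set_integral_scaleR_right)
qed

lemma set_integral_vanishing:
 fixes f :: "'a::euclidean_space => 'b::{banach, second_countable_topology}" and S :: "nat => 'a set"
 assumes f: "sint T f" and S: "!!j. S j : sets borel" "!!j. S j \<subseteq> T"
  and l: "!!x. x : T ==> \<forall>\<^sub>F j in sequentially. x \<notin> S j"
 shows "(%j. SINT x:S j. f x) ----> 0"
proof -
 have eq: "(SINT x:S j. f x) = (SINT x:T. ind (S j) x *R f x)" for j
  unfolding int_def using S(2)[of j] by (intro Bochner_Integration.integral_cong) (auto simp: indicator_def)
 have "(%j. SINT x:T. ind (S j) x *R f x) ----> 0 *R (SINT x:T. f x)"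
 proof (rule set_integral_weight_limit[OF f])
  show "\<forall>\<^sub>F j in sequentially. ind (S j) x = 0" if "x : T" for x
   using l[OF that] by eventually_elim simp
 qed (use S(1) in \<open>auto simp: indicator_def\<close>)
 thus ?thesis unfolding eq by simp
qed

text \<open>If \<open>f\<close> is not integrable, the left side is 0 by convention, and the sign of
  \<open>g\<close> covers this case.\<close>

lemma set_integral_mono_nonneg:
 fixes f g :: "'a => real"
 assumes "set_integrable M S g" "!!x. x : S ==> f x <= g x" "!!x. x : S ==> 0 <= g x"
 shows "(LINT x:S|M. f x) <= (LINT x:S|M. g x)"
 unfolding int_def
 by (rule Bochner_Integration.integral_mono'[OF assms(1)[unfolded sint_def]]) (use assms(2,3) in \<open>auto simp: indicator_def\<close>)

lemma set_integral_split:
 fixes f :: "'a::euclidean_space => 'b::{banach, second_countable_topology}"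
 assumes f: "sint S f" and A: "A : sets borel" "A \<subseteq> S" and B: "B : sets borel" "B \<subseteq> S" "A \<inter> B = {}"
  and ae: "AE x in lborel. x : S \<longrightarrow> x : A \<or> x : B \<or> f x = 0"
 shows "sint A f" "sint B f" "(SINT x:S. f x) = (SINT x:A. f x) + (SINT x:B. f x)"
proof -
 show i: "sint A f" "sint B f" by (intro set_integrable_subset[OF f]; use A B in simp)+
 have "(SINT x:S. f x) = (LINT x|lborel. ind A x *R f x + ind B x *R f x)"
  unfolding int_def
 proof (rule integral_cong_AE)
  show "(%x. ind S x *R f x) : borel_measurable lborel" "(%x. ind A x *R f x + ind B x *R f x) : borel_measurable lborel"
   using f i unfolding sint_def by - (intro borel_measurable_add borel_measurable_integrable; assumption)+
  show "AE x in lborel. ind S x *R f x = ind A x *R f x + ind B x *R f x"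
   using ae by eventually_elim (use A(2) B(2,3) in \<open>auto simp: indicator_def\<close>)
 qed
 thus "(SINT x:S. f x) = (SINT x:A. f x) + (SINT x:B. f x)"
  using i by (simp add: sint_def int_def)
qed

section \<open>Cutoffs at the ends of the angular interval\<close>

definition edges :: "real => real set" where
 "edges et = {0<..<et} \<union> {pi - et<..<pi}"

text \<open>The shift by 4 keeps \<open>eta k\<close> at most 1/4, so the two transition layers of
  \<open>bump k\<close>, at distances between eta and 2 eta from 0 and from pi, are
  disjoint.\<close>

definition eta :: "nat => real" where "eta k = 1 / (real k + 4)"

definition bump :: "nat => real => real" where
 "bump k p = step (p / eta k - 1) * step ((pi - p) / eta k - 1)"

definition bump' :: "nat => real => real" where
 "bump' k p = step' (p / eta k - 1) / eta k * step ((pi - p) / eta k - 1)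
   - step (p / eta k - 1) * (step' ((pi - p) / eta k - 1) / eta k)"

lemma eta: "eta k > 0" "eta k <= 1/4" "eta k <= pi - eta k" "eta k ~= 0"
proof -
 show p: "eta k > 0" by (simp add: eta_def add_nonneg_pos)
 show le: "eta k <= 1/4" by (simp add: eta_def field_simps)
 show "eta k <= pi - eta k" using le pi_gt3 by linarith
 show "eta k ~= 0" using p by simp
qed

lemma eta_tendsto: "eta ----> 0"
 unfolding eta_def using LIMSEQ_ignore_initial_segment[OF lim_const_over_n[of "1::real"], of 4]
 by (simp add: add.commute)

lemma bump_deriv: "(bump k has_real_derivative bump' k p) (at p)"
proof -
 have 1: "((%p. step (p / eta k - 1)) has_real_derivative step' (p / eta k - 1) * (1 / eta k)) (at p)"
  by (rule DERIV_chain2[OF step_deriv]) (auto intro!: derivative_eq_intros simp: eta(4))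
 have 2: "((%p. step ((pi - p) / eta k - 1)) has_real_derivative step' ((pi - p) / eta k - 1) * (- 1 / eta k)) (at p)"
  by (rule DERIV_chain2[OF step_deriv]) (auto intro!: derivative_eq_intros simp: eta(4))
 show ?thesis
  unfolding bump_def by (rule DERIV_cong[OF DERIV_mult[OF 1 2]]) (simp add: bump'_def)
qed

lemma step_continuous [continuous_intros]:
 "continuous_on S g ==> continuous_on S (%x. step (g x))"
 "continuous_on S g ==> continuous_on S (%x. step' (g x))"
proof -
 have "continuous_on UNIV step"
  by (rule DERIV_continuous_on[OF step_deriv])
 thus "continuous_on S g ==> continuous_on S (%x. step (g x))"
  by (rule continuous_on_compose2) simp_all
 show "continuous_on S g ==> continuous_on S (%x. step' (g x))"
  by (rule continuous_on_compose2[OF step'_cont]) simp_all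
qed

lemma bump'_cont: "continuous_on S (bump' k)"
 unfolding bump'_def[abs_def]
 by (intro continuous_intros) (simp_all add: eta(4))

lemma bump_cont: "continuous_on S (bump k)"
 by (rule DERIV_continuous_on[OF has_field_derivative_at_within[OF bump_deriv]])

lemma bump_continuous [continuous_intros]:
 "continuous_on S g ==> continuous_on S (%x. bump k (g x))"
 "continuous_on S g ==> continuous_on S (%x. bump' k (g x))"
 by (rule continuous_on_compose2[OF bump_cont[of UNIV]] continuous_on_compose2[OF bump'_cont[of UNIV]]; simp)+

lemma bump_bounds: "0 <= bump k p" "bump k p <= 1"
 using step_bounds by (auto simp: bump_def mult_le_one)

lemma bump_zero: "p <= eta k \<or> p >= pi - eta k ==> bump k p = 0 \<and> bump' k p = 0"
proof -
 assume "p <= eta k \<or> p >= pi - eta k"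
 hence "p / eta k - 1 <= 0 \<or> (pi - p) / eta k - 1 <= 0"
  using eta(1)[of k] by (auto simp: divide_le_eq)
 thus ?thesis by (auto simp: bump_def bump'_def)
qed

lemma bump'_zero:
 assumes "p : {0<..<pi}" "p \<notin> edges (2 * eta k)"
 shows "bump' k p = 0"
proof -
 have "p / eta k - 1 >= 1" "(pi - p) / eta k - 1 >= 1"
  using assms eta(1)[of k] by (auto simp: edges_def le_divide_eq algebra_simps)
 thus ?thesis by (simp add: bump'_def)
qed

lemma bump'_bound: "\<bar>bump' k p\<bar> <= 3 / eta k"
proof -
 let ?x = "p / eta k - 1" and ?y = "(pi - p) / eta k - 1"
 let ?d = "step' ?x * step ?y - step ?x * step' ?y"
 have "\<bar>step' ?x * step ?y\<bar> <= 3/2 * 1" "\<bar>step ?x * step' ?y\<bar> <= 1 * (3/2)"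
  unfolding abs_mult using step_bounds by (intro mult_mono; simp)+
 hence d: "\<bar>?d\<bar> <= 3" by linarith
 have e: "bump' k p = ?d / eta k" by (simp add: bump'_def diff_divide_distrib)
 have "\<bar>?d / eta k\<bar> = \<bar>?d\<bar> / eta k" using eta(1)[of k] by (simp only: abs_divide abs_of_pos)
 thus ?thesis
  unfolding e using eta(1)[of k] d by (simp only: divide_right_mono less_imp_le)
qed

lemma bump_tendsto: "p : {0<..<pi} ==> \<forall>\<^sub>F k in sequentially. bump k p = 1"
proof -
 assume p: "p : {0<..<pi}"
 hence "\<forall>\<^sub>F k in sequentially. eta k < min (p / 2) ((pi - p) / 2)"
  by (intro order_tendstoD[OF eta_tendsto]) auto
 thus ?thesis
 proof eventually_elim
  case (elim k)
  hence "p / eta k - 1 >= 1" "(pi - p) / eta k - 1 >= 1"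
   using eta(1)[of k] by (auto simp: le_divide_eq algebra_simps)
  thus ?case by (simp add: bump_def)
 qed
qed

lemma strip_edges:
 fixes ah bt :: real
 assumes "0 < et" "et <= pi / 2"
 shows "edges et : sets lborel" "edges et \<subseteq> {0<..<pi}" "{ah<..<bt} \<times> edges et : sets lborel" "bounded ({ah<..<bt} \<times> edges et)"
  "ah <= bt ==> measure lborel ({ah<..<bt} \<times> edges et) = (bt - ah) * (2 * et)"
proof -
 show es: "edges et : sets lborel" "edges et \<subseteq> {0<..<pi}" using assms by (auto simp: edges_def)
 show "{ah<..<bt} \<times> edges et : sets lborel" by (auto simp: edges_def intro!: borel_open open_Times open_Un)
 show "bounded ({ah<..<bt} \<times> edges et)" by (intro bounded_Times bounded_subset[OF bounded_Ioo es(2)] bounded_Ioo)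
 have "emeasure lborel ({ah<..<bt} \<times> edges et) = emeasure lborel {ah<..<bt} * emeasure lborel (edges et)"
  unfolding lborel_prod[symmetric] by (rule lborel.emeasure_pair_measure_Times) (use es in auto)
 hence "measure lborel ({ah<..<bt} \<times> edges et) = measure lborel {ah<..<bt} * measure lborel (edges et)"
  unfolding measure_def by (simp only: enn2real_mult)
 also have "measure lborel (edges et) = measure lborel {0<..<et} + measure lborel {pi - et<..<pi}"
  unfolding edges_def by (rule measure_Union) (use assms in auto)
 finally show "ah <= bt ==> measure lborel ({ah<..<bt} \<times> edges et) = (bt - ah) * (2 * et)" using assms by simp
qed

section \<open>Waves on a half strip\<close>

text \<open>\<open>neumann\<close> is the boundary condition in the mean: over edges of width
  \<open>et\<close>, the L1 norm of the angular derivative is o (et), which is the form used in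
  \<open>rho_L1\<close>. The power \<open>exp (t / 2)\<close> in \<open>radiation\<close> arises
  because \<open>wt\<close> is r times the radial derivative and Sommerfeld's condition has the
  factor sqrt r.\<close>

locale strip_wave =
 fixes w wt wp wtt wpp :: "real => real => complex" and t0 :: real
 assumes dt: "!!t p. t0 < t ==> p : {0<..<pi} ==> ((%s. w s p) has_vector_derivative wt t p) (at t)"
  and dtt: "!!t p. t0 < t ==> p : {0<..<pi} ==> ((%s. wt s p) has_vector_derivative wtt t p) (at t)"
  and dp: "!!t p. t0 < t ==> p : {0<..<pi} ==> ((%s. w t s) has_vector_derivative wp t p) (at p)"
  and dpp: "!!t p. t0 < t ==> p : {0<..<pi} ==> ((%s. wp t s) has_vector_derivative wpp t p) (at p)"
  and pde: "!!t p. t0 < t ==> p : {0<..<pi} ==> wtt t p + wpp t p + of_real ((exp t)^2) * w t p = 0"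
  and w_cont: "continuous_on ({t0<..} \<times> {0<..<pi}) (%(t, p). w t p)"
  and wt_cont: "continuous_on ({t0<..} \<times> {0<..<pi}) (%(t, p). wt t p)"
  and wp_cont: "continuous_on ({t0<..} \<times> {0<..<pi}) (%(t, p). wp t p)"
  and wtt_cont: "continuous_on ({t0<..} \<times> {0<..<pi}) (%(t, p). wtt t p)"
  and wpp_cont: "continuous_on ({t0<..} \<times> {0<..<pi}) (%(t, p). wpp t p)"
  and bounded: "!!ah bt. t0 < ah ==> \<exists>B. \<forall>t\<in>{ah..bt}. \<forall>p\<in>{0<..<pi}. cmod (w t p) <= B"
  and energy_t: "!!ah bt. t0 < ah ==> sint ({ah<..<bt} \<times> {0<..<pi}) (%(t, p). nsq (wt t p))"
  and energy_p: "!!ah bt. t0 < ah ==> sint ({ah<..<bt} \<times> {0<..<pi}) (%(t, p). nsq (wp t p))"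
  and neumann: "!!ah bt. t0 < ah ==>
    ((%et. (SINT z:{ah<..<bt} \<times> edges et. (case z of (t, p) => cmod (wp t p))) / et) \<longlongrightarrow> 0) (at_right 0)"
  and radiation: "!!e. e > 0 ==> \<exists>T. \<forall>t\<ge>T. \<forall>p\<in>{0<..<pi}. cmod (wt t p - \<i> * of_real (exp t) * w t p) <= e * exp (t / 2)"
begin

text \<open>Angular coefficients smoothed by \<open>bump k\<close>. The integrand vanishes near both
  sides of the strip, so differentiation under the integral and integration by parts use interior
  regularity only.\<close>

definition I :: "(real => real => complex) => nat => nat => real => complex" where
 "I f n k t = integral {eta k..pi - eta k} (%p. f t p * of_real (cos (real n * p) * bump k p))"

text \<open>The terms in which a derivative falls on the cutoff. The first is controlled by
  \<open>neumann\<close>, the second by the zeros of the sine at 0 and pi.\<close>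

definition rho :: "nat => nat => real => complex" where
 "rho n k t = integral {eta k..pi - eta k}
   (%p. wp t p * of_real (cos (real n * p) * bump' k p) + w t p * of_real (real n * sin (real n * p) * bump' k p))"

definition V :: "nat => real => complex" where "V n t = cosine.coef (w t) n"

lemma sub: "{eta k..pi - eta k} \<subseteq> {0<..<pi}"
 using eta(1)[of k] by auto

lemma slice_cont:
 assumes "continuous_on ({t0<..} \<times> {0<..<pi}) (%(t, p). f t p)" "t0 < t"
 shows "continuous_on {0<..<pi} (f t)"
proof -
 have "continuous_on {0<..<pi} (%p. case (t, p) of (t, p) => f t p)"
  by (rule continuous_on_compose2[OF assms(1)]) (use assms(2) in \<open>auto intro!: continuous_intros\<close>)
 thus ?thesis by simp
qed

lemmas slices = slice_cont[OF w_cont] slice_cont[OF wt_cont] slice_cont[OF wp_cont]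
 slice_cont[OF wtt_cont] slice_cont[OF wpp_cont]

lemma slice_int:
 fixes f :: "real => complex"
 assumes "continuous_on {0<..<pi} f" "continuous_on UNIV g"
 shows "(%p. f p * of_real (g p)) integrable_on {eta k..pi - eta k}"
 by (intro integrable_continuous_interval continuous_intros continuous_on_subset[OF assms(1) sub]
   continuous_on_subset[OF assms(2)]) simp

lemma J_eq_mpi:
 fixes f :: "real => complex"
 assumes "continuous_on {0<..<pi} f" "continuous_on UNIV g" "!!p. p <= eta k \<or> p >= pi - eta k ==> g p = 0"
 shows "integral {eta k..pi - eta k} (%p. f p * of_real (g p)) = (LINT p|mpi. f p * of_real (g p))"
  and "integrable mpi (%p. f p * of_real (g p))"
proof -
 let ?g = "%p. f p * of_real (g p)"
 have "continuous_on {eta k..pi - eta k} ?g"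
  by (intro continuous_intros continuous_on_subset[OF assms(1) sub] continuous_on_subset[OF assms(2)]) auto
 hence i: "sint {eta k..pi - eta k} ?g" by (rule borel_integrable_atLeastAtMost')
 have z: "ind {eta k..pi - eta k} p *R ?g p = ind {0<..<pi} p *R ?g p" for p
  using assms(3)[of p] sub[of k] by (cases "p : {eta k..pi - eta k}") (auto simp: indicator_def)
 show "integrable mpi ?g"
  using i unfolding integrable_mpi_iff sint_def z .
 show "integral {eta k..pi - eta k} ?g = (LINT p|mpi. ?g p)"
  unfolding set_borel_integral_eq_integral(2)[OF i, symmetric] integral_mpi int_def z ..
qed

lemma I_eq_mpi:
 assumes "continuous_on {0<..<pi} (f t)"
 shows "I f n k t = (LINT p|mpi. f t p * of_real (cos (real n * p) * bump k p))"
  and "integrable mpi (%p. f t p * of_real (cos (real n * p) * bump k p))"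
 unfolding I_def by (rule J_eq_mpi[OF assms]; use bump_zero in \<open>auto intro!: continuous_intros\<close>)+

lemma I_deriv:
 assumes df: "!!t p. t0 < t ==> p : {0<..<pi} ==> ((%s. f s p) has_vector_derivative f' t p) (at t)"
  and f: "continuous_on ({t0<..} \<times> {0<..<pi}) (%(t, p). f t p)"
  and f': "continuous_on ({t0<..} \<times> {0<..<pi}) (%(t, p). f' t p)" and t: "t0 < t"
 shows "(I f n k has_vector_derivative I f' n k t) (at t)"
proof -
 let ?c = "%p. complex_of_real (cos (real n * p) * bump k p)"
 have "((%t. integral (cbox (eta k) (pi - eta k)) (%p. f t p * ?c p)) has_vector_derivative
   integral (cbox (eta k) (pi - eta k)) (%p. f' t p * ?c p)) (at t within {t0<..})"
 proof (rule leibniz_rule_vector_derivative)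
  show "((%t. f t p * ?c p) has_vector_derivative f' t p * ?c p) (at t within {t0<..})"
   if "t : {t0<..}" "p : cbox (eta k) (pi - eta k)" for t p
  proof -
   have "p : {0<..<pi}" "t0 < t" using that sub[of k] by auto
   thus ?thesis
    by (intro has_vector_derivative_mult_left has_vector_derivative_at_within[OF df])
  qed
  show "(%p. f t p * ?c p) integrable_on cbox (eta k) (pi - eta k)" if "t : {t0<..}" for t
   unfolding cbox_interval using that
   by (intro slice_int slice_cont[OF f] continuous_intros bump_cont) simp
  have "continuous_on ({t0<..} \<times> cbox (eta k) (pi - eta k)) (%z. (case z of (t, p) => f' t p) * ?c (snd z))"
  proof (intro continuous_on_mult continuous_on_of_real continuous_on_cos bump_continuous continuous_on_snd continuous_on_id continuous_on_const)
   show "continuous_on ({t0<..} \<times> cbox (eta k) (pi - eta k)) (%z. case z of (t, p) => f' t p)"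
    by (rule continuous_on_subset[OF f']) (use sub[of k] in auto)
  qed
  thus "continuous_on ({t0<..} \<times> cbox (eta k) (pi - eta k)) (%(t, p). f' t p * ?c p)"
   by (simp add: case_prod_beta)
 qed (use t in auto)
 thus ?thesis
  using t unfolding I_def[abs_def] cbox_interval by (subst (asm) at_within_open) auto
qed

text \<open>Integration by parts; there are no boundary terms because \<open>g\<close> vanishes at
  both ends.\<close>

lemma integral_deriv_zero:
 fixes f f' :: "real => complex"
 assumes "!!p. p : {0<..<pi} ==> (f has_vector_derivative f' p) (at p)"
  and g: "!!p. (g has_real_derivative g' p) (at p)" and z: "!!p. p = eta k \<or> p = pi - eta k ==> g p = 0"
  and c: "continuous_on {0<..<pi} f'" "continuous_on UNIV g'"
 shows "integral {eta k..pi - eta k} (%p. f' p * of_real (g p)) = - integral {eta k..pi - eta k} (%p. f p * of_real (g' p))"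
proof -
 have fc: "continuous_on {0<..<pi} f"
  by (rule continuous_on_vector_derivative[OF has_vector_derivative_at_within[OF assms(1)]])
 have gc: "continuous_on UNIV g"
  by (rule DERIV_continuous_on[OF has_field_derivative_at_within[OF g]])
 have 1: "((%p. f p * of_real (g p)) has_vector_derivative (f p * of_real (g' p) + f' p * of_real (g p))) (at p within {eta k..pi - eta k})"
  if "p : {eta k..pi - eta k}" for p
 proof -
  have "((%p. complex_of_real (g p)) has_vector_derivative of_real (g' p)) (at p)"
   using g[of p] by (intro has_vector_derivative_of_real) (simp add: has_real_derivative_iff_has_vector_derivative)
  hence "((%p. complex_of_real (g p)) has_vector_derivative of_real (g' p)) (at p within {eta k..pi - eta k})"
   by (rule has_vector_derivative_at_within)
  moreover have "p : {0<..<pi}" using that sub[of k] by auto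
  ultimately show ?thesis
   by (intro has_vector_derivative_mult has_vector_derivative_at_within[OF assms(1)])
 qed
 have "((%p. f p * of_real (g' p) + f' p * of_real (g p)) has_integral
   (f (pi - eta k) * of_real (g (pi - eta k)) - f (eta k) * of_real (g (eta k)))) {eta k..pi - eta k}"
  by (rule fundamental_theorem_of_calculus[OF _ 1]) (use eta[of k] in auto)
 hence "integral {eta k..pi - eta k} (%p. f p * of_real (g' p) + f' p * of_real (g p)) = 0"
  using z by (simp add: integral_unique)
 moreover have "integral {eta k..pi - eta k} (%p. f p * of_real (g' p) + f' p * of_real (g p)) =
  integral {eta k..pi - eta k} (%p. f p * of_real (g' p)) + integral {eta k..pi - eta k} (%p. f' p * of_real (g p))"
  by (intro integral_add integrable_continuous_interval continuous_intros
    continuous_on_subset[OF fc sub] continuous_on_subset[OF c(1) sub]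
    continuous_on_subset[OF c(2)] continuous_on_subset[OF gc]) auto
 ultimately show ?thesis by (simp add: eq_neg_iff_add_eq_0 add.commute)
qed

lemma integral_lincomb:
 fixes F G :: "real => complex"
 assumes "F integrable_on S" "G integrable_on S"
 shows "integral S (%p. F p + c * G p) = integral S F + c * integral S G"
 by (simp only: integral_add[OF assms(1) integrable_on_mult_right[OF assms(2)]] integral_mult_right)

lemma sine_parts:
 assumes t: "t0 < t"
 shows "integral {eta k..pi - eta k} (%p. wp t p * of_real (sin (real n * p) * bump k p)) =
  - (integral {eta k..pi - eta k} (%p. w t p * of_real (sin (real n * p) * bump' k p)) + of_real (real n) * I w n k t)"
proof -
 let ?J = "integral {eta k..pi - eta k}"
 let ?c = "%p. cos (real n * p)" and ?s = "%p. sin (real n * p)"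
 note int = slice_int[OF slices(1)[OF t]]
 have g2: "((%p. ?s p * bump k p) has_real_derivative (?s p * bump' k p + real n * ?c p * bump k p)) (at p)" for p
  by (auto intro!: derivative_eq_intros bump_deriv)
 have B: "?J (%p. wp t p * of_real (?s p * bump k p)) =
   - ?J (%p. w t p * of_real (?s p * bump' k p + real n * ?c p * bump k p))"
 proof (rule integral_deriv_zero[OF dp[OF t] g2 _ slices(3)[OF t]])
  show "?s p * bump k p = 0" if "p = eta k \<or> p = pi - eta k" for p using that bump_zero[of p k] by auto
 qed (assumption | intro continuous_intros bump_cont bump'_cont)+
 have B2: "?J (%p. w t p * of_real (?s p * bump' k p + real n * ?c p * bump k p)) =
   ?J (%p. w t p * of_real (?s p * bump' k p)) + of_real (real n) * I w n k t"
 proof -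
  have "(%p. w t p * of_real (?s p * bump' k p + real n * ?c p * bump k p)) =
   (%p. w t p * of_real (?s p * bump' k p) + of_real (real n) * (w t p * of_real (?c p * bump k p)))"
   by (auto simp: algebra_simps)
  moreover have "?J ... = ?J (%p. w t p * of_real (?s p * bump' k p)) + of_real (real n) * ?J (%p. w t p * of_real (?c p * bump k p))"
   by (intro integral_lincomb int continuous_intros bump_cont bump'_cont)
  ultimately show ?thesis unfolding I_def by (simp only:)
 qed
 show ?thesis unfolding B B2 by (rule refl)
qed

text \<open>The equation replaces \<open>wtt\<close>, and two integrations by parts in p bring the
  cosine back with the factor n^2; what falls on the cutoff is \<open>rho\<close>.\<close>

lemma I_wtt:
 assumes t: "t0 < t"
 shows "I wtt n k t = of_real ((real n)^2 - (exp t)^2) * I w n k t + rho n k t"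
proof -
 let ?J = "integral {eta k..pi - eta k}"
 let ?c = "%p. cos (real n * p)" and ?s = "%p. sin (real n * p)"
 note int = slice_int[OF slices(1)[OF t]] slice_int[OF slices(3)[OF t]] slice_int[OF slices(5)[OF t]]
 have g1: "((%p. ?c p * bump k p) has_real_derivative (?c p * bump' k p - real n * ?s p * bump k p)) (at p)" for p
  by (auto intro!: derivative_eq_intros bump_deriv)
 have A: "?J (%p. wpp t p * of_real (?c p * bump k p)) =
   - ?J (%p. wp t p * of_real (?c p * bump' k p - real n * ?s p * bump k p))"
 proof (rule integral_deriv_zero[OF dpp[OF t] g1 _ slices(5)[OF t]])
  show "?c p * bump k p = 0" if "p = eta k \<or> p = pi - eta k" for p using that bump_zero[of p k] by auto
 qed (assumption | intro continuous_intros bump_cont bump'_cont)+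
 have A2: "?J (%p. wp t p * of_real (?c p * bump' k p - real n * ?s p * bump k p)) =
   ?J (%p. wp t p * of_real (?c p * bump' k p)) - real n * ?J (%p. wp t p * of_real (?s p * bump k p))"
 proof -
  have "(%p. wp t p * of_real (?c p * bump' k p - real n * ?s p * bump k p)) =
   (%p. wp t p * of_real (?c p * bump' k p) + (- of_real (real n)) * (wp t p * of_real (?s p * bump k p)))"
   by (auto simp: algebra_simps)
  moreover have "?J ... = ?J (%p. wp t p * of_real (?c p * bump' k p)) + (- of_real (real n)) * ?J (%p. wp t p * of_real (?s p * bump k p))"
   by (intro integral_lincomb int continuous_intros bump_cont bump'_cont)
  ultimately show ?thesis by (simp only:) simp
 qed
 have R: "rho n k t = ?J (%p. wp t p * of_real (?c p * bump' k p)) + real n * ?J (%p. w t p * of_real (?s p * bump' k p))"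
 proof -
  have "(%p. wp t p * of_real (?c p * bump' k p) + w t p * of_real (real n * ?s p * bump' k p)) =
    (%p. wp t p * of_real (?c p * bump' k p) + of_real (real n) * (w t p * of_real (?s p * bump' k p)))"
   by (auto simp: algebra_simps)
  moreover have "?J ... = ?J (%p. wp t p * of_real (?c p * bump' k p)) + of_real (real n) * ?J (%p. w t p * of_real (?s p * bump' k p))"
   by (intro integral_lincomb int continuous_intros bump_cont bump'_cont)
  ultimately show ?thesis unfolding rho_def by (simp only:)
 qed
 have C: "I wtt n k t = - ?J (%p. wpp t p * of_real (?c p * bump k p)) - of_real ((exp t)^2) * I w n k t"
 proof -
  have "I wtt n k t = ?J (%p. wpp t p * of_real (- (?c p * bump k p)) + (- of_real ((exp t)^2)) * (w t p * of_real (?c p * bump k p)))"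
   unfolding I_def
  proof (rule integral_cong)
   fix p assume "p : {eta k..pi - eta k}"
   hence "wtt t p + wpp t p + of_real ((exp t)^2) * w t p = 0"
    using pde[OF t, of p] sub[of k] by blast
   hence e: "wtt t p = - wpp t p - of_real ((exp t)^2) * w t p"
    by (simp only: diff_conv_add_uminus minus_add_distrib[symmetric] eq_neg_iff_add_eq_0 add.assoc)
   show "wtt t p * of_real (?c p * bump k p) =
    wpp t p * of_real (- (?c p * bump k p)) + (- of_real ((exp t)^2)) * (w t p * of_real (?c p * bump k p))"
    unfolding e of_real_minus left_diff_distrib by (simp only: mult.assoc mult_minus_left mult_minus_right diff_conv_add_uminus)
  qed
  also have "... = ?J (%p. wpp t p * of_real (- (?c p * bump k p))) + (- of_real ((exp t)^2)) * ?J (%p. w t p * of_real (?c p * bump k p))"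
   by (intro integral_lincomb int continuous_intros bump_cont)
  finally show ?thesis unfolding I_def of_real_minus mult_minus_right integral_neg by simp
 qed
 show ?thesis
  unfolding C A A2 sine_parts[OF t] R by (simp add: power2_eq_square ring_distribs)
qed

lemma bump_mass: "(%k. LINT p|mpi. 1 - bump k p) ----> 0"
proof -
 have "(%k. LINT p|mpi. 1 - bump k p) ----> (LINT p|mpi. 0)"
 proof (rule integral_dominated_convergence[where w = "%_. 1"])
  show "AE p in mpi. (%k. 1 - bump k p) ----> 0"
  proof (rule AE_I2)
   fix p assume "p : space mpi"
   hence "\<forall>\<^sub>F k in sequentially. bump k p = 1" by (intro bump_tendsto) simp
   hence "\<forall>\<^sub>F k in sequentially. 1 - bump k p = 0" by eventually_elim simp
   thus "(%k. 1 - bump k p) ----> 0" by (rule tendsto_eventually)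
  qed
  show "integrable mpi (%_. 1::real)" by (rule finite_measure.integrable_const[OF finite_mpi])
  show "(%p. 1 - bump k p) : borel_measurable mpi" for k
   by (intro borel_measurable_mpiI continuous_intros)
 qed (use bump_bounds in \<open>auto intro!: AE_I2\<close>)
 thus ?thesis by simp
qed

lemma slice_sq_int:
 assumes "t0 < t" shows "sq_int mpi (w t)"
proof -
 obtain B where B: "\<forall>s\<in>{t..t}. \<forall>p\<in>{0<..<pi}. cmod (w s p) <= B" using bounded[OF assms] by blast
 have "w t : borel_measurable mpi" by (rule borel_measurable_mpiI[OF slices(1)[OF assms]])
 thus ?thesis
  unfolding sq_int_def using B
  by (auto intro!: finite_measure.integrable_const_bound[OF finite_mpi, of _ "B^2"] AE_I2 power_mono)
qed

lemma slice_complete: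
 assumes "t0 < t" shows "cosine.complete_for (w t)"
proof -
 obtain B where B: "\<forall>s\<in>{t..t}. \<forall>p\<in>{0<..<pi}. cmod (w s p) <= B" using bounded[OF assms] by blast
 show ?thesis
  by (rule cosine_complete[OF slices(1)[OF assms], of B]) (use B in auto)
qed

text \<open>On a bounded range of t one constant bounds the field, so the error is at most this
  constant times the mass of \<open>1 - bump k\<close>, in which t does not occur.\<close>

lemma I_uniform:
 assumes "t0 < a"
 shows "uniform_limit {a..b} (%k. I w n k) (V n) sequentially"
proof (rule uniform_limitI)
 fix e :: real assume e: "e > 0"
 obtain B where B: "\<forall>t\<in>{a..b}. \<forall>p\<in>{0<..<pi}. cmod (w t p) <= B" using bounded[OF assms] by blast
 define B' where "B' = max B 1"
 have B': "B' > 0" "!!t p. t : {a..b} ==> p : {0<..<pi} ==> cmod (w t p) <= B'"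
  using B by (auto simp: B'_def le_max_iff_disj)
 have "\<forall>\<^sub>F k in sequentially. (LINT p|mpi. 1 - bump k p) < e / B'"
  using bump_mass e B' by (intro order_tendstoD) auto
 thus "\<forall>\<^sub>F k in sequentially. \<forall>t\<in>{a..b}. dist (I w n k t) (V n t) < e"
 proof eventually_elim
  case (elim k)
  show ?case
  proof
   fix t assume t: "t : {a..b}"
   hence t0: "t0 < t" using assms by auto
   note c = slices(1)[OF t0]
   have "V n t = (LINT p|mpi. w t p * of_real (cos (real n * p)))"
    by (simp add: V_def cosine.coef_def)
   moreover have "integrable mpi (%p. w t p * of_real (cos (real n * p)))"
    using sq_int_prod[OF slice_sq_int[OF t0] cosine.sq_int_e[of n]] by simp
   ultimately have "V n t - I w n k t =
     (LINT p|mpi. w t p * of_real (cos (real n * p)) - w t p * of_real (cos (real n * p) * bump k p))"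
    unfolding I_eq_mpi(1)[where f = w, OF c] using I_eq_mpi(2)[where f = w, OF c] by simp
   also have "cmod ... <= (LINT p|mpi. B' * (1 - bump k p))"
   proof (rule Bochner_Integration.integral_norm_bound_integral)
    show "integrable mpi (%p. w t p * of_real (cos (real n * p)) - w t p * of_real (cos (real n * p) * bump k p))"
     using I_eq_mpi(2)[where f = w, OF c] sq_int_prod[OF slice_sq_int[OF t0] cosine.sq_int_e[of n]] by simp
    show "integrable mpi (%p. B' * (1 - bump k p))"
     by (rule finite_measure.integrable_const_bound[OF finite_mpi, of _ B'])
       (use B'(1) bump_bounds in \<open>auto intro!: AE_I2 borel_measurable_mpiI continuous_intros simp: abs_mult\<close>)
    fix p assume "p : space mpi"
    hence p: "p : {0<..<pi}" by simp
    have "w t p * of_real (cos (real n * p)) - w t p * of_real (cos (real n * p) * bump k p)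
     = w t p * of_real (cos (real n * p) * (1 - bump k p))" by (simp add: algebra_simps)
    also have "cmod ... = cmod (w t p) * (\<bar>cos (real n * p)\<bar> * (1 - bump k p))"
     using bump_bounds[of k p] by (simp only: norm_mult norm_of_real abs_mult abs_of_nonneg diff_ge_0_iff_ge)
    also have "... <= B' * (1 * (1 - bump k p))"
     using B'(2)[OF t p] bump_bounds[of k p] B'(1) by (intro mult_mono) auto
    finally show "cmod (w t p * of_real (cos (real n * p)) - w t p * of_real (cos (real n * p) * bump k p)) <= B' * (1 - bump k p)"
     by simp
   qed
   also have "... = B' * (LINT p|mpi. 1 - bump k p)" by simp
   also have "... < e" using elim B'(1) by (simp add: field_simps)
   finally show "dist (I w n k t) (V n t) < e" by (simp add: dist_norm norm_minus_commute)
  qed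
 qed
qed

lemma rho_cont: "t0 < a ==> continuous_on {a..b} (rho n k)"
proof -
 assume a: "t0 < a"
 have s: "{a..b} \<times> cbox (eta k) (pi - eta k) \<subseteq> {t0<..} \<times> {0<..<pi}"
  using a sub[of k] by auto
 have "continuous_on {a..b} (%t. integral (cbox (eta k) (pi - eta k))
   (%p. wp t p * of_real (cos (real n * p) * bump' k p) + w t p * of_real (real n * sin (real n * p) * bump' k p)))"
 proof (rule integral_continuous_on_param)
  have "continuous_on ({a..b} \<times> cbox (eta k) (pi - eta k))
    (%z. (case z of (t, p) => wp t p) * of_real (cos (real n * snd z) * bump' k (snd z)) +
     (case z of (t, p) => w t p) * of_real (real n * sin (real n * snd z) * bump' k (snd z)))"
   by (intro continuous_on_add continuous_on_mult continuous_on_of_real continuous_on_cos continuous_on_sin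
      bump_continuous continuous_on_snd continuous_on_id continuous_on_const
      continuous_on_subset[OF wp_cont s] continuous_on_subset[OF w_cont s])
  thus "continuous_on ({a..b} \<times> cbox (eta k) (pi - eta k))
   (%(t, p). wp t p * of_real (cos (real n * p) * bump' k p) + w t p * of_real (real n * sin (real n * p) * bump' k p))"
   by (simp add: case_prod_beta)
 qed
 thus ?thesis by (simp only: rho_def[abs_def] cbox_interval)
qed

lemma wp_integrable:
 assumes "t0 < ah"
 shows "sint ({ah<..<bt} \<times> {0<..<pi}) (%(t, p). cmod (wp t p))"
proof -
 let ?S = "{ah<..<bt} \<times> {0<..<pi}"
 have S: "open ?S" "bounded ?S" by (intro open_Times bounded_Times; simp)+
 have one: "sint ?S (%_. 1::real)" by (rule set_integrable_const) (use S in auto)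
 from set_integral_add(1)[OF one energy_p[OF assms]] show ?thesis
 proof (rule set_integrable_bound)
  have "continuous_on ?S (%z. cmod (case z of (t, p) => wp t p))"
   by (intro continuous_intros continuous_on_subset[OF wp_cont]) (use assms in auto)
  thus "set_borel_measurable lborel ?S (%(t, p). cmod (wp t p))"
   unfolding case_prod_beta by (rule set_borel_measurable_open[OF S(1)])
  show "AE z in lborel. z : ?S \<longrightarrow> norm (case z of (t, p) => cmod (wp t p)) <= norm (1 + (case z of (t, p) => nsq (wp t p)))"
   using norm_le_sq by (auto intro!: AE_I2 simp: abs_of_nonneg add_nonneg_nonneg)
 qed
qed

lemma sin_edge:
 assumes p: "p : {0<..<pi}" and True: "p : edges (2 * eta k)"
 shows "\<bar>sin (real n * p)\<bar> <= real n * (2 * eta k)"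
proof -
 consider "p < 2 * eta k" | "pi - p < 2 * eta k" using True by (auto simp: edges_def)
 thus ?thesis
 proof cases
  case 1
  have "\<bar>sin (real n * p)\<bar> <= \<bar>real n * p\<bar>" by (rule abs_sin_x_le_abs_x)
  also have "... <= real n * (2 * eta k)" using 1 p by (simp add: abs_mult mult_left_mono)
  finally show ?thesis .
 next
  case 2
  have "sin (real n * p) = sin (real n * pi - real n * (pi - p))" by (simp add: algebra_simps)
  also have "... = - (cos (real n * pi) * sin (real n * (pi - p)))" by (simp add: sin_diff)
  finally have "\<bar>sin (real n * p)\<bar> <= \<bar>sin (real n * (pi - p))\<bar>"
   by (simp add: abs_mult cos_npi)
  also have "... <= \<bar>real n * (pi - p)\<bar>" by (rule abs_sin_x_le_abs_x)
  also have "... <= real n * (2 * eta k)" using 2 p by (simp add: abs_mult mult_left_mono)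
  finally show ?thesis .
 qed
qed

text \<open>\<open>bump'\<close> is of size 1 / eta, but sin (n p) vanishes at 0 and pi and is at
  most 2 n eta on the edges, so the second term of \<open>rho\<close> stays bounded. The first keeps
  the factor 1 / eta.\<close>

lemma rho_pointwise:
 assumes t: "t0 < t" and B: "!!p. p : {0<..<pi} ==> cmod (w t p) <= B" and p: "p : {0<..<pi}"
 shows "cmod (wp t p * of_real (cos (real n * p) * bump' k p) + w t p * of_real (real n * sin (real n * p) * bump' k p))
   <= ind (edges (2 * eta k)) p * (3 / eta k * cmod (wp t p) + 6 * (real n)^2 * B)"
proof (cases "p : edges (2 * eta k)")
 case True
 have e: "eta k > 0" by (rule eta)
 have b: "\<bar>bump' k p\<bar> <= 3 / eta k" by (rule bump'_bound)
 have "\<bar>sin (real n * p)\<bar> <= real n * (2 * eta k)" by (rule sin_edge[OF p True])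
 hence s: "\<bar>real n * sin (real n * p) * bump' k p\<bar> <= (real n * (real n * (2 * eta k))) * (3 / eta k)"
  unfolding abs_mult using b e by (intro mult_mono) auto
 have s': "(real n * (real n * (2 * eta k))) * (3 / eta k) = 6 * (real n)^2"
  using e by (simp add: power2_eq_square)
 have c: "\<bar>cos (real n * p) * bump' k p\<bar> <= 1 * (3 / eta k)"
  unfolding abs_mult using b e by (intro mult_mono) auto
 have "cmod (wp t p * of_real (cos (real n * p) * bump' k p) + w t p * of_real (real n * sin (real n * p) * bump' k p))
  <= cmod (wp t p) * \<bar>cos (real n * p) * bump' k p\<bar> + cmod (w t p) * \<bar>real n * sin (real n * p) * bump' k p\<bar>"
  by (rule order_trans[OF norm_triangle_ineq]) (simp only: norm_mult norm_of_real order_refl)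
 also have "... <= cmod (wp t p) * (1 * (3 / eta k)) + B * (6 * (real n)^2)"
  using c s B[OF p] order_trans[OF norm_ge_zero B[OF p]] unfolding s'
  by (intro add_mono mult_mono) auto
 finally show ?thesis using True by (simp add: mult_ac)
next
 case False
 hence "bump' k p = 0" using bump'_zero[OF p] by simp
 thus ?thesis using False by simp
qed

text \<open>Integrate \<open>rho_pointwise\<close> over edges of total width 4 eta: the bounded term
  gives O (eta), and the term with 1 / eta is a multiple of the quotient in \<open>neumann\<close>
  at \<open>et = 2 * eta k\<close>.\<close>

lemma rho_L1:
 assumes a: "t0 < a" and ab: "a < b"
 shows "(%k. integral {a..b} (%t. cmod (rho n k t))) ----> 0"
proof -
 let ?A = "{a<..<b}"
 obtain B where B: "\<forall>t\<in>{a..b}. \<forall>p\<in>{0<..<pi}. cmod (w t p) <= B" using bounded[OF a] by blast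
 have B0: "0 <= B" using B[rule_format, of a "pi/2"] ab by (simp add: order_trans[OF norm_ge_zero])
 let ?N = "%et. SINT z:?A \<times> edges et. (case z of (t, p) => cmod (wp t p))"
 have bound: "integral {a..b} (%t. cmod (rho n k t)) <= 6 * (?N (2 * eta k) / (2 * eta k)) + 24 * (real n)^2 * B * (b - a) * eta k" for k
 proof -
  let ?E = "edges (2 * eta k)" and ?C = "6 * (real n)^2 * B"
  have e: "eta k > 0" "0 < 2 * eta k" "2 * eta k <= pi / 2" using eta[of k] pi_gt3 by auto
  note E = strip_edges(3-5)[OF e(2,3), where ah = a and bt = b]
  have i1: "sint (?A \<times> ?E) (%(t, p). cmod (wp t p))"
   by (rule set_integrable_subset[OF wp_integrable[OF a] E(1)]) (use strip_edges(2)[OF e(2,3)] in auto)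
  note i2 = set_integrable_const(1)[OF E(1,2), of ?C]
  let ?F = "%t p. 3 / eta k * cmod (wp t p) + ?C"
  have iF: "sint (?A \<times> ?E) (%(t, p). ?F t p)"
   using set_integral_add(1)[OF set_integrable_mult_right[of "3 / eta k", OF i1] i2]
   unfolding case_prod_beta .
  note Fub = set_Fubini[OF iF]
  have pt: "cmod (rho n k t) <= (SINT p:?E. ?F t p)" if t: "t : ?A" and s: "sint ?E (?F t)" for t
  proof -
   have t0: "t0 < t" "t : {a..b}" using t a by auto
   let ?f = "%p. wp t p * of_real (cos (real n * p) * bump' k p) + w t p * of_real (real n * sin (real n * p) * bump' k p)"
   have "continuous_on {eta k..pi - eta k} ?f"
    by (intro continuous_intros continuous_on_subset[OF slices(3)[OF t0(1)] sub] continuous_on_subset[OF slices(1)[OF t0(1)] sub])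
   hence fi: "sint {eta k..pi - eta k} ?f" by (rule borel_integrable_atLeastAtMost')
   have req: "rho n k t = (LINT p|lborel. ind {eta k..pi - eta k} p *R ?f p)"
    unfolding rho_def set_borel_integral_eq_integral(2)[OF fi, symmetric] int_def ..
   show ?thesis
    unfolding req int_def
   proof (rule Bochner_Integration.integral_norm_bound_integral[OF fi[unfolded sint_def] s[unfolded sint_def]])
    fix p
    have "0 <= ind ?E p *R ?F t p" using e B0 by (intro scaleR_nonneg_nonneg add_nonneg_nonneg mult_nonneg_nonneg) auto
    moreover have "cmod (?f p) <= ind ?E p *R ?F t p" if "p : {eta k..pi - eta k}"
     using rho_pointwise[OF t0(1) B[rule_format, OF t0(2)], of p] that sub[of k] unfolding real_scaleR_def by blast
    ultimately show "cmod (ind {eta k..pi - eta k} p *R ?f p) <= ind ?E p *R ?F t p"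
     by (cases "p : {eta k..pi - eta k}") (simp_all only: indicator_simps scaleR_one scaleR_zero_left norm_zero if_False not_False_eq_True)
   qed
  qed
  have "continuous_on {a..b} (%t. cmod (rho n k t))" by (intro continuous_intros rho_cont[OF a])
  note r = integral_open_box[OF this]
  have "integral {a..b} (%t. cmod (rho n k t)) <= (SINT t:?A. SINT p:?E. ?F t p)"
   unfolding r(2)[symmetric]
   by (rule set_integral_mono_AE[OF r(1) Fub(2)]) (use Fub(1) in eventually_elim, use pt in blast)
  also have "... = 3 / eta k * ?N (2 * eta k) + (b - a) * (2 * (2 * eta k)) * ?C"
   unfolding Fub(3) case_prod_beta set_integral_add(2)[OF set_integrable_mult_right[OF i1[unfolded case_prod_beta]] i2] set_integral_mult_right
    set_integrable_const(2)[OF E(1,2)] E(3)[OF less_imp_le[OF ab]] by (simp only: mult_ac)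
  finally show ?thesis by (simp add: algebra_simps)
 qed
 have "(%k. 6 * (?N (2 * eta k) / (2 * eta k)) + 24 * (real n)^2 * B * (b - a) * eta k) ---->
   6 * 0 + 24 * (real n)^2 * B * (b - a) * 0"
 proof (intro tendsto_intros eta_tendsto filterlim_compose[OF neumann[OF a]])
  have "(%k. 2 * eta k) ----> 2 * 0" by (intro tendsto_intros eta_tendsto)
  thus "filterlim (%k. 2 * eta k) (at_right 0) sequentially"
   by (intro tendsto_imp_filterlim_at_right) (auto simp: eta(1))
 qed
 hence lim: "(%k. 6 * (?N (2 * eta k) / (2 * eta k)) + 24 * (real n)^2 * B * (b - a) * eta k) ----> 0" by simp
 show ?thesis
  by (rule tendsto_sandwich[OF _ _ tendsto_const lim])
   (intro always_eventually allI integral_nonneg integrable_continuous_interval continuous_intros rho_cont[OF a] norm_ge_zero bound)+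
qed

text \<open>Defined through the smoothed coefficients because \<open>wt t\<close> is not known to be
  integrable on every slice. Finite energy gives this for almost every t, and there
  \<open>V1_coef\<close> identifies the limit with the coefficient of \<open>wt t\<close>.\<close>

definition V1 :: "nat => real => complex" where "V1 n t = lim (%k. I wt n k t)"

lemma V_ode:
 assumes t: "t0 < t"
 shows "(V n has_vector_derivative V1 n t) (at t)"
  and "(V1 n has_vector_derivative of_real ((real n)^2 - (exp t)^2) * V n t) (at t)"
  and "(%k. I wt n k t) ----> V1 n t"
proof -
 define a b where "a = (t0 + t) / 2" and "b = t + 1"
 have ab: "t0 < a" "a < t" "t < b" "a < b" using t by (auto simp: a_def b_def)
 have t0: "t0 < s" if "s : {a..b}" for s using ab that by auto
 obtain G where G: "!!s. s : {a..b} ==> (V n has_vector_derivative G s) (at s within {a..b})"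
  "!!s. s : {a..b} ==> (G has_vector_derivative of_real ((real n)^2 - (exp s)^2) * V n s) (at s within {a..b})"
  "!!s. s : {a..b} ==> (%k. I wt n k s) ----> G s"
 proof (rule ode_limit[of a b "I w n" "I wt n" "%s. of_real ((real n)^2 - (exp s)^2)" "rho n" "V n"])
  show "(I w n k has_vector_derivative I wt n k s) (at s within {a..b})" if "s : {a..b}" for k s
   by (rule has_vector_derivative_at_within[OF I_deriv[OF dt w_cont wt_cont t0[OF that]]])
  show "(I wt n k has_vector_derivative of_real ((real n)^2 - (exp s)^2) * I w n k s + rho n k s) (at s within {a..b})"
   if "s : {a..b}" for k s
   unfolding I_wtt[OF t0[OF that], symmetric]
   by (rule has_vector_derivative_at_within[OF I_deriv[OF dtt wt_cont wtt_cont t0[OF that]]])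
  show "continuous_on {a..b} (%s. complex_of_real ((real n)^2 - (exp s)^2))"
   by (intro continuous_intros)
 qed (use ab in \<open>auto intro: rho_cont I_uniform rho_L1\<close>)
 have VG: "V1 n s = G s" if "s : {a..b}" for s
  unfolding V1_def by (rule limI[OF G(3)[OF that]])
 have tt: "t : {a<..<b}" "t : {a..b}" using ab by auto
 have w: "at t within {a..b} = at t" by (rule at_within_interior) (use ab in auto)
 show "(V n has_vector_derivative V1 n t) (at t)" using G(1)[OF tt(2)] w VG[OF tt(2)] by simp
 show "(%k. I wt n k t) ----> V1 n t" using G(3)[OF tt(2)] VG[OF tt(2)] by simp
 have "(G has_vector_derivative of_real ((real n)^2 - (exp t)^2) * V n t) (at t)"
  using G(2)[OF tt(2)] w by simp
 thus "(V1 n has_vector_derivative of_real ((real n)^2 - (exp t)^2) * V n t) (at t)"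
  by (rule has_vector_derivative_transform_within_open[of _ _ _ "{a<..<b}"])
    (use VG tt in auto)
qed

lemma coef_limit:
 assumes f: "sq_int mpi f" and g: "continuous_on UNIV g" "!!p. \<bar>g p\<bar> <= 1"
 shows "(%k. LINT p|mpi. f p * of_real (g p * bump k p)) ----> (LINT p|mpi. f p * of_real (g p))"
proof (rule integral_dominated_convergence[where w = "%p. cmod (f p)"])
 have [measurable]: "f : borel_measurable mpi" using f by (simp add: sq_int_def)
 have [measurable]: "g : borel_measurable mpi" "bump k : borel_measurable mpi" for k
  by (auto intro!: borel_measurable_mpiI continuous_on_subset[OF g(1)] bump_cont)
 show "(%p. f p * of_real (g p)) : borel_measurable mpi" by measurable
 show "(%p. f p * of_real (g p * bump k p)) : borel_measurable mpi" for k by measurable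
 show "integrable mpi (%p. cmod (f p))"
  using finite_measure.sq_int_integrable[OF finite_mpi f] by (rule integrable_norm)
 show "AE p in mpi. (%k. f p * of_real (g p * bump k p)) ----> f p * of_real (g p)"
 proof (rule AE_I2)
  fix p assume "p : space mpi"
  hence "\<forall>\<^sub>F k in sequentially. bump k p = 1" by (intro bump_tendsto) simp
  hence "\<forall>\<^sub>F k in sequentially. f p * of_real (g p * bump k p) = f p * of_real (g p)" by eventually_elim simp
  thus "(%k. f p * of_real (g p * bump k p)) ----> f p * of_real (g p)" by (rule tendsto_eventually)
 qed
 show "AE p in mpi. norm (f p * of_real (g p * bump k p)) <= cmod (f p)" for k
 proof (rule AE_I2)
  fix p
  have "\<bar>g p * bump k p\<bar> <= 1" using g(2)[of p] bump_bounds[of k p] by (simp add: abs_mult mult_le_one)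
  thus "norm (f p * of_real (g p * bump k p)) <= cmod (f p)"
   unfolding norm_mult norm_of_real by (rule mult_left_le) simp
 qed
qed

lemma V1_coef:
 assumes t: "t0 < t" and sq: "sq_int mpi (wt t)"
 shows "V1 n t = cosine.coef (wt t) n"
proof (rule LIMSEQ_unique[OF V_ode(3)[OF t]])
 show "(%k. I wt n k t) ----> cosine.coef (wt t) n"
  unfolding cosine.coef_def I_eq_mpi(1)[where f = wt, OF slices(2)[OF t]]
  by (rule coef_limit[OF sq]) (auto intro!: continuous_intros)
qed

text \<open>Integration by parts in the smoothed coefficient; the term with \<open>bump'\<close>
  tends to 0 by dominated convergence, the sine compensating 1 / eta. Through this lemma Bessel's
  inequality for the sines bounds the sum of n^2 |V n|^2 by the angular energy.\<close>

lemma sine_coef: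
 assumes t: "t0 < t" and sq: "sq_int mpi (wp t)"
 shows "sine.coef (wp t) n = - of_real (real (Suc n)) * V (Suc n) t"
proof -
 let ?n = "real (Suc n)"
 let ?s = "%p. sin (?n * p)"
 have eq: "(LINT p|mpi. wp t p * of_real (?s p * bump k p)) =
   - ((LINT p|mpi. w t p * of_real (?s p * bump' k p)) + of_real ?n * I w (Suc n) k t)" for k
  using sine_parts[OF t, where k = k and n = "Suc n"] bump_zero
  by (subst (asm) (1 2) J_eq_mpi) (auto intro!: continuous_intros slices t simp del: of_nat_Suc)
 obtain B where "\<forall>s\<in>{t..t}. \<forall>p\<in>{0<..<pi}. cmod (w s p) <= B" using bounded[OF t] by blast
 hence B: "!!p. p : {0<..<pi} ==> cmod (w t p) <= B" by auto
 have B0: "0 <= B" using B[of "pi/2"] by (simp add: order_trans[OF norm_ge_zero])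
 have "(%k. LINT p|mpi. w t p * of_real (?s p * bump' k p)) ----> (LINT p|mpi. 0)"
 proof (rule integral_dominated_convergence[where w = "%_. B * (6 * ?n)"])
  show "(%p. w t p * of_real (?s p * bump' k p)) : borel_measurable mpi" for k
   by (intro borel_measurable_mpiI continuous_intros slices(1)[OF t])
  show "integrable mpi (%_. B * (6 * ?n))" by (rule finite_measure.integrable_const[OF finite_mpi])
  show "AE p in mpi. (%k. w t p * of_real (?s p * bump' k p)) ----> 0"
  proof (rule AE_I2)
   fix p assume p: "p : space mpi"
   hence "\<forall>\<^sub>F k in sequentially. eta k < min (p / 2) ((pi - p) / 2)" by (intro order_tendstoD[OF eta_tendsto]) auto
   hence "\<forall>\<^sub>F k in sequentially. w t p * of_real (?s p * bump' k p) = 0"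
    by eventually_elim (use p in \<open>auto simp: edges_def intro!: bump'_zero\<close>)
   thus "(%k. w t p * of_real (?s p * bump' k p)) ----> 0" by (rule tendsto_eventually)
  qed
  show "AE p in mpi. norm (w t p * of_real (?s p * bump' k p)) <= B * (6 * ?n)" for k
  proof (rule AE_I2)
   fix p assume "p : space mpi"
   hence p: "p : {0<..<pi}" by simp
   have "\<bar>?s p * bump' k p\<bar> <= 6 * ?n"
   proof (cases "p : edges (2 * eta k)")
    case True
    have "\<bar>?s p * bump' k p\<bar> <= (?n * (2 * eta k)) * (3 / eta k)"
     unfolding abs_mult using sin_edge[OF p True, of "Suc n"] bump'_bound[of k p] eta(1)[of k] by (intro mult_mono) auto
    thus ?thesis using eta(1)[of k] by simp
   qed (use bump'_zero[OF p] in simp)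
   thus "norm (w t p * of_real (?s p * bump' k p)) <= B * (6 * ?n)"
    unfolding norm_mult norm_of_real using B[OF p] B0 by (intro mult_mono) auto
  qed
 qed simp
 moreover have "(%k. I w (Suc n) k t) ----> V (Suc n) t"
  by (rule tendsto_uniform_limitI[OF I_uniform[OF t, where b = t]]) simp
 ultimately have "(%k. LINT p|mpi. wp t p * of_real (?s p * bump k p)) ----> - ((LINT p|mpi. 0) + of_real ?n * V (Suc n) t)"
  unfolding eq by (intro tendsto_intros)
 moreover have "(%k. LINT p|mpi. wp t p * of_real (?s p * bump k p)) ----> sine.coef (wp t) n"
  unfolding sine.coef_def by (rule coef_limit[OF sq]) (auto intro!: continuous_intros)
 ultimately have "sine.coef (wp t) n = - ((LINT p|mpi. 0) + of_real ?n * V (Suc n) t)" by (rule LIMSEQ_unique[symmetric])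
 thus ?thesis by (simp add: algebra_simps)
qed

text \<open>The bound is proved for the smoothed coefficients, uniformly in the cutoff, and survives
  the limit that defines \<open>V1\<close>. The factor pi is the length of the angular
  interval.\<close>

lemma V_radiation:
 assumes "e > 0"
 shows "\<exists>T. \<forall>t\<ge>T. cmod (V1 n t - \<i> * of_real (exp t) * V n t) <= e * exp (t / 2)"
proof -
 obtain T where T: "\<forall>t\<ge>T. \<forall>p\<in>{0<..<pi}. cmod (wt t p - \<i> * of_real (exp t) * w t p) <= e / pi * exp (t / 2)"
  using radiation[of "e / pi"] assms by auto
 have "cmod (V1 n t - \<i> * of_real (exp t) * V n t) <= e * exp (t / 2)" if t: "t >= max T (t0 + 1)" for t
 proof -
  have t0: "t0 < t" using t by auto
  have "(%k. I w n k t) ----> V n t"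
   by (rule tendsto_uniform_limitI[OF I_uniform[OF t0, where b = t]]) simp
  hence "(%k. cmod (I wt n k t - \<i> * of_real (exp t) * I w n k t)) ----> cmod (V1 n t - \<i> * of_real (exp t) * V n t)"
   by (intro tendsto_intros V_ode(3)[OF t0])
  moreover have "cmod (I wt n k t - \<i> * of_real (exp t) * I w n k t) <= e * exp (t / 2)" for k
  proof -
   let ?c = "%p. complex_of_real (cos (real n * p) * bump k p)"
   note i = I_eq_mpi(2)[where f = wt, OF slices(2)[OF t0], of n k] I_eq_mpi(2)[where f = w, OF slices(1)[OF t0], of n k]
   have "I wt n k t - \<i> * of_real (exp t) * I w n k t = (LINT p|mpi. wt t p * ?c p) - (LINT p|mpi. \<i> * of_real (exp t) * (w t p * ?c p))"
    unfolding I_eq_mpi(1)[where f = wt, OF slices(2)[OF t0]] I_eq_mpi(1)[where f = w, OF slices(1)[OF t0]]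
    by (simp only: integral_mult_right_zero)
   moreover have "... = (LINT p|mpi. wt t p * ?c p - \<i> * of_real (exp t) * (w t p * ?c p))"
    by (rule Bochner_Integration.integral_diff[symmetric]) (intro integrable_mult_right i)+
   ultimately have e: "I wt n k t - \<i> * of_real (exp t) * I w n k t = (LINT p|mpi. wt t p * ?c p - \<i> * of_real (exp t) * (w t p * ?c p))"
    by simp
   have "cmod (LINT p|mpi. wt t p * ?c p - \<i> * of_real (exp t) * (w t p * ?c p)) <= (LINT p|mpi. e / pi * exp (t / 2))"
   proof (rule Bochner_Integration.integral_norm_bound_integral)
    show "integrable mpi (%p. wt t p * ?c p - \<i> * of_real (exp t) * (w t p * ?c p))"
     by (intro Bochner_Integration.integrable_diff integrable_mult_right i)
    show "integrable mpi (%p. e / pi * exp (t / 2))"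
     by (rule finite_measure.integrable_const[OF finite_mpi])
    fix p assume "p : space mpi"
    hence p: "p : {0<..<pi}" by simp
    have "wt t p * ?c p - \<i> * of_real (exp t) * (w t p * ?c p) = (wt t p - \<i> * of_real (exp t) * w t p) * ?c p"
     by (simp only: left_diff_distrib mult.assoc)
    moreover have "cmod ((wt t p - \<i> * of_real (exp t) * w t p) * ?c p) <= e / pi * exp (t / 2) * 1"
     unfolding norm_mult[of "wt t p - \<i> * of_real (exp t) * w t p"]
    proof (rule mult_mono)
     show "cmod (wt t p - \<i> * of_real (exp t) * w t p) <= e / pi * exp (t / 2)" using T p t by auto
     show "cmod (?c p) <= 1"
      unfolding norm_of_real abs_mult using bump_bounds[of k p] by (intro mult_le_one) auto
    qed (use assms in auto)
    ultimately show "cmod (wt t p * ?c p - \<i> * of_real (exp t) * (w t p * ?c p)) <= e / pi * exp (t / 2)" by simp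
   qed
   also have "... = e * exp (t / 2)" by (simp add: measure_mpi)
   finally show ?thesis unfolding e .
  qed
  ultimately show ?thesis by (intro LIMSEQ_le_const2) auto
 qed
 thus ?thesis by blast
qed

sublocale mode: bessel_mode "%t. Re (V n t)" "%t. Re (V1 n t)" "%t. Im (V n t)" "%t. Im (V1 n t)" n t0 for n
proof
 fix t assume t: "t0 < t"
 show "((%t. Re (V n t)) has_real_derivative Re (V1 n t)) (at t)"
  "((%t. Im (V n t)) has_real_derivative Im (V1 n t)) (at t)"
  unfolding has_real_derivative_iff_has_vector_derivative
  by (rule bounded_linear.has_vector_derivative[OF bounded_linear_Re V_ode(1)[OF t]]
     bounded_linear.has_vector_derivative[OF bounded_linear_Im V_ode(1)[OF t]])+
 show "((%t. Re (V1 n t)) has_real_derivative ((real n)^2 - (exp t)^2) * Re (V n t)) (at t)"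
  "((%t. Im (V1 n t)) has_real_derivative ((real n)^2 - (exp t)^2) * Im (V n t)) (at t)"
  using bounded_linear.has_vector_derivative[OF bounded_linear_Re V_ode(2)[OF t, of n]]
   bounded_linear.has_vector_derivative[OF bounded_linear_Im V_ode(2)[OF t, of n]]
  unfolding has_real_derivative_iff_has_vector_derivative by simp_all
next
 show "((%t. ((Re (V1 n t) + exp t * Im (V n t))^2 + (Im (V1 n t) - exp t * Re (V n t))^2) / exp t) \<longlongrightarrow> 0) at_top"
 proof (rule tendstoI)
  fix e :: real assume e: "e > 0"
  define d where "d = sqrt (e / 2)"
  have d: "d > 0" "d^2 = e / 2" using e by (auto simp: d_def)
  obtain T where T: "\<forall>t\<ge>T. cmod (V1 n t - \<i> * of_real (exp t) * V n t) <= d * exp (t / 2)"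
   using V_radiation[OF d(1)] by blast
  show "\<forall>\<^sub>F t in at_top. dist (((Re (V1 n t) + exp t * Im (V n t))^2 + (Im (V1 n t) - exp t * Re (V n t))^2) / exp t) 0 < e"
   using eventually_ge_at_top[of T]
  proof eventually_elim
   case (elim t)
   have "(Re (V1 n t) + exp t * Im (V n t))^2 + (Im (V1 n t) - exp t * Re (V n t))^2 = nsq (V1 n t - \<i> * of_real (exp t) * V n t)"
    unfolding cmod_power2 by simp
   also have "... <= (d * exp (t / 2))^2" using T elim by (intro power_mono) auto
   also have "... = e / 2 * exp t"
    unfolding power_mult_distrib d(2) by (simp add: power2_eq_square mult_exp_exp)
   finally have "((Re (V1 n t) + exp t * Im (V n t))^2 + (Im (V1 n t) - exp t * Re (V n t))^2) / exp t <= e / 2"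
    by (simp add: divide_le_eq)
   moreover have "((Re (V1 n t) + exp t * Im (V n t))^2 + (Im (V1 n t) - exp t * Re (V n t))^2) / exp t >= 0"
    by simp
   ultimately show ?case using e unfolding dist_real_def by linarith
  qed
 qed
qed

end

section \<open>The radial cutoff and the energy inequality on the strip\<close>

lemma set_integrable_weight:
 fixes f :: "real \<times> real => 'b::{banach, second_countable_topology}" and g :: "real => real"
 assumes "sint S f" and g: "continuous_on UNIV g" "!!t. \<bar>g t\<bar> <= K"
 shows "sint S (%z. g (fst z) *R f z)"
proof (rule set_integral_weight[OF assms(1) _ g(2)])
 show "(%z::real \<times> real. g (fst z)) : borel_measurable borel"
  by (intro borel_measurable_continuous_onI continuous_on_compose2[OF g(1)] continuous_intros) auto
qed

text \<open>The transition lies in -2 <= t <= -1. The margin from -4 to -2, where the value is 1,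
  pays in \<open>mode_ineq\<close> for the boundary term that the transition leaves at t =
  -2.\<close>

definition chi :: "real => real" where "chi t = 1 - step (t + 2)"

lemma chi_bounds: "0 <= chi t" "chi t <= 1" "\<bar>chi t\<bar> <= 1" "t <= -2 ==> chi t = 1" "t >= -1 ==> chi t = 0"
 using step_bounds[of "t + 2"] by (auto simp: chi_def)

lemma chi_deriv: "(chi has_real_derivative - step' (t + 2)) (at t)"
proof -
 have "((%t. step (t + 2)) has_real_derivative step' (t + 2) * 1) (at t)"
  by (rule DERIV_chain2[OF step_deriv]) (auto intro!: derivative_eq_intros)
 thus ?thesis unfolding chi_def[abs_def] by (auto intro!: derivative_eq_intros)
qed

lemma chi_cont: "continuous_on S chi"
 by (rule DERIV_continuous_on[OF has_field_derivative_at_within[OF chi_deriv]])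

abbreviation strip_integral :: "(real => real) => (real => real => 'b::{banach, second_countable_topology}) => 'b" where
 "strip_integral g f \<equiv> SINT z:{-4<..<-1} \<times> {0<..<pi}. g (fst z) *R (case z of (t, p) => f t p)"

context strip_wave begin

definition P where "P n t = nsq (V n t)"
definition Q where "Q n t = nsq (V1 n t)"
definition Bn where "Bn n t = Re (V1 n t * cnj (V n t))"

lemma Bn_eq: "Bn n t = Re (V1 n t) * Re (V n t) + Im (V1 n t) * Im (V n t)"
 by (simp add: Bn_def)

lemma V_continuous: "t0 < a ==> continuous_on {a..b} (V n)" "t0 < a ==> continuous_on {a..b} (V1 n)"
 by (rule continuous_on_vector_derivative[OF has_vector_derivative_at_within[OF V_ode(1)]]
   continuous_on_vector_derivative[OF has_vector_derivative_at_within[OF V_ode(2)]]; auto)+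

lemma PQB_continuous:
 assumes "t0 < a"
 shows "continuous_on {a..b} (P n)" "continuous_on {a..b} (Q n)" "continuous_on {a..b} (Bn n)"
 unfolding P_def[abs_def] Q_def[abs_def] Bn_def[abs_def]
 by (intro continuous_intros V_continuous[OF assms])+

lemma P_deriv: "t0 < t ==> (P n has_real_derivative 2 * Bn n t) (at t)"
 unfolding P_def[abs_def] cmod_power2 Bn_eq
 by (rule DERIV_cong[OF DERIV_add[OF DERIV_power[OF mode.dp] DERIV_power[OF mode.dq]]]) (simp_all add: algebra_simps)

lemma Bn_le: "2 * tu * Bn n t <= Q n t + tu^2 * P n t"
proof -
 have "0 <= (Re (V1 n t) - tu * Re (V n t))^2 + (Im (V1 n t) - tu * Im (V n t))^2" by simp
 thus ?thesis unfolding P_def Q_def cmod_power2 Bn_eq by (simp add: power2_eq_square algebra_simps)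
qed

text \<open>The cutoff term is bounded by the energy of the mode itself, with two gains: 7/16 of the
  mass, which later absorbs the Helmholtz term, and 1/8 of the value at t = -4, which controls the
  field further in. On [-2, -1] \<open>mode_ratio\<close> and integration by parts leave (n - 1/2) P
  (-2); on [-4, -2] a Riccati argument pays for it.\<close>

lemma mode_ineq:
 assumes t0: "t0 < -4" and n: "n >= 1"
 shows "integral {-4..-1} (%t. step' (t + 2) * Bn n t) + P n (-4) / 8
   <= integral {-4..-1} (%t. chi t * (Q n t + ((real n)^2 - 7/16) * P n t))"
proof -
 have n1: "real n >= 1" using n by simp
 note cont = PQB_continuous[OF t0] chi_cont
 let ?G = "%t. Q n t + ((real n)^2 - 7/16) * P n t"
 have P0: "P n t >= 0" for t by (simp add: P_def)
 \<comment> \<open>The linear weight from -1/8 at t = -4 to n - 1/2 at t = -2. Since P' = 2 Bn and 2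
   tu Bn <= Q + tu^2 P, the derivative of tu P is bounded by the energy once tu' + tu^2 <= n^2 -
   7/16; with |tu| <= n - 1/2 this amounts to n >= 1, and for n = 1 the constant 7/16 is
   attained.\<close>
 define tu where "tu t = - 1/8 + (real n - 3/8) * (t + 4) / 2" for t
 have tau: "(real n - 3/8) / 2 + (tu t)^2 <= (real n)^2 - 7/16" if "t : {-4..-2}" for t
 proof -
  define x where "x = (real n - 3/8) * (t + 4)"
  have "x <= (real n - 3/8) * 2" "x >= 0" unfolding x_def
   using that n1 by (intro mult_left_mono mult_nonneg_nonneg; simp)+
  moreover have "tu t = - 1/8 + x / 2" by (simp add: tu_def x_def)
  moreover have "\<bar>T\<bar> <= r - 1/2" if "x <= (r - 3/8) * 2" "0 <= x" "T = - 1/8 + x / 2" "1 <= r" for T r :: real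
   using that by (auto simp: abs_le_iff)
  ultimately have "\<bar>tu t\<bar> <= real n - 1/2" using n1 by blast
  hence "\<bar>tu t\<bar>^2 <= (real n - 1/2)^2" by (intro power_mono) auto
  hence "(tu t)^2 <= (real n)^2 - real n + 1/4" by (simp add: power2_diff power_divide)
  moreover have "(r - 3/8) / 2 + T <= R - 7/16" if "T <= R - r + 1/4" "1 <= r" for r T R :: real
   using that by (simp add: field_simps)
  ultimately show ?thesis using n1 by blast
 qed
 have dtau: "(tu has_real_derivative (real n - 3/8) / 2) (at t)" for t
  unfolding tu_def[abs_def] by (auto intro!: derivative_eq_intros)
 have "((%t. (real n - 3/8) / 2 * P n t + 2 * Bn n t * tu t) has_integral (tu (-2) * P n (-2) - tu (-4) * P n (-4))) {-4..-2}"
 proof (rule fundamental_theorem_of_calculus)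
  fix t :: real assume "t : {-4..-2}"
  hence t: "t0 < t" using t0 by auto
  show "((%t. tu t * P n t) has_vector_derivative (real n - 3/8) / 2 * P n t + 2 * Bn n t * tu t) (at t within {-4..-2})"
   unfolding has_real_derivative_iff_has_vector_derivative[symmetric]
   by (rule has_field_derivative_at_within[OF DERIV_mult'[OF dtau P_deriv[OF t], THEN DERIV_cong]]) simp
 qed simp
 moreover have "(?G has_integral integral {-4..-2} ?G) {-4..-2}"
  by (intro integrable_integral integrable_continuous_interval continuous_intros cont)
 moreover have "(real n - 3/8) / 2 * P n t + 2 * Bn n t * tu t <= ?G t" if "t : {-4..-2}" for t
 proof -
  have "((real n - 3/8) / 2 + (tu t)^2) * P n t <= ((real n)^2 - 7/16) * P n t"
   by (rule mult_right_mono[OF tau[OF that] P0])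
  thus ?thesis using Bn_le[of "tu t" n t] by (simp add: algebra_simps)
 qed
 ultimately have "tu (-2) * P n (-2) - tu (-4) * P n (-4) <= integral {-4..-2} ?G"
  by (rule has_integral_le)
 hence I1: "(real n - 1/2) * P n (-2) + P n (-4) / 8 <= integral {-4..-2} ?G"
 proof -
  have "tu (-2) = real n - 1/2" "tu (-4) = - 1/8" unfolding tu_def by (simp_all add: field_simps)
  thus ?thesis using \<open>tu (-2) * P n (-2) - tu (-4) * P n (-4) <= integral {-4..-2} ?G\<close> by simp
 qed
 \<comment> \<open>The derivative of \<open>chi t * (real n - 1/2) * P n t\<close>; adding
   \<open>step' * Bn\<close> and using \<open>mode_ratio\<close> cancels the term with
   \<open>step'\<close>.\<close>
 let ?L = "%t. - step' (t + 2) * ((real n - 1/2) * P n t) + 2 * ((real n - 1/2) * Bn n t) * chi t"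
 have "(?L has_integral (chi (-1) * ((real n - 1/2) * P n (-1)) - chi (-2) * ((real n - 1/2) * P n (-2)))) {-2..-1}"
 proof (rule fundamental_theorem_of_calculus)
  fix t :: real assume "t : {-2..-1}"
  hence t: "t0 < t" using t0 by auto
  show "((%t. chi t * ((real n - 1/2) * P n t)) has_vector_derivative ?L t) (at t within {-2..-1})"
   unfolding has_real_derivative_iff_has_vector_derivative[symmetric]
   by (rule has_field_derivative_at_within[OF DERIV_mult'[OF chi_deriv DERIV_cmult[OF P_deriv[OF t]], THEN DERIV_cong]]) simp
 qed simp
 hence "(?L has_integral (- (real n - 1/2) * P n (-2))) {-2..-1}"
  by (simp only: chi_bounds(4)[of "-2", simplified] chi_bounds(5)[of "-1", simplified]) (simp only: mult_minus_left mult_zero_left mult_1 diff_0)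
 hence "((%t. ?L t + step' (t + 2) * Bn n t) has_integral
   (- (real n - 1/2) * P n (-2) + integral {-2..-1} (%t. step' (t + 2) * Bn n t))) {-2..-1}"
  by (rule has_integral_add[OF _ integrable_integral])
   (use t0 in \<open>intro integrable_continuous_interval continuous_intros PQB_continuous; simp\<close>)
 moreover have "((%t. chi t * ?G t) has_integral integral {-2..-1} (%t. chi t * ?G t)) {-2..-1}"
  using t0 by (intro integrable_integral integrable_continuous_interval continuous_intros PQB_continuous chi_cont; simp)
 moreover have "?L t + step' (t + 2) * Bn n t <= chi t * ?G t" if "t : {-2..-1}" for t
 proof -
  have t: "t0 < t" using t0 that by auto
  have "Bn n t <= (real n - 1/2) * P n t"
   using mode.mode_ratio[OF n t] unfolding Bn_eq P_def cmod_power2 .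
  hence 1: "step' (t + 2) * Bn n t <= step' (t + 2) * ((real n - 1/2) * P n t)"
   by (rule mult_left_mono) (rule step_bounds)
  have "(real n - 1/2)^2 <= (real n)^2 - 7/16" using n1 by (simp add: power2_diff power_divide)
  hence "(real n - 1/2)^2 * P n t <= ((real n)^2 - 7/16) * P n t" by (rule mult_right_mono[OF _ P0])
  moreover have "2 * ((real n - 1/2) * Bn n t) <= Q n t + (real n - 1/2)^2 * P n t"
   using Bn_le[of "real n - 1/2" n t] by (simp only: mult.assoc)
  ultimately have "2 * ((real n - 1/2) * Bn n t) <= ?G t" by (rule order_trans[OF _ add_left_mono, rotated])
  hence "2 * ((real n - 1/2) * Bn n t) * chi t <= ?G t * chi t" by (rule mult_right_mono) (rule chi_bounds)
  thus ?thesis using 1 by (simp add: mult.commute)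
 qed
 ultimately have I2: "- (real n - 1/2) * P n (-2) + integral {-2..-1} (%t. step' (t + 2) * Bn n t) <= integral {-2..-1} (%t. chi t * ?G t)"
  by (rule has_integral_le)
 have c1: "integral {-4..-1} (%t. chi t * ?G t) = integral {-4..-2} ?G + integral {-2..-1} (%t. chi t * ?G t)"
 proof -
  have "integral {-4..-2} (%t. chi t * ?G t) = integral {-4..-2} ?G"
   by (rule integral_cong) (simp add: chi_bounds)
  moreover have "integral {-4..-2} (%t. chi t * ?G t) + integral {-2..-1} (%t. chi t * ?G t) = integral {-4..-1} (%t. chi t * ?G t)"
   by (rule Henstock_Kurzweil_Integration.integral_combine) (auto intro!: integrable_continuous_interval continuous_intros cont)
  ultimately show ?thesis by simp
 qed
 have c2: "integral {-4..-1} (%t. step' (t + 2) * Bn n t) = integral {-2..-1} (%t. step' (t + 2) * Bn n t)"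
 proof -
  have "integral {-4..-2} (%t. step' (t + 2) * Bn n t) = integral {-4..-2} (%t::real. 0::real)"
   by (rule integral_cong) simp
  moreover have "integral {-4..-2} (%t. step' (t + 2) * Bn n t) + integral {-2..-1} (%t. step' (t + 2) * Bn n t) = integral {-4..-1} (%t. step' (t + 2) * Bn n t)"
   by (rule Henstock_Kurzweil_Integration.integral_combine) (auto intro!: integrable_continuous_interval continuous_intros cont)
  ultimately show ?thesis by simp
 qed
 show ?thesis using I1 I2 unfolding c1 c2 mult_minus_left by argo
qed

text \<open>For t between -4 and -1, the factor \<open>exp (exp (- 2 * t) / 4)\<close> of
  \<open>zero_mode_bound\<close> is at most \<open>exp (exp 8 / 4)\<close>, and \<open>exp t\<close>
  is at most 1.\<close>

definition K0 :: real where "K0 = 2 * exp (exp 8 / 4)"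

lemma zero_mode:
 assumes t0: "t0 < -4" and t: "t : {-4..-1}"
 shows "P 0 t <= 4 * K0 * mode.flux 0 (-4)" "Bn 0 t <= 3 * K0 * mode.flux 0 (-4)"
proof -
 have tt: "t0 < t" using t t0 by auto
 let ?J = "mode.flux 0 (-4)"
 have J: "mode.flux 0 t = ?J" by (rule mode.flux_const[OF tt t0])
 have J0: "?J >= 0" by (rule mode.flux_nonneg[OF t0])
 let ?X = "(Re (V1 0 t) + Re (V 0 t) / 2)^2 + (Im (V1 0 t) + Im (V 0 t) / 2)^2"
 have "?X + ((exp t)^2 + 1/4) * P 0 t <= 2 * exp t * exp (exp (- 2 * t) / 4) * ?J"
  using mode.zero_mode_bound[OF refl tt] unfolding J P_def cmod_power2 .
 also have "... <= K0 * ?J"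
  unfolding K0_def using t J0 by (intro mult_right_mono mult_mono) auto
 finally have b: "?X + ((exp t)^2 + 1/4) * P 0 t <= K0 * ?J" .
 have P0: "P 0 t >= 0" by (simp add: P_def)
 have "1/4 * P 0 t <= ((exp t)^2 + 1/4) * P 0 t" using P0 by (intro mult_right_mono) auto
 moreover have X0: "?X >= 0" by simp
 ultimately have P: "P 0 t <= 4 * (K0 * ?J)" using b by linarith
 thus "P 0 t <= 4 * K0 * ?J" by simp
 have X: "?X <= K0 * ?J" using b \<open>1/4 * P 0 t <= _\<close> P0 by linarith
 \<comment> \<open>This is |V' - V/2|^2 = |V' + V/2|^2 - 2 Re (V' cnj V).\<close>
 have "0 <= (Re (V1 0 t) + Re (V 0 t) / 2 - Re (V 0 t))^2 + (Im (V1 0 t) + Im (V 0 t) / 2 - Im (V 0 t))^2" by simp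
 hence "2 * Bn 0 t <= ?X" 
  unfolding Bn_eq by (simp add: power2_eq_square algebra_simps) 
 moreover have "0 <= K0 * ?J" using J0 by (simp add: K0_def)
 ultimately have "Bn 0 t <= 3 * (K0 * ?J)" using X by linarith
 thus "Bn 0 t <= 3 * K0 * ?J" by simp
qed


abbreviation "A \<equiv> {-4<..<-1::real}"
abbreviation "D \<equiv> {0<..<pi}"

definition "Et t = (LINT p|mpi. nsq (wt t p))"
definition "Ep t = (LINT p|mpi. nsq (wp t p))"
definition "Ew t = (LINT p|mpi. nsq (w t p))"
definition "Z t = (LINT p|mpi. wt t p * cnj (w t p))"

lemmas A_integral = integral_open_box[of "-4" "-1"]

text \<open>Fubini turns the finite energy of the strip into finite energy of almost every
  slice.\<close>

lemma slices_AE: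
 assumes t0: "t0 < -4"
 shows "AE t in lborel. t : A \<longrightarrow> sq_int mpi (wt t) \<and> sq_int mpi (wp t)"
 using set_Fubini(1)[OF energy_t[OF t0, of "-1"]] set_Fubini(1)[OF energy_p[OF t0, of "-1"]]
proof eventually_elim
 case (elim t)
 show ?case
 proof
  assume t: "t : A"
  hence tt: "t0 < t" using t0 by auto
  show "sq_int mpi (wt t) \<and> sq_int mpi (wp t)"
   using elim t unfolding sq_int_def integrable_mpi_iff
   by (auto intro!: borel_measurable_mpiI slices tt)
 qed
qed

lemma sum_modes:
 fixes f :: "nat => real"
 shows "(\<Sum>n<Suc N. f n / (if n = 0 then pi else pi / 2)) = f 0 / pi + (\<Sum>n=1..N. 2 / pi * f n)"
 unfolding sum.lessThan_Suc_shift
 by (simp add: sum.atLeast1_atMost_eq mult.commute)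

text \<open>These partial sums start at n = 1: \<open>mode_ineq\<close> is false ground for n = 0,
  whose contribution is handled through the flux. The factor 2 / pi is the inverse norm of the
  cosines.\<close>

definition "si N t = (\<Sum>n=1..N. 2 / pi * P n t)"
definition "bt N t = (\<Sum>n=1..N. 2 / pi * Bn n t)"

lemma sums_continuous:
 assumes "t0 < a"
 shows "continuous_on {a..b} (si N)" "continuous_on {a..b} (bt N)"
 unfolding si_def[abs_def] bt_def[abs_def] by (intro continuous_intros PQB_continuous[OF assms])+

lemma si_bound: assumes t: "t0 < t" shows "si N t <= Ew t" "0 <= si N t"
proof -
 have "(\<Sum>n<Suc N. P n t / (if n = 0 then pi else pi / 2)) <= Ew t"
  using cosine.bessel[OF slice_sq_int[OF t], of "Suc N"] unfolding P_def V_def Ew_def .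
 hence "P 0 t / pi + si N t <= Ew t" unfolding sum_modes si_def .
 moreover have "0 <= P 0 t / pi" by (simp add: P_def)
 ultimately show "si N t <= Ew t" by linarith
 show "0 <= si N t" unfolding si_def P_def by (intro sum_nonneg) auto
qed

lemma si_lim: assumes t: "t0 < t" shows "(%N. si N t) ----> Ew t - P 0 t / pi"
proof -
 have "(%N. \<Sum>n<Suc N. P n t / (if n = 0 then pi else pi / 2)) ----> Ew t"
  using LIMSEQ_Suc[OF cosine.parseval_norm(2)[OF slice_complete[OF t]]] unfolding P_def V_def Ew_def .
 hence "(%N. P 0 t / pi + si N t) ----> Ew t" unfolding sum_modes si_def .
 hence "(%N. (P 0 t / pi + si N t) - P 0 t / pi) ----> Ew t - P 0 t / pi"
  by (intro tendsto_intros)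
 thus ?thesis by simp
qed

lemma energy_bessel:
 assumes t: "t0 < t" and sq: "sq_int mpi (wt t)" "sq_int mpi (wp t)"
 shows "(\<Sum>n=1..N. 2 / pi * Q n t) <= Et t" "(\<Sum>n=1..N. 2 / pi * ((real n)^2 * P n t)) <= Ep t"
proof -
 have "(\<Sum>n<Suc N. Q n t / (if n = 0 then pi else pi / 2)) <= Et t"
  using cosine.bessel[OF sq(1), of "Suc N"] unfolding Q_def V1_coef[OF t sq(1)] Et_def .
 hence "Q 0 t / pi + (\<Sum>n=1..N. 2 / pi * Q n t) <= Et t" unfolding sum_modes .
 moreover have "0 <= Q 0 t / pi" by (simp add: Q_def)
 ultimately show "(\<Sum>n=1..N. 2 / pi * Q n t) <= Et t" by linarith
 have "(\<Sum>n=1..N. 2 / pi * ((real n)^2 * P n t)) = (\<Sum>n<N. 2 / pi * ((real (Suc n))^2 * P (Suc n) t))"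
  by (simp add: sum.atLeast1_atMost_eq)
 also have "... = (\<Sum>n<N. nsq (sine.coef (wp t) n) / (pi / 2))"
  unfolding sine_coef[OF t sq(2)] P_def norm_mult norm_minus_cancel norm_of_real
  by (simp add: power_mult_distrib mult_ac)
 also have "... <= Ep t" unfolding Ep_def by (rule sine.bessel[OF sq(2)])
 finally show "(\<Sum>n=1..N. 2 / pi * ((real n)^2 * P n t)) <= Ep t" .
qed

lemma bt_lim:
 assumes t: "t0 < t" and sq: "sq_int mpi (wt t)"
 shows "(%N. bt N t) ----> Re (Z t) - Bn 0 t / pi"
proof -
 have e: "Re (\<Sum>n<N. cosine.coef (wt t) n * cnj (cosine.coef (w t) n) / of_real (if n = 0 then pi else pi / 2))
   = (\<Sum>n<N. Bn n t / (if n = 0 then pi else pi / 2))" for N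
  unfolding Re_sum Bn_def V1_coef[OF t sq] V_def by (intro sum.cong refl) (simp del: complex_cnj_cancel_iff)
 have "(%N. Re (\<Sum>n<Suc N. cosine.coef (wt t) n * cnj (cosine.coef (w t) n) / of_real (if n = 0 then pi else pi / 2))) ----> Re (Z t)"
  unfolding Z_def by (intro tendsto_Re LIMSEQ_Suc[OF cosine.parseval_pair[OF sq slice_complete[OF t]]])
 hence "(%N. Bn 0 t / pi + bt N t) ----> Re (Z t)" unfolding e sum_modes bt_def .
 hence "(%N. (Bn 0 t / pi + bt N t) - Bn 0 t / pi) ----> Re (Z t) - Bn 0 t / pi"
  by (intro tendsto_intros)
 thus ?thesis by simp
qed

text \<open>By Parseval Im (Z t) is a weighted sum of the mode fluxes. All of them are nonnegative,
  so the zero mode alone is a lower bound, and its flux may be evaluated at any other t.\<close>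

lemma flux_lower:
 assumes t0: "t0 < s" and t: "t0 < t" and sq: "sq_int mpi (wt t)"
 shows "mode.flux 0 s / pi <= Im (Z t)"
proof -
 have fl: "Im (V1 n t * cnj (V n t)) = mode.flux n t" for n
  by (simp add: mode.flux_def algebra_simps)
 have lim: "(%N. Im (\<Sum>n<Suc N. cosine.coef (wt t) n * cnj (cosine.coef (w t) n) / of_real (if n = 0 then pi else pi / 2))) ----> Im (Z t)"
  unfolding Z_def by (intro tendsto_Im LIMSEQ_Suc[OF cosine.parseval_pair[OF sq slice_complete[OF t]]])
 have e: "Im (\<Sum>n<N. cosine.coef (wt t) n * cnj (cosine.coef (w t) n) / of_real (if n = 0 then pi else pi / 2))
   = (\<Sum>n<N. mode.flux n t / (if n = 0 then pi else pi / 2))" for N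
 proof -
  have "Im (\<Sum>n<N. cosine.coef (wt t) n * cnj (cosine.coef (w t) n) / of_real (if n = 0 then pi else pi / 2))
   = (\<Sum>n<N. Im (V1 n t * cnj (V n t)) / (if n = 0 then pi else pi / 2))"
   unfolding Im_sum V1_coef[OF t sq] V_def by (intro sum.cong refl) simp
  thus ?thesis unfolding fl .
 qed
 have "mode.flux 0 t / pi <= (\<Sum>n<Suc N. mode.flux n t / (if n = 0 then pi else pi / 2))" for N
  unfolding sum_modes using mode.flux_nonneg[OF t] by (simp add: sum_nonneg)
 hence "mode.flux 0 t / pi <= Im (Z t)"
  by (intro LIMSEQ_le_const[OF lim[unfolded e]]) blast
 thus ?thesis using mode.flux_const[OF t0 t, of 0] by simp
qed

text \<open>A bound independent of N and integrable in t, for the dominated convergence in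
  \<open>mode_inequality\<close>.\<close>

lemma bt_bound:
 assumes t: "t0 < t" and sq: "sq_int mpi (wt t)"
 shows "\<bar>bt N t\<bar> <= Et t + Ew t"
proof -
 have "\<bar>Bn n t\<bar> <= Q n t + P n t" for n
 proof -
  have "\<bar>Bn n t\<bar> <= cmod (V1 n t) * cmod (V n t)"
   unfolding Bn_def using abs_Re_le_cmod[of "V1 n t * cnj (V n t)"] by (simp add: norm_mult)
  also have "... <= Q n t + P n t"
  proof -
   have "2 * (cmod (V1 n t) * cmod (V n t)) <= Q n t + P n t"
    unfolding Q_def P_def using sum_squares_bound[of "cmod (V1 n t)" "cmod (V n t)"] by simp
   moreover have "0 <= cmod (V1 n t) * cmod (V n t)" by simp
   ultimately show ?thesis by linarith
  qed
  finally show ?thesis .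
 qed
 note bn = this
 have "\<bar>bt N t\<bar> <= (\<Sum>n=1..N. 2 / pi * (Q n t + P n t))"
  unfolding bt_def
 proof (intro order_trans[OF sum_abs] sum_mono)
  fix n
  have "\<bar>2 / pi * Bn n t\<bar> = 2 / pi * \<bar>Bn n t\<bar>" by (simp add: abs_mult)
  also have "... <= 2 / pi * (Q n t + P n t)" using bn[of n] by (rule mult_left_mono) simp
  finally show "\<bar>2 / pi * Bn n t\<bar> <= 2 / pi * (Q n t + P n t)" .
 qed
 also have "... = (\<Sum>n=1..N. 2 / pi * Q n t) + si N t"
  unfolding si_def by (simp add: distrib_left sum.distrib)
 also have "... <= Et t + Ew t"
 proof (rule add_mono)
  have "(\<Sum>n<Suc N. Q n t / (if n = 0 then pi else pi / 2)) <= Et t"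
   using cosine.bessel[OF sq, of "Suc N"] unfolding Q_def V1_coef[OF t sq] Et_def .
  hence "Q 0 t / pi + (\<Sum>n=1..N. 2 / pi * Q n t) <= Et t" unfolding sum_modes .
  moreover have "0 <= Q 0 t / pi" by (simp add: Q_def)
  ultimately show "(\<Sum>n=1..N. 2 / pi * Q n t) <= Et t" by linarith
 qed (rule si_bound[OF t])
 finally show ?thesis .
qed


abbreviation "en N t \<equiv> (\<Sum>n=1..N. 2 / pi * Q n t) + (\<Sum>n=1..N. 2 / pi * ((real n)^2 * P n t))"

lemma finite_mode_ineq:
 assumes t0: "t0 < -4"
 shows "(SINT t:A. step' (t + 2) * bt N t) + si N (-4) / 8
  + 7/16 * (SINT t:A. chi t * si N t) <=
  integral {-4..-1} (%t. chi t * en N t)"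
proof -
 note c = PQB_continuous[OF t0] chi_cont sums_continuous[OF t0]
 have int: "g integrable_on {-4..-1}" if "continuous_on {-4..-1} g" for g :: "real => real"
  using that by (rule integrable_continuous_interval)
 have "(\<Sum>n=1..N. 2 / pi * (integral {-4..-1} (%t. step' (t + 2) * Bn n t) + P n (-4) / 8))
   <= (\<Sum>n=1..N. 2 / pi * integral {-4..-1} (%t. chi t * (Q n t + ((real n)^2 - 7/16) * P n t)))"
  using mode_ineq[OF t0] by (intro sum_mono mult_left_mono) auto
 moreover have "(\<Sum>n=1..N. 2 / pi * (integral {-4..-1} (%t. step' (t + 2) * Bn n t) + P n (-4) / 8)) =
   integral {-4..-1} (%t. step' (t + 2) * bt N t) + si N (-4) / 8"
 proof -
  have "integral {-4..-1} (%t. step' (t + 2) * bt N t) = integral {-4..-1} (%t. \<Sum>n=1..N. 2 / pi * (step' (t + 2) * Bn n t))"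
   unfolding bt_def sum_distrib_left by (simp only: mult.left_commute)
  also have "... = (\<Sum>n=1..N. integral {-4..-1} (%t. 2 / pi * (step' (t + 2) * Bn n t)))"
   by (intro integral_sum int continuous_intros c) simp
  also have "... = (\<Sum>n=1..N. 2 / pi * integral {-4..-1} (%t. step' (t + 2) * Bn n t))"
   by (simp only: integral_mult_right)
  finally show ?thesis
   by (simp only: distrib_left sum.distrib) (simp add: si_def sum_divide_distrib)
 qed
 moreover have "(\<Sum>n=1..N. 2 / pi * integral {-4..-1} (%t. chi t * (Q n t + ((real n)^2 - 7/16) * P n t))) =
   integral {-4..-1} (%t. chi t * en N t)
   - 7/16 * integral {-4..-1} (%t. chi t * si N t)"
 proof -
  have "(\<Sum>n=1..N. 2 / pi * integral {-4..-1} (%t. chi t * (Q n t + ((real n)^2 - 7/16) * P n t)))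
   = (\<Sum>n=1..N. integral {-4..-1} (%t. 2 / pi * (chi t * (Q n t + ((real n)^2 - 7/16) * P n t))))"
   by (simp only: integral_mult_right)
  also have "... = integral {-4..-1} (%t. \<Sum>n=1..N. 2 / pi * (chi t * (Q n t + ((real n)^2 - 7/16) * P n t)))"
   by (intro integral_sum[symmetric] int continuous_intros c) simp
  also have "... = integral {-4..-1} (%t. chi t * en N t - 7/16 * (chi t * si N t))"
  proof (rule integral_cong)
   fix t
   have "2 / pi * (chi t * (Q n t + ((real n)^2 - 7/16) * P n t)) =
    chi t * (2 / pi * Q n t + 2 / pi * ((real n)^2 * P n t)) - 7/16 * (chi t * (2 / pi * P n t))" for n
    by (simp add: algebra_simps)
   hence "(\<Sum>n=1..N. 2 / pi * (chi t * (Q n t + ((real n)^2 - 7/16) * P n t))) =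
    chi t * (\<Sum>n=1..N. 2 / pi * Q n t + 2 / pi * ((real n)^2 * P n t)) - 7/16 * (chi t * (\<Sum>n=1..N. 2 / pi * P n t))"
    by (simp only: sum_subtractf sum_distrib_left)
   thus "(\<Sum>n=1..N. 2 / pi * (chi t * (Q n t + ((real n)^2 - 7/16) * P n t))) =
    chi t * en N t - 7/16 * (chi t * si N t)"
    unfolding sum.distrib si_def .
  qed
  also have "... = integral {-4..-1} (%t. chi t * en N t)
   - integral {-4..-1} (%t. 7/16 * (chi t * si N t))"
   by (intro Henstock_Kurzweil_Integration.integral_diff int continuous_intros c)
  finally show ?thesis by (simp only: integral_mult_right)
 qed
 moreover have "(SINT t:A. step' (t + 2) * bt N t) = integral {-4..-1} (%t. step' (t + 2) * bt N t)"
  by (intro A_integral continuous_intros c)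
 moreover have "(SINT t:A. chi t * si N t) = integral {-4..-1} (%t. chi t * si N t)"
  by (intro A_integral continuous_intros c)
 ultimately show ?thesis by simp
qed

text \<open>Sum of \<open>mode_ineq\<close> over n >= 1. On the left the partial sums converge by
  Parseval and dominated convergence in t. The zero mode, absent from the sums, is put back at the
  cost of a multiple of its flux, which is at most pi * Im S by \<open>flux_lower\<close>.\<close>

theorem mode_inequality:
 assumes t0: "t0 < -4"
 defines "S \<equiv> strip_integral (%t. step' (t + 2)) (%t p. wt t p * cnj (w t p))"
 shows "Re S + (LINT p|mpi. nsq (w (-4) p)) / 8
   + 7/16 * (strip_integral chi (%t p. nsq (w t p)))
   <= (strip_integral chi (%t p. nsq (wt t p)))
   + (strip_integral chi (%t p. nsq (wp t p))) + 9 * K0 * Im S"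
  and "0 <= Im S"
proof -
 have AD: "open (A \<times> D)" "A \<times> D : sets lborel" by (auto intro!: open_Times borel_open)
 have sub: "A \<times> D \<subseteq> {t0<..} \<times> {0<..<pi}" using t0 by auto
 have tt: "t0 < t" if "t : A" for t using that t0 by auto
 obtain B where B: "\<forall>t\<in>{-4..-1}. \<forall>p\<in>{0<..<pi}. cmod (w t p) <= B" using bounded[OF t0] by blast
 have B0: "0 <= B" using B[rule_format, of "-4" "pi/2"] by (simp add: order_trans[OF norm_ge_zero])
 have "bounded (A \<times> D)" by (intro bounded_Times) auto
 note one = set_integrable_const(1)[OF AD(2) this]
 note meas = set_borel_measurable_open[OF AD(1) continuous_on_subset[OF _ sub]]
 have iw: "sint (A \<times> D) (%(t, p). nsq (w t p))"
 proof (rule set_integrable_bound[OF one[of "B^2"]])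
  have "continuous_on ({t0<..} \<times> {0<..<pi}) (%z. nsq (case z of (t, p) => w t p))"
   by (intro continuous_intros w_cont)
  thus "set_borel_measurable lborel (A \<times> D) (%(t, p). nsq (w t p))"
   by (intro meas) (simp add: case_prod_beta)
 qed (use B in \<open>auto intro!: AE_I2 power_mono\<close>)
 have iz: "sint (A \<times> D) (%(t, p). wt t p * cnj (w t p))"
 proof (rule set_integrable_bound[OF set_integral_add(1)[OF energy_t[OF t0, of "-1"] iw]])
  have "continuous_on ({t0<..} \<times> {0<..<pi}) (%z. (case z of (t, p) => wt t p) * cnj (case z of (t, p) => w t p))"
   by (intro continuous_intros w_cont wt_cont)
  thus "set_borel_measurable lborel (A \<times> D) (%(t, p). wt t p * cnj (w t p))"
   by (intro meas) (simp add: case_prod_beta)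
  have "cmod (x * cnj y) <= nsq x + nsq y" for x y
  proof -
   have "2 * (cmod x * cmod y) <= nsq x + nsq y" using sum_squares_bound[of "cmod x" "cmod y"] by simp
   moreover have "0 <= cmod x * cmod y" by simp
   ultimately show ?thesis unfolding norm_mult complex_mod_cnj by linarith
  qed
  thus "AE z in lborel. z : A \<times> D \<longrightarrow> norm (case z of (t, p) => wt t p * cnj (w t p))
    <= norm ((case z of (t, p) => nsq (wt t p)) + (case z of (t, p) => nsq (w t p)))"
   by (auto intro!: AE_I2)
 qed
 note chi_ok = chi_cont[of UNIV] chi_bounds(3)
 have s'c: "continuous_on UNIV (%t. step' (t + 2))" by (intro continuous_intros)
 have s'b: "\<bar>step' (t + 2)\<bar> <= 3/2" for t by (rule step_bounds)
 have cp: "(%z. g (fst z) *R (case z of (t, p) => f t p)) = (%(t, p). g t *R f t p)"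
  for g :: "real => real" and f :: "real => real => 'z::{banach, second_countable_topology}"
  by (simp add: fun_eq_iff)
 note it = set_integrable_weight[OF energy_t[OF t0, of "-1"] chi_ok]
 note ip = set_integrable_weight[OF energy_p[OF t0, of "-1"] chi_ok]
 note iw' = set_integrable_weight[OF iw chi_ok]
 note iz' = set_integrable_weight[OF iz s'c s'b]
 note Ft = set_Fubini[OF it[unfolded cp]]
 note Fp = set_Fubini[OF ip[unfolded cp]]
 note Fw = set_Fubini[OF iw'[unfolded cp]]
 note Fz = set_Fubini[OF iz'[unfolded cp[of "%t. step' (t + 2)"]]]
 have sc: "(SINT p:D. g *R f p) = g *R (LINT p|mpi. f p)"
  for g :: real and f :: "real => 'z::{banach, second_countable_topology}"
  unfolding integral_mpi by (rule set_integral_scaleR_right)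
 note Ft = Ft[unfolded sc Et_def[symmetric]]
 note Fp = Fp[unfolded sc Ep_def[symmetric]]
 note Fw = Fw[unfolded sc Ew_def[symmetric]]
 note Fz = Fz[unfolded sc Z_def[symmetric]]
 have Ewb: "Ew t <= B^2 * pi" if t: "t : {-4..-1}" for t
 proof -
  have "Ew t <= (LINT p|mpi. B^2)"
   unfolding Ew_def
  proof (rule integral_mono)
   show "integrable mpi (%p. nsq (w t p))" using slice_sq_int[of t] t t0 by (simp add: sq_int_def)
   show "integrable mpi (%p. B^2)" by (rule finite_measure.integrable_const[OF finite_mpi])
  qed (use B t in \<open>auto intro!: power_mono\<close>)
  thus ?thesis by (simp add: measure_mpi mult.commute)
 qed
 have iEt: "sint A Et"
 proof -
  have "sint A (%t. SINT p:D. nsq (wt t p))"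
   using set_Fubini(2)[OF energy_t[OF t0, of "-1"]] .
  thus ?thesis unfolding Et_def[abs_def] integral_mpi .
 qed
 define X where "X = mode.flux 0 (-4)"
 have X0: "X >= 0" unfolding X_def by (rule mode.flux_nonneg[OF t0])
 have S: "S = (SINT t:A. step' (t + 2) *R Z t)"
  unfolding S_def Fz(3) cp[of "%t. step' (t + 2)"] ..
 have iZ: "integrable lborel (%t. ind A t *R (step' (t + 2) *R Z t))"
  using Fz(2) by (simp add: sint_def)
 have ReS: "Re S = (SINT t:A. step' (t + 2) * Re (Z t))"
  and iRe: "sint A (%t. step' (t + 2) * Re (Z t))"
  using integral_Re[OF iZ] integrable_Re[OF iZ] unfolding S int_def sint_def by (simp_all add: mult.assoc)
 have ImS: "Im S = (SINT t:A. step' (t + 2) * Im (Z t))"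
  and iIm: "sint A (%t. step' (t + 2) * Im (Z t))"
  using integral_Im[OF iZ] integrable_Im[OF iZ] unfolding S int_def sint_def by (simp_all add: mult.assoc)
 have iB: "sint A (%t. step' (t + 2) * (Bn 0 t / pi))"
  and iP: "sint A (%t. chi t * (P 0 t / pi))"
  by (intro A_integral continuous_intros PQB_continuous[OF t0] chi_cont; simp)+
 have ic: "sint A (%_. c)" for c :: real by (rule set_integrable_const) auto
 have lhs: "(%N. SINT t:A. step' (t + 2) * bt N t) ----> (SINT t:A. step' (t + 2) * (Re (Z t) - Bn 0 t / pi))"
 proof (rule set_dominated_convergence_AE[where g = "%t. 3/2 * (Et t + B^2 * pi)"])
  show "sint A (%t. step' (t + 2) * (Re (Z t) - Bn 0 t / pi))"
   using set_integral_diff(1)[OF iRe iB] by (simp only: right_diff_distrib)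
  show "sint A (%t. 3/2 * (Et t + B^2 * pi))" by (intro set_integrable_mult_right set_integral_add iEt ic)
  show "AE t in lborel. t : A \<longrightarrow> (%N. step' (t + 2) * bt N t) ----> step' (t + 2) * (Re (Z t) - Bn 0 t / pi)"
   using slices_AE[OF t0] by eventually_elim (intro impI tendsto_intros bt_lim tt; blast)
  show "AE t in lborel. t : A \<longrightarrow> norm (step' (t + 2) * bt N t) <= 3/2 * (Et t + B^2 * pi)" for N
   using slices_AE[OF t0]
  proof (eventually_elim, intro impI)
   fix t assume sq: "t : A \<longrightarrow> sq_int mpi (wt t) \<and> sq_int mpi (wp t)" and t: "t : A"
   have "\<bar>bt N t\<bar> <= Et t + B^2 * pi" using bt_bound[OF tt[OF t], of N] sq Ewb[of t] t by force
   hence "\<bar>step' (t + 2)\<bar> * \<bar>bt N t\<bar> <= 3/2 * (Et t + B^2 * pi)" by (intro mult_mono s'b) auto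
   thus "norm (step' (t + 2) * bt N t) <= 3/2 * (Et t + B^2 * pi)" by (simp add: abs_mult)
  qed
 qed (intro A_integral continuous_intros sums_continuous[OF t0])
 have rhs: "(%N. SINT t:A. chi t * si N t) ----> (SINT t:A. chi t * (Ew t - P 0 t / pi))"
 proof (rule set_dominated_convergence_AE[OF _ _ ic[of "B^2 * pi"]])
  show "sint A (%t. chi t * (Ew t - P 0 t / pi))"
   using set_integral_diff(1)[OF Fw(2) iP] by (simp only: right_diff_distrib real_scaleR_def)
  show "AE t in lborel. t : A \<longrightarrow> (%N. chi t * si N t) ----> chi t * (Ew t - P 0 t / pi)"
   by (intro AE_I2 impI tendsto_intros si_lim tt)
  show "AE t in lborel. t : A \<longrightarrow> norm (chi t * si N t) <= B^2 * pi" for N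
  proof (intro AE_I2 impI)
   fix t assume t: "t : A"
   have "\<bar>si N t\<bar> <= B^2 * pi" using si_bound[OF tt[OF t], of N] Ewb[of t] t by force
   hence "\<bar>chi t\<bar> * \<bar>si N t\<bar> <= 1 * (B^2 * pi)" by (intro mult_mono chi_bounds) auto
   thus "norm (chi t * si N t) <= B^2 * pi" by (simp add: abs_mult)
  qed
 qed (intro A_integral continuous_intros sums_continuous[OF t0] chi_cont)
 let ?Wt = "strip_integral chi (%t p. nsq (wt t p))"
 let ?Wp = "strip_integral chi (%t p. nsq (wp t p))"
 let ?Ww = "strip_integral chi (%t p. nsq (w t p))"
 \<comment> \<open>Only an upper bound of the right side is wanted, so Bessel's inequality is
   applied slice by slice.\<close>
 have bess: "integral {-4..-1} (%t. chi t * en N t) <= ?Wt + ?Wp" for N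
 proof -
  let ?F = "%t. chi t * en N t"
  have c: "continuous_on {-4..-1} ?F" by (intro continuous_intros chi_cont PQB_continuous[OF t0])
  have "integral {-4..-1} ?F = (SINT t:A. ?F t)" by (rule A_integral(2)[OF c, symmetric])
  also have "... <= (SINT t:A. chi t *R Et t + chi t *R Ep t)"
  proof (rule set_integral_mono_AE[OF A_integral(1)[OF c] set_integral_add(1)[OF Ft(2) Fp(2)]])
   show "AE t\<in>A in lborel. ?F t <= chi t *R Et t + chi t *R Ep t"
    using slices_AE[OF t0] unfolding real_scaleR_def distrib_left[symmetric]
    by eventually_elim (intro impI mult_left_mono add_mono energy_bessel tt chi_bounds; blast)
  qed
  also have "... = ?Wt + ?Wp"
   unfolding set_integral_add(2)[OF Ft(2) Fp(2)] Ft(3) Fp(3) cp ..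
  finally show ?thesis .
 qed
 let ?L = "SINT t:A. step' (t + 2) * (Re (Z t) - Bn 0 t / pi)"
 let ?R = "SINT t:A. chi t * (Ew t - P 0 t / pi)"
 have main: "?L + (Ew (-4) - P 0 (-4) / pi) / 8 + 7/16 * ?R <= ?Wt + ?Wp"
 proof (rule LIMSEQ_le_const2)
  show "(%N. (SINT t:A. step' (t + 2) * bt N t) + si N (-4) / 8 + 7/16 * (SINT t:A. chi t * si N t))
   ----> ?L + (Ew (-4) - P 0 (-4) / pi) / 8 + 7/16 * ?R"
   by (intro tendsto_intros lhs rhs si_lim[OF t0]) simp
  show "\<exists>N. \<forall>n\<ge>N. (SINT t:A. step' (t + 2) * bt n t) + si n (-4) / 8 + 7/16 * (SINT t:A. chi t * si n t) <= ?Wt + ?Wp"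
   using order_trans[OF finite_mode_ineq[OF t0] bess] by blast
 qed
 have s'int: "sint A (%t. step' (t + 2) * c)" "(SINT t:A. step' (t + 2) * c) = c" for c
 proof -
  show "sint A (%t. step' (t + 2) * c)" by (intro A_integral continuous_intros)
  have "((%t. step' (t + 2) * c) has_integral (- chi (-1) * c - - chi (-4) * c)) {-4..-1}"
  proof (rule fundamental_theorem_of_calculus)
   fix t :: real
   have "((%t. - chi t * c) has_real_derivative step' (t + 2) * c) (at t)"
    by (rule DERIV_cmult_right[OF DERIV_minus[OF chi_deriv], THEN DERIV_cong]) simp
   thus "((%t. - chi t * c) has_vector_derivative step' (t + 2) * c) (at t within {-4..-1})"
    unfolding has_real_derivative_iff_has_vector_derivative[symmetric] by (rule has_field_derivative_at_within)
  qed simp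
  hence "((%t. step' (t + 2) * c) has_integral c) {-4..-1}"
   by (simp add: chi_bounds)
  hence "integral {-4..-1} (%t. step' (t + 2) * c) = c"
   by (rule integral_unique)
  moreover have "(SINT t:A. step' (t + 2) * c) = integral {-4..-1} (%t. step' (t + 2) * c)"
   by (intro A_integral continuous_intros)
  ultimately show "(SINT t:A. step' (t + 2) * c) = c" by (simp only:)
 qed
 have "X / pi = (SINT t:A. step' (t + 2) * (X / pi))" by (simp only: s'int)
 also have "... <= Im S"
  unfolding ImS
 proof (rule set_integral_mono_AE[OF s'int(1) iIm])
  show "AE t\<in>A in lborel. step' (t + 2) * (X / pi) <= step' (t + 2) * Im (Z t)"
   using slices_AE[OF t0] unfolding X_def
   by eventually_elim (intro impI mult_left_mono step_bounds flux_lower t0 tt; blast)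
 qed
 finally have XS: "X / pi <= Im S" .
 have "0 <= X / pi" using X0 by simp
 thus "0 <= Im S" using XS by linarith
 have K0: "K0 > 0" by (simp add: K0_def)
 have L: "?L >= Re S - 3 * K0 * X / pi"
 proof -
  have "?L = (SINT t:A. step' (t + 2) * Re (Z t) - step' (t + 2) * (Bn 0 t / pi))"
   by (simp only: right_diff_distrib)
  also have "... = Re S - (SINT t:A. step' (t + 2) * (Bn 0 t / pi))"
   unfolding ReS by (rule set_integral_diff(2)[OF iRe iB])
  finally have 1: "?L = Re S - (SINT t:A. step' (t + 2) * (Bn 0 t / pi))" .
  have "(SINT t:A. step' (t + 2) * (Bn 0 t / pi)) <= (SINT t:A. step' (t + 2) * (3 * K0 * X / pi))"
  proof (rule set_integral_mono[OF iB s'int(1)])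
   fix t assume t: "t : A"
   show "step' (t + 2) * (Bn 0 t / pi) <= step' (t + 2) * (3 * K0 * X / pi)"
    unfolding X_def using zero_mode(2)[OF t0, of t] t by (intro mult_left_mono divide_right_mono step_bounds) auto
  qed
  thus ?thesis using 1 unfolding s'int(2) by linarith
 qed
 have R: "?R >= ?Ww - 12 * K0 * X / pi"
 proof -
  have "?R = (SINT t:A. chi t *R Ew t - chi t * (P 0 t / pi))"
   by (simp only: right_diff_distrib real_scaleR_def)
  also have "... = (SINT t:A. chi t *R Ew t) - (SINT t:A. chi t * (P 0 t / pi))"
   by (rule set_integral_diff(2)[OF Fw(2) iP])
  finally have 1: "?R = ?Ww - (SINT t:A. chi t * (P 0 t / pi))" unfolding Fw(3) cp .
  have "(SINT t:A. chi t * (P 0 t / pi)) <= (SINT t:A. 4 * K0 * X / pi)"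
  proof (rule set_integral_mono[OF iP ic])
   fix t assume t: "t : A"
   have "chi t * (P 0 t / pi) <= 1 * (4 * K0 * X / pi)"
    unfolding X_def using zero_mode(1)[OF t0, of t] t
    by (intro mult_mono divide_right_mono chi_bounds) (auto simp: P_def)
   thus "chi t * (P 0 t / pi) <= 4 * K0 * X / pi" by simp
  qed
  also have "... = 12 * K0 * X / pi"
   by (subst A_integral) (auto intro!: continuous_intros)
  finally show ?thesis using 1 by linarith
 qed
 have P4: "P 0 (-4) / pi <= 4 * K0 * X / pi"
  unfolding X_def using zero_mode(1)[OF t0, of "-4"] by (intro divide_right_mono) auto
 \<comment> \<open>The zero mode costs 3 + 4/8 + 12 * 7/16 = 8.75 multiples of
   \<open>K0 * X / pi\<close>, rounded up to 9.\<close>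
 have "9 * K0 * (X / pi) <= 9 * K0 * Im S" using XS K0 by (intro mult_left_mono) auto
 moreover have "0 <= K0 * (X / pi)" using K0 X0 by simp
 ultimately show "Re S + (LINT p|mpi. nsq (w (-4) p)) / 8 + 7/16 * ?Ww <= ?Wt + ?Wp + 9 * K0 * Im S"
  using main L R P4 unfolding Ew_def[symmetric] by (simp only: times_divide_eq_right[symmetric] mult.assoc) argo
qed

end

section \<open>Gradients, integrals and Green's formula on real^2\<close>

abbreviation pt :: "real => real => real^2" where "pt x y \<equiv> vector [x, y]"

lemma pt_nth [simp]: "pt x y $ 1 = x" "pt x y $ 2 = y" by (simp_all add: vector_2)

lemma pt_eta: "pt (z $ 1) (z $ 2) = z" by (simp add: vec_eq_iff forall_2)

lemma pt_eq: "pt x y = x *R pt 1 0 + y *R pt 0 1"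
 by (simp add: vec_eq_iff forall_2)

lemma pt_cont [continuous_intros]:
 "continuous_on S f ==> continuous_on S g ==> continuous_on S (%x. pt (f x) (g x))"
 by (subst pt_eq) (intro continuous_intros)

lemma norm_pt: "norm (z :: real^2) = sqrt ((z $ 1)^2 + (z $ 2)^2)"
 by (simp add: norm_vec_def L2_set_def sum_2)

text \<open>The bridge to the product measure, through which Fubini applies to integrals over
  real^2. It suffices to compare both measures on boxes.\<close>

lemma lborel_pt: "(lborel :: (real^2) measure) = distr (lborel :: (real \<times> real) measure) borel (%(x, y). pt x y)"
proof (rule lborel_eqI)
 have [measurable]: "(%(x, y). pt x y) : borel_measurable (borel :: (real \<times> real) measure)"
  unfolding case_prod_beta by (intro borel_measurable_continuous_onI continuous_intros)
 fix l u :: "real^2"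
 assume le: "!!b. b : Basis ==> l \<bullet> b <= u \<bullet> b"
 have ax: "axis i (1::real) : (Basis :: (real^2) set)" for i by (auto simp: Basis_vec_def)
 have "l $ 1 <= u $ 1" "l $ 2 <= u $ 2" using le[OF ax[of 1]] le[OF ax[of 2]] by (simp_all add: inner_axis)
 have pre: "(%(x, y). pt x y) -` box l u \<inter> space (lborel :: (real \<times> real) measure) = box (l $ 1, l $ 2) (u $ 1, u $ 2)"
  by (auto simp: mem_box_cart forall_2 box_prod)
 show "emeasure (distr lborel borel (%(x, y). pt x y)) (box l u) = ennreal (\<Prod>b\<in>Basis. (u - l) \<bullet> b)"
 proof -
  have B2: "(Basis :: (real^2) set) = {axis 1 1, axis 2 1}"
   by (auto simp: Basis_vec_def UNIV_2)
  have ne: "axis (1::2) (1::real) ~= axis 2 1" by (simp add: axis_eq_axis)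
  have "emeasure (distr lborel borel (%(x, y). pt x y)) (box l u) = emeasure lborel (box (l $ 1, l $ 2) (u $ 1, u $ 2))"
   unfolding pre[symmetric] by (rule emeasure_distr) auto
  also have "... = ennreal ((u $ 1 - l $ 1) * (u $ 2 - l $ 2))"
   using \<open>l $ 1 <= u $ 1\<close> \<open>l $ 2 <= u $ 2\<close>
   by (subst emeasure_lborel_box) (auto simp: Basis_prod_def algebra_simps)
  also have "(u $ 1 - l $ 1) * (u $ 2 - l $ 2) = (\<Prod>b\<in>Basis. (u - l) \<bullet> b)"
   using ne unfolding B2 by (simp add: inner_axis)
  finally show ?thesis .
 qed
qed simp

lemma pt_measurable [measurable]: "(%(x, y). pt x y) : borel_measurable (lborel :: (real \<times> real) measure)"
proof -
 have "(%(x, y). pt x y) : borel_measurable (borel :: (real \<times> real) measure)"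
  unfolding case_prod_beta by (intro borel_measurable_continuous_onI continuous_intros)
 thus ?thesis by simp
qed

lemma integrable_pt_iff:
 fixes f :: "real^2 => 'a::{banach, second_countable_topology}"
 assumes "f : borel_measurable borel"
 shows "integrable lborel f \<longleftrightarrow> integrable lborel (%(x, y). f (pt x y))"
 using integrable_distr_eq[OF pt_measurable, of f] assms
 unfolding lborel_pt[symmetric] case_prod_beta by simp

lemma integral_pt:
 fixes f :: "real^2 => 'a::{banach, second_countable_topology}"
 assumes "f : borel_measurable borel"
 shows "integral\<^sup>L lborel f = integral\<^sup>L lborel (%(x, y). f (pt x y))"
 using integral_distr[OF pt_measurable, of f] assms
 unfolding lborel_pt[symmetric] case_prod_beta by simp

text \<open>The Frechet derivative with its two components named. \<open>dir_deriv\<close> is a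
  total function, meaningful only where a derivative exists; products, compositions, lines and polar
  coordinates are all treated through this relation instead.\<close>

definition grad_at :: "(real^2 => 'a::real_normed_vector) => 'a => 'a => real^2 => bool" where
 "grad_at f a b x \<longleftrightarrow> (f has_derivative (%h. (h $ 1) *R a + (h $ 2) *R b)) (at x)"

lemma grad_at_dir:
 assumes "grad_at f a b x"
 shows "((%t. f (x + t *R v)) has_vector_derivative (v $ 1) *R a + (v $ 2) *R b) (at 0)"
proof -
 have 1: "((%t. x + t *R v) has_derivative (%t. t *R v)) (at 0)"
  by (auto intro!: derivative_eq_intros)
 have "((%t. f (x + t *R v)) has_derivative (%t. ((t *R v) $ 1) *R a + ((t *R v) $ 2) *R b)) (at 0)"
  using has_derivative_compose[OF 1, of f "%h. (h $ 1) *R a + (h $ 2) *R b"] assms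
  by (simp add: grad_at_def)
 thus ?thesis by (simp add: has_vector_derivative_def scaleR_add_right)
qed

lemma dir_deriv_grad:
 assumes "grad_at f a b x"
 shows "dir_deriv f v x = (v $ 1) *R a + (v $ 2) *R b"
 unfolding dir_deriv_def by (rule vector_derivative_at[OF grad_at_dir[OF assms]])

lemma partial_grad:
 assumes "grad_at f a b x"
 shows "partial 1 f x = a" "partial 2 f x = b"
 unfolding dir_deriv_grad[OF assms] by (simp_all add: axis_def)

lemma grad_at_partial:
 assumes "f differentiable (at x)"
 shows "grad_at f (partial 1 f x) (partial 2 f x) x"
proof -
 obtain f' where f': "(f has_derivative f') (at x)" using assms by (auto simp: differentiable_def)
 interpret linear f' by (rule has_derivative_linear[OF f'])
 have h: "h = (h $ 1) *R axis 1 1 + (h $ 2) *R axis 2 1" for h :: "real^2"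
  by (simp add: vec_eq_iff forall_2 axis_def)
 have "f' h = (h $ 1) *R f' (axis 1 1) + (h $ 2) *R f' (axis 2 1)" for h
 proof -
  have "f' h = f' ((h $ 1) *R axis 1 1 + (h $ 2) *R axis 2 1)" by (rule arg_cong[OF h])
  also have "... = (h $ 1) *R f' (axis 1 1) + (h $ 2) *R f' (axis 2 1)" by (simp only: add scale)
  finally show ?thesis .
 qed
 hence "f' = (%h. (h $ 1) *R f' (axis 1 1) + (h $ 2) *R f' (axis 2 1))" by (rule ext)
 hence "grad_at f (f' (axis 1 1)) (f' (axis 2 1)) x" using f' unfolding grad_at_def by (simp only:)
 thus ?thesis by (simp only: partial_grad)
qed

lemma grad_at_line:
 assumes "grad_at f a b (pt x y)"
 shows "((%s. f (pt s y)) has_vector_derivative a) (at x)" "((%s. f (pt x s)) has_vector_derivative b) (at y)"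
proof -
 have d: "((%s. s *R c + c') has_derivative (%t. t *R c)) (at z)" for c c' :: "real^2" and z :: real
  by (auto intro!: derivative_eq_intros)
 have e: "pt s y = s *R pt 1 0 + pt 0 y" "pt x s = s *R pt 0 1 + pt x 0" for s
  by (simp_all add: vec_eq_iff forall_2)
 have f: "(f has_derivative (%h. (h $ 1) *R a + (h $ 2) *R b)) (at (x *R pt 1 0 + pt 0 y))"
  "(f has_derivative (%h. (h $ 1) *R a + (h $ 2) *R b)) (at (y *R pt 0 1 + pt x 0))"
  using assms unfolding grad_at_def e[symmetric] by auto
 show "((%s. f (pt s y)) has_vector_derivative a) (at x)"
  using has_derivative_compose[OF d f(1)] unfolding has_vector_derivative_def e(1)[symmetric] by simp
 show "((%s. f (pt x s)) has_vector_derivative b) (at y)"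
  using has_derivative_compose[OF d f(2)] unfolding has_vector_derivative_def e(2)[symmetric] by simp
qed

lemma grad_at_const: "grad_at (%x. c) 0 0 x"
 by (simp add: grad_at_def)

lemma grad_at_add: "grad_at f a b x ==> grad_at g a' b' x ==> grad_at (%x. f x + g x) (a + a') (b + b') x"
 unfolding grad_at_def by (drule (1) has_derivative_add) (simp add: algebra_simps scaleR_add_right)

lemma grad_at_diff: "grad_at f a b x ==> grad_at g a' b' x ==> grad_at (%x. f x - g x) (a - a') (b - b') x"
 unfolding grad_at_def by (drule (1) has_derivative_diff) (simp add: algebra_simps scaleR_diff_right)

lemma grad_at_mult:
 fixes f g :: "real^2 => 'a::real_normed_algebra"
 shows "grad_at f a b x ==> grad_at g a' b' x ==>
  grad_at (%x. f x * g x) (f x * a' + a * g x) (f x * b' + b * g x) x"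
 unfolding grad_at_def by (drule (1) has_derivative_mult) (simp add: algebra_simps scaleR_add_right)

lemma grad_at_scaleR:
 "grad_at f a b x ==> grad_at g a' b' x ==>
  grad_at (%x. f x *R g x) (f x *R a' + a *R g x) (f x *R b' + b *R g x) x"
 unfolding grad_at_def by (drule (1) has_derivative_scaleR) (simp add: algebra_simps scaleR_add_right scaleR_add_left)

lemma grad_at_linear:
 assumes "bounded_linear L" "grad_at f a b x"
 shows "grad_at (%x. L (f x)) (L a) (L b) x"
proof -
 interpret bounded_linear L by fact
 show ?thesis
  using has_derivative[of f "%h. (h $ 1) *R a + (h $ 2) *R b" "at x"] assms(2)
  unfolding grad_at_def by (simp add: add scaleR)
qed

lemmas grad_at_cnj = grad_at_linear[OF bounded_linear_cnj]

lemma grad_at_comp: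
 assumes "grad_at f a b x" "(g has_real_derivative g') (at (f x))"
 shows "grad_at (%x. g (f x)) (g' * a) (g' * b) x"
 using has_derivative_compose[of f "%h. (h $ 1) *R a + (h $ 2) *R b" x UNIV g "(*) g'"] assms
 unfolding grad_at_def has_field_derivative_def by (simp add: algebra_simps)

lemma grad_at_nth: "grad_at (%z. z $ 1) 1 0 x" "grad_at (%z. z $ 2) 0 1 x"
 using bounded_linear_imp_has_derivative[OF bounded_linear_vec_nth] by (simp_all add: grad_at_def)

lemma grad_at_continuous: "grad_at f a b x ==> isCont f x"
 unfolding grad_at_def by (rule has_derivative_continuous)

lemma grad_at_transform:
 "grad_at f a b x ==> open S ==> x : S ==> (!!y. y : S ==> f y = g y) ==> grad_at g a b x"
 unfolding grad_at_def by (rule has_derivative_transform_within_open)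

lemma C2_on_grad:
 assumes "C2_on S f" "open S" "x : S"
 shows "grad_at f (partial 1 f x) (partial 2 f x) x"
  "grad_at (partial i f) (partial 1 (partial i f) x) (partial 2 (partial i f) x) x"
 using assms unfolding C2_on_def
 by (auto intro!: grad_at_partial simp: differentiable_on_eq_differentiable_at)

lemma C2_on_cont:
 assumes "C2_on S f"
 shows "continuous_on S f" "continuous_on S (partial i f)" "continuous_on S (partial j (partial i f))"
 using assms unfolding C2_on_def by (auto intro: differentiable_imp_continuous_on)

text \<open>The disjunction serves both coordinate directions: integrating first in the direction of
  the derivative gives 0 by the fundamental theorem of calculus.\<close>

lemma integral_deriv_compact:
 fixes F F' :: "real^2 => complex"
 assumes d: "(\<forall>x y. ((%s. F (pt s y)) has_vector_derivative F' (pt x y)) (at x)) \<or>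
   (\<forall>x y. ((%s. F (pt x s)) has_vector_derivative F' (pt x y)) (at y))"
  and c: "continuous_on UNIV F'" and K: "compact K"
  and z: "!!x. x \<notin> K ==> F x = 0" "!!x. x \<notin> K ==> F' x = 0"
 shows "integrable lborel F'" "integral\<^sup>L lborel F' = 0"
proof -
 obtain R where R: "!!x. x : K ==> norm x < R" "R > 0"
  using compact_imp_bounded[OF K] by (auto simp: bounded_pos_less)
 have zR: "F x = 0" "F' x = 0" if "norm x >= R" for x using z[of x] R(1)[of x] that by force+
 have "sint K F'"
  by (rule borel_integrable_compact[OF K continuous_on_subset[OF c], unfolded sint_def[symmetric]]) auto
 moreover have "(%x. ind K x *R F' x) = F'" using z by (auto simp: fun_eq_iff indicator_def)
 ultimately show i: "integrable lborel F'" by (simp add: sint_def)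
 have m: "F' : borel_measurable borel" by (rule borel_measurable_continuous_onI[OF c])
 have i2: "integrable (lborel \<Otimes>\<^sub>M lborel) (%(x, y). F' (pt x y))"
  using i integrable_pt_iff[OF m] by (simp add: lborel_prod)
 have cx: "continuous_on S (%x. F' (pt x y))" "continuous_on S (%y. F' (pt x y))" for S x y
  by (intro continuous_on_compose2[OF c] continuous_intros subset_UNIV)+
 have big: "R <= norm (pt x y)" if "\<bar>x\<bar> >= R \<or> \<bar>y\<bar> >= R" for x y
  using that component_le_norm_cart[of "pt x y" 1] component_le_norm_cart[of "pt x y" 2] by auto
 have one: "(LINT x|lborel. f' x) = 0"
  if "!!x. (f has_vector_derivative f' x) (at x)" "continuous_on UNIV f'" "!!x. \<bar>x\<bar> >= R ==> f x = 0 \<and> f' x = 0"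
  for f f' :: "real => complex"
 proof -
  have c': "continuous_on {-R..R} f'" by (rule continuous_on_subset[OF that(2)]) simp
  have "(f' has_integral (f R - f (- R))) {-R..R}"
   using R(2) by (intro fundamental_theorem_of_calculus has_vector_derivative_at_within[OF that(1)]) auto
  hence "integral {-R..R} f' = 0" using that(3)[of R] that(3)[of "-R"] R(2) by (simp add: integral_unique)
  moreover have "(SINT x:{-R..R}. f' x) = integral {-R..R} f'"
   by (rule set_borel_integral_eq_integral(2)[OF borel_integrable_atLeastAtMost'[OF c']])
  moreover have "(%x. ind {-R..R} x *R f' x) = f'"
   using that(3) by (force simp: fun_eq_iff indicator_def)
  ultimately show ?thesis by (simp add: int_def)
 qed
 show "integral\<^sup>L lborel F' = 0"
  using d
 proof
  assume d: "\<forall>x y. ((%s. F (pt s y)) has_vector_derivative F' (pt x y)) (at x)"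
  have "(LINT x|lborel. F' (pt x y)) = 0" for y
  proof (rule one[of "%x. F (pt x y)"])
   show "((%x. F (pt x y)) has_vector_derivative F' (pt x y)) (at x)" for x using d by blast
   show "F (pt x y) = 0 \<and> F' (pt x y) = 0" if "\<bar>x\<bar> >= R" for x using that zR[OF big] by blast
  qed (rule cx)
  thus ?thesis
   using lborel_pair.integral_snd[OF i2] integral_pt[OF m] by (simp add: lborel_prod)
 next
  assume d: "\<forall>x y. ((%s. F (pt x s)) has_vector_derivative F' (pt x y)) (at y)"
  have "(LINT y|lborel. F' (pt x y)) = 0" for x
  proof (rule one[of "%y. F (pt x y)"])
   show "((%y. F (pt x y)) has_vector_derivative F' (pt x y)) (at y)" for y using d by blast
   show "F (pt x y) = 0 \<and> F' (pt x y) = 0" if "\<bar>y\<bar> >= R" for y using that zR[OF big] by blast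
  qed (rule cx)
  thus ?thesis
   using lborel_pair.integral_fst'[OF i2] integral_pt[OF m] by (simp add: lborel_prod)
 qed
qed

text \<open>The divergence theorem for the field ps (p1, p2), extended by 0 outside
  \<open>S\<close>; the compact support inside \<open>S\<close> makes the extension differentiable
  everywhere.\<close>

lemma green_compact:
 fixes p ps :: "real^2 => complex"
 assumes S: "open S" and K: "compact K" "K \<subseteq> S"
  and p1: "!!x. x : S ==> grad_at p1 (p11 x) (p12 x) x" and p2: "!!x. x : S ==> grad_at p2 (p21 x) (p22 x) x"
  and pc: "continuous_on S p11" "continuous_on S p22"
  and ps: "!!x. x : S ==> grad_at ps (ps1 x) (ps2 x) x" and psc: "continuous_on S ps1" "continuous_on S ps2"
  and z: "!!x. x : S ==> x \<notin> K ==> ps x = 0 \<and> ps1 x = 0 \<and> ps2 x = 0"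
 shows "sint S (%x. p1 x * ps1 x + p2 x * ps2 x + (p11 x + p22 x) * ps x)"
  and "(SINT x:S. p1 x * ps1 x + p2 x * ps2 x + (p11 x + p22 x) * ps x) = 0"
proof -
 have c: "continuous_on S f" if "!!x. x : S ==> grad_at f (f1 x) (f2 x) x" for f :: "real^2 => complex" and f1 f2
  using that grad_at_continuous by (blast intro: continuous_at_imp_continuous_on)
 note cc = c[OF p1] c[OF p2] c[OF ps]
 have oK: "open (- K)" using compact_imp_closed[OF K(1)] by (rule open_Compl)
 have ext: "continuous_on UNIV (%x. if x : S then f x else 0)"
  if f: "continuous_on S f" "!!x. x : S ==> x \<notin> K ==> f x = 0" for f :: "real^2 => complex"
 proof -
  have "continuous_on (S \<union> - K) (%x. if x : S then f x else 0)"
  proof (rule continuous_on_open_Un[OF S oK])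
   show "continuous_on S (%x. if x : S then f x else 0)"
    using f(1) by (rule continuous_on_eq) simp
   show "continuous_on (- K) (%x. if x : S then f x else 0)"
    by (rule continuous_on_eq[OF continuous_on_const[of _ 0]]) (use f(2) in auto)
  qed
  moreover have "S \<union> - K = UNIV" using K by auto
  ultimately show ?thesis by simp
 qed
 have der: "grad_at (%x. if x : S then p' x * ps x else 0) (if x : S then p' x * ps1 x + a x * ps x else 0)
   (if x : S then p' x * ps2 x + b x * ps x else 0) x"
  if p': "!!x. x : S ==> grad_at p' (a x) (b x) x" for p' a b x
 proof (cases "x : S")
  case True
  have "grad_at (%x. if x : S then p' x * ps x else 0) (p' x * ps1 x + a x * ps x) (p' x * ps2 x + b x * ps x) x"
   by (rule grad_at_transform[OF grad_at_mult[OF p' ps] S]) (use True in auto)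
  thus ?thesis using True by simp
 next
  case False
  have "grad_at (%x. if x : S then p' x * ps x else 0) 0 0 x"
   by (rule grad_at_transform[OF grad_at_const oK]) (use False K z in auto)
  thus ?thesis using False by simp
 qed
 let ?F1 = "%x. if x : S then p1 x * ps1 x + p11 x * ps x else 0"
 let ?F2 = "%x. if x : S then p2 x * ps2 x + p22 x * ps x else 0"
 have 1: "integrable lborel ?F1" "integral\<^sup>L lborel ?F1 = 0"
 proof -
  have d: "((%s. if pt s y : S then p1 (pt s y) * ps (pt s y) else 0) has_vector_derivative ?F1 (pt x y)) (at x)" for x y
   by (rule grad_at_line(1)[OF der[OF p1]])
  have c: "continuous_on UNIV ?F1"
  proof (rule ext)
   show "continuous_on S (%x. p1 x * ps1 x + p11 x * ps x)" by (intro continuous_intros cc pc psc)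
  qed (simp add: z)
  have z1: "(if x : S then p1 x * ps x else 0) = 0" "?F1 x = 0" if "x \<notin> K" for x
   using z[OF _ that] by simp_all
  show "integrable lborel ?F1" "integral\<^sup>L lborel ?F1 = 0"
   by (rule integral_deriv_compact[OF disjI1[OF allI[OF allI[OF d]]] c K(1) z1]; assumption)+
 qed
 have 2: "integrable lborel ?F2" "integral\<^sup>L lborel ?F2 = 0"
 proof -
  have d: "((%s. if pt x s : S then p2 (pt x s) * ps (pt x s) else 0) has_vector_derivative ?F2 (pt x y)) (at y)" for x y
   by (rule grad_at_line(2)[OF der[OF p2]])
  have c: "continuous_on UNIV ?F2"
  proof (rule ext)
   show "continuous_on S (%x. p2 x * ps2 x + p22 x * ps x)" by (intro continuous_intros cc pc psc)
  qed (simp add: z)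
  have z1: "(if x : S then p2 x * ps x else 0) = 0" "?F2 x = 0" if "x \<notin> K" for x
   using z[OF _ that] by simp_all
  show "integrable lborel ?F2" "integral\<^sup>L lborel ?F2 = 0"
   by (rule integral_deriv_compact[OF disjI2[OF allI[OF allI[OF d]]] c K(1) z1]; assumption)+
 qed
 have e: "(%x. ind S x *R (p1 x * ps1 x + p2 x * ps2 x + (p11 x + p22 x) * ps x)) = (%x. ?F1 x + ?F2 x)"
  by (auto simp: fun_eq_iff indicator_def algebra_simps)
 show "sint S (%x. p1 x * ps1 x + p2 x * ps2 x + (p11 x + p22 x) * ps x)"
  unfolding sint_def e using 1 2 by simp
 show "(SINT x:S. p1 x * ps1 x + p2 x * ps2 x + (p11 x + p22 x) * ps x) = 0"
  unfolding int_def e using 1 2 by simp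
qed

lemma set_integrable_sq_prod:
 fixes f g :: "'a::euclidean_space => complex"
 assumes S: "open S" and c: "continuous_on S f" "continuous_on S g"
  and i: "sint S (%x. nsq (f x))" "sint S (%x. nsq (g x))"
 shows "sint S (%x. f x * g x)"
proof (rule set_integrable_bound[OF set_integral_add(1)[OF i]])
 show "set_borel_measurable lborel S (%x. f x * g x)"
  by (intro set_borel_measurable_open S continuous_intros c)
 have "cmod (x * y) <= nsq x + nsq y" for x y
 proof -
  have "2 * (cmod x * cmod y) <= nsq x + nsq y" using sum_squares_bound[of "cmod x" "cmod y"] by simp
  moreover have "0 <= cmod x * cmod y" by simp
  ultimately show ?thesis unfolding norm_mult by linarith
 qed
 note b = this
 show "AE x in lborel. x : S \<longrightarrow> norm (f x * g x) <= norm (nsq (f x) + nsq (g x))"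
  unfolding real_norm_def by (intro AE_I2 impI order_trans[OF b abs_ge_self])
qed

text \<open>A Lebesgue number of the cover of \<open>K\<close> by the balls of the pointwise limits
  provides one radius for all boundary points.\<close>

lemma uniform_boundary_limit:
 fixes f :: "'a::metric_space => 'b::real_normed_vector"
 assumes K: "compact K" "K \<inter> S = {}" and lim: "!!x. x : K ==> (f \<longlongrightarrow> 0) (at x within S)" and e: "e > 0"
 obtains r where "r > 0" "!!x y. x : K ==> y : S ==> dist y x < r ==> norm (f y) < e"
proof -
 have "\<exists>r>0. \<forall>y\<in>S. dist y x < r \<longrightarrow> norm (f y) < e" if "x : K" for x
 proof -
  have "\<forall>\<^sub>F y in at x within S. dist (f y) 0 < e" using lim[OF that] e by (rule tendstoD)
  then obtain r where "r > 0" "\<forall>y\<in>S. y ~= x \<and> dist y x < r \<longrightarrow> dist (f y) 0 < e"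
   by (auto simp: eventually_at)
  moreover have "x \<notin> S" using that K by auto
  ultimately show ?thesis by (auto intro!: exI[of _ r])
 qed
 hence "\<forall>x\<in>K. \<exists>r>0. \<forall>y\<in>S. dist y x < r \<longrightarrow> norm (f y) < e" by blast
 from bchoice[OF this] obtain r where r: "!!x. x : K ==> r x > 0" "!!x y. x : K ==> y : S ==> dist y x < r x ==> norm (f y) < e"
  by blast
 obtain rr where rr: "rr > 0" "!!x. x : K ==> \<exists>G\<in>(%x. ball x (r x)) ` K. ball x rr \<subseteq> G"
 proof (rule Heine_Borel_lemma[OF K(1), of "(%x. ball x (r x)) ` K"])
  show "K \<subseteq> \<Union> ((%x. ball x (r x)) ` K)" using r(1) by fastforce
  show "open G" if "G : (%x. ball x (r x)) ` K" for G using that by auto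
 qed blast
 show ?thesis
 proof (rule that[OF rr(1)])
  fix x y assume x: "x : K" and y: "y : S" "dist y x < rr"
  obtain x' where x': "x' : K" "ball x rr \<subseteq> ball x' (r x')" using rr(2)[OF x] by auto
  have "y : ball x rr" using y by (simp add: dist_commute)
  hence "dist y x' < r x'" using x'(2) by (auto simp: dist_commute)
  thus "norm (f y) < e" using r(2)[OF x'(1) y(1)] by simp
 qed
qed

lemma dist_pt_line: "dist (z :: real^2) (pt (z $ 1) y) = \<bar>z $ 2 - y\<bar>" "dist (z :: real^2) (pt x (z $ 2)) = \<bar>z $ 1 - x\<bar>"
 unfolding dist_norm norm_pt by simp_all

section \<open>Weak formulation of the cavity problem\<close>

locale cavity_solution =
 fixes ep d kp th :: real and u :: "real^2 => complex"
 assumes eps: "0 < ep" and d: "0 < d" and kp: "0 < kp" and sol: "pec_pmc_solution ep d kp th u"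
begin

abbreviation "Om \<equiv> Omega ep d"
abbreviation "cav \<equiv> cavity ep d"
abbreviation "up \<equiv> upper_half_plane"
abbreviation "u1 \<equiv> partial 1 u"
abbreviation "u2 \<equiv> partial 2 u"

lemma Om_iff: "x : Om \<longleftrightarrow> 0 < x $ 2 \<or> (0 < x $ 1 \<and> x $ 1 < ep \<and> - d < x $ 2)"
 using d by (auto simp: Omega_def upper_half_plane_def aperture_def cavity_def)

lemma up_iff: "x : up \<longleftrightarrow> 0 < x $ 2" by (simp add: upper_half_plane_def)

lemma cav_iff: "x : cav \<longleftrightarrow> 0 < x $ 1 \<and> x $ 1 < ep \<and> - d < x $ 2 \<and> x $ 2 < 0" by (simp add: cavity_def)

lemma open_sets: "open Om" "open cav" "open up"
proof -
 have Om: "Om = {x. 0 < x $ 2} \<union> ({x. 0 < x $ 1} \<inter> {x. x $ 1 < ep} \<inter> {x. - d < x $ 2})"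
  by (auto simp: Om_iff)
 have cav: "cav = {x. 0 < x $ 1} \<inter> {x. x $ 1 < ep} \<inter> {x. - d < x $ 2} \<inter> {x. x $ 2 < 0}"
  by (auto simp: cav_iff)
 show "open Om" "open cav" "open up"
  unfolding Om cav upper_half_plane_def
  by (intro open_Un open_Int open_Collect_less continuous_intros)+
qed

lemma subsets: "cav \<subseteq> Om" "up \<subseteq> Om" by (auto simp: Om_iff cav_iff up_iff)

lemma C2: "C2_on Om u" using sol by (simp add: pec_pmc_solution_def)

lemmas u_grad = C2_on_grad[OF C2 open_sets(1)]
lemmas u_cont = C2_on_cont[OF C2]

lemma helmholtz: "x : Om ==> partial 1 u1 x + partial 2 u2 x = - of_real (kp^2) * u x"
 using sol unfolding pec_pmc_solution_def laplacian_def sum_2 by (simp add: eq_neg_iff_add_eq_0)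

lemma energy:
 "sint (Om \<inter> ball 0 R) (%x. nsq (u x))"
 "sint (Om \<inter> ball 0 R) (%x. nsq (u1 x))"
 "sint (Om \<inter> ball 0 R) (%x. nsq (u2 x))"
proof -
 have i: "sint (Om \<inter> ball 0 (max R 1)) (%x. nsq (u x) + (nsq (u1 x) + nsq (u2 x)))"
  using sol unfolding pec_pmc_solution_def finite_energy_def sum_2 by (auto elim!: allE[of _ "max R 1"])
 have o: "open (Om \<inter> ball 0 R)" by (intro open_Int open_sets open_ball)
 have "sint (Om \<inter> ball 0 R) (%x. nsq (u x) + (nsq (u1 x) + nsq (u2 x)))"
  by (rule set_integrable_subset[OF i]) (use o in auto)
 note b = set_integrable_bound[OF this set_borel_measurable_open[OF o]]
 have c: "continuous_on (Om \<inter> ball 0 R) u" "continuous_on (Om \<inter> ball 0 R) u1" "continuous_on (Om \<inter> ball 0 R) u2"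
  by (auto intro: continuous_on_subset u_cont)
 show "sint (Om \<inter> ball 0 R) (%x. nsq (u x))"
  "sint (Om \<inter> ball 0 R) (%x. nsq (u1 x))"
  "sint (Om \<inter> ball 0 R) (%x. nsq (u2 x))"
 proof -
  have m: "continuous_on (Om \<inter> ball 0 R) (%x. nsq (u x))" "continuous_on (Om \<inter> ball 0 R) (%x. nsq (u1 x))"
   "continuous_on (Om \<inter> ball 0 R) (%x. nsq (u2 x))"
   by (intro continuous_intros c)+
  show "sint (Om \<inter> ball 0 R) (%x. nsq (u x))" by (rule b[OF m(1)]) simp
  show "sint (Om \<inter> ball 0 R) (%x. nsq (u1 x))" by (rule b[OF m(2)]) simp
  show "sint (Om \<inter> ball 0 R) (%x. nsq (u2 x))" by (rule b[OF m(3)]) simp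
 qed
qed

lemma frontierI:
 assumes "x \<notin> Om" and "!!e. e > 0 ==> \<exists>y\<in>Om. dist y x < e"
 shows "x : frontier Om"
 using assms unfolding frontier_def interior_open[OF open_sets(1)] by (simp add: closure_approachable)

lemma neumann_limit:
 assumes "x : frontier Om" "x \<notin> bottom ep d" "x \<notin> corners ep d"
 shows "((%y. (outward_normal d x $ 1) *R u1 y + (outward_normal d x $ 2) *R u2 y) \<longlongrightarrow> 0) (at x within Om)"
proof (rule Lim_transform_within[of "%y. dir_deriv u (outward_normal d x) y" _ _ _ 1])
 show "((%y. dir_deriv u (outward_normal d x) y) \<longlongrightarrow> 0) (at x within Om)"
  using sol assms unfolding pec_pmc_solution_def by blast
 show "dir_deriv u (outward_normal d x) y = (outward_normal d x $ 1) *R u1 y + (outward_normal d x $ 2) *R u2 y"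
  if "y : Om" for y
  by (rule dir_deriv_grad[OF u_grad(1)[OF that]])
qed simp

lemma neumann_top:
 assumes "x \<notin> {0..ep}"
 shows "(u2 \<longlongrightarrow> 0) (at (pt x 0) within Om)"
proof -
 have "pt x 0 : frontier Om"
 proof (rule frontierI)
  fix e :: real assume "e > 0"
  thus "\<exists>y\<in>Om. dist y (pt x 0) < e"
   using dist_pt_line(1)[of "pt x (e/2)" 0] by (intro bexI[of _ "pt x (e/2)"]) (auto simp: Om_iff)
 qed (use assms in \<open>auto simp: Om_iff\<close>)
 moreover have "pt x 0 \<notin> bottom ep d" using assms by (auto simp: bottom_def)
 moreover have "pt x 0 \<notin> corners ep d"
  using assms eps by (auto simp: corners_def vec_eq_iff forall_2)
 ultimately have "((%y. - u2 y) \<longlongrightarrow> 0) (at (pt x 0) within Om)"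
  using neumann_limit[of "pt x 0"] by (simp add: outward_normal_def)
 from tendsto_minus[OF this] show ?thesis by simp
qed

lemma neumann_walls:
 assumes y: "- d < y" "y < 0" and x: "x = 0 \<or> x = ep"
 shows "(u1 \<longlongrightarrow> 0) (at (pt x y) within Om)"
proof -
 have "pt x y : frontier Om"
 proof (rule frontierI)
  fix e :: real assume e: "e > 0"
  define h where "h = (if x = 0 then 1 else - 1) * (min e ep / 2)"
  have "pt (x + h) y : Om" "\<bar>h\<bar> < e" using x y e eps by (auto simp: Om_iff h_def min_def)
  thus "\<exists>z\<in>Om. dist z (pt x y) < e"
   using dist_pt_line(2)[of "pt (x + h) y" x] by (intro bexI[of _ "pt (x + h) y"]) auto
 qed (use x y in \<open>auto simp: Om_iff\<close>)
 moreover have "pt x y \<notin> bottom ep d" using y by (auto simp: bottom_def)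
 moreover have "pt x y \<notin> corners ep d" using y by (auto simp: corners_def vec_eq_iff forall_2)
 ultimately have "((%z. (if x = 0 then - 1 else 1) *R u1 z) \<longlongrightarrow> 0) (at (pt x y) within Om)"
  using neumann_limit[of "pt x y"] y by (auto simp: outward_normal_def split: if_splits)
 from tendsto_scaleR[OF tendsto_const[of "if x = 0 then - 1 else 1"] this]
 show ?thesis by (cases "x = 0") simp_all
qed

lemma dirichlet_bottom: "x : {0<..<ep} ==> (u \<longlongrightarrow> 0) (at (pt x (- d)) within Om)"
 using sol unfolding pec_pmc_solution_def by (auto simp: bottom_def)

text \<open>Keeping the distance \<open>s\<close> from the corners and bounding by \<open>R\<close>
  makes the boundary piece compact. At the corners themselves the hypotheses give no limit.\<close>

lemma neumann_top_uniform:
 assumes "e > 0" "s > 0"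
 obtains r where "r > 0" "!!z. 0 < z $ 2 ==> z $ 2 < r ==> z $ 1 : {- R..- s} \<union> {ep + s..R} ==> cmod (u2 z) < e"
proof -
 let ?K = "(%x. pt x 0) ` ({- R..- s} \<union> {ep + s..R})"
 have K: "compact ?K" by (intro compact_continuous_image continuous_intros compact_Un) auto
 have "?K \<inter> Om = {}" using assms(2) eps by (auto simp: Om_iff)
 moreover have "(u2 \<longlongrightarrow> 0) (at x within Om)" if "x : ?K" for x
  using that assms(2) eps by (auto intro!: neumann_top)
 ultimately obtain r where r: "r > 0" "!!x y. x : ?K ==> y : Om ==> dist y x < r ==> cmod (u2 y) < e"
  using uniform_boundary_limit[OF K _ _ assms(1), of Om u2] by blast
 show ?thesis
 proof (rule that[OF r(1)])
  fix z :: "real^2" assume z: "0 < z $ 2" "z $ 2 < r" "z $ 1 : {- R..- s} \<union> {ep + s..R}"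
  show "cmod (u2 z) < e"
   by (rule r(2)[of "pt (z $ 1) 0"]) (use z dist_pt_line(1)[of z 0] in \<open>auto simp: Om_iff\<close>)
 qed
qed

lemma neumann_walls_uniform:
 assumes "e > 0" "s > 0"
 obtains r where "r > 0" "!!z. z : Om ==> z $ 2 : {- d + s..- s} ==> z $ 1 < r \<or> z $ 1 > ep - r ==> cmod (u1 z) < e"
proof -
 let ?K = "(%y. pt 0 y) ` {- d + s..- s} \<union> (%y. pt ep y) ` {- d + s..- s}"
 have K: "compact ?K" by (intro compact_Un compact_continuous_image continuous_intros) auto
 have "?K \<inter> Om = {}" using assms(2) by (auto simp: Om_iff)
 moreover have "(u1 \<longlongrightarrow> 0) (at x within Om)" if "x : ?K" for x
  using that assms(2) by (auto intro!: neumann_walls)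
 ultimately obtain r where r: "r > 0" "!!x y. x : ?K ==> y : Om ==> dist y x < r ==> cmod (u1 y) < e"
  using uniform_boundary_limit[OF K _ _ assms(1), of Om u1] by blast
 show ?thesis
 proof (rule that[OF r(1)])
  fix z :: "real^2" assume z: "z : Om" "z $ 2 : {- d + s..- s}" "z $ 1 < r \<or> z $ 1 > ep - r"
  have x: "0 < z $ 1" "z $ 1 < ep" using z assms(2) by (auto simp: Om_iff)
  show "cmod (u1 z) < e"
  proof (cases "z $ 1 < r")
   case True
   thus ?thesis
    by (intro r(2)[of "pt 0 (z $ 2)"]) (use z x dist_pt_line(2)[of z 0] in auto)
  next
   case False
   thus ?thesis
    by (intro r(2)[of "pt ep (z $ 2)"]) (use z x dist_pt_line(2)[of z ep] in auto)
  qed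
 qed
qed

end

section \<open>Cutoffs at the corners and at the Neumann walls\<close>

lemma box_area:
 assumes "a <= c" "b <= e"
 shows "measure lborel (cbox (pt a b) (pt c e)) = (c - a) * (e - b)" "emeasure lborel (cbox (pt a b) (pt c e)) < \<infinity>"
proof -
 have "cbox (pt a b) (pt c e) ~= {}"
  using assms by (auto simp: box_ne_empty Basis_vec_def inner_axis UNIV_2)
 thus "measure lborel (cbox (pt a b) (pt c e)) = (c - a) * (e - b)"
  by (simp add: content_cbox_cart UNIV_2)
 show "emeasure lborel (cbox (pt a b) (pt c e)) < \<infinity>" by (rule emeasure_lborel_cbox_finite)
qed

lemma in_box: "z : cbox (pt a b) (pt c e) \<longleftrightarrow> a <= z $ 1 \<and> z $ 1 <= c \<and> b <= z $ 2 \<and> z $ 2 <= e"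
 by (auto simp: mem_box_cart forall_2)

text \<open>The squared distance keeps this differentiable at the corner itself. Only the two
  corners at the aperture receive such a cutoff, since test functions are taken to vanish near the
  bottom.\<close>

definition corner_cut :: "real => real => real^2 => real" where
 "corner_cut si a z = step (((z $ 1 - a)^2 + (z $ 2)^2) / si^2 - 1)"

definition corner_cut1 :: "real => real => real^2 => real" where
 "corner_cut1 si a z = step' (((z $ 1 - a)^2 + (z $ 2)^2) / si^2 - 1) * (2 * (z $ 1 - a) / si^2)"

definition corner_cut2 :: "real => real => real^2 => real" where
 "corner_cut2 si a z = step' (((z $ 1 - a)^2 + (z $ 2)^2) / si^2 - 1) * (2 * (z $ 2) / si^2)"

lemma corner_cut_grad:
 assumes "si > 0"
 shows "grad_at (corner_cut si a) (corner_cut1 si a z) (corner_cut2 si a z) z"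
proof -
 have "grad_at (%z. z $ 1 - a) 1 0 z"
  using grad_at_diff[OF grad_at_nth(1) grad_at_const] by simp
 note s1 = grad_at_mult[OF this this] and s2 = grad_at_mult[OF grad_at_nth(2)[of z] grad_at_nth(2)[of z]]
 have "grad_at (%z. ((z $ 1 - a)^2 + (z $ 2)^2)) (2 * (z $ 1 - a)) (2 * (z $ 2)) z"
  using grad_at_add[OF s1 s2] by (simp add: power2_eq_square)
 from grad_at_comp[OF this, of "%x. step (x / si^2 - 1)" "step' (((z $ 1 - a)^2 + (z $ 2)^2) / si^2 - 1) * (1 / si^2)"]
 show ?thesis
  unfolding corner_cut_def[abs_def] corner_cut1_def corner_cut2_def
 proof (rule back_subst[where P = "%q. grad_at _ q _ z", OF back_subst[where P = "%q. grad_at _ _ q z"]])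
  show "((%x. step (x / si^2 - 1)) has_real_derivative step' (((z $ 1 - a)^2 + (z $ 2)^2) / si^2 - 1) * (1 / si^2))
    (at ((z $ 1 - a)^2 + (z $ 2)^2))"
   by (rule DERIV_chain2[OF step_deriv])
    (use DERIV_diff[OF DERIV_cdivide[OF DERIV_ident] DERIV_const] in simp)
 qed simp_all
qed

lemma corner_cut_cont: "si > 0 ==> continuous_on S (corner_cut1 si a)" "si > 0 ==> continuous_on S (corner_cut2 si a)"
  "si > 0 ==> continuous_on S (corner_cut si a)"
 unfolding corner_cut1_def[abs_def] corner_cut2_def[abs_def] corner_cut_def[abs_def]
 by (intro continuous_intros; simp)+

lemma corner_cut_bounds:
 assumes "si > 0"
 shows "0 <= corner_cut si a z" "corner_cut si a z <= 1"
  "\<bar>corner_cut1 si a z\<bar> <= 5 / si * ind (cbox (pt (a - 2 * si) (- 2 * si)) (pt (a + 2 * si) (2 * si))) z"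
  "\<bar>corner_cut2 si a z\<bar> <= 5 / si * ind (cbox (pt (a - 2 * si) (- 2 * si)) (pt (a + 2 * si) (2 * si))) z"
  "(z $ 1 - a)^2 + (z $ 2)^2 <= si^2 ==> corner_cut si a z = 0"
  "(z $ 1 - a)^2 + (z $ 2)^2 >= 2 * si^2 ==> corner_cut si a z = 1"
proof -
 show "0 <= corner_cut si a z" "corner_cut si a z <= 1" by (simp_all add: corner_cut_def step_bounds)
 let ?q = "((z $ 1 - a)^2 + (z $ 2)^2)"
 have s2: "si^2 > 0" using assms by simp
 show "?q <= si^2 ==> corner_cut si a z = 0" "?q >= 2 * si^2 ==> corner_cut si a z = 1"
  using s2 by (simp_all add: corner_cut_def divide_le_eq le_divide_eq)
 let ?B = "cbox (pt (a - 2 * si) (- 2 * si)) (pt (a + 2 * si) (2 * si))"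
 have key: "\<bar>step' (?q / si^2 - 1) * (2 * x / si^2)\<bar> <= 5 / si * ind ?B z" if x: "x^2 <= ?q" for x
 proof (cases "?q >= 2 * si^2")
  case True
  hence "?q / si^2 - 1 >= 1" using s2 by (simp add: le_divide_eq)
  thus ?thesis using assms by simp
 next
  case False
  \<comment> \<open>The transition ends at radius sqrt 2 * si, and sqrt 2 < 3/2. The resulting slope
    9/2 / si is rounded up to 5 / si.\<close>
  have sq: "\<bar>y\<bar> <= 3/2 * si" if "y^2 <= ?q" for y
  proof (rule power2_le_imp_le)
   have "(3/2 * si)^2 = 9/4 * si^2" by (simp add: power2_eq_square)
   thus "\<bar>y\<bar>^2 <= (3/2 * si)^2" unfolding power2_abs using that False s2 by argo
  qed (use assms in simp)
  have "\<bar>z $ 1 - a\<bar> <= 3/2 * si" "\<bar>z $ 2\<bar> <= 3/2 * si" by (rule sq; simp)+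
  hence "z : ?B" using assms unfolding in_box by (simp add: abs_le_iff; argo)
  moreover have "\<bar>step' (?q / si^2 - 1) * (2 * x / si^2)\<bar> <= 3/2 * (2 * (3/2 * si) / si^2)"
   unfolding abs_mult
  proof (rule mult_mono)
   have "\<bar>2 * x / si^2\<bar> = 2 * \<bar>x\<bar> / si^2" by (simp add: abs_mult)
   also have "... <= 2 * (3/2 * si) / si^2" using sq[OF x] by (intro divide_right_mono mult_left_mono) auto
   finally show "\<bar>2 * x / si^2\<bar> <= 2 * (3/2 * si) / si^2" .
  qed (rule step_bounds, simp, simp)
  moreover have "3/2 * (2 * (3/2 * si) / si^2) = 9/2 / si" using assms by (simp add: power2_eq_square)
  moreover have "9/2 / si <= 5 / si" using assms by (intro divide_right_mono) auto
  ultimately show ?thesis by simp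
 qed
 show "\<bar>corner_cut1 si a z\<bar> <= 5 / si * ind ?B z" unfolding corner_cut1_def by (rule key) simp
 show "\<bar>corner_cut2 si a z\<bar> <= 5 / si * ind ?B z" unfolding corner_cut2_def by (rule key) simp
qed

definition wall_cut :: "real => real => real => real" where
 "wall_cut dl ep x = step (x / dl - 1) * step ((ep - x) / dl - 1)"

definition wall_cut' :: "real => real => real => real" where
 "wall_cut' dl ep x = step' (x / dl - 1) / dl * step ((ep - x) / dl - 1)
   - step (x / dl - 1) * (step' ((ep - x) / dl - 1) / dl)"

text \<open>Vanishes near the Neumann walls. Away from the corners its gradient is normal to the nearest wall, where the normal derivative of u is small.\<close>

definition neumann_cut :: "real => real => real^2 => real" where
 "neumann_cut dl ep z = 1 - (1 - step (z $ 2 / dl - 1)) * (1 - wall_cut dl ep (z $ 1))"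

definition neumann_cut1 :: "real => real => real^2 => real" where
 "neumann_cut1 dl ep z = (1 - step (z $ 2 / dl - 1)) * wall_cut' dl ep (z $ 1)"

definition neumann_cut2 :: "real => real => real^2 => real" where
 "neumann_cut2 dl ep z = step' (z $ 2 / dl - 1) / dl * (1 - wall_cut dl ep (z $ 1))"

lemma scaled_step_deriv:
 "((%x. step (x / dl - 1)) has_real_derivative step' (x / dl - 1) / dl) (at x)"
 "((%x. step ((ep - x) / dl - 1)) has_real_derivative - (step' ((ep - x) / dl - 1) / dl)) (at x)"
proof -
 have 1: "((%x. x / dl - 1) has_real_derivative 1 / dl) (at x)"
  using DERIV_diff[OF DERIV_cdivide[OF DERIV_ident] DERIV_const] by simp
 have 2: "((%x. (ep - x) / dl - 1) has_real_derivative - 1 / dl) (at x)"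
  using DERIV_diff[OF DERIV_cdivide[OF DERIV_diff[OF DERIV_const DERIV_ident]] DERIV_const] by simp
 show "((%x. step (x / dl - 1)) has_real_derivative step' (x / dl - 1) / dl) (at x)"
  using DERIV_chain2[OF step_deriv 1] by simp
 show "((%x. step ((ep - x) / dl - 1)) has_real_derivative - (step' ((ep - x) / dl - 1) / dl)) (at x)"
  using DERIV_chain2[OF step_deriv 2] by simp
qed

lemma wall_cut_deriv: "(wall_cut dl ep has_real_derivative wall_cut' dl ep x) (at x)"
 unfolding wall_cut_def[abs_def]
 by (rule DERIV_cong[OF DERIV_mult[OF scaled_step_deriv]]) (simp add: wall_cut'_def)

lemma neumann_cut_grad: "grad_at (neumann_cut dl ep) (neumann_cut1 dl ep z) (neumann_cut2 dl ep z) z"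
proof -
 have a: "grad_at (%z. 1 - step (z $ 2 / dl - 1)) 0 (- (step' (z $ 2 / dl - 1) / dl)) z"
  using grad_at_diff[OF grad_at_const grad_at_comp[OF grad_at_nth(2) scaled_step_deriv(1)]] by simp
 have b: "grad_at (%z. 1 - wall_cut dl ep (z $ 1)) (- wall_cut' dl ep (z $ 1)) 0 z"
  using grad_at_diff[OF grad_at_const grad_at_comp[OF grad_at_nth(1) wall_cut_deriv]] by simp
 show ?thesis
  using grad_at_diff[OF grad_at_const[of 1] grad_at_mult[OF a b]]
  unfolding neumann_cut_def[abs_def] neumann_cut1_def neumann_cut2_def by simp
qed

lemma wall_cut_bounds:
 assumes "dl > 0"
 shows "0 <= wall_cut dl ep x" "wall_cut dl ep x <= 1" "\<bar>wall_cut' dl ep x\<bar> <= 3 / dl"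
  "x <= dl \<or> x >= ep - dl ==> wall_cut dl ep x = 0"
  "x >= 2 * dl ==> x <= ep - 2 * dl ==> wall_cut dl ep x = 1"
  "\<not> (dl < x \<and> x < 2 * dl) ==> \<not> (ep - 2 * dl < x \<and> x < ep - dl) ==> wall_cut' dl ep x = 0"
proof -
 let ?x = "x / dl - 1" and ?y = "(ep - x) / dl - 1"
 show "0 <= wall_cut dl ep x" "wall_cut dl ep x <= 1"
  unfolding wall_cut_def by (intro mult_nonneg_nonneg mult_le_one step_bounds)+
 have le: "x <= dl ==> ?x <= 0" "x >= 2 * dl ==> ?x >= 1" "x >= ep - dl ==> ?y <= 0" "x <= ep - 2 * dl ==> ?y >= 1"
  using assms by (auto simp: divide_le_eq le_divide_eq algebra_simps)
 show "x <= dl \<or> x >= ep - dl ==> wall_cut dl ep x = 0" unfolding wall_cut_def using le(1,3) by auto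
 show "x >= 2 * dl ==> x <= ep - 2 * dl ==> wall_cut dl ep x = 1" unfolding wall_cut_def using le(2,4) by auto
 show "wall_cut' dl ep x = 0" if a: "\<not> (dl < x \<and> x < 2 * dl)" and b: "\<not> (ep - 2 * dl < x \<and> x < ep - dl)"
 proof -
  have "step' ?x = 0" using le(1,2) a by (cases "x <= dl") auto
  moreover have "step' ?y = 0" using le(3,4) b by (cases "x >= ep - dl") auto
  ultimately show ?thesis by (simp add: wall_cut'_def)
 qed
 let ?d = "step' ?x * step ?y - step ?x * step' ?y"
 have "\<bar>step' ?x * step ?y\<bar> <= 3/2 * 1" "\<bar>step ?x * step' ?y\<bar> <= 1 * (3/2)"
  unfolding abs_mult using step_bounds by (intro mult_mono; simp)+
 hence d: "\<bar>?d\<bar> <= 3" by linarith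
 have e: "wall_cut' dl ep x = ?d / dl" by (simp add: wall_cut'_def diff_divide_distrib)
 have "\<bar>?d / dl\<bar> = \<bar>?d\<bar> / dl" using assms by (simp only: abs_divide abs_of_pos)
 thus "\<bar>wall_cut' dl ep x\<bar> <= 3 / dl"
  unfolding e using assms d by (simp only: divide_right_mono less_imp_le)
qed

lemma neumann_cut_cont:
 assumes "dl > 0"
 shows "continuous_on S (neumann_cut1 dl ep)" "continuous_on S (neumann_cut2 dl ep)"
 unfolding neumann_cut1_def[abs_def] neumann_cut2_def[abs_def] wall_cut_def wall_cut'_def
 using assms by (intro continuous_intros; simp)+

lemma neumann_cut_bounds:
 assumes dl: "dl > 0"
 shows "0 <= neumann_cut dl ep z" "neumann_cut dl ep z <= 1"
  "\<bar>neumann_cut1 dl ep z\<bar> <= 3 / dl" "\<bar>neumann_cut2 dl ep z\<bar> <= 3 / dl"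
  "z $ 2 <= dl ==> z $ 1 <= dl \<or> z $ 1 >= ep - dl ==> neumann_cut dl ep z = 0"
  "z $ 2 >= 2 * dl \<or> (z $ 1 >= 2 * dl \<and> z $ 1 <= ep - 2 * dl) ==> neumann_cut dl ep z = 1"
  "neumann_cut1 dl ep z ~= 0 ==> z $ 2 < 2 * dl \<and> (dl < z $ 1 \<and> z $ 1 < 2 * dl \<or> ep - 2 * dl < z $ 1 \<and> z $ 1 < ep - dl)"
  "neumann_cut2 dl ep z ~= 0 ==> dl < z $ 2 \<and> z $ 2 < 2 * dl \<and> (z $ 1 < 2 * dl \<or> z $ 1 > ep - 2 * dl)"
proof -
 let ?s = "step (z $ 2 / dl - 1)" and ?w = "wall_cut dl ep (z $ 1)"
 note w = wall_cut_bounds[OF dl, where ep = ep and x = "z $ 1"] and s = step_bounds[of "z $ 2 / dl - 1"]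
 have le: "z $ 2 <= dl ==> z $ 2 / dl - 1 <= 0" "z $ 2 >= 2 * dl ==> z $ 2 / dl - 1 >= 1"
  using dl by (auto simp: divide_le_eq le_divide_eq)
 have "0 <= (1 - ?s) * (1 - ?w)" "(1 - ?s) * (1 - ?w) <= 1"
  using w s by (auto intro!: mult_nonneg_nonneg mult_le_one)
 thus "0 <= neumann_cut dl ep z" "neumann_cut dl ep z <= 1" unfolding neumann_cut_def by linarith+
 have "\<bar>1 - ?s\<bar> * \<bar>wall_cut' dl ep (z $ 1)\<bar> <= 1 * (3 / dl)"
  using w s by (intro mult_mono) auto
 thus "\<bar>neumann_cut1 dl ep z\<bar> <= 3 / dl" by (simp add: neumann_cut1_def abs_mult)
 have "\<bar>step' (z $ 2 / dl - 1) / dl\<bar> * \<bar>1 - ?w\<bar> <= 3 / dl * 1"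
  using w s dl by (intro mult_mono) (auto simp: divide_right_mono)
 thus "\<bar>neumann_cut2 dl ep z\<bar> <= 3 / dl" by (simp add: neumann_cut2_def abs_mult)
 show "z $ 2 <= dl ==> z $ 1 <= dl \<or> z $ 1 >= ep - dl ==> neumann_cut dl ep z = 0"
  using le(1) w(4) by (simp add: neumann_cut_def)
 show "z $ 2 >= 2 * dl \<or> (z $ 1 >= 2 * dl \<and> z $ 1 <= ep - 2 * dl) ==> neumann_cut dl ep z = 1"
  using le(2) w(5) by (auto simp: neumann_cut_def)
 show "z $ 2 < 2 * dl \<and> (dl < z $ 1 \<and> z $ 1 < 2 * dl \<or> ep - 2 * dl < z $ 1 \<and> z $ 1 < ep - dl)"
  if nz: "neumann_cut1 dl ep z ~= 0"
 proof -
  have "?s ~= 1" "wall_cut' dl ep (z $ 1) ~= 0" using nz by (auto simp: neumann_cut1_def)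
  thus ?thesis using le(2) w(6) step_eqs(2) by (metis not_le)
 qed
 show "dl < z $ 2 \<and> z $ 2 < 2 * dl \<and> (z $ 1 < 2 * dl \<or> z $ 1 > ep - 2 * dl)" if nz: "neumann_cut2 dl ep z ~= 0"
 proof -
  have "step' (z $ 2 / dl - 1) ~= 0" "?w ~= 1" using nz by (auto simp: neumann_cut2_def)
  thus ?thesis using le w(5) step_eqs(3,4) by (metis not_le)
 qed
qed

text \<open>Integrand of the Helmholtz form. It is bilinear, as Green's formula is; the conjugate
  enters through the choice of the test function.\<close>

abbreviation form :: "real => ('a => complex) => ('a => complex) => ('a => complex) => ('a => complex) => ('a => complex) => ('a => complex) => 'a => complex" where
 "form kp f f1 f2 ps ps1 ps2 x \<equiv> f1 x * ps1 x + f2 x * ps2 x - of_real (kp^2) * f x * ps x"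

context cavity_solution begin

text \<open>The sup bound \<open>M\<close> is what the cutoff argument consumes: near walls and
  corners smallness comes from grad u and the cutoffs alone. The margin \<open>s\<close> keeps the
  support away from the Dirichlet side and its corners, while the Neumann walls impose no
  condition.\<close>

definition test_fun :: "(real^2 => complex) => (real^2 => complex) => (real^2 => complex) => real => real => real => bool" where
 "test_fun ps ps1 ps2 M R s \<longleftrightarrow>
   (\<forall>x\<in>Om. grad_at ps (ps1 x) (ps2 x) x) \<and> continuous_on Om ps1 \<and> continuous_on Om ps2 \<and>
   (\<forall>x\<in>Om. cmod (ps x) <= M) \<and>
   (\<forall>x\<in>Om. norm x >= R \<or> x $ 2 <= - d + s \<longrightarrow> ps x = 0 \<and> ps1 x = 0 \<and> ps2 x = 0) \<and>
   sint Om (%x. nsq (ps1 x)) \<and> sint Om (%x. nsq (ps2 x))"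

lemma form_integrable:
 assumes t: "test_fun ps ps1 ps2 M R s" and c: "continuous_on Om f" "continuous_on Om f1" "continuous_on Om f2"
  and e: "sint (Om \<inter> ball 0 R) (%x. nsq (f x))" "sint (Om \<inter> ball 0 R) (%x. nsq (f1 x))"
   "sint (Om \<inter> ball 0 R) (%x. nsq (f2 x))"
 shows "sint Om (form kp f f1 f2 ps ps1 ps2)"
proof (rule set_integrable_superset)
 let ?S = "Om \<inter> ball 0 R"
 have S: "open ?S" by (intro open_Int open_sets open_ball)
 have cS: "continuous_on Om f ==> continuous_on ?S f" for f :: "real^2 => complex"
  by (erule continuous_on_subset) auto
 have psc: "continuous_on Om ps"
  using t grad_at_continuous unfolding test_fun_def by (blast intro: continuous_at_imp_continuous_on)
 have sub: "sint Om f ==> sint ?S f" for f :: "real^2 => real"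
  by (erule set_integrable_subset) (use S in auto)
 have "sint ?S (%_. M^2)"
  by (rule set_integrable_const) (use S in \<open>auto intro: bounded_subset[OF bounded_ball]\<close>)
 hence ps2i: "sint ?S (%x. nsq (ps x))"
 proof (rule set_integrable_bound)
  show "set_borel_measurable lborel ?S (%x. nsq (ps x))"
   by (intro set_borel_measurable_open S continuous_intros cS psc)
  show "AE x in lborel. x : ?S \<longrightarrow> norm (nsq (ps x)) <= norm (M^2)"
   using t unfolding test_fun_def by (intro AE_I2 impI) (auto intro!: power_mono)
 qed
 have "sint ?S (%x. f1 x * ps1 x + f2 x * ps2 x - of_real (kp^2) * (f x * ps x))"
  using t unfolding test_fun_def
  by (intro set_integral_diff set_integral_add set_integrable_mult_right set_integrable_sq_prod S cS c psc e ps2i sub) auto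
 thus "sint ?S (form kp f f1 f2 ps ps1 ps2)" by (simp only: mult.assoc)
 show "form kp f f1 f2 ps ps1 ps2 x = 0" if "x : Om" "x \<notin> ?S" for x
 proof -
  have "ps x = 0 \<and> ps1 x = 0 \<and> ps2 x = 0" using t that unfolding test_fun_def by (auto simp: not_less)
  thus ?thesis by simp
 qed
qed simp

lemmas test_integrable = form_integrable[OF _ u_cont(1,2,2) energy(1-3)]

text \<open>Cutoffs at the corners only have bounded Dirichlet energy, but it is concentrated on these boxes, where the energy of u tends to 0.\<close>

definition corner_boxes where
 "corner_boxes si = cbox (pt (- 2 * si) (- 2 * si)) (pt (2 * si) (2 * si)) \<union> cbox (pt (ep - 2 * si) (- 2 * si)) (pt (ep + 2 * si) (2 * si))"

lemma corner_energy_small: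
 assumes si: "si ----> 0"
 shows "(%j. SINT x:Om \<inter> ball 0 R. ind (corner_boxes (si j)) x * (nsq (u1 x) + nsq (u2 x))) ----> 0"
proof -
 have "(%j. SINT x:Om \<inter> ball 0 R. ind (corner_boxes (si j)) x *R (nsq (u1 x) + nsq (u2 x))) ---->
  0 *R (SINT x:Om \<inter> ball 0 R. nsq (u1 x) + nsq (u2 x))"
 proof (rule set_integral_weight_limit)
  show "sint (Om \<inter> ball 0 R) (%x. nsq (u1 x) + nsq (u2 x))" by (intro set_integral_add energy)
  show "\<forall>\<^sub>F j in sequentially. ind (corner_boxes (si j)) x = 0" if "x : Om \<inter> ball 0 R" for x
  proof -
   have x: "\<bar>x $ 2\<bar> > 0 \<or> (\<bar>x $ 1\<bar> > 0 \<and> \<bar>x $ 1 - ep\<bar> > 0)" using that by (auto simp: Om_iff)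
   define m where "m = (if \<bar>x $ 2\<bar> > 0 then \<bar>x $ 2\<bar> else min \<bar>x $ 1\<bar> \<bar>x $ 1 - ep\<bar>)"
   have m: "m / 2 > 0" using x by (auto simp: m_def)
   have "\<forall>\<^sub>F j in sequentially. si j < m / 2" using si m by (rule order_tendstoD)
   thus ?thesis
   proof eventually_elim
    case (elim j)
    have "x \<notin> corner_boxes (si j)"
     using elim unfolding corner_boxes_def in_box Un_iff by (auto simp: m_def split: if_splits)
    thus ?case by simp
   qed
  qed
 qed (auto simp: corner_boxes_def indicator_def)
 thus ?thesis by simp
qed

text \<open>Green's formula for the compactly supported \<open>cu * ps\<close> leaves the integral
  of ps grad u . grad cu. In wall layers of width dl the gradient of the cutoff is normal and at
  most 3 / dl, while the normal derivative of u is below e: size times area gives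
  \<open>6 * e * (R + d)\<close>. At the corners a mean inequality with weight \<open>N\<close>
  separates the energy of u from that of the cutoffs, which contributes 1600 / N.\<close>

lemma weak_cutoff:
 assumes t: "test_fun ps ps1 ps2 M R s" and pos: "0 < s" "0 <= M" "0 < R" "0 < si" "0 < e" "0 < N"
 shows "\<exists>cu. continuous_on UNIV cu \<and> (\<forall>z. \<bar>cu z\<bar> <= 1) \<and>
  (\<forall>z. 2 * si <= z $ 2 \<or> (2 * si <= z $ 1 \<and> z $ 1 <= ep - 2 * si) \<longrightarrow> cu z = 1) \<and>
  cmod (SINT x:Om. cu x *R form kp u u1 u2 ps ps1 ps2 x) <=
   M * (6 * e * (R + d) + N * (SINT x:Om \<inter> ball 0 R. ind (corner_boxes si) x * (nsq (u1 x) + nsq (u2 x))) + 1600 / N)"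
proof -
 obtain r1 where r1: "r1 > 0" "!!z. 0 < z $ 2 ==> z $ 2 < r1 ==> z $ 1 : {- R..- (si/2)} \<union> {ep + si/2..R} ==> cmod (u2 z) < e"
  using neumann_top_uniform[of e "si/2" R] pos by auto
 define s' where "s' = min s (si/2)"
 obtain r2 where r2: "r2 > 0" "!!z. z : Om ==> z $ 2 : {- d + s'..- s'} ==> z $ 1 < r2 \<or> z $ 1 > ep - r2 ==> cmod (u1 z) < e"
  using neumann_walls_uniform[of e s'] pos by (auto simp: s'_def)
 \<comment> \<open>Chosen last, because r1 and r2 depend on e and on the distance si / 2 from the
   corners. With 8 dl <= si a point of a wall layer outside the corner discs is far from the corners
   along the wall.\<close>
 define dl where "dl = Min {r1/2, r2/2, si/8, ep/8}"
 have dl: "dl > 0" "2 * dl <= r1" "2 * dl <= r2" "8 * dl <= si" "8 * dl <= ep"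
  using r1(1) r2(1) pos eps by (auto simp: dl_def min_def)
 let ?a = "corner_cut si 0" and ?b = "corner_cut si ep" and ?n = "neumann_cut dl ep"
 let ?a1 = "corner_cut1 si 0" and ?b1 = "corner_cut1 si ep" and ?n1 = "neumann_cut1 dl ep"
 let ?a2 = "corner_cut2 si 0" and ?b2 = "corner_cut2 si ep" and ?n2 = "neumann_cut2 dl ep"
 note a = corner_cut_bounds[OF pos(4), where a = 0] and b = corner_cut_bounds[OF pos(4), where a = ep] and n = neumann_cut_bounds[OF dl(1), where ep = ep]
 define cu where "cu z = ?a z * ?b z * ?n z" for z
 define cu1 where "cu1 z = ?a z * ?b z * ?n1 z + (?a z * ?b1 z + ?a1 z * ?b z) * ?n z" for z
 define cu2 where "cu2 z = ?a z * ?b z * ?n2 z + (?a z * ?b2 z + ?a2 z * ?b z) * ?n z" for z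
 have cug: "grad_at cu (cu1 z) (cu2 z) z" for z
  unfolding cu_def[abs_def] cu1_def cu2_def
  by (rule grad_at_mult[OF grad_at_mult[OF corner_cut_grad[OF pos(4)] corner_cut_grad[OF pos(4)]] neumann_cut_grad])
 have nc: "continuous_on S ?n" for S
  using grad_at_continuous[OF neumann_cut_grad] by (blast intro: continuous_at_imp_continuous_on)
 have cuc: "continuous_on S cu" "continuous_on S cu1" "continuous_on S cu2" for S
  unfolding cu_def[abs_def] cu1_def[abs_def] cu2_def[abs_def]
  by (intro continuous_intros corner_cut_cont neumann_cut_cont nc pos dl)+
 let ?B0 = "cbox (pt (- 2 * si) (- 2 * si)) (pt (2 * si) (2 * si)) :: (real^2) set"
 let ?B1 = "cbox (pt (ep - 2 * si) (- 2 * si)) (pt (ep + 2 * si) (2 * si)) :: (real^2) set"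
 let ?T = "cbox (pt (- R) dl) (pt R (2 * dl)) :: (real^2) set"
 let ?W0 = "cbox (pt dl (- d)) (pt (2 * dl) 0) :: (real^2) set"
 let ?W1 = "cbox (pt (ep - 2 * dl) (- d)) (pt (ep - dl) 0) :: (real^2) set"
 let ?S = "Om \<inter> ball 0 R"
 let ?E = "form kp u u1 u2 ps ps1 ps2"
 let ?D = "%x. ps x * (u1 x * of_real (cu1 x) + u2 x * of_real (cu2 x))"
 have psg: "x : Om ==> grad_at ps (ps1 x) (ps2 x) x" and psc: "continuous_on Om ps1" "continuous_on Om ps2"
  and psM: "x : Om ==> cmod (ps x) <= M"
  and psz: "x : Om ==> norm x >= R \<or> x $ 2 <= - d + s ==> ps x = 0 \<and> ps1 x = 0 \<and> ps2 x = 0" for x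
  using t unfolding test_fun_def by blast+
 have ps0: "continuous_on Om ps"
  using psg grad_at_continuous by (blast intro: continuous_at_imp_continuous_on)
 \<comment> \<open>Contains the support of \<open>cu * ps\<close>: the last factor keeps it off the
   Neumann walls, the second off the bottom.\<close>
 define K where "K = cball 0 R \<inter> {z :: real^2. - d + s <= z $ 2} \<inter> ({z. dl <= z $ 2} \<union> ({z. dl <= z $ 1} \<inter> {z. z $ 1 <= ep - dl}))"
 have K: "compact K" unfolding K_def
  by (intro compact_Int_closed closed_Int closed_Un closed_Collect_le continuous_intros compact_cball)
 have KO: "K \<subseteq> Om" using dl pos by (auto simp: K_def Om_iff)
 have z: "cu x = 0 \<and> cu1 x = 0 \<and> cu2 x = 0" if "x $ 2 < dl" "x $ 1 < dl \<or> x $ 1 > ep - dl" for x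
 proof -
  have "?n x = 0" by (rule n(5)) (use that in auto)
  moreover have "?n1 x = 0"
   using that dl n(7)[where z = x] by (rule_tac ccontr) auto
  moreover have "?n2 x = 0" using that n(8)[where z = x] by (rule_tac ccontr) auto
  ultimately show ?thesis by (simp add: cu_def cu1_def cu2_def)
 qed
 have gcu: "grad_at (%x. complex_of_real (cu x)) (of_real (cu1 x)) (of_real (cu2 x)) x" for x
  by (rule grad_at_linear[OF bounded_linear_of_real cug])
 have green: "sint Om (%x. u1 x * (ps x * of_real (cu1 x) + ps1 x * of_real (cu x)) + u2 x * (ps x * of_real (cu2 x) + ps2 x * of_real (cu x)) +
   (partial 1 u1 x + partial 2 u2 x) * (ps x * of_real (cu x)))" (is "set_integrable _ _ ?F")
  "(SINT x:Om. u1 x * (ps x * of_real (cu1 x) + ps1 x * of_real (cu x)) + u2 x * (ps x * of_real (cu2 x) + ps2 x * of_real (cu x)) +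
   (partial 1 u1 x + partial 2 u2 x) * (ps x * of_real (cu x))) = 0"
 proof -
  have c: "continuous_on Om (%x. ps x * of_real (cu1 x) + ps1 x * of_real (cu x))" "continuous_on Om (%x. ps x * of_real (cu2 x) + ps2 x * of_real (cu x))"
   by (intro continuous_intros cuc psc ps0)+
  have zz: "ps x * of_real (cu x) = 0 \<and> ps x * of_real (cu1 x) + ps1 x * of_real (cu x) = 0 \<and> ps x * of_real (cu2 x) + ps2 x * of_real (cu x) = 0"
   if "x : Om" "x \<notin> K" for x
  proof (cases "norm x >= R \<or> x $ 2 <= - d + s")
   case True
   thus ?thesis using psz[OF that(1)] by simp
  next
   case False
   hence "x $ 2 < dl" "x $ 1 < dl \<or> x $ 1 > ep - dl" using that(2) by (auto simp: K_def)
   thus ?thesis using z by simp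
  qed
  note G = green_compact[OF open_sets(1) K KO u_grad(2)[of _ 1] u_grad(2)[of _ 2] u_cont(3) u_cont(3) grad_at_mult[OF psg gcu] c zz]
  show "sint Om ?F" by (rule G(1))
  show "(SINT x:Om. ?F x) = 0" by (rule G(2))
 qed
 have cub: "0 <= cu x" "cu x <= 1" for x
  using a[where z = x] b[where z = x] n[where z = x] by (auto simp: cu_def intro!: mult_le_one)
 have Ei: "sint Om (%x. cu x *R ?E x)"
  by (rule set_integral_weight[OF test_integrable[OF t] borel_measurable_continuous_onI[OF cuc(1)], where B = 1]) (use cub in auto)
 have FE: "?F x = cu x *R ?E x + ?D x" if "x : Om" for x
  unfolding helmholtz[OF that] by (simp add: scaleR_conv_of_real algebra_simps)
 have Di: "sint Om ?D"
  by (rule set_integrable_eq[OF set_integral_diff(1)[OF green(1) Ei]]) (simp add: FE)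
 have eq: "(SINT x:Om. cu x *R ?E x) = - (SINT x:Om. ?D x)"
 proof -
  have "(SINT x:Om. ?F x) = (SINT x:Om. cu x *R ?E x + ?D x)" by (rule set_integral_eq) (rule FE)
  thus ?thesis using green(2) set_integral_add(2)[OF Ei Di] by (simp add: eq_neg_iff_add_eq_0)
 qed
 \<comment> \<open>A majorant of |grad u . grad cu| on the support of \<open>ps\<close>: the three
   wall layers, the energy of u on the corner boxes, and the squared slopes of the corner
   cutoffs.\<close>
 define h where "h x = 3 * e / dl * (ind ?T x + ind ?W0 x + ind ?W1 x) +
   N * (ind ?S x *R (ind (corner_boxes si) x * (nsq (u1 x) + nsq (u2 x)))) + 50 / (N * si^2) * (ind ?B0 x + ind ?B1 x)" for x
 have BB: "corner_boxes si = ?B0 \<union> ?B1" by (simp add: corner_boxes_def)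
 have SB: "?S \<inter> corner_boxes si : sets lborel" using open_sets by (auto simp: BB)
 have "sint ?S (%x. nsq (u1 x) + nsq (u2 x))" by (intro set_integral_add energy)
 from set_integrable_subset[OF this SB Int_lower1]
 have Si: "integrable lborel (%x. ind ?S x *R (ind (corner_boxes si) x * (nsq (u1 x) + nsq (u2 x))))"
  by (simp add: sint_def indicator_inter_arith mult.assoc)
 have Bi: "integrable lborel (indicat_real (cbox p q))" for p q :: "real^2"
  by (intro integrable_real_indicator emeasure_lborel_cbox_finite) simp
 have hi: "integrable lborel h" unfolding h_def by (intro Bochner_Integration.integrable_add integrable_mult_right Bi Si)
 have hI: "(LINT x|lborel. h x) = 3 * e / dl * (2 * R * dl + 2 * (dl * d)) + N * (SINT x:?S. ind (corner_boxes si) x * (nsq (u1 x) + nsq (u2 x))) + 50 / (N * si^2) * (32 * si^2)"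
 proof -
  have m: "measure lborel ?T = 2 * R * dl" "measure lborel ?W0 = dl * d" "measure lborel ?W1 = dl * d"
   "measure lborel ?B0 = 16 * si^2" "measure lborel ?B1 = 16 * si^2"
   by (subst box_area; use pos dl d in \<open>simp add: power2_eq_square\<close>)+
  have gen: "(LINT x|lborel. c * (f1 x + f2 x + f3 x) + c' * f x + c'' * (g1 x + g2 x)) =
    c * (integral\<^sup>L lborel f1 + integral\<^sup>L lborel f2 + integral\<^sup>L lborel f3) + c' * integral\<^sup>L lborel f + c'' * (integral\<^sup>L lborel g1 + integral\<^sup>L lborel g2)"
   if "integrable lborel f1" "integrable lborel f2" "integrable lborel f3" "integrable lborel f" "integrable lborel g1" "integrable lborel g2"
   for c c' c'' :: real and f1 f2 f3 f g1 g2 :: "real^2 => real"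
   by (simp add: that)
  have il: "integral\<^sup>L lborel (indicat_real (cbox p q)) = measure lborel (cbox p q)" for p q :: "real^2" by simp
  have "integral\<^sup>L lborel h = 3 * e / dl * (2 * R * dl + dl * d + dl * d) + N * (SINT x:?S. ind (corner_boxes si) x * (nsq (u1 x) + nsq (u2 x))) + 50 / (N * si^2) * (16 * si^2 + 16 * si^2)"
   unfolding h_def[abs_def] gen[OF Bi Bi Bi Si Bi Bi] int_def il m by (rule refl)
  thus ?thesis by (simp only: add.assoc mult_2[symmetric])
 qed
 have Dh: "cmod (ind Om x *R ?D x) <= M * h x" for x
 proof (cases "x : Om \<and> ps x ~= 0")
  case False
  have "0 <= h x" unfolding h_def using pos dl by (intro add_nonneg_nonneg mult_nonneg_nonneg scaleR_nonneg_nonneg) auto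
  thus ?thesis using False pos by (auto simp: indicator_def)
 next
  case True
  hence x: "x : Om" "norm x < R" "- d + s < x $ 2" using psz[of x] by (auto simp: not_le[symmetric])
  have xR: "\<bar>x $ 1\<bar> < R" using component_le_norm_cart[of x 1] x(2) by simp
  have ab: "0 <= ?a x * ?b x" "?a x * ?b x <= 1" using a[where z = x] b[where z = x] by (auto intro!: mult_le_one)
  \<comment> \<open>Outside the disc of radius si at least one coordinate offset exceeds si / 2,
    which is the distance for which r1 and r2 were chosen.\<close>
  have far: "\<bar>x $ 1 - c\<bar> > si/2 \<or> \<bar>x $ 2\<bar> > si/2" if "corner_cut si c x ~= 0" for c
  proof (rule ccontr)
   assume "\<not> ?thesis"
   hence "\<bar>x $ 1 - c\<bar>^2 <= (si/2)^2" "\<bar>x $ 2\<bar>^2 <= (si/2)^2" by (intro power_mono; simp)+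
   hence "(x $ 1 - c)^2 + (x $ 2)^2 <= si^2" by (simp add: power_divide) (use zero_le_power2[of si] in linarith)
   from corner_cut_bounds(5)[OF pos(4) this] that show False by simp
  qed
  have edl: "0 <= 3 * e / dl" using pos dl by simp
  have edge: "cmod (v * of_real (?a x * ?b x * m)) <= 3 * e / dl * I"
   if m: "\<bar>m\<bar> <= 3 / dl" "0 <= I" and nz: "?a x ~= 0 ==> ?b x ~= 0 ==> m ~= 0 ==> cmod v < e \<and> 1 <= I" for v m I
  proof (cases "?a x = 0 \<or> ?b x = 0 \<or> m = 0")
   case True
   thus ?thesis using mult_nonneg_nonneg[OF edl m(2)] by auto
  next
   case False
   hence v: "cmod v < e" "1 <= I" using nz by auto
   have "cmod v * (\<bar>?a x * ?b x\<bar> * \<bar>m\<bar>) <= e * (1 * (3 / dl))" using ab m v pos dl by (intro mult_mono) auto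
   also have "... = 3 * e / dl * 1" by simp
   also have "... <= 3 * e / dl * I" by (rule mult_left_mono[OF v(2) edl])
   finally show ?thesis unfolding norm_mult[of v] norm_of_real abs_mult[of "?a x * ?b x"] .
  qed
  have n1: "cmod (u1 x * of_real (?a x * ?b x * ?n1 x)) <= 3 * e / dl * (ind ?W0 x + ind ?W1 x)"
  proof (rule edge)
   assume nz: "?a x ~= 0" "?b x ~= 0" "?n1 x ~= 0"
   have q: "x $ 2 < 2 * dl" "dl < x $ 1 \<and> x $ 1 < 2 * dl \<or> ep - 2 * dl < x $ 1 \<and> x $ 1 < ep - dl"
    using n(7)[OF nz(3)] by auto
   have q2: "x $ 2 < - si/2" using far[OF nz(1)] far[OF nz(2)] q dl pos by auto
   have "cmod (u1 x) < e" by (rule r2(2)[OF x(1)]) (use q q2 x dl in \<open>auto simp: s'_def\<close>)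
   moreover have "x : ?W0 \<or> x : ?W1" unfolding in_box using q q2 x pos by auto
   hence "1 <= indicat_real ?W0 x + indicat_real ?W1 x" by (elim disjE) simp_all
   ultimately show "cmod (u1 x) < e \<and> 1 <= indicat_real ?W0 x + indicat_real ?W1 x" by blast
  qed (use n(3)[where z = x] in auto)
  have n2: "cmod (u2 x * of_real (?a x * ?b x * ?n2 x)) <= 3 * e / dl * ind ?T x"
  proof (rule edge)
   assume nz: "?a x ~= 0" "?b x ~= 0" "?n2 x ~= 0"
   have q: "dl < x $ 2" "x $ 2 < 2 * dl" "x $ 1 < 2 * dl \<or> x $ 1 > ep - 2 * dl"
    using n(8)[OF nz(3)] by auto
   have q2: "x $ 1 <= - si/2 \<or> x $ 1 >= ep + si/2" using far[OF nz(1)] far[OF nz(2)] q dl pos(4) by (auto simp: abs_if split: if_splits)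
   have "cmod (u2 x) < e" by (rule r1(2)) (use q q2 x xR dl in auto)
   moreover have "x : ?T" unfolding in_box using q x xR by auto
   ultimately show "cmod (u2 x) < e \<and> 1 <= indicat_real ?T x" by simp
  qed (use n(4)[where z = x] in auto)
  \<comment> \<open>A slope of at most 10 / si is split off |v| by the mean inequality. The
    remainder 25 / (N si^2), integrated over boxes of area 16 si^2, is a constant over N whatever si
    is.\<close>
  have corner: "cmod (v * of_real ((?a x * g1 + g0 * ?b x) * ?n x)) <= N * (ind (corner_boxes si) x * nsq v) + 25 / (N * si^2) * (ind ?B0 x + ind ?B1 x)"
   if g: "\<bar>g0\<bar> <= 5 / si * ind ?B0 x" "\<bar>g1\<bar> <= 5 / si * ind ?B1 x" for v g0 g1
  proof (cases "x : ?B0 \<union> ?B1")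
   case False
   hence "g0 = 0" "g1 = 0" using g by auto
   thus ?thesis using False by (simp add: BB)
  next
   case True
   have i1: "5 / si * indicat_real B x <= 5 / si" for B
    using pos by (intro mult_left_le) auto
   have "\<bar>?a x * g1\<bar> <= 1 * (5 / si)" unfolding abs_mult
    by (rule mult_mono[OF _ order_trans[OF g(2) i1]]) (use a(1,2)[where z = x] pos in simp_all)
   moreover have "\<bar>g0 * ?b x\<bar> <= (5 / si) * 1" unfolding abs_mult
    by (rule mult_mono[OF order_trans[OF g(1) i1]]) (use b(1,2)[where z = x] pos in simp_all)
   ultimately have "\<bar>?a x * g1 + g0 * ?b x\<bar> <= 10 / si" by simp
   hence "\<bar>(?a x * g1 + g0 * ?b x) * ?n x\<bar> <= 10 / si * 1"
    unfolding abs_mult using n(1,2)[where z = x] pos by (intro mult_mono) auto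
   hence "cmod v * \<bar>(?a x * g1 + g0 * ?b x) * ?n x\<bar> <= cmod v * (10 / si)"
    by (intro mult_left_mono) auto
   also have "... <= N * nsq v + 25 / (N * si^2)"
   proof -
    have "0 <= (N * si * cmod v - 5)^2 / (N * si^2)" using pos by (intro divide_nonneg_pos) auto
    also have "... = N * nsq v + 25 / (N * si^2) - cmod v * (10 / si)"
     using pos by (simp add: power2_eq_square field_simps)
    finally show ?thesis by simp
   qed
   finally have 1: "cmod (v * of_real ((?a x * g1 + g0 * ?b x) * ?n x)) <= N * nsq v + 25 / (N * si^2)"
    by (simp only: norm_mult norm_of_real)
   have "1 <= indicat_real ?B0 x + indicat_real ?B1 x" using True unfolding Un_iff by (elim disjE) simp_all
   from mult_left_mono[OF this, of "25 / (N * si^2)"]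
   have "25 / (N * si^2) <= 25 / (N * si^2) * (indicat_real ?B0 x + indicat_real ?B1 x)" using pos by simp
   moreover have "indicat_real (corner_boxes si) x = 1" using True by (simp add: BB)
   ultimately show ?thesis using 1 by (simp only: mult_1)
  qed
  have a1: "\<bar>?a1 x\<bar> <= 5 / si * ind ?B0 x" "\<bar>?a2 x\<bar> <= 5 / si * ind ?B0 x" using a(3,4)[where z = x] by simp_all
  note c1 = corner[OF a1(1) b(3), of "u1 x"] and c2 = corner[OF a1(2) b(4), of "u2 x"]
  let ?t1 = "u1 x * of_real (?a x * ?b x * ?n1 x)" and ?t2 = "u2 x * of_real (?a x * ?b x * ?n2 x)"
  let ?t3 = "u1 x * of_real ((?a x * ?b1 x + ?a1 x * ?b x) * ?n x)" and ?t4 = "u2 x * of_real ((?a x * ?b2 x + ?a2 x * ?b x) * ?n x)"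
  have sp: "u1 x * of_real (cu1 x) + u2 x * of_real (cu2 x) = (?t1 + ?t2) + (?t3 + ?t4)"
   unfolding cu1_def cu2_def of_real_add by (simp only: distrib_left add_ac)
  have "cmod (u1 x * of_real (cu1 x) + u2 x * of_real (cu2 x)) <= (cmod ?t1 + cmod ?t2) + (cmod ?t3 + cmod ?t4)"
   unfolding sp by (intro norm_triangle_le add_mono norm_triangle_ineq)
  also have "... <= h x"
  proof -
   have S1: "indicat_real ?S x = 1" using x by simp
   have gen: "(t1 + t2) + (t3 + t4) <= p * (T + W0 + W1) + N * (1 *R (B * (A1 + A2))) + 50 / q * BB"
    if "t1 <= p * (W0 + W1)" "t2 <= p * T" "t3 <= N * (B * A1) + 25 / q * BB" "t4 <= N * (B * A2) + 25 / q * BB"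
    for t1 t2 t3 t4 p T W0 W1 B A1 A2 BB q :: real
   proof -
    have "50 / q * BB = 25 / q * BB + 25 / q * BB" by simp
    thus ?thesis using add_mono[OF add_mono[OF that(1,2)] add_mono[OF that(3,4)]] by (simp only: scaleR_one distrib_left add_ac)
   qed
   show ?thesis unfolding h_def S1 by (rule gen[OF n1 n2 c1 c2])
  qed
  finally have 2: "cmod (u1 x * of_real (cu1 x) + u2 x * of_real (cu2 x)) <= h x" .
  have "cmod (ps x) * cmod (u1 x * of_real (cu1 x) + u2 x * of_real (cu2 x)) <= M * h x"
   by (intro mult_mono 2 psM x pos norm_ge_zero)
  thus ?thesis using x by (simp only: norm_mult indicator_simps scaleR_one)
 qed
 have "cmod (SINT x:Om. ?D x) <= (LINT x|lborel. M * h x)"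
  unfolding int_def
  by (rule Bochner_Integration.integral_norm_bound_integral[OF Di[unfolded sint_def] integrable_mult_right[OF hi] Dh])
 hence "cmod (SINT x:Om. cu x *R ?E x) <= M * (LINT x|lborel. h x)"
  unfolding eq norm_minus_cancel by simp
 moreover have "3 * e / dl * (2 * R * dl + 2 * (dl * d)) = 6 * e * (R + d)" "50 / (N * si^2) * (32 * si^2) = 1600 / N"
  using dl pos by (simp_all add: field_simps)
 ultimately have fin: "cmod (SINT x:Om. cu x *R ?E x) <= M * (6 * e * (R + d) +
   N * (SINT x:?S. ind (corner_boxes si) x * (nsq (u1 x) + nsq (u2 x))) + 1600 / N)"
  unfolding hI by simp
 have one: "cu z = 1" if zz: "2 * si <= z $ 2 \<or> (2 * si <= z $ 1 \<and> z $ 1 <= ep - 2 * si)" for z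
 proof -
  have sq: "2 * si^2 <= w^2" if "2 * si <= \<bar>w\<bar>" for w :: real
  proof -
   have "(2 * si)^2 <= \<bar>w\<bar>^2" using that pos by (intro power_mono) auto
   moreover have "(2 * si)^2 = 4 * si^2" by (simp add: power_mult_distrib)
   ultimately show ?thesis using zero_le_power2[of si] unfolding power2_abs by linarith
  qed
  have sq2: "2 * si^2 <= w^2 + v^2" if "2 * si <= \<bar>w\<bar> \<or> 2 * si <= \<bar>v\<bar>" for w v :: real
   using that sq[of w] sq[of v] zero_le_power2[of w] zero_le_power2[of v] by linarith
  have "?a z = 1" by (rule a(6)[OF sq2]) (use zz in auto)
  moreover have "?b z = 1" by (rule b(6)[OF sq2]) (use zz in auto)
  moreover have "?n z = 1" by (rule n(6)) (use zz dl pos in auto)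
  ultimately show ?thesis by (simp add: cu_def)
 qed
 have "\<bar>cu z\<bar> <= 1" for z using cub[of z] by simp
 thus ?thesis by (intro exI[of _ cu] conjI allI impI cuc one fin)
qed

text \<open>For fixed \<open>N\<close> first let si and e tend to 0, which removes the wall terms
  and the energy of u at the corners; then \<open>N\<close> to infinity removes 1600 / N. The order
  matters because the corner energy tends to 0 without a rate.\<close>

theorem weak_form:
 assumes t: "test_fun ps ps1 ps2 M R s" and pos: "0 < s" "0 <= M" "0 < R"
 shows "(SINT x:Om. form kp u u1 u2 ps ps1 ps2 x) = 0"
proof -
 let ?E = "form kp u u1 u2 ps ps1 ps2"
 let ?I = "SINT x:Om. ?E x"
 define si where "si j = inverse (real (Suc j))" for j
 have si: "0 < si j" "si ----> 0" for j
  unfolding si_def[abs_def] using LIMSEQ_inverse_real_of_nat by auto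
 have main: "cmod ?I <= M * (6 * 0 * (R + d) + N * 0 + 1600 / N)" if N: "N > 0" for N
 proof -
  let ?c = "%j. SINT x:Om \<inter> ball 0 R. ind (corner_boxes (si j)) x * (nsq (u1 x) + nsq (u2 x))"
  from choice[OF allI[OF weak_cutoff[OF t pos, where si = "si j" and e = "si j" for j, OF si(1) si(1) N]]]
  obtain cu where w: "\<forall>j. continuous_on UNIV (cu j) \<and> (\<forall>z. \<bar>cu j z\<bar> <= 1) \<and>
   (\<forall>z. 2 * si j <= z $ 2 \<or> (2 * si j <= z $ 1 \<and> z $ 1 <= ep - 2 * si j) \<longrightarrow> cu j z = 1) \<and>
   cmod (SINT x:Om. cu j x *R ?E x) <= M * (6 * si j * (R + d) + N * ?c j + 1600 / N)" ..
  note cu = w[THEN spec, THEN conjunct1] w[THEN spec, THEN conjunct2, THEN conjunct1, THEN spec]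
   w[THEN spec, THEN conjunct2, THEN conjunct2, THEN conjunct1, THEN spec, THEN mp] w[THEN spec, THEN conjunct2, THEN conjunct2, THEN conjunct2]
  have "(%j. SINT x:Om. cu j x *R ?E x) ----> 1 *R ?I"
  proof (rule set_integral_weight_limit[OF test_integrable[OF t] borel_measurable_continuous_onI[OF cu(1)] cu(2)])
   fix x assume x: "x : Om"
   define m where "m = (if x $ 2 > 0 then x $ 2 else min (x $ 1) (ep - x $ 1))"
   have "m / 2 > 0" using x by (auto simp: m_def Om_iff)
   hence "\<forall>\<^sub>F j in sequentially. si j < m / 2" using si(2) by (intro order_tendstoD)
   thus "\<forall>\<^sub>F j in sequentially. cu j x = 1"
    by eventually_elim (rule cu(3), auto simp: m_def split: if_splits)
  qed
  hence l: "(%j. cmod (SINT x:Om. cu j x *R ?E x)) ----> cmod ?I" using tendsto_norm by fastforce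
  have "(%j. M * (6 * si j * (R + d) + N * ?c j + 1600 / N)) ----> M * (6 * 0 * (R + d) + N * 0 + 1600 / N)"
   by (intro tendsto_intros si(2) corner_energy_small)
  from LIMSEQ_le[OF l this] cu(4) show ?thesis by blast
 qed
 have "cmod ?I <= 0 + e" if "e > 0" for e
 proof -
  have "M * (1600 / ((1600 * M + 1) / e)) = 1600 * M / (1600 * M + 1) * e" using pos that by simp
  also have "... <= 1 * e" using pos that by (intro mult_right_mono) (auto simp: divide_le_eq)
  finally show ?thesis using main[of "(1600 * M + 1) / e"] pos that by simp
 qed
 thus ?thesis using field_le_epsilon[of "cmod ?I" 0] by simp
qed

end

section \<open>Increments along segments and the Poincare inequality\<close>

lemma in_open_box: "z : box (pt a b) (pt c e) \<longleftrightarrow> a < z $ 1 \<and> z $ 1 < c \<and> b < z $ 2 \<and> z $ 2 < e"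
 by (auto simp: mem_box_cart forall_2)

lemma box_pt_iff:
 fixes g :: "real^2 => 'b::{banach, second_countable_topology}"
 assumes "set_borel_measurable lborel (box (pt a c) (pt b e)) g"
 shows "sint (box (pt a c) (pt b e)) g \<longleftrightarrow> sint ({a<..<b} \<times> {c<..<e}) (%(x, y). g (pt x y))"
  and "(SINT z:box (pt a c) (pt b e). g z) = (SINT z:{a<..<b} \<times> {c<..<e}. (case z of (x, y) => g (pt x y)))"
proof -
 have m: "(%z. ind (box (pt a c) (pt b e)) z *R g z) : borel_measurable borel"
  using assms by (simp add: set_borel_measurable_def)
 have e: "(%(x, y). ind (box (pt a c) (pt b e)) (pt x y) *R g (pt x y)) =
   (%z. ind ({a<..<b} \<times> {c<..<e}) z *R (case z of (x, y) => g (pt x y)))"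
  by (auto simp: fun_eq_iff indicator_def in_open_box)
 show "sint (box (pt a c) (pt b e)) g \<longleftrightarrow> sint ({a<..<b} \<times> {c<..<e}) (%(x, y). g (pt x y))"
  unfolding sint_def integrable_pt_iff[OF m] e by (rule refl)
 show "(SINT z:box (pt a c) (pt b e). g z) = (SINT z:{a<..<b} \<times> {c<..<e}. (case z of (x, y) => g (pt x y)))"
  unfolding int_def integral_pt[OF m] e by (rule refl)
qed

text \<open>The Cauchy-Schwarz inequality, obtained from the nonnegative variance of |f'| about its
  mean \<open>m\<close>.\<close>

lemma sq_increment_cont:
 fixes f f' :: "real => complex"
 assumes f: "!!s. s : {x..y} ==> (f has_vector_derivative f' s) (at s)" and c: "continuous_on {x..y} f'" and xy: "x <= y"
 shows "nsq (f y - f x) <= (y - x) * integral {x..y} (%s. nsq (f' s))"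
proof (cases "x = y")
 case False
 hence L: "y - x > 0" using xy by simp
 have "(f' has_integral (f y - f x)) {x..y}"
  by (intro fundamental_theorem_of_calculus xy has_vector_derivative_at_within[OF f])
 hence "f y - f x = integral {x..y} f'" by (simp add: integral_unique)
 hence 1: "cmod (f y - f x) <= integral {x..y} (%s. cmod (f' s))"
  by (simp only:) (intro integral_norm_bound_integral integrable_continuous_interval continuous_intros c order_refl)
 define A where "A = integral {x..y} (%s. cmod (f' s))"
 define B where "B = integral {x..y} (%s. nsq (f' s))"
 define m where "m = A / (y - x)"
 have i: "(%s. cmod (f' s)) integrable_on {x..y}" "(%s. nsq (f' s)) integrable_on {x..y}"
  by (intro integrable_continuous_interval continuous_intros c)+
 have "0 <= integral {x..y} (%s. nsq (f' s) - 2 * m * cmod (f' s) + m^2)"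
 proof (rule integral_nonneg)
  show "(%s. nsq (f' s) - 2 * m * cmod (f' s) + m^2) integrable_on {x..y}"
   by (intro integrable_continuous_interval continuous_intros c)
  show "0 <= nsq (f' s) - 2 * m * cmod (f' s) + m^2" for s
   using zero_le_power2[of "cmod (f' s) - m"] by (simp add: power2_diff algebra_simps)
 qed
 also have "... = B - 2 * m * A + m^2 * (y - x)"
  unfolding A_def B_def using xy
  by (subst Henstock_Kurzweil_Integration.integral_add Henstock_Kurzweil_Integration.integral_diff;
    (intro integrable_continuous_interval continuous_intros c | subst Henstock_Kurzweil_Integration.integral_diff;
    (intro integrable_continuous_interval continuous_intros c | simp)))
 also have "... = B - A^2 / (y - x)" proof -
  have "B - 2 * (A / l) * A + (A / l)^2 * l = B - A^2 / l" if "l > 0" for l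
   using that by (simp add: power2_eq_square field_simps)
  thus ?thesis unfolding m_def using L by blast
 qed
 finally have "A^2 <= (y - x) * B" using L by (simp add: divide_le_eq mult.commute)
 moreover have "nsq (f y - f x) <= A^2" using 1 unfolding A_def by (intro power_mono) auto
 ultimately show ?thesis unfolding B_def by linarith
qed simp

lemma sq_increment:
 fixes f f' :: "real => complex"
 assumes f: "!!s. s : S ==> (f has_vector_derivative f' s) (at s)" and c: "continuous_on S f'" and xy: "x <= y" "{x..y} \<subseteq> S"
  and i: "sint S (%s. nsq (f' s))"
 shows "nsq (f y - f x) <= (y - x) * (SINT s:S. nsq (f' s))"
proof -
 have c': "continuous_on {x..y} f'" by (rule continuous_on_subset[OF c xy(2)])
 have i': "sint {x..y} (%s. nsq (f' s))"
  by (rule borel_integrable_atLeastAtMost') (intro continuous_intros c')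
 have "integral {x..y} (%s. nsq (f' s)) = (SINT s:{x..y}. nsq (f' s))"
  by (rule set_borel_integral_eq_integral(2)[OF i', symmetric])
 also have "... <= (SINT s:S. nsq (f' s))"
  unfolding int_def
  by (rule integral_mono[OF i'[unfolded sint_def] i[unfolded sint_def]])
   (use xy(2) in \<open>auto simp: indicator_def\<close>)
 finally have "integral {x..y} (%s. nsq (f' s)) <= (SINT s:S. nsq (f' s))" .
 from mult_left_mono[OF this, of "y - x"] sq_increment_cont[OF f c' xy(1)] xy show ?thesis by fastforce
qed

text \<open>The boundary value is a one-sided limit on each vertical line separately, so the
  increment is bounded from an interior point \<open>s\<close> and \<open>s\<close> is sent to
  \<open>c\<close>. Vertical lines of infinite energy form a null set by Fubini.\<close>

lemma poincare:
 fixes f f1 f2 :: "real^2 => complex"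
 assumes h: "0 < h" and g: "!!z. z : box (pt a c) (pt b (c + h)) ==> grad_at f (f1 z) (f2 z) z"
  and c2: "continuous_on (box (pt a c) (pt b (c + h))) f2"
  and i: "sint (box (pt a c) (pt b (c + h))) (%z. nsq (f z))"
  and i2: "sint (box (pt a c) (pt b (c + h))) (%z. nsq (f2 z))"
  and lim: "!!x. a < x ==> x < b ==> ((%y. f (pt x y)) \<longlongrightarrow> 0) (at_right c)"
 shows "(SINT z:box (pt a c) (pt b (c + h)). nsq (f z)) <= h^2 * (SINT z:box (pt a c) (pt b (c + h)). nsq (f2 z))"
proof -
 let ?B = "box (pt a c) (pt b (c + h))" and ?X = "{a<..<b}" and ?Y = "{c<..<c + h}"
 have cf: "continuous_on ?B f"
  using g grad_at_continuous by (blast intro: continuous_at_imp_continuous_on)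
 have m: "set_borel_measurable lborel ?B (%z. nsq (f z))" "set_borel_measurable lborel ?B (%z. nsq (f2 z))"
  by (intro set_borel_measurable_open open_box continuous_intros cf c2)+
 note F = set_Fubini[of ?X ?Y "%x y. nsq (f (pt x y))", OF i[unfolded box_pt_iff(1)[OF m(1)]]]
 note F2 = set_Fubini[of ?X ?Y "%x y. nsq (f2 (pt x y))", OF i2[unfolded box_pt_iff(1)[OF m(2)]]]
 have "(SINT x:?X. SINT y:?Y. nsq (f (pt x y))) <= (SINT x:?X. h^2 * (SINT y:?Y. nsq (f2 (pt x y))))"
  unfolding int_def[of lborel ?X]
 proof (rule integral_mono_AE)
  show "integrable lborel (%x. ind ?X x *R (SINT y:?Y. nsq (f (pt x y))))"
   using F(2) by (simp only: sint_def)
  show "integrable lborel (%x. ind ?X x *R (h^2 * (SINT y:?Y. nsq (f2 (pt x y)))))"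
   using set_integrable_mult_right[OF F2(2), of "h^2"] by (simp only: sint_def)
  show "AE x in lborel. ind ?X x *R (SINT y:?Y. nsq (f (pt x y))) <= ind ?X x *R (h^2 * (SINT y:?Y. nsq (f2 (pt x y))))"
   using F(1) F2(1)
  proof eventually_elim
   case (elim x)
   show ?case
   proof (cases "x : ?X")
    case True
    let ?J = "SINT y:?Y. nsq (f2 (pt x y))"
    have J0: "?J >= 0" unfolding int_def by (intro integral_nonneg_AE) auto
    have in_B: "pt x y : ?B" if "y : ?Y" for y using that True by (simp add: in_open_box)
    have d: "((%s. f (pt x s)) has_vector_derivative f2 (pt x y)) (at y)" if "y : ?Y" for y
     using grad_at_line(2)[OF g[OF in_B[OF that]]] .
    have cy: "continuous_on ?Y (%y. f2 (pt x y))"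
     by (rule continuous_on_compose2[OF c2]) (use in_B in \<open>auto intro!: continuous_intros\<close>)
    have b: "nsq (f (pt x y)) <= h * ?J" if y: "y : ?Y" for y
    proof -
     have "((%s. nsq (f (pt x y) - f (pt x s))) \<longlongrightarrow> nsq (f (pt x y) - 0)) (at_right c)"
      by (intro tendsto_intros lim) (use True in auto)
     moreover have "\<forall>\<^sub>F s in at_right c. nsq (f (pt x y) - f (pt x s)) <= h * ?J"
      unfolding eventually_at_right_field
     proof (intro exI[of _ y] conjI allI impI)
      show "c < y" using y by simp
      fix s assume s: "c < s" "s < y"
      have "nsq (f (pt x y) - f (pt x s)) <= (y - s) * ?J"
       by (rule sq_increment[OF d cy]) (use s y elim True in auto)
      also have "... <= h * ?J" using s y J0 by (intro mult_right_mono) auto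
      finally show "nsq (f (pt x y) - f (pt x s)) <= h * ?J" .
     qed
     ultimately have "nsq (f (pt x y) - 0) <= h * ?J"
      by (intro tendsto_upperbound[of _ _ "at_right c"]) auto
     thus ?thesis by simp
    qed
    have "(SINT y:?Y. nsq (f (pt x y))) <= (SINT y:?Y. h * ?J)"
    proof (rule set_integral_mono)
     show "sint ?Y (%y. h * ?J)"
      unfolding sint_def using h by (intro integrable_scaleR_left integrable_real_indicator) auto
    qed (use elim True b in auto)
    also have "... = h^2 * ?J" using h by (simp add: int_def power2_eq_square)
    finally show ?thesis using True by simp
   qed simp
  qed
 qed
 thus ?thesis unfolding F(3) set_integral_mult_right F2(3) box_pt_iff(2)[OF m(1)] box_pt_iff(2)[OF m(2)] .
qed

section \<open>Logarithmic polar coordinates\<close>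

definition pl :: "real => real => real => real^2" where
 "pl kp t p = pt (exp t / kp * cos p) (exp t / kp * sin p)"

lemma pl_nth [simp]: "pl kp t p $ 1 = exp t / kp * cos p" "pl kp t p $ 2 = exp t / kp * sin p"
 by (simp_all add: pl_def)

lemma norm_pl: "0 < kp ==> norm (pl kp t p) = exp t / kp"
proof -
 assume k: "0 < kp"
 have "(exp t / kp * cos p)^2 + (exp t / kp * sin p)^2 = (exp t / kp)^2 * ((cos p)^2 + (sin p)^2)"
  by (simp only: power_mult_distrib distrib_left)
 hence "(exp t / kp * cos p)^2 + (exp t / kp * sin p)^2 = (exp t / kp)^2"
  by (simp only: sin_cos_squared_add2 mult_1_right)
 thus ?thesis using k unfolding norm_pt by simp
qed

lemma ln_norm_pl: "0 < kp ==> ln (kp * norm (pl kp t p)) = t"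
 by (simp add: norm_pl)

lemma pl_upper: "0 < kp ==> p : {0<..<pi} ==> pl kp t p : upper_half_plane"
 using sin_gt_zero[of p] by (simp add: upper_half_plane_def)

lemma pl_cont: "continuous_on S (%(t, p). pl kp t p)"
 unfolding pl_def case_prod_beta divide_inverse by (intro continuous_intros)

lemma polar_ex:
 assumes k: "0 < kp" and z: "z : upper_half_plane"
 obtains p where "p : {0<..<pi}" "z = pl kp (ln (kp * norm z)) p"
proof -
 have z2: "0 < z $ 2" using z by (simp add: upper_half_plane_def)
 hence n: "norm z > 0" by (auto simp: norm_pt intro: add_nonneg_pos)
 have e: "exp (ln (kp * norm z)) / kp = norm z" using k n by simp
 have "(z $ 1)^2 < (norm z)^2" using z2 unfolding norm_pt by simp
 hence "\<bar>z $ 1\<bar> < norm z" using power2_less_imp_less[of "\<bar>z $ 1\<bar>" "norm z"] by simp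
 hence c: "- 1 < z $ 1 / norm z" "z $ 1 / norm z < 1" using n by (auto simp: abs_less_iff less_divide_eq divide_less_eq)
 let ?p = "arccos (z $ 1 / norm z)"
 have p: "0 < ?p" "?p < pi" using arccos_lt_bounded[OF c] by auto
 have cp: "cos ?p = z $ 1 / norm z" using c by simp
 have "sin ?p = sqrt (1 - (z $ 1 / norm z)^2)" using c by (simp add: sin_arccos)
 also have "1 - (z $ 1 / norm z)^2 = ((norm z)^2 - (z $ 1)^2) / (norm z)^2" using n by (simp add: power_divide diff_divide_distrib)
 also have "(norm z)^2 - (z $ 1)^2 = (z $ 2)^2" unfolding norm_pt by simp
 also have "sqrt ((z $ 2)^2 / (norm z)^2) = z $ 2 / norm z" using z2 by (simp add: real_sqrt_divide)
 finally have sp: "sin ?p = z $ 2 / norm z" .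
 show ?thesis
 proof (rule that[of ?p])
  show "?p : {0<..<pi}" using p by simp
  show "z = pl kp (ln (kp * norm z)) ?p"
   unfolding pl_def e cp sp using n by (simp add: vec_eq_iff forall_2)
 qed
qed

lemma pl_inj:
 assumes "0 < kp" "pl kp t p = pl kp s q" "p : {0<..<pi}" "q : {0<..<pi}"
 shows "t = s" "p = q"
proof -
 show ts: "t = s" using arg_cong[OF assms(2), of "%z. ln (kp * norm z)"] assms(1) by (simp add: ln_norm_pl)
 have "pl kp t p $ 1 = pl kp s q $ 1" using assms(2) by simp
 hence "cos p = cos q" using ts assms(1) by simp
 from _ _ _ _ this show "p = q" by (rule cos_inj_pi) (use assms(3,4) in auto)
qed

lemma pl_grad:
 "grad_at (%z. pl kp (z $ 1) (z $ 2)) (pt (exp (z $ 1) / kp * cos (z $ 2)) (exp (z $ 1) / kp * sin (z $ 2)))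
   (pt (- (exp (z $ 1) / kp * sin (z $ 2))) (exp (z $ 1) / kp * cos (z $ 2))) z"
proof -
 have e: "grad_at (%z. exp (z $ 1) / kp) (exp (z $ 1) / kp) 0 z"
  using grad_at_comp[OF grad_at_nth(1) DERIV_cdivide[OF DERIV_exp]] by simp
 have c: "grad_at (%z. cos (z $ 2)) 0 (- sin (z $ 2)) z" using grad_at_comp[OF grad_at_nth(2) DERIV_cos] by simp
 have s: "grad_at (%z. sin (z $ 2)) 0 (cos (z $ 2)) z" using grad_at_comp[OF grad_at_nth(2) DERIV_sin] by simp
 note x = grad_at_linear[OF bounded_linear_scaleR_left[of "pt 1 0"] grad_at_mult[OF e c]]
 note y = grad_at_linear[OF bounded_linear_scaleR_left[of "pt 0 1"] grad_at_mult[OF e s]]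
 have eq: "(%z. (exp (z $ 1) / kp * cos (z $ 2)) *R pt 1 0 + (exp (z $ 1) / kp * sin (z $ 2)) *R pt 0 1) = (%z :: real^2. pl kp (z $ 1) (z $ 2))"
  unfolding pl_def by (rule ext) (simp only: pt_eq[symmetric])
 show ?thesis
 proof (rule back_subst[where P = "%q. grad_at _ q _ z", OF back_subst[where P = "%q. grad_at _ _ q z", OF grad_at_add[OF x y, unfolded eq]]])
 qed (simp_all add: vec_eq_iff forall_2)
qed

lemma polar_deriv:
 assumes "grad_at f a b (pl kp t p)"
 shows "((%s. f (pl kp s p)) has_vector_derivative (exp t / kp * cos p) *R a + (exp t / kp * sin p) *R b) (at t)"
  and "((%s. f (pl kp t s)) has_vector_derivative - (exp t / kp * sin p) *R a + (exp t / kp * cos p) *R b) (at p)"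
proof -
 have g: "grad_at (%z. pl kp (z $ 1) (z $ 2)) (pt (exp t / kp * cos p) (exp t / kp * sin p))
   (pt (- (exp t / kp * sin p)) (exp t / kp * cos p)) (pt t p)"
  using pl_grad[of kp "pt t p"] by simp
 have d: "((%s. pl kp s p) has_vector_derivative pt (exp t / kp * cos p) (exp t / kp * sin p)) (at t)"
   "((%s. pl kp t s) has_vector_derivative pt (- (exp t / kp * sin p)) (exp t / kp * cos p)) (at p)"
  using grad_at_line[OF g] by simp_all
 show "((%s. f (pl kp s p)) has_vector_derivative (exp t / kp * cos p) *R a + (exp t / kp * sin p) *R b) (at t)"
  using has_derivative_compose[OF d(1)[unfolded has_vector_derivative_def] assms[unfolded grad_at_def]]
  unfolding has_vector_derivative_def by (simp add: scaleR_add_right scaleR_diff_right)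
 show "((%s. f (pl kp t s)) has_vector_derivative - (exp t / kp * sin p) *R a + (exp t / kp * cos p) *R b) (at p)"
  using has_derivative_compose[OF d(2)[unfolded has_vector_derivative_def] assms[unfolded grad_at_def]]
  unfolding has_vector_derivative_def by (simp add: scaleR_add_right scaleR_diff_right)
qed

text \<open>Change of variables with Jacobian (exp t / kp)^2. Integrability is stated as an
  equivalence because it is transported in both directions: from the plane for the energy of the
  field, from the strip for subsets of the half disc.\<close>

lemma polar_integral:
 fixes f :: "real^2 => complex"
 assumes k: "0 < kp" and A: "open A"
 defines "U \<equiv> {z : upper_half_plane. ln (kp * norm z) : A}"
 assumes c: "continuous_on U f"
 shows "open U"
  and "sint U f \<longleftrightarrow> sint (A \<times> {0<..<pi}) (%(t, p). (exp t / kp)^2 *R f (pl kp t p))"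
  and "(SINT z:U. f z) = (SINT z:A \<times> {0<..<pi}. (case z of (t, p) => (exp t / kp)^2 *R f (pl kp t p)))"
proof -
 define S where "S = {z :: real^2. z $ 1 : A \<and> z $ 2 : {0<..<pi}}"
 let ?g = "%z :: real^2. pl kp (z $ 1) (z $ 2)"
 have "open ((%z :: real^2. z $ 1) -` A)" "open ((%z :: real^2. z $ 2) -` {0<..<pi})"
  by (intro open_vimage A continuous_intros; simp)+
 moreover have "S = ((%z :: real^2. z $ 1) -` A) \<inter> ((%z :: real^2. z $ 2) -` {0<..<pi})" by (auto simp: S_def)
 ultimately have S: "open S" by auto
 show U: "open U"
 proof -
  have "open upper_half_plane" unfolding upper_half_plane_def by (intro open_Collect_less continuous_intros)
  moreover have "continuous_on upper_half_plane (%z. ln (kp * norm z))"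
   using k by (intro continuous_intros) (auto simp: upper_half_plane_def)
  ultimately have "open (upper_half_plane \<inter> (%z. ln (kp * norm z)) -` A)"
   using A continuous_on_open_vimage[of upper_half_plane "%z. ln (kp * norm z)"] by (simp add: Int_commute)
  thus ?thesis by (simp add: U_def Int_def vimage_def)
 qed
 have img: "?g ` S = U"
 proof
  show "?g ` S \<subseteq> U"
  proof (rule image_subsetI)
   fix z assume "z : S"
   thus "?g z : U" using pl_upper[OF k, of "z $ 2" "z $ 1"] unfolding U_def S_def mem_Collect_eq ln_norm_pl[OF k] by blast
  qed
  show "U \<subseteq> ?g ` S"
  proof
   fix z assume z: "z : U"
   hence zu: "z : upper_half_plane" "ln (kp * norm z) : A" by (simp_all add: U_def)
   obtain p where p: "p : {0<..<pi}" "z = pl kp (ln (kp * norm z)) p" by (rule polar_ex[OF k zu(1)])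
   have "pt (ln (kp * norm z)) p : S" using p(1) zu(2) unfolding S_def by simp
   hence "?g (pt (ln (kp * norm z)) p) : ?g ` S" by (rule imageI)
   hence "pl kp (ln (kp * norm z)) p : ?g ` S" by (simp only: pt_nth)
   thus "z : ?g ` S" unfolding p(2)[symmetric] .
  qed
 qed
 have inj: "inj_on ?g S"
 proof (rule inj_onI)
  fix x y assume xy: "x : S" "y : S" "?g x = ?g y"
  have "x $ 1 = y $ 1" "x $ 2 = y $ 2" using pl_inj[OF k xy(3)] xy(1,2) by (auto simp: S_def)
  thus "x = y" by (simp add: vec_eq_iff forall_2)
 qed
 let ?g' = "%z h. (h $ 1) *R pt (exp (z $ 1) / kp * cos (z $ 2)) (exp (z $ 1) / kp * sin (z $ 2)) +
   (h $ 2) *R pt (- (exp (z $ 1) / kp * sin (z $ 2))) (exp (z $ 1) / kp * cos (z $ 2))"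
 have der: "(?g has_derivative ?g' z) (at z within S)" for z
  using pl_grad[of kp z] unfolding grad_at_def by (rule has_derivative_at_withinI)
 have det: "\<bar>det (matrix (?g' z))\<bar> = (exp (z $ 1) / kp)^2" for z
 proof -
  have "det (matrix (?g' z)) = (exp (z $ 1) / kp * cos (z $ 2))^2 + (exp (z $ 1) / kp * sin (z $ 2))^2"
   by (simp add: det_2 matrix_def axis_def power2_eq_square)
  also have "... = (exp (z $ 1) / kp)^2 * ((cos (z $ 2))^2 + (sin (z $ 2))^2)"
   by (simp only: power_mult_distrib distrib_left)
  also have "... = (exp (z $ 1) / kp)^2" by (simp only: sin_cos_squared_add2 mult_1_right)
  finally show ?thesis by simp
 qed
 \<comment> \<open>\<open>J\<close> identifies complex with real^2, the value type in which the
   change of variables is carried out; \<open>J'\<close> is its inverse.\<close>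
 define J where "J c = pt (Re c) (Im c)" for c
 define J' where "J' z = Complex (z $ 1) (z $ 2)" for z :: "real^2"
 have J: "bounded_linear J" and J': "bounded_linear J'"
  unfolding J_def J'_def linear_conv_bounded_linear[symmetric]
  by (rule linearI; simp add: vec_eq_iff forall_2 complex_eq_iff)+
 have JJ: "J' (J c) = c" for c by (simp add: J_def J'_def)
 interpret J': bounded_linear J' by (rule J')
 interpret J: bounded_linear J by (rule J)
 let ?h = "%z :: real^2. (exp (z $ 1) / kp)^2 *R f (?g z)"
 have Sl: "S : sets lebesgue" using S by auto
 note cov = has_absolute_integral_change_of_variables[OF Sl der inj, where f = "%z. J (f z)", unfolded det img]
 have tr: "(%z. J (q z)) absolutely_integrable_on X \<longleftrightarrow> q absolutely_integrable_on X"
  "q absolutely_integrable_on X ==> integral X (%z. J (q z)) = J (integral X q)" for q :: "real^2 => complex" and X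
 proof -
  show "(%z. J (q z)) absolutely_integrable_on X \<longleftrightarrow> q absolutely_integrable_on X"
   using absolutely_integrable_linear[OF _ J, where f = q and s = X] absolutely_integrable_linear[OF _ J', where f = "%z. J (q z)" and s = X]
   by (auto simp: o_def JJ)
  show "integral X (%z. J (q z)) = J (integral X q)" if "q absolutely_integrable_on X"
   using integral_linear[OF set_lebesgue_integral_eq_integral(1)[OF that] J] by (simp add: o_def)
 qed
 have cg: "continuous_on S ?g"
  by (rule has_derivative_continuous_on[OF der])
 have "continuous_on S (%z. f (?g z))"
  by (rule continuous_on_compose2[OF c cg]) (simp only: img order_refl)
 hence cS: "continuous_on S ?h"
  unfolding divide_inverse by (intro continuous_intros)
 have leb: "q absolutely_integrable_on X \<longleftrightarrow> sint X q" "q absolutely_integrable_on X ==> integral X q = (SINT z:X. q z)"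
  if "open X" "continuous_on X q" for q :: "real^2 => complex" and X
 proof -
  have m: "(%x. ind X x *R q x) : borel_measurable lborel"
   using set_borel_measurable_open[OF that] by (simp add: set_borel_measurable_def)
  show "q absolutely_integrable_on X \<longleftrightarrow> sint X q"
   unfolding sint_def by (rule integrable_completion[OF m])
  assume "q absolutely_integrable_on X"
  hence "integral X q = (LINT z:X|lebesgue. q z)" by (rule set_lebesgue_integral_eq_integral(2)[symmetric])
  thus "integral X q = (SINT z:X. q z)"
   unfolding int_def using integral_completion[OF m] by simp
 qed
 have t1: "(%z. (exp (z $ 1) / kp)^2 *R J (f (?g z))) absolutely_integrable_on S \<longleftrightarrow> ?h absolutely_integrable_on S"
  unfolding J.scaleR[symmetric] by (rule tr(1))
 have t2: "(%z. J (f z)) absolutely_integrable_on U \<longleftrightarrow> f absolutely_integrable_on U"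
  by (rule tr(1))
 have 1: "?h absolutely_integrable_on S \<longleftrightarrow> f absolutely_integrable_on U"
  using cov[of "integral S (%x. (exp (x $ 1) / kp)^2 *R J (f (?g x)))"] cov[of "integral U (%z. J (f z))"]
  unfolding t1 t2 by blast
 have 2: "integral S ?h = integral U f" if U: "f absolutely_integrable_on U"
 proof -
  have hS: "?h absolutely_integrable_on S" using U 1 by blast
  have "integral S (%x. (exp (x $ 1) / kp)^2 *R J (f (?g x))) = integral U (%z. J (f z))"
   using cov[of "integral U (%z. J (f z))"] U unfolding t2 by blast
  hence "integral S (%z. J (?h z)) = integral U (%z. J (f z))" unfolding J.scaleR .
  hence "J (integral S ?h) = J (integral U f)" unfolding tr(2)[OF hS] tr(2)[OF U] .
  hence "J' (J (integral S ?h)) = J' (J (integral U f))" by (rule arg_cong)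
  thus ?thesis unfolding JJ .
 qed
 have m: "(%x. ind S x *R ?h x) : borel_measurable borel"
  using set_borel_measurable_open[OF S cS] by (simp add: set_borel_measurable_def)
 have e: "(%(x, y). ind S (pt x y) *R ?h (pt x y)) = (%z. ind (A \<times> {0<..<pi}) z *R (case z of (t, p) => (exp t / kp)^2 *R f (pl kp t p)))"
  by (auto simp: fun_eq_iff indicator_def S_def)
 have hS: "sint S ?h \<longleftrightarrow> sint (A \<times> {0<..<pi}) (%(t, p). (exp t / kp)^2 *R f (pl kp t p))"
  unfolding sint_def integrable_pt_iff[OF m] e by (rule refl)
 have hS2: "(SINT z:S. ?h z) = (SINT z:A \<times> {0<..<pi}. (case z of (t, p) => (exp t / kp)^2 *R f (pl kp t p)))"
  unfolding int_def integral_pt[OF m] e by (rule refl)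
 show 3: "sint U f \<longleftrightarrow> sint (A \<times> {0<..<pi}) (%(t, p). (exp t / kp)^2 *R f (pl kp t p))"
  using 1 leb(1)[OF S cS] leb(1)[OF U c] hS by blast
 show "(SINT z:U. f z) = (SINT z:A \<times> {0<..<pi}. (case z of (t, p) => (exp t / kp)^2 *R f (pl kp t p)))"
 proof (cases "sint U f")
  case True
  hence "f absolutely_integrable_on U" "?h absolutely_integrable_on S" using 1 leb(1)[OF U c] by auto
  thus ?thesis using 2 leb(2)[OF S cS] leb(2)[OF U c] hS2 by simp
 next
  case False
  hence "\<not> sint (A \<times> {0<..<pi}) (%(t, p). (exp t / kp)^2 *R f (pl kp t p))" using 3 by blast
  note n = not_integrable_integral_eq[OF this[unfolded sint_def]] not_integrable_integral_eq[OF False[unfolded sint_def]]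
  show ?thesis unfolding int_def n by (rule refl)
 qed
qed

section \<open>The sum of the incident and the reflected wave\<close>

definition pw :: "real => real => real^2 => complex" where
 "pw a b x = exp (\<i> * complex_of_real (a * x $ 1 + b * x $ 2))"

lemma norm_pw: "cmod (pw a b x) = 1"
 by (simp add: pw_def)

lemma pw_grad: "grad_at (pw a b) (\<i> * of_real a * pw a b x) (\<i> * of_real b * pw a b x) x"
proof -
 have "grad_at (%x. a * x $ 1 + b * x $ 2) a b x"
  using grad_at_add[OF grad_at_mult[OF grad_at_const[of a] grad_at_nth(1)] grad_at_mult[OF grad_at_const[of b] grad_at_nth(2)]] by simp
 from grad_at_linear[OF bounded_linear_of_real this]
 have g: "grad_at (%x. \<i> * complex_of_real (a * x $ 1 + b * x $ 2)) (\<i> * of_real a) (\<i> * of_real b) x"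
  by (rule grad_at_linear[OF bounded_linear_mult_right])
 have e: "(exp has_derivative (*) (exp z)) (at z)" for z :: complex
  using DERIV_exp[of z] by (simp add: has_field_derivative_def)
 show ?thesis
  using has_derivative_compose[OF g[unfolded grad_at_def] e]
  unfolding grad_at_def pw_def[abs_def] by (simp add: algebra_simps scaleR_conv_of_real)
qed

definition gw :: "real => real => real^2 => complex" where
 "gw kp th x = u_inc kp th x + u_ref kp th x"

definition gw1 :: "real => real => real^2 => complex" where
 "gw1 kp th x = \<i> * of_real (kp * sin th) * gw kp th x"

definition gw2 :: "real => real => real^2 => complex" where
 "gw2 kp th x = \<i> * of_real (kp * cos th) * (u_ref kp th x - u_inc kp th x)"

lemma u_inc_pw: "u_inc kp th = pw (kp * sin th) (- (kp * cos th))"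
 by (simp add: fun_eq_iff u_inc_def pw_def algebra_simps)

lemma u_ref_pw: "u_ref kp th = pw (kp * sin th) (kp * cos th)"
 by (simp add: fun_eq_iff u_ref_def pw_def algebra_simps)

lemma gw_grad:
 "grad_at (gw kp th) (gw1 kp th x) (gw2 kp th x) x"
 "grad_at (gw1 kp th) (- of_real ((kp * sin th)^2) * gw kp th x) (\<i> * of_real (kp * sin th) * gw2 kp th x) x"
 "grad_at (gw2 kp th) (\<i> * of_real (kp * sin th) * gw2 kp th x) (- of_real ((kp * cos th)^2) * gw kp th x) x"
proof -
 let ?s = "complex_of_real (kp * sin th)" and ?c = "complex_of_real (kp * cos th)"
 note i = pw_grad[of "kp * sin th" "- (kp * cos th)" x, folded u_inc_pw] and r = pw_grad[of "kp * sin th" "kp * cos th" x, folded u_ref_pw]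
 have e: "\<i> * ?s * u_inc kp th x + \<i> * ?s * u_ref kp th x = gw1 kp th x"
  "\<i> * of_real (- (kp * cos th)) * u_inc kp th x + \<i> * ?c * u_ref kp th x = gw2 kp th x"
  unfolding gw1_def gw2_def gw_def by (simp_all add: algebra_simps)
 show g: "grad_at (gw kp th) (gw1 kp th x) (gw2 kp th x) x"
  using grad_at_add[OF i r] unfolding e gw_def[abs_def] .
 have q: "\<i> * ?s * (\<i> * ?s * gw kp th x) = - of_real ((kp * sin th)^2) * gw kp th x"
  by (simp add: power2_eq_square algebra_simps)
 show "grad_at (gw1 kp th) (- of_real ((kp * sin th)^2) * gw kp th x) (\<i> * of_real (kp * sin th) * gw2 kp th x) x"
  using grad_at_linear[OF bounded_linear_mult_right[of "\<i> * ?s"] g] unfolding gw1_def[abs_def] q .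
 have e2: "\<i> * ?c * (\<i> * ?s * u_ref kp th x - \<i> * ?s * u_inc kp th x) = \<i> * ?s * gw2 kp th x"
  "\<i> * ?c * (\<i> * ?c * u_ref kp th x - \<i> * of_real (- (kp * cos th)) * u_inc kp th x) = - of_real ((kp * cos th)^2) * gw kp th x"
  unfolding gw2_def gw_def by (simp_all add: algebra_simps power2_eq_square)
 show "grad_at (gw2 kp th) (\<i> * of_real (kp * sin th) * gw2 kp th x) (- of_real ((kp * cos th)^2) * gw kp th x) x"
  using grad_at_linear[OF bounded_linear_mult_right[of "\<i> * ?c"] grad_at_diff[OF r i]] unfolding e2 gw2_def[abs_def] .
qed

lemma gw_cont [continuous_intros]: "continuous_on S (gw kp th)" "continuous_on S (gw1 kp th)" "continuous_on S (gw2 kp th)"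
 using gw_grad grad_at_continuous by (blast intro: continuous_at_imp_continuous_on)+

lemma gw_helmholtz: "- of_real ((kp * sin th)^2) * gw kp th x + - of_real ((kp * cos th)^2) * gw kp th x = - of_real (kp^2) * gw kp th x"
proof -
 have "(kp * sin th)^2 + (kp * cos th)^2 = kp^2 * ((sin th)^2 + (cos th)^2)" by (simp only: power_mult_distrib distrib_left)
 hence "(kp * sin th)^2 + (kp * cos th)^2 = kp^2" by (simp only: sin_cos_squared_add mult_1_right)
 hence "complex_of_real ((kp * sin th)^2) + of_real ((kp * cos th)^2) = of_real (kp^2)" by (metis of_real_add)
 thus ?thesis by (simp only: minus_mult_left[symmetric] distrib_right[symmetric] minus_add_distrib[symmetric])
qed

text \<open>Up to a phase G is 2 cos (kp x2 cos th) and its vertical derivative is kp cos th times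
  twice a sine, so all bounds are uniform in th. The last claim, that |G| stays at least 1 near the
  axis, is the source of the lower bounds.\<close>

lemma gw_bounds:
 assumes "0 < kp"
 shows "cmod (gw kp th x) <= 2" "cmod (gw1 kp th x) <= 2 * kp" "cmod (gw2 kp th x) <= 2 * kp" "cmod (gw2 kp th x) <= 2 * kp^2 * \<bar>x $ 2\<bar>"
  "kp * \<bar>x $ 2\<bar> <= 1 ==> 1 <= cmod (gw kp th x)"
proof -
 let ?p = "u_inc kp th x" and ?q = "u_ref kp th x" and ?a = "kp * x $ 2 * cos th"
 have n: "cmod ?p = 1" "cmod ?q = 1" unfolding u_inc_pw u_ref_pw by (rule norm_pw)+
 have sp: "?p = exp (\<i> * of_real (kp * x $ 1 * sin th)) * exp (- (\<i> * of_real ?a))" "?q = exp (\<i> * of_real (kp * x $ 1 * sin th)) * exp (\<i> * of_real ?a)"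
  unfolding u_inc_def u_ref_def exp_add[symmetric] by (simp_all add: algebra_simps)
 have ex: "exp (\<i> * complex_of_real y) = of_real (cos y) + \<i> * of_real (sin y)" "exp (- (\<i> * complex_of_real y)) = of_real (cos y) - \<i> * of_real (sin y)" for y
  using cis_conv_exp[of y] cis_conv_exp[of "- y"] by (simp_all add: complex_eq_iff)
 show g2: "cmod (gw kp th x) <= 2" unfolding gw_def using norm_triangle_ineq[of ?p ?q] n by simp
 have "cmod (gw1 kp th x) = kp * \<bar>sin th\<bar> * cmod (gw kp th x)" using assms by (simp add: gw1_def norm_mult abs_mult)
 also have "... <= kp * 1 * 2" using assms g2 by (intro mult_mono) auto
 finally show "cmod (gw1 kp th x) <= 2 * kp" by simp
 have d: "cmod (?q - ?p) = 2 * \<bar>sin ?a\<bar>"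
 proof -
  have "?q - ?p = exp (\<i> * of_real (kp * x $ 1 * sin th)) * (2 * \<i> * of_real (sin ?a))"
   unfolding sp ex(1)[of ?a] ex(2)[of ?a] by (simp add: algebra_simps)
  thus ?thesis by (simp add: norm_mult)
 qed
 have c: "gw kp th x = exp (\<i> * of_real (kp * x $ 1 * sin th)) * (2 * of_real (cos ?a))"
  unfolding gw_def sp ex(1)[of ?a] ex(2)[of ?a] by (simp add: algebra_simps)
 have m: "cmod (gw2 kp th x) = kp * \<bar>cos th\<bar> * (2 * \<bar>sin ?a\<bar>)" using assms d by (simp add: gw2_def norm_mult abs_mult)
 also have "... <= kp * 1 * (2 * 1)" using assms by (intro mult_mono) auto
 finally show "cmod (gw2 kp th x) <= 2 * kp" by simp
 have a: "\<bar>?a\<bar> <= kp * \<bar>x $ 2\<bar>" using assms by (simp add: abs_mult mult_left_le)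
 have "cmod (gw2 kp th x) <= kp * 1 * (2 * (kp * \<bar>x $ 2\<bar>))"
  unfolding m using assms a abs_sin_x_le_abs_x[of ?a] by (intro mult_mono) (auto intro: order_trans)
 thus "cmod (gw2 kp th x) <= 2 * kp^2 * \<bar>x $ 2\<bar>" by (simp add: power2_eq_square algebra_simps)
 assume "kp * \<bar>x $ 2\<bar> <= 1"
 hence a1: "\<bar>?a\<bar> <= 1" using a by simp
 have "(sin (?a / 2))^2 <= (1/2)^2"
 proof (rule abs_le_square_iff[THEN iffD1])
  show "\<bar>sin (?a / 2)\<bar> <= \<bar>1/2\<bar>" using abs_sin_x_le_abs_x[of "?a / 2"] a1 by simp
 qed
 moreover have "cos ?a = 1 - 2 * (sin (?a / 2))^2" using cos_double_sin[of "?a / 2"] by simp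
 ultimately have "1/2 <= cos ?a" by (simp add: power2_eq_square)
 thus "1 <= cmod (gw kp th x)" unfolding c by (simp add: norm_mult)
qed

lemma axis_null: "AE x in (lborel :: (real^2) measure). x $ 2 ~= 0"
proof -
 have "{x :: real^2. x $ 2 = 0} : null_sets lborel"
  using negligible_standard_hyperplane_cart[of "2::2"] unfolding negligible_iff_null_sets
  by (simp add: null_sets_completion_iff)
 thus ?thesis by (rule AE_I') auto
qed

text \<open>The vertical derivative of G vanishes linearly at the axis and compensates the slope 1 /
  dl of a cutoff in a layer of height dl, so the layer contributes O (dl). Test functions may
  therefore be nonzero on the axis, in particular on the aperture.\<close>

lemma gw_weak:
 fixes ps :: "real^2 => complex"
 assumes kp: "0 < kp" and g: "!!x. x : upper_half_plane ==> grad_at ps (ps1 x) (ps2 x) x"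
  and c: "continuous_on upper_half_plane ps1" "continuous_on upper_half_plane ps2"
  and b: "!!x. x : upper_half_plane ==> cmod (ps x) <= M" and R: "0 < R" and M: "0 <= M"
  and z: "!!x. x : upper_half_plane ==> norm x >= R ==> ps x = 0 \<and> ps1 x = 0 \<and> ps2 x = 0"
  and i: "sint upper_half_plane (form kp (gw kp th) (gw1 kp th) (gw2 kp th) ps ps1 ps2)"
 shows "(SINT x:upper_half_plane. form kp (gw kp th) (gw1 kp th) (gw2 kp th) ps ps1 ps2 x) = 0"
proof -
 let ?up = "upper_half_plane"
 have up: "open ?up" unfolding upper_half_plane_def by (intro open_Collect_less continuous_intros)
 let ?E = "form kp (gw kp th) (gw1 kp th) (gw2 kp th) ps ps1 ps2"
 let ?I = "SINT x:?up. ?E x"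
 define dl where "dl j = inverse (real (Suc j))" for j
 have dl: "0 < dl j" "dl ----> 0" for j
  unfolding dl_def[abs_def] using LIMSEQ_inverse_real_of_nat by auto
 define cu where "cu j x = step (x $ 2 / dl j - 1)" for j and x :: "real^2"
 define cu2 where "cu2 j x = step' (x $ 2 / dl j - 1) / dl j" for j and x :: "real^2"
 have gcu: "grad_at (%x. complex_of_real (cu j x)) 0 (of_real (cu2 j x)) x" for j x
  using grad_at_linear[OF bounded_linear_of_real grad_at_comp[OF grad_at_nth(2) scaled_step_deriv(1)]]
  unfolding cu_def[abs_def] cu2_def by (simp del: of_real_divide)
 have cuc: "continuous_on S (cu j)" "continuous_on S (cu2 j)" for S j
  unfolding cu_def[abs_def] cu2_def[abs_def] by (intro continuous_intros; use dl(1)[of j] in simp)+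
 have cub: "0 <= cu j x" "cu j x <= 1" for j x by (simp_all add: cu_def step_bounds)
 have ps0: "continuous_on ?up ps"
  using g grad_at_continuous by (blast intro: continuous_at_imp_continuous_on)
 have est: "cmod (SINT x:?up. cu j x *R ?E x) <= 12 * M * kp^2 * R * dl j" for j
 proof -
  define K where "K = cball 0 R \<inter> {z :: real^2. dl j <= z $ 2}"
  have K: "compact K" unfolding K_def
   by (intro compact_Int_closed closed_Collect_le continuous_intros compact_cball)
  have KO: "K \<subseteq> ?up" using dl(1)[of j] by (auto simp: K_def upper_half_plane_def)
  have zz: "ps x * of_real (cu j x) = 0 \<and> ps x * 0 + ps1 x * of_real (cu j x) = 0 \<and> ps x * of_real (cu2 j x) + ps2 x * of_real (cu j x) = 0"
   if "x : ?up" "x \<notin> K" for x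
  proof (cases "norm x >= R")
   case True
   thus ?thesis using z[OF that(1)] by simp
  next
   case False
   hence "x $ 2 / dl j - 1 <= 0" using that(2) dl(1)[of j] by (auto simp: K_def divide_le_eq)
   thus ?thesis by (simp add: cu_def cu2_def)
  qed
  have cc: "continuous_on ?up (%x. ps x * 0 + ps1 x * of_real (cu j x))" "continuous_on ?up (%x. ps x * of_real (cu2 j x) + ps2 x * of_real (cu j x))"
   by (intro continuous_intros cuc c ps0)+
  have pc: "continuous_on ?up (%x. - of_real ((kp * sin th)^2) * gw kp th x)" "continuous_on ?up (%x. - of_real ((kp * cos th)^2) * gw kp th x)"
   by (intro continuous_intros)+
  note G = green_compact[OF up K KO gw_grad(2) gw_grad(3) pc grad_at_mult[OF g gcu] cc zz, unfolded gw_helmholtz]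
  let ?D = "%x. ps x * (gw2 kp th x * of_real (cu2 j x))"
  let ?F = "%x. gw1 kp th x * (ps x * 0 + ps1 x * of_real (cu j x)) + gw2 kp th x * (ps x * of_real (cu2 j x) + ps2 x * of_real (cu j x)) +
    - of_real (kp^2) * gw kp th x * (ps x * of_real (cu j x))"
  have FE: "?F = (%x. cu j x *R ?E x + ?D x)"
   by (rule ext) (simp add: scaleR_conv_of_real algebra_simps)
  have Ei: "sint ?up (%x. cu j x *R ?E x)"
   by (rule set_integral_weight[OF i borel_measurable_continuous_onI[OF cuc(1)], where B = 1]) (use cub in auto)
  have Fi: "sint ?up (%x. cu j x *R ?E x + ?D x)" "(SINT x:?up. cu j x *R ?E x + ?D x) = 0"
   unfolding FE[symmetric] by - ((rule G(1); assumption), (rule G(2); assumption))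
  have Di: "sint ?up ?D"
   using set_integral_diff(1)[OF Fi(1) Ei] by (simp only: add_diff_cancel_left')
  have eq: "(SINT x:?up. cu j x *R ?E x) = - (SINT x:?up. ?D x)"
   using Fi(2) set_integral_add(2)[OF Ei Di] by (simp add: eq_neg_iff_add_eq_0)
  let ?T = "cbox (pt (- R) (dl j)) (pt R (2 * dl j)) :: (real^2) set"
  have Ti: "integrable lborel (%x. 6 * M * kp^2 * indicat_real ?T x)"
   by (intro integrable_mult_right integrable_real_indicator emeasure_lborel_cbox_finite) simp
  have Db: "cmod (ind ?up x *R ?D x) <= 6 * M * kp^2 * indicat_real ?T x" for x
  proof (cases "x : ?up \<and> ps x ~= 0 \<and> cu2 j x ~= 0")
   case False
   hence "ind ?up x *R ?D x = 0" by auto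
   thus ?thesis using M by (simp only: norm_zero) simp
  next
   case True
   hence x: "norm x < R" using z[of x] by force
   have xR: "\<bar>x $ 1\<bar> < R" using component_le_norm_cart[of x 1] x by simp
   have "0 < x $ 2 / dl j - 1" "x $ 2 / dl j - 1 < 1" using True unfolding cu2_def by (auto simp: not_le[symmetric])
   hence x2: "dl j < x $ 2" "x $ 2 < 2 * dl j" using dl(1)[of j] by (simp_all add: less_divide_eq divide_less_eq)
   have "\<bar>cu2 j x\<bar> <= 3/2 / dl j"
    unfolding cu2_def abs_divide abs_of_pos[OF dl(1)[of j]] using dl(1)[of j] by (intro divide_right_mono step_bounds) simp
   moreover have "cmod (gw2 kp th x) <= 2 * kp^2 * (2 * dl j)"
    by (rule order_trans[OF gw_bounds(4)[OF kp]]) (use x2 dl(1)[of j] in \<open>intro mult_left_mono; simp\<close>)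
   ultimately have "cmod (gw2 kp th x) * \<bar>cu2 j x\<bar> <= 2 * kp^2 * (2 * dl j) * (3/2 / dl j)"
    using dl(1)[of j] by (intro mult_mono) auto
   also have "... = 6 * kp^2" using dl(1)[of j] by simp
   finally have k6: "cmod (gw2 kp th x) * \<bar>cu2 j x\<bar> <= 6 * kp^2" .
   have "cmod (ps x) * (cmod (gw2 kp th x) * \<bar>cu2 j x\<bar>) <= M * (6 * kp^2)"
    by (rule mult_mono[OF _ k6]) (use b[of x] True M in auto)
   moreover have "x : ?T" unfolding in_box using x2 xR by auto
   moreover have "x : ?up" using True by blast
   ultimately show ?thesis by (simp add: norm_mult algebra_simps)
  qed
  have "cmod (SINT x:?up. ?D x) <= (LINT x|lborel. 6 * M * kp^2 * indicat_real ?T x)"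
   unfolding int_def
   by (rule Bochner_Integration.integral_norm_bound_integral[OF Di[unfolded sint_def] Ti Db])
  also have "... = 6 * M * kp^2 * measure lborel ?T" by simp
  also have "measure lborel ?T = 2 * R * dl j" by (subst box_area) (use R dl(1)[of j] in auto)
  finally show ?thesis unfolding eq norm_minus_cancel by (simp add: algebra_simps)
 qed
 have "(%j. SINT x:?up. cu j x *R ?E x) ----> 1 *R ?I"
 proof (rule set_integral_weight_limit[OF i borel_measurable_continuous_onI[OF cuc(1)]])
  fix x assume "x : ?up"
  hence "x $ 2 / 2 > 0" by (simp add: upper_half_plane_def)
  hence "\<forall>\<^sub>F j in sequentially. dl j < x $ 2 / 2" using dl(2) by (intro order_tendstoD)
  thus "\<forall>\<^sub>F j in sequentially. cu j x = 1"
  proof eventually_elim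
   case (elim j)
   hence "x $ 2 / dl j - 1 >= 1" using dl(1)[of j] by (simp add: le_divide_eq)
   thus ?case by (simp add: cu_def)
  qed
 qed (use cub in auto)
 hence l: "(%j. cmod (SINT x:?up. cu j x *R ?E x)) ----> cmod ?I" using tendsto_norm by fastforce
 have "(%j. 12 * M * kp^2 * R * dl j) ----> 12 * M * kp^2 * R * 0" by (intro tendsto_intros dl(2))
 from LIMSEQ_le[OF l this] est show ?thesis by simp
qed


section \<open>The field with the incident and reflected waves removed\<close>

definition ramp :: "real => real^2 => real" where "ramp d x = step (1 + x $ 2 / d)"

definition ramp' :: "real => real^2 => real" where "ramp' d x = step' (1 + x $ 2 / d) / d"

lemma ramp_grad: "grad_at (ramp d) 0 (ramp' d x) x"
proof -
 have "((%y. step (1 + y / d)) has_real_derivative step' (1 + x $ 2 / d) * (0 + 1 / d)) (at (x $ 2))"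
  by (rule DERIV_chain2[OF step_deriv]) (rule DERIV_add[OF DERIV_const DERIV_cdivide[OF DERIV_ident]])
 from grad_at_comp[OF grad_at_nth(2) this] show ?thesis
  unfolding ramp_def[abs_def] ramp'_def by simp
qed

lemma ramp_props:
 assumes "0 < d"
 shows "0 <= ramp d x" "ramp d x <= 1" "\<bar>ramp' d x\<bar> <= 3/2 / d" "0 <= x $ 2 ==> ramp d x = 1" "0 <= x $ 2 ==> ramp' d x = 0"
  "x $ 2 <= - d ==> ramp d x = 0" "continuous_on S (ramp d)" "continuous_on S (ramp' d)"
proof -
 show "0 <= ramp d x" "ramp d x <= 1" by (simp_all add: ramp_def step_bounds)
 show "\<bar>ramp' d x\<bar> <= 3/2 / d"
  unfolding ramp'_def abs_divide abs_of_pos[OF assms] using assms by (intro divide_right_mono step_bounds) simp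
 show "0 <= x $ 2 ==> ramp d x = 1" "0 <= x $ 2 ==> ramp' d x = 0" using assms by (simp_all add: ramp_def ramp'_def)
 show "x $ 2 <= - d ==> ramp d x = 0" using assms by (auto simp: ramp_def intro!: step_eqs(1) simp: divide_le_eq add_nonpos_nonpos field_simps)
 show "continuous_on S (ramp d)" "continuous_on S (ramp' d)"
  unfolding ramp_def[abs_def] ramp'_def[abs_def] using assms by (intro continuous_intros; simp)+
qed

context cavity_solution begin

text \<open>The slope of the ramp is 0 at both ends, so \<open>h\<close> continues G across the
  aperture with a continuous gradient. In the cavity this gradient is bounded by multiples of kp and
  1 / d, which is what gives the source its size.\<close>

definition h where "h x = of_real (ramp d x) * gw kp th x"
definition h1 where "h1 x = of_real (ramp d x) * gw1 kp th x"
definition h2 where "h2 x = of_real (ramp d x) * gw2 kp th x + of_real (ramp' d x) * gw kp th x"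
definition Ph where "Ph x = u x - h x"
definition Ph1 where "Ph1 x = u1 x - h1 x"
definition Ph2 where "Ph2 x = u2 x - h2 x"

lemma h_grad: "grad_at h (h1 x) (h2 x) x"
 using grad_at_mult[OF grad_at_linear[OF bounded_linear_of_real ramp_grad] gw_grad(1)]
 unfolding h_def[abs_def] h1_def h2_def by simp

lemma Ph_grad: "x : Om ==> grad_at Ph (Ph1 x) (Ph2 x) x"
 unfolding Ph_def[abs_def] Ph1_def Ph2_def by (rule grad_at_diff[OF u_grad(1) h_grad])

lemma h_cont: "continuous_on S h" "continuous_on S h1" "continuous_on S h2"
 unfolding h_def[abs_def] h1_def[abs_def] h2_def[abs_def] by (intro continuous_intros ramp_props d)+

lemma Ph_cont: "continuous_on Om Ph" "continuous_on Om Ph1" "continuous_on Om Ph2"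
 unfolding Ph_def[abs_def] Ph1_def[abs_def] Ph2_def[abs_def] by (intro continuous_intros u_cont h_cont)+

lemma h_up: "x : up ==> h x = gw kp th x" "x : up ==> h1 x = gw1 kp th x" "x : up ==> h2 x = gw2 kp th x"
 using ramp_props(4,5)[OF d, where x = x] by (simp_all add: up_iff h_def h1_def h2_def)

lemma h_bounds: "cmod (h x) <= 2" "cmod (h1 x) <= 2 * kp" "cmod (h2 x) <= 2 * kp + 3 / d"
proof -
 note r = ramp_props(1-6)[OF d, where x = x] and g = gw_bounds[OF kp, where th = th and x = x]
 have 1: "\<bar>ramp d x\<bar> * y <= y" if "0 <= y" for y using r that by (simp add: mult_left_le_one_le)
 show "cmod (h x) <= 2" "cmod (h1 x) <= 2 * kp"
  using 1[of "cmod (gw kp th x)"] 1[of "cmod (gw1 kp th x)"] g by (simp_all add: h_def h1_def norm_mult)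
 have "cmod (h2 x) <= \<bar>ramp d x\<bar> * cmod (gw2 kp th x) + \<bar>ramp' d x\<bar> * cmod (gw kp th x)"
  unfolding h2_def by (rule norm_triangle_le) (simp add: norm_mult)
 moreover have "\<bar>ramp' d x\<bar> * cmod (gw kp th x) <= 3/2 / d * 2" using r g d by (intro mult_mono) auto
 ultimately show "cmod (h2 x) <= 2 * kp + 3 / d" using 1[of "cmod (gw2 kp th x)"] g by simp
qed

lemma Ph_energy:
 "sint (Om \<inter> ball 0 R) (%x. nsq (Ph x))"
 "sint (Om \<inter> ball 0 R) (%x. nsq (Ph1 x))"
 "sint (Om \<inter> ball 0 R) (%x. nsq (Ph2 x))"
proof -
 let ?S = "Om \<inter> ball 0 R"
 have S: "open ?S" by (intro open_Int open_sets open_ball)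
 have one: "sint ?S (%_. c)" for c :: real
  by (rule set_integrable_const) (use S in \<open>auto intro: bounded_subset[OF bounded_ball]\<close>)
 have main: "sint ?S (%x. nsq (f x - g x))"
  if f: "continuous_on Om f" "sint ?S (%x. nsq (f x))" and g: "continuous_on Om g" "!!x. cmod (g x) <= B" for f g B
 proof (rule set_integrable_bound[OF set_integral_add(1)[OF set_integrable_mult_right[OF f(2), of 2] one[of "2 * B^2"]]])
  show "set_borel_measurable lborel ?S (%x. nsq (f x - g x))"
   by (intro set_borel_measurable_open S continuous_intros continuous_on_subset[OF f(1)] continuous_on_subset[OF g(1)]) auto
  show "AE x in lborel. x : ?S \<longrightarrow> norm (nsq (f x - g x)) <= norm (2 * nsq (f x) + 2 * B^2)"
   using order_trans[OF sq_add[of "f _" "- g _", simplified] add_left_mono[OF mult_left_mono[OF power_mono[OF g(2) norm_ge_zero]]]] by (intro AE_I2) simp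
 qed
 show "sint ?S (%x. nsq (Ph x))"
  unfolding Ph_def by (rule main[OF u_cont(1) energy(1) h_cont(1) h_bounds(1)])
 show "sint ?S (%x. nsq (Ph1 x))"
  unfolding Ph1_def by (rule main[OF u_cont(2) energy(2) h_cont(2) h_bounds(2)])
 show "sint ?S (%x. nsq (Ph2 x))"
  unfolding Ph2_def by (rule main[OF u_cont(2) energy(3) h_cont(3) h_bounds(3)])
qed

lemma Om_split:
 fixes f :: "real^2 => 'b::{banach, second_countable_topology}"
 assumes "sint Om f"
 shows "sint cav f" "sint up f" "(SINT x:Om. f x) = (SINT x:cav. f x) + (SINT x:up. f x)"
proof -
 have "AE x in lborel. x : Om \<longrightarrow> x : cav \<or> x : up \<or> f x = 0"
  using axis_null by eventually_elim (auto simp: Om_iff cav_iff up_iff)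
 hence "cav \<inter> up = {}" by (auto simp: cav_iff up_iff)
 note sp = set_integral_split[OF assms _ subsets(1) _ subsets(2) this \<open>AE x in lborel. _\<close>]
 show "sint cav f" "sint up f" "(SINT x:Om. f x) = (SINT x:cav. f x) + (SINT x:up. f x)"
  by (rule sp; use open_sets in simp)+
qed

lemmas h_integrable = form_integrable[OF _ Ph_cont Ph_energy]

text \<open>Above the axis \<open>h\<close> is G, which satisfies the weak form by itself by
  \<open>gw_weak\<close>; in the difference only the cavity remains as a source. The aperture line
  is a null set.\<close>

lemma weak_form_Ph:
 assumes t: "test_fun ps ps1 ps2 M R s" and pos: "0 < s" "0 <= M" "0 < R"
 shows "(SINT x:Om. form kp Ph Ph1 Ph2 ps ps1 ps2 x) =
   - (SINT x:cav. form kp h h1 h2 ps ps1 ps2 x)"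
  and "sint cav (form kp h h1 h2 ps ps1 ps2)"
proof -
 let ?E = "form kp u u1 u2 ps ps1 ps2"
 let ?P = "form kp Ph Ph1 Ph2 ps ps1 ps2"
 let ?H = "form kp h h1 h2 ps ps1 ps2"
 have e: "?E x - ?P x = ?H x" for x by (simp add: Ph_def Ph1_def Ph2_def algebra_simps)
 note Ei = test_integrable[OF t] and Pi = h_integrable[OF t]
 have H: "sint Om ?H" using set_integral_diff(1)[OF Ei Pi] unfolding e .
 have HI: "(SINT x:Om. ?P x) = - (SINT x:Om. ?H x)"
  using set_integral_diff(2)[OF Ei Pi] weak_form[OF t pos] unfolding e by simp
 note sp = Om_split[OF H]
 show "sint cav ?H" by (rule sp(1))
 let ?G = "form kp (gw kp th) (gw1 kp th) (gw2 kp th) ps ps1 ps2"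
 have gi: "sint up ?G" using sp(2)
  by (rule set_integrable_eq) (simp add: h_up)
 have tt: "!!x. x : up ==> grad_at ps (ps1 x) (ps2 x) x" "!!x. x : up ==> cmod (ps x) <= M"
  "!!x. x : up ==> norm x >= R ==> ps x = 0 \<and> ps1 x = 0 \<and> ps2 x = 0" "continuous_on up ps1" "continuous_on up ps2"
  using t subsets(2) unfolding test_fun_def by (blast intro: continuous_on_subset)+
 have "(SINT x:up. ?H x) = (SINT x:up. ?G x)"
  by (rule set_integral_eq) (simp add: h_up)
 also have "... = 0" by (rule gw_weak[OF kp tt(1,4,5,2) pos(3,2) tt(3) gi])
 finally show "(SINT x:Om. ?P x) = - (SINT x:cav. ?H x)" using HI sp(3) by simp
qed

end

section \<open>Truncated test functions and the energy identity\<close>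

text \<open>Test functions have to be bounded, but the solution might be unbounded at the corners; hence trunc k, which tends to cnj.\<close>

definition trunc :: "real => complex => complex" where
 "trunc k z = (1 / (1 + nsq z / k)) *R cnj z"

definition trunc' :: "real => complex => complex => complex" where
 "trunc' k z a = (1 / (1 + nsq z / k)) *R cnj a - (2 / k * Re (cnj z * a) * (1 / (1 + nsq z / k))^2) *R cnj z"

lemma trunc_pos: "0 < k ==> 1 <= 1 + nsq z / k" "0 < k ==> 1 + nsq z / k ~= 0"
proof -
 assume "0 < k"
 hence "0 <= nsq z / k" by simp
 thus "1 <= 1 + nsq z / k" "1 + nsq z / k ~= 0" by linarith+
qed

lemma trunc_grad:
 assumes k: "0 < k" and f: "grad_at f a b x"
 shows "grad_at (%x. trunc k (f x)) (trunc' k (f x) a) (trunc' k (f x) b) x"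
proof -
 note re = grad_at_linear[OF bounded_linear_Re f] and im = grad_at_linear[OF bounded_linear_Im f]
 have s: "grad_at (%x. nsq (f x)) (2 * Re (cnj (f x) * a)) (2 * Re (cnj (f x) * b)) x"
 proof -
  have "(%x. nsq (f x)) = (%x. Re (f x) * Re (f x) + Im (f x) * Im (f x))"
   by (rule ext) (simp add: cmod_power2 power2_eq_square[symmetric])
  thus ?thesis
   using grad_at_add[OF grad_at_mult[OF re re] grad_at_mult[OF im im]] by (simp add: algebra_simps)
 qed
 let ?q = "1 / (1 + nsq (f x) / k)"
 have d: "((%s. 1 / (1 + s / k)) has_real_derivative - (1 / k) * ?q^2) (at (nsq (f x)))"
 proof -
  have "((%s. inverse (1 + s / k)) has_real_derivative - (inverse (1 + nsq (f x) / k) * (0 + 1 / k) * inverse (1 + nsq (f x) / k))) (at (nsq (f x)))"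
   by (rule DERIV_inverse'[OF DERIV_add[OF DERIV_const DERIV_cdivide[OF DERIV_ident]] trunc_pos(2)[OF k]])
  thus ?thesis by (simp add: inverse_eq_divide power2_eq_square mult_ac)
 qed
 show ?thesis
  using grad_at_scaleR[OF grad_at_comp[OF s d] grad_at_cnj[OF f]]
  unfolding trunc_def trunc'_def by (simp add: algebra_simps)
qed

text \<open>The bounds by |z| and 3 |a| do not involve \<open>k\<close> and dominate the limit k to
  infinity. Only the sup bound sqrt k grows, and it is used solely to make the test functions
  admissible.\<close>

lemma trunc_bounds:
 assumes k: "0 < k"
 shows "cmod (trunc k z) <= sqrt k" "cmod (trunc k z) <= cmod z" "cmod (trunc' k z a) <= 3 * cmod a"
proof -
 let ?s = "nsq z" and ?q = "1 / (1 + nsq z / k)"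
 have q: "0 < ?q" "?q <= 1" using trunc_pos(1)[OF k, of z] by (auto simp: divide_le_eq)
 have sq: "?s * ?q <= k"
 proof -
  have "?s <= k * (1 + ?s / k)" using k by (simp add: distrib_left)
  thus ?thesis using trunc_pos(1)[OF k, of z] by (simp add: divide_le_eq)
 qed
 have n: "cmod (trunc k z) = ?q * cmod z" unfolding trunc_def using q by (simp only: norm_scaleR complex_mod_cnj abs_of_pos)
 show "cmod (trunc k z) <= cmod z" unfolding n using q by (intro mult_left_le_one_le) auto
 have "nsq (trunc k z) = (?s * ?q) * ?q" unfolding n by (simp only: power_mult_distrib power2_eq_square mult_ac)
 also have "... <= k * 1" using sq q k by (intro mult_mono) auto
 finally show "cmod (trunc k z) <= sqrt k" by (intro real_le_rsqrt) simp
 have c: "2 / k * \<bar>Re (cnj z * a)\<bar> * ?q^2 * cmod z <= 2 * cmod a"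
 proof -
  have "\<bar>Re (cnj z * a)\<bar> <= cmod z * cmod a" using abs_Re_le_cmod[of "cnj z * a"] by (simp add: norm_mult)
  hence "2 / k * \<bar>Re (cnj z * a)\<bar> * ?q^2 * cmod z <= 2 / k * (cmod z * cmod a) * ?q^2 * cmod z"
   using k by (intro mult_right_mono mult_left_mono) auto
  also have "... = 2 * cmod a * (((?s * ?q) / k) * ?q)"
  proof -
   have "2 / k * (y * c) * q^2 * y = 2 * c * (((y^2 * q) / k) * q)" for y c q :: real by (simp add: power2_eq_square)
   thus ?thesis .
  qed
  also have "... <= 2 * cmod a * (1 * 1)"
  proof (intro mult_left_mono mult_mono)
   show "?s * ?q / k <= 1" using sq k by (simp only: divide_le_eq_1_pos)
  qed (use q in auto)
  finally show ?thesis by simp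
 qed
 have "cmod (trunc' k z a) <= ?q * cmod a + 2 / k * \<bar>Re (cnj z * a)\<bar> * ?q^2 * cmod z"
 proof -
  have e: "\<bar>2 / k * y * ?q^2\<bar> = 2 / k * \<bar>y\<bar> * ?q^2" for y
   using k by (simp only: abs_mult abs_divide abs_numeral abs_of_pos abs_power2)
  show ?thesis
   unfolding trunc'_def
   by (rule norm_triangle_le_diff) (simp only: norm_scaleR e complex_mod_cnj abs_of_pos[OF q(1)] order_refl)
 qed
 also have "... <= 1 * cmod a + 2 * cmod a" using q c by (intro add_mono mult_right_mono) auto
 finally show "cmod (trunc' k z a) <= 3 * cmod a" by simp
qed

lemma trunc_cont:
 assumes "0 < k" "continuous_on S f" "continuous_on S a"
 shows "continuous_on S (%x. trunc k (f x))" "continuous_on S (%x. trunc' k (f x) (a x))"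
 unfolding trunc_def trunc'_def by (intro continuous_intros assms ballI trunc_pos(2); use assms in simp)+

lemma trunc_lim: "(%j. trunc (real (Suc j)) z) ----> cnj z" "(%j. trunc' (real (Suc j)) z a) ----> cnj a"
proof -
 have i: "(%j. c / real (Suc j)) ----> 0" for c :: real
  using tendsto_mult[OF tendsto_const[of c] LIMSEQ_inverse_real_of_nat] by (simp add: divide_inverse)
 have q: "(%j. 1 / (1 + nsq z / real (Suc j))) ----> 1 / (1 + 0)"
  by (intro tendsto_intros i) simp
 have "(%j. trunc (real (Suc j)) z) ----> (1 / (1 + 0)) *R cnj z"
  unfolding trunc_def by (intro tendsto_intros q)
 thus "(%j. trunc (real (Suc j)) z) ----> cnj z" by simp
 have "(%j. trunc' (real (Suc j)) z a) ----> (1 / (1 + 0)) *R cnj a - (0 * Re (cnj z * a) * (1 / (1 + 0))^2) *R cnj z"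
  unfolding trunc'_def by (intro tendsto_intros q i)
 thus "(%j. trunc' (real (Suc j)) z a) ----> cnj a" by simp
qed

text \<open>This is \<open>chi (ln (kp * norm x))\<close>, the cutoff of the strip seen in the
  plane.\<close>

definition radial :: "real => real^2 => real" where "radial kp x = 1 - step (ln (kp * norm x) + 2)"

definition radial' :: "2 => real => real^2 => real" where
 "radial' i kp x = - step' (ln (kp * norm x) + 2) * (x $ i / (norm x)^2)"

lemma norm_pos: "x ~= 0 ==> 0 < (x $ 1)^2 + (x $ 2)^2" for x :: "real^2"
proof -
 assume "x ~= 0"
 hence "norm x > 0" by simp
 thus ?thesis unfolding norm_pt by simp
qed

lemma radial_grad:
 assumes kp: "0 < kp" and x: "x ~= 0"
 shows "grad_at (radial kp) (radial' 1 kp x) (radial' 2 kp x) x"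
proof -
 have p: "0 < (x $ 1)^2 + (x $ 2)^2" by (rule norm_pos[OF x])
 have nn: "(norm x)^2 = (x $ 1)^2 + (x $ 2)^2" unfolding norm_pt by simp
 have s: "grad_at (%z. (z $ 1)^2 + (z $ 2)^2) (2 * x $ 1) (2 * x $ 2) x"
  using grad_at_add[OF grad_at_mult[OF grad_at_nth(1) grad_at_nth(1)] grad_at_mult[OF grad_at_nth(2) grad_at_nth(2)]]
  by (simp add: power2_eq_square)
 let ?l = "%s. 1 - step (ln kp + ln s / 2 + 2)"
 have l: "ln (kp * norm z) = ln kp + ln ((z $ 1)^2 + (z $ 2)^2) / 2" if "z ~= 0" for z :: "real^2"
 proof -
  have "ln (norm z) = ln ((z $ 1)^2 + (z $ 2)^2) / 2" unfolding norm_pt using norm_pos[OF that] by (simp add: ln_sqrt)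
  thus ?thesis using kp that by (simp add: ln_mult)
 qed
 have "((%s. ln kp + ln s / 2 + 2) has_real_derivative 0 + (inverse ((x $ 1)^2 + (x $ 2)^2)) / 2 + 0) (at ((x $ 1)^2 + (x $ 2)^2))"
  by (intro DERIV_add DERIV_const DERIV_cdivide DERIV_ln p)
 from DERIV_diff[OF DERIV_const[of 1] DERIV_chain2[OF step_deriv this]]
 have "(?l has_real_derivative - step' (ln (kp * norm x) + 2) * (1 / (norm x)^2) / 2) (at ((x $ 1)^2 + (x $ 2)^2))"
  unfolding l[OF x] nn by (simp add: inverse_eq_divide)
 from grad_at_comp[OF s this] have g: "grad_at (%z. ?l ((z $ 1)^2 + (z $ 2)^2)) (radial' 1 kp x) (radial' 2 kp x) x"
  by (simp add: radial'_def)
 show ?thesis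
  by (rule grad_at_transform[OF g open_delete[OF open_UNIV, of 0]]) (use x l in \<open>auto simp: radial_def\<close>)
qed

lemma radial_cont:
 assumes "0 < kp" "0 \<notin> S"
 shows "continuous_on S (radial kp)" "continuous_on S (radial' i kp)"
 unfolding radial_def[abs_def] radial'_def[abs_def] using assms by (intro continuous_intros; auto)+

lemma radial_props:
 assumes kp: "0 < kp" and x: "x ~= 0"
 shows "0 <= radial kp x" "radial kp x <= 1" "\<bar>radial' i kp x\<bar> <= 3/2 * (kp * exp 2)"
  "norm x >= exp (-1) / kp ==> radial kp x = 0 \<and> radial' i kp x = 0"
  "norm x <= exp (-2) / kp ==> radial kp x = 1 \<and> radial' i kp x = 0"
proof -
 have n: "0 < norm x" "0 < kp * norm x" using assms by auto
 show "0 <= radial kp x" "radial kp x <= 1" by (simp_all add: radial_def step_bounds)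
 have ge: "ln (kp * norm x) >= a" if "norm x >= exp a / kp" for a
  using that kp n by (subst ln_ge_iff) (auto simp: divide_le_eq mult.commute)
 have le: "ln (kp * norm x) <= a" if "norm x <= exp a / kp" for a
 proof -
  have "kp * norm x <= exp a" using that kp by (simp add: le_divide_eq mult.commute)
  hence "ln (kp * norm x) <= ln (exp a)" using n by (subst ln_le_cancel_iff) auto
  thus ?thesis by simp
 qed
 show "norm x >= exp (-1) / kp ==> radial kp x = 0 \<and> radial' i kp x = 0"
  using ge[of "-1"] by (simp add: radial_def radial'_def)
 show small: "norm x <= exp (-2) / kp ==> radial kp x = 1 \<and> radial' i kp x = 0"
  using le[of "-2"] by (simp add: radial_def radial'_def)
 show "\<bar>radial' i kp x\<bar> <= 3/2 * (kp * exp 2)"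
 proof (cases "norm x <= exp (-2) / kp")
  case True
  thus ?thesis using small kp by simp
 next
  case False
  hence "1 <= kp * exp 2 * norm x" using kp by (simp add: exp_minus inverse_eq_divide divide_simps mult_ac not_le less_imp_le)
  have "\<bar>x $ i / (norm x)^2\<bar> = \<bar>x $ i\<bar> / (norm x)^2" by simp
  also have "... <= norm x / (norm x)^2" by (intro divide_right_mono component_le_norm_cart) simp
  also have "... = 1 / norm x" using n by (simp add: power2_eq_square)
  also have "... <= kp * exp 2" using n \<open>1 <= kp * exp 2 * norm x\<close> by (simp add: divide_le_eq)
  finally have "\<bar>x $ i / (norm x)^2\<bar> <= kp * exp 2" .
  thus ?thesis unfolding radial'_def abs_mult abs_minus_cancel
   by (intro mult_mono step_bounds(3)) auto
 qed
qed

context cavity_solution begin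

lemma Ph_bottom:
 assumes x: "0 < x" "x < ep"
 shows "((%y. Ph (pt x y)) \<longlongrightarrow> 0) (at_right (- d))"
proof -
 have p: "((%y. pt x y) \<longlongrightarrow> pt x (- d)) (at_right (- d))"
  using continuous_on_tendsto_compose[of UNIV "%y. pt x y" "%y. y" "- d" "at_right (- d)"]
  by (simp add: continuous_intros)
 have "filterlim (%y. pt x y) (at (pt x (- d)) within Om) (at_right (- d))"
  unfolding filterlim_at
 proof (intro conjI p)
  have "\<forall>\<^sub>F y in at_right (- d). - d < y" by (rule eventually_at_right_less)
  thus "\<forall>\<^sub>F y in at_right (- d). pt x y : Om \<and> pt x y ~= pt x (- d)"
   by eventually_elim (use x in \<open>auto simp: Om_iff vec_eq_iff forall_2\<close>)
 qed
 from filterlim_compose[OF dirichlet_bottom this] x have 1: "((%y. u (pt x y)) \<longlongrightarrow> 0) (at_right (- d))" by simp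
 have "isCont h (pt x (- d))" by (rule grad_at_continuous[OF h_grad])
 from isCont_tendsto_compose[OF this p] have "((%y. h (pt x y)) \<longlongrightarrow> h (pt x (- d))) (at_right (- d))" .
 moreover have "h (pt x (- d)) = 0" using ramp_props(6)[OF d, of "pt x (- d)"] by (simp add: h_def)
 ultimately show ?thesis unfolding Ph_def using tendsto_diff[OF 1] by fastforce
qed

lemma cav_box: "cav = box (pt 0 (- d)) (pt ep (- d + d))"
 by (auto simp: cav_iff in_open_box)

lemma cav_ball: "cav \<subseteq> Om \<inter> ball 0 (ep + d)"
proof
 fix x assume x: "x : cav"
 have "norm x <= \<bar>x $ 1\<bar> + \<bar>x $ 2\<bar>" unfolding norm_pt by (rule sqrt_sum_squares_le_sum_abs)
 thus "x : Om \<inter> ball 0 (ep + d)" using x subsets(1) by (auto simp: cav_iff)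
qed

lemma cav_energy:
 "sint cav (%x. nsq (u x))" "sint cav (%x. nsq (u1 x))" "sint cav (%x. nsq (u2 x))"
 "sint cav (%x. nsq (Ph x))" "sint cav (%x. nsq (Ph1 x))" "sint cav (%x. nsq (Ph2 x))"
 by (rule set_integrable_subset[OF _ _ cav_ball]; use energy Ph_energy open_sets in auto)+

text \<open>The height \<open>s\<close> is variable because thin strips at the bottom are used as
  well: there the factor s^2 compensates the squared slope of the cutoff that keeps test functions
  off the bottom.\<close>

lemma poincare_Ph:
 assumes s: "0 < s" "s <= d"
 shows "(SINT z:box (pt 0 (- d)) (pt ep (- d + s)). nsq (Ph z)) <= s^2 * (SINT z:box (pt 0 (- d)) (pt ep (- d + s)). nsq (Ph2 z))"
proof -
 have sub: "box (pt 0 (- d)) (pt ep (- d + s)) \<subseteq> cav" using s by (auto simp: cav_iff in_open_box)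
 show ?thesis
 proof (rule poincare[OF s(1)])
  show "grad_at Ph (Ph1 z) (Ph2 z) z" if "z : box (pt 0 (- d)) (pt ep (- d + s))" for z
   using Ph_grad that sub subsets(1) by blast
  show "continuous_on (box (pt 0 (- d)) (pt ep (- d + s))) Ph2"
   by (rule continuous_on_subset[OF Ph_cont(3)]) (use sub subsets(1) in blast)
 qed (rule set_integrable_subset[OF cav_energy(4) _ sub] set_integrable_subset[OF cav_energy(6) _ sub] Ph_bottom; simp)+
qed

definition radial_term where
 "radial_term x = (of_real (radial' 1 kp x) * Ph1 x + of_real (radial' 2 kp x) * Ph2 x) * cnj (Ph x)"

definition energy_density where
 "energy_density x = nsq (Ph1 x) + nsq (Ph2 x) - kp^2 * nsq (Ph x)"

definition source where
 "source x = h1 x * cnj (Ph1 x) + h2 x * cnj (Ph2 x) - of_real (kp^2) * h x * cnj (Ph x)"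

lemma strip_small:
 assumes si: "si ----> 0" and i: "sint cav g"
 shows "(%j. SINT z:box (pt 0 (- d)) (pt ep (- d + min d (si j))). (g z :: real)) ----> 0"
proof (rule set_integral_vanishing[OF i])
 fix x assume "x : cav"
 hence "0 < x $ 2 + d" by (simp add: cav_iff)
 hence "\<forall>\<^sub>F j in sequentially. si j < x $ 2 + d" using si by (intro order_tendstoD)
 thus "\<forall>\<^sub>F j in sequentially. x \<notin> box (pt 0 (- d)) (pt ep (- d + min d (si j)))"
  by eventually_elim (auto simp: in_open_box)
qed (auto simp: cav_iff in_open_box)

text \<open>The test functions are \<open>radial\<close> times a bottom cutoff \<open>b j\<close>
  times the truncation of \<open>Ph\<close>. The truncation makes them bounded, \<open>b j\<close>
  makes them vanish near the bottom, and both are removed as j tends to infinity.\<close>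

theorem energy_identity:
 assumes small: "ep + d <= exp (-2) / kp"
 shows "sint Om (%x. of_real (radial kp x * energy_density x) + radial_term x)"
  and "sint cav source"
  and "(SINT x:Om. of_real (radial kp x * energy_density x) + radial_term x) = - (SINT x:cav. source x)"
proof -
 define R where "R = exp (-1) / kp"
 define K where "K = 3/2 * (kp * exp 2)"
 have R: "0 < R" and K: "0 < K" using kp by (simp_all add: R_def K_def)
 have nz: "x ~= 0" if "x : Om" for x using that by (auto simp: Om_iff)
 note Xp = radial_props[OF kp nz]
 have Xc: "continuous_on Om (radial kp)" "continuous_on Om (radial' i kp)" for i
  by (rule radial_cont[OF kp]; use nz in blast)+
 have Xcav: "radial kp x = 1 \<and> radial' i kp x = 0" if "x : cav" for x i
  by (rule Xp(5)) (use that cav_ball small in \<open>auto simp: subset_iff\<close>)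
 \<comment> \<open>Halved so that the transition of \<open>b j\<close>, which ends at height 2 si
   above the bottom, stays inside the cavity.\<close>
 define si where "si j = d * inverse (real (Suc j)) / 2" for j
 define k where "k j = real (Suc j)" for j
 have si: "0 < si j" "2 * si j <= d" for j
  using d by (simp_all add: si_def divide_le_eq inverse_eq_divide)
 have "si ----> d * 0 / 2" unfolding si_def[abs_def] by (intro tendsto_intros LIMSEQ_inverse_real_of_nat) simp
 hence si0: "si ----> 0" by simp
 have k: "0 < k j" for j by (simp add: k_def)
 define b where "b j x = step ((x $ 2 + d) / si j - 1)" for j and x :: "real^2"
 define b' where "b' j x = step' ((x $ 2 + d) / si j - 1) / si j" for j and x :: "real^2"
 have bg: "grad_at (b j) 0 (b' j x) x" for j x
 proof -
  have "((%y. step ((y + d) / si j - 1)) has_real_derivative step' ((x $ 2 + d) / si j - 1) * ((1 + 0) / si j - 0)) (at (x $ 2))"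
   by (rule DERIV_chain2[OF step_deriv]) (intro DERIV_diff DERIV_add DERIV_cdivide DERIV_ident DERIV_const)
  from grad_at_comp[OF grad_at_nth(2) this] show ?thesis unfolding b_def[abs_def] b'_def by simp
 qed
 have bc: "continuous_on S (b j)" "continuous_on S (b' j)" for S j
  unfolding b_def[abs_def] b'_def[abs_def] by (intro continuous_intros; use si(1)[of j] in simp)+
 have b01: "0 <= b j x" "b j x <= 1" for j x by (simp_all add: b_def step_bounds)
 have b'b: "\<bar>b' j x\<bar> <= 3/2 / si j" for j x
  unfolding b'_def abs_divide abs_of_pos[OF si(1)[of j]] using si(1)[of j] by (intro divide_right_mono step_bounds) simp
 have b'z: "b' j x = 0" if "- d + 2 * si j <= x $ 2" for j x
 proof -
  have "(x $ 2 + d) / si j - 1 >= 1" using that si(1)[of j] by (simp add: le_divide_eq)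
  thus ?thesis by (simp add: b'_def)
 qed
 have bz: "b j x = 0 \<and> b' j x = 0" if "x $ 2 <= - d + si j" for j x
 proof -
  have "(x $ 2 + d) / si j - 1 <= 0" using that si(1)[of j] by (simp add: divide_le_eq)
  thus ?thesis by (simp add: b_def b'_def)
 qed
 have blim: "(%j. b j x) ----> 1" if x: "x : Om" for x
 proof -
  have "0 < (x $ 2 + d) / 2" using x d by (auto simp: Om_iff)
  hence "\<forall>\<^sub>F j in sequentially. si j < (x $ 2 + d) / 2" using si0 by (intro order_tendstoD)
  hence "\<forall>\<^sub>F j in sequentially. b j x = 1"
  proof eventually_elim
   case (elim j)
   hence "(x $ 2 + d) / si j - 1 >= 1" using si(1)[of j] by (simp add: le_divide_eq)
   thus ?case by (simp add: b_def)
  qed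
  thus ?thesis by (rule tendsto_eventually)
 qed
 define T where "T j x = trunc (k j) (Ph x)" for j x
 define T1 where "T1 j x = trunc' (k j) (Ph x) (Ph1 x)" for j x
 define T2 where "T2 j x = trunc' (k j) (Ph x) (Ph2 x)" for j x
 note Td = T_def[abs_def] T1_def[abs_def] T2_def[abs_def]
 have Tg: "grad_at (T j) (T1 j x) (T2 j x) x" if "x : Om" for j x
  unfolding Td by (rule trunc_grad[OF k Ph_grad[OF that]])
 have Tc: "continuous_on Om (T j)" "continuous_on Om (T1 j)" "continuous_on Om (T2 j)" for j
  unfolding Td
  by - (rule trunc_cont(1)[OF k Ph_cont(1) Ph_cont(1)], rule trunc_cont(2)[OF k Ph_cont(1) Ph_cont(2)],
    rule trunc_cont(2)[OF k Ph_cont(1) Ph_cont(3)])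
 have Tb: "cmod (T j x) <= sqrt (k j)" "cmod (T j x) <= cmod (Ph x)" "cmod (T1 j x) <= 3 * cmod (Ph1 x)" "cmod (T2 j x) <= 3 * cmod (Ph2 x)" for j x
  unfolding T_def T1_def T2_def by (intro trunc_bounds k)+
 have Tl: "(%j. T j x) ----> cnj (Ph x)" "(%j. T1 j x) ----> cnj (Ph1 x)" "(%j. T2 j x) ----> cnj (Ph2 x)" for x
  unfolding T_def T1_def T2_def k_def by (rule trunc_lim)+
 define Y where "Y j x = radial kp x * b j x" for j x
 define Y1 where "Y1 j x = radial' 1 kp x * b j x" for j x
 define Y2 where "Y2 j x = radial kp x * b' j x + radial' 2 kp x * b j x" for j x
 have Yg: "grad_at (Y j) (Y1 j x) (Y2 j x) x" if "x : Om" for j x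
  using grad_at_mult[OF radial_grad[OF kp nz[OF that]] bg[of j x]]
  unfolding Y_def[abs_def] Y1_def Y2_def by simp
 have Yc: "continuous_on Om (Y j)" "continuous_on Om (Y1 j)" "continuous_on Om (Y2 j)" for j
  unfolding Y_def[abs_def] Y1_def[abs_def] Y2_def[abs_def] by (intro continuous_intros Xc bc)+
 have Xb: "\<bar>radial kp x * b j x\<bar> <= 1" if "x : Om" for j x
  using Xp(1,2)[OF that] b01[of j x] by (simp add: mult_le_one)
 have X'b: "\<bar>radial' i kp x * b j x\<bar> <= K" if "x : Om" for i j x
 proof -
  have "\<bar>radial' i kp x\<bar> * \<bar>b j x\<bar> <= K * 1"
   by (rule mult_mono) (use Xp(3)[OF that, of i] b01[of j x] K in \<open>auto simp: K_def\<close>)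
  thus ?thesis by (simp add: abs_mult)
 qed
 have Yb: "\<bar>Y j x\<bar> <= 1" "\<bar>Y1 j x\<bar> <= K" "\<bar>Y2 j x\<bar> <= 3/2 / si j + K" if x: "x : Om" for j x
 proof -
  show "\<bar>Y j x\<bar> <= 1" "\<bar>Y1 j x\<bar> <= K" unfolding Y_def Y1_def by (rule Xb[OF x], rule X'b[OF x])
  have "\<bar>radial kp x\<bar> * \<bar>b' j x\<bar> <= 1 * (3/2 / si j)"
   by (rule mult_mono) (use Xp(1,2)[OF x] b'b[of j x] in auto)
  thus "\<bar>Y2 j x\<bar> <= 3/2 / si j + K" unfolding Y2_def
   using X'b[OF x, of 2 j] abs_triangle_ineq[of "radial kp x * b' j x" "radial' 2 kp x * b j x"] by (simp add: abs_mult)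
 qed
 define ps where "ps j x = Y j x *R T j x" for j x
 define ps1 where "ps1 j x = Y j x *R T1 j x + Y1 j x *R T j x" for j x
 define ps2 where "ps2 j x = Y j x *R T2 j x + Y2 j x *R T j x" for j x
 have Yz: "Y j x = 0 \<and> Y1 j x = 0 \<and> Y2 j x = 0" if "x : Om" "norm x >= R \<or> x $ 2 <= - d + si j" for j x
  using that(2)
 proof
  assume "norm x >= R"
  thus ?thesis using Xp(4)[OF that(1)] by (simp add: R_def Y_def Y1_def Y2_def)
 next
  assume "x $ 2 <= - d + si j"
  thus ?thesis using bz[of x j] by (simp add: Y_def Y1_def Y2_def)
 qed
 have psc: "continuous_on Om (ps1 j)" "continuous_on Om (ps2 j)" for j
  unfolding ps1_def[abs_def] ps2_def[abs_def] by (intro continuous_intros Yc Tc)+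
 let ?S = "Om \<inter> ball 0 R"
 have S: "open ?S" by (intro open_Int open_sets open_ball)
 have one: "sint ?S (%_. c)" "sint cav (%_. c)" for c :: real
  by (rule set_integrable_const; use S open_sets cav_ball in \<open>auto intro: bounded_subset[OF bounded_ball]\<close>)+
 have sqi: "sint Om (%x. nsq (p x))"
  if pc: "continuous_on Om p" and pb: "!!x. x : Om ==> cmod (p x) <= 3 * cmod (q x) + c"
   and pz: "!!x. x : Om ==> norm x >= R ==> p x = 0" and q: "sint ?S (%x. nsq (q x))" for p q :: "real^2 => complex" and c
 proof (rule set_integrable_superset[where S = ?S])
  have "sint ?S (%x. 18 * nsq (q x) + 2 * c^2)"
   by (intro set_integral_add set_integrable_mult_right q one)
  thus "sint ?S (%x. nsq (p x))"
  proof (rule set_integrable_bound)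
   show "set_borel_measurable lborel ?S (%x. nsq (p x))"
    by (intro set_borel_measurable_open S continuous_intros continuous_on_subset[OF pc] Int_lower1)
   have "nsq (p x) <= 18 * nsq (q x) + 2 * c^2" if "x : Om" for x
   proof -
    have "nsq (p x) <= (3 * cmod (q x) + c)^2" by (intro power_mono pb that) simp
    thus ?thesis using sum_squares_bound[of "3 * cmod (q x)" c] by (simp add: power2_sum power_mult_distrib)
   qed
   thus "AE x in lborel. x : ?S \<longrightarrow> norm (nsq (p x)) <= norm (18 * nsq (q x) + 2 * c^2)" by (intro AE_I2) simp
  qed
 qed (use pz in \<open>auto simp: not_less\<close>)
 have tf: "test_fun (ps j) (ps1 j) (ps2 j) (sqrt (k j)) R (si j)" for j
  unfolding test_fun_def
 proof (intro conjI ballI impI psc)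
  fix x assume x: "x : Om"
  show "grad_at (ps j) (ps1 j x) (ps2 j x) x"
   unfolding ps_def[abs_def] ps1_def ps2_def by (rule grad_at_scaleR[OF Yg[OF x] Tg[OF x]])
  have "\<bar>Y j x\<bar> * cmod (T j x) <= 1 * sqrt (k j)" by (intro mult_mono Yb x Tb) auto
  thus "cmod (ps j x) <= sqrt (k j)" by (simp add: ps_def)
  assume "norm x >= R \<or> x $ 2 <= - d + si j"
  from Yz[OF x this] show "ps j x = 0" "ps1 j x = 0" "ps2 j x = 0" by (simp_all add: ps_def ps1_def ps2_def)
 next
  have gen: "cmod (y *R t + y' *R t') <= 3 * q + B * s" if "\<bar>y\<bar> <= 1" "\<bar>y'\<bar> <= B" "cmod t <= 3 * q" "cmod t' <= s" for y y' q B s t t'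
  proof -
   have "\<bar>y\<bar> * cmod t <= 1 * (3 * q)" "\<bar>y'\<bar> * cmod t' <= B * s" using that by (intro mult_mono; auto)+
   thus ?thesis using norm_triangle_ineq[of "y *R t" "y' *R t'"] by simp
  qed
  show "sint Om (%x. nsq (ps1 j x))"
  proof (rule sqi[OF psc(1) _ _ Ph_energy(2)])
   show "cmod (ps1 j x) <= 3 * cmod (Ph1 x) + K * sqrt (k j)" if "x : Om" for x
    unfolding ps1_def by (rule gen) (use Yb[OF that, of j] Tb in auto)
   show "ps1 j x = 0" if "x : Om" "R <= norm x" for x using Yz[OF that(1), of j] that(2) by (simp add: ps1_def)
  qed
  show "sint Om (%x. nsq (ps2 j x))"
  proof (rule sqi[OF psc(2) _ _ Ph_energy(3)])
   show "cmod (ps2 j x) <= 3 * cmod (Ph2 x) + (3/2 / si j + K) * sqrt (k j)" if "x : Om" for x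
    unfolding ps2_def by (rule gen) (use Yb[OF that, of j] Tb in auto)
   show "ps2 j x = 0" if "x : Om" "R <= norm x" for x using Yz[OF that(1), of j] that(2) by (simp add: ps2_def)
  qed
 qed
 \<comment> \<open>The tested identity splits into \<open>A j\<close>, the energy with the radial
   cutoff term, \<open>C j\<close>, the source, and \<open>D j\<close>, the term with the slope of
   \<open>b j\<close>. In \<open>D j\<close> the contributions of \<open>Ph2\<close> and
   \<open>h2\<close> recombine to \<open>u2\<close>.\<close>
 define A where "A j x = of_real (Y j x) * (form kp Ph Ph1 Ph2 (T j) (T1 j) (T2 j) x)
   + (of_real (radial' 1 kp x * b j x) * Ph1 x + of_real (radial' 2 kp x * b j x) * Ph2 x) * T j x" for j x
 define C where "C j x = of_real (b j x) * (form kp h h1 h2 (T j) (T1 j) (T2 j) x)" for j x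
 define D where "D j x = of_real (b' j x) * (u2 x * T j x)" for j x
 define P where "P j = box (pt 0 (- d)) (pt ep (- d + min d (2 * si j)))" for j
 have cavc: "continuous_on cav f" if "continuous_on Om f" for f :: "real^2 => complex"
  by (rule continuous_on_subset[OF that subsets(1)])
 have prod: "cmod (y * t) <= c * (nsq y + q^2)" if "cmod t <= 2 * c * q" "0 <= c" "0 <= q" for y t :: complex and c q
 proof -
  have "cmod y * cmod t <= cmod y * (2 * c * q)" using that by (intro mult_left_mono) auto
  also have "... = c * (2 * cmod y * q)" by simp
  also have "... <= c * (nsq y + q^2)" using that sum_squares_bound[of "cmod y" q] by (intro mult_left_mono) auto
  finally show ?thesis by (simp add: norm_mult)
 qed
 have Ac: "continuous_on Om (A j)" for j
  unfolding A_def[abs_def] by (intro continuous_intros Yc Xc bc Tc Ph_cont)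
 have Cc: "continuous_on cav (C j)" for j
  unfolding C_def[abs_def] by (intro continuous_intros bc cavc[OF Tc(1)] cavc[OF Tc(2)] cavc[OF Tc(3)] h_cont)
 let ?A = "%x. of_real (radial kp x) * (Ph1 x * cnj (Ph1 x) + Ph2 x * cnj (Ph2 x) - of_real (kp^2) * Ph x * cnj (Ph x))
   + (of_real (radial' 1 kp x) * Ph1 x + of_real (radial' 2 kp x) * Ph2 x) * cnj (Ph x)"
 let ?q = "%x. 3 * nsq (Ph1 x) + 3 * nsq (Ph2 x) + kp^2 * nsq (Ph x)
   + K * (nsq (Ph1 x) + nsq (Ph x)) + K * (nsq (Ph2 x) + nsq (Ph x))"
 let ?gA = "%x. ind (ball 0 R) x * ?q x"
 have LA: "sint Om (A j)" "sint Om ?A" "(%j. SINT x:Om. A j x) ----> (SINT x:Om. ?A x)" for j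
 proof -
  have "sint ?S ?q" by (intro set_integral_add set_integrable_mult_right Ph_energy)
  hence "sint ?S ?gA" by (rule set_integrable_eq) simp
  hence gi: "sint Om ?gA" by (rule set_integrable_superset) auto
  have Ab: "cmod (A j x) <= ?gA x" if x: "x : Om" for j x
  proof (cases "norm x >= R")
   case True
   thus ?thesis using Yz[OF x, of j] Xp(4)[OF x] by (simp add: A_def R_def)
  next
   case False
   have t: "cmod (Ph1 x * T1 j x) <= 3 * nsq (Ph1 x)" "cmod (Ph2 x * T2 j x) <= 3 * nsq (Ph2 x)"
    using prod[of "T1 j x" "3/2" "cmod (Ph1 x)" "Ph1 x"] prod[of "T2 j x" "3/2" "cmod (Ph2 x)" "Ph2 x"] Tb by simp_all
   have "cmod (Ph x) * cmod (T j x) <= cmod (Ph x) * cmod (Ph x)" by (intro mult_left_mono Tb) simp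
   from mult_left_mono[OF this zero_le_power2[of kp]]
   have t3: "cmod (of_real (kp^2) * Ph x * T j x) <= kp^2 * nsq (Ph x)"
    by (simp only: norm_mult norm_of_real abs_power2 mult.assoc power2_eq_square[of "cmod (Ph x)"])
   have p1: "cmod (of_real (Y j x) * (form kp Ph Ph1 Ph2 (T j) (T1 j) (T2 j) x)) <= 3 * nsq (Ph1 x) + 3 * nsq (Ph2 x) + kp^2 * nsq (Ph x)"
   proof -
    have "cmod (form kp Ph Ph1 Ph2 (T j) (T1 j) (T2 j) x) <= 3 * nsq (Ph1 x) + 3 * nsq (Ph2 x) + kp^2 * nsq (Ph x)"
     by (intro norm_triangle_le_diff norm_triangle_le add_mono t t3 order_refl norm_triangle_ineq order_trans[OF norm_triangle_ineq])
    hence "\<bar>Y j x\<bar> * cmod (form kp Ph Ph1 Ph2 (T j) (T1 j) (T2 j) x) <= 1 * (3 * nsq (Ph1 x) + 3 * nsq (Ph2 x) + kp^2 * nsq (Ph x))"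
     by (intro mult_mono Yb x) auto
    thus ?thesis unfolding norm_mult[of "of_real (Y j x)"] norm_of_real by simp
   qed
   have p2: "cmod (of_real (radial' i kp x * b j x) * q * T j x) <= K * (nsq q + nsq (Ph x))" for i and q :: complex
   proof -
    have "cmod (of_real (radial' i kp x * b j x) * T j x) <= K * cmod (Ph x)"
     unfolding norm_mult norm_of_real by (intro mult_mono X'b x Tb) (use K in auto)
    moreover have "0 <= K * cmod (Ph x)" "2 * K * cmod (Ph x) = K * cmod (Ph x) + K * cmod (Ph x)" using K by simp_all
    ultimately have "cmod (of_real (radial' i kp x * b j x) * T j x) <= 2 * K * cmod (Ph x)" by linarith
    from prod[OF this, of q] K show ?thesis by (simp add: mult.assoc mult.left_commute)
   qed
   have e: "A j x = of_real (Y j x) * (form kp Ph Ph1 Ph2 (T j) (T1 j) (T2 j) x)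
    + of_real (radial' 1 kp x * b j x) * Ph1 x * T j x + of_real (radial' 2 kp x * b j x) * Ph2 x * T j x"
    unfolding A_def by (simp only: distrib_right add.assoc)
   have "cmod (A j x) <= ?q x"
    unfolding e by (intro norm_triangle_le add_mono p1 p2 order_trans[OF norm_triangle_ineq])
   thus ?thesis using False by simp
  qed
  have Al: "(%j. A j x) ----> ?A x" if x: "x : Om" for x
  proof -
   have "(%j. A j x) ----> of_real (radial kp x * 1) * (Ph1 x * cnj (Ph1 x) + Ph2 x * cnj (Ph2 x) - of_real (kp^2) * Ph x * cnj (Ph x))
   + (of_real (radial' 1 kp x * 1) * Ph1 x + of_real (radial' 2 kp x * 1) * Ph2 x) * cnj (Ph x)"
    unfolding A_def Y_def by (intro tendsto_intros blim x Tl)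
   thus ?thesis by (simp only: mult_1_right)
  qed
  have Ainf: "continuous_on Om ?A" by (intro continuous_intros Xc Ph_cont)
  note L = set_dominated_convergence[OF open_sets(1) Ac Ainf gi Ab Al]
  show "sint Om (A j)" "sint Om ?A" "(%j. SINT x:Om. A j x) ----> (SINT x:Om. ?A x)"
   by - ((rule L(1); assumption), (rule L(2); assumption), (rule L(3); assumption))
 qed
 have LC: "sint cav (C j)" "sint cav source" "(%j. SINT x:cav. C j x) ----> (SINT x:cav. source x)" for j
 proof -
  let ?gC = "%x. 3/2 * ((2 * kp)^2 + nsq (Ph1 x)) + 3/2 * ((2 * kp + 3 / d)^2 + nsq (Ph2 x)) + kp^2 * (2^2 + nsq (Ph x))"
  have gi: "sint cav ?gC"
   by (intro set_integral_add set_integrable_mult_right cav_energy one)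
  have Cb: "cmod (C j x) <= ?gC x" for j x
  proof -
   have pp: "cmod (y * t) <= c * (B^2 + q^2)" if "cmod t <= 2 * c * q" "0 <= c" "0 <= q" "cmod y <= B" for y t :: complex and c q B
   proof -
    have "nsq y <= B^2" using that by (intro power_mono) auto
    hence "c * (nsq y + q^2) <= c * (B^2 + q^2)" using that by (intro mult_left_mono) auto
    thus ?thesis using prod[OF that(1-3), of y] by linarith
   qed
   have t3: "cmod (of_real (kp^2) * T j x) <= 2 * kp^2 * cmod (Ph x)"
   proof -
    have "kp^2 * cmod (T j x) <= kp^2 * cmod (Ph x)" by (intro mult_left_mono Tb) simp
    moreover have "0 <= kp^2 * cmod (Ph x)" "2 * kp^2 * cmod (Ph x) = kp^2 * cmod (Ph x) + kp^2 * cmod (Ph x)" by simp_all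
    ultimately show ?thesis unfolding norm_mult norm_of_real abs_power2 by linarith
   qed
   have q1: "cmod (h1 x * T1 j x) <= 3/2 * ((2 * kp)^2 + nsq (Ph1 x))" by (rule pp) (use Tb h_bounds in auto)
   have q2: "cmod (h2 x * T2 j x) <= 3/2 * ((2 * kp + 3 / d)^2 + nsq (Ph2 x))" by (rule pp) (use Tb h_bounds in auto)
   have q3: "cmod (h x * (of_real (kp^2) * T j x)) <= kp^2 * (2^2 + nsq (Ph x))" by (rule pp[OF t3]) (use h_bounds in auto)
   have q3': "of_real (kp^2) * h x * T j x = h x * (of_real (kp^2) * T j x)" by simp
   have "cmod (form kp h h1 h2 (T j) (T1 j) (T2 j) x) <= ?gC x"
    unfolding q3' by (intro norm_triangle_le_diff add_mono q1 q2 q3 order_trans[OF norm_triangle_ineq])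
   hence "\<bar>b j x\<bar> * cmod (form kp h h1 h2 (T j) (T1 j) (T2 j) x) <= 1 * ?gC x"
    using b01[of j x] by (intro mult_mono) auto
   thus ?thesis unfolding C_def norm_mult[of "of_real (b j x)"] norm_of_real by simp
  qed
  have Cl: "(%j. C j x) ----> source x" if x: "x : cav" for x
  proof -
   have "x : Om" using x subsets(1) by blast
   hence "(%j. C j x) ----> of_real 1 * (h1 x * cnj (Ph1 x) + h2 x * cnj (Ph2 x) - of_real (kp^2) * h x * cnj (Ph x))"
    unfolding C_def by (intro tendsto_intros blim Tl)
   thus ?thesis by (simp add: source_def)
  qed
  have Cinf: "continuous_on cav source"
   unfolding source_def[abs_def] by (intro continuous_intros h_cont cavc[OF Ph_cont(1)] cavc[OF Ph_cont(2)] cavc[OF Ph_cont(3)])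
  note L = set_dominated_convergence[OF open_sets(2) Cc Cinf gi Cb Cl]
  show "sint cav (C j)" "sint cav source" "(%j. SINT x:cav. C j x) ----> (SINT x:cav. source x)"
   by - ((rule L(1); assumption), (rule L(2); assumption), (rule L(3); assumption))
 qed
 have D: "(SINT x:cav. D j x) = - (SINT x:Om. A j x) - (SINT x:cav. C j x)" "sint cav (D j)" for j
 proof -
  let ?P = "form kp Ph Ph1 Ph2 (ps j) (ps1 j) (ps2 j)"
  let ?H = "form kp h h1 h2 (ps j) (ps1 j) (ps2 j)"
  let ?E = "%x. of_real (radial kp x * b' j x) * (Ph2 x * T j x)"
  let ?F = "%x. of_real (b' j x) * (h2 x * T j x)"
  have PE: "?P x - A j x = ?E x" for x
   unfolding ps_def ps1_def ps2_def A_def Y_def Y1_def Y2_def by (simp add: scaleR_conv_of_real algebra_simps)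
  note Pi = h_integrable[OF tf[of j]]
  have kk: "0 <= sqrt (k j)" using k[of j] by simp
  note W = weak_form_Ph[OF tf[of j] si(1) kk R]
  have Ei: "sint Om ?E" "(SINT x:Om. ?E x) = (SINT x:Om. ?P x) - (SINT x:Om. A j x)"
   using set_integral_diff[OF Pi LA(1)[of j]] unfolding PE by auto
  have up0: "(SINT x:up. ?E x) = 0"
  proof -
   have "(SINT x:up. ?E x) = (SINT x:up. 0)"
   proof (rule set_integral_eq)
    fix x assume "x : up"
    hence "b' j x = 0" by (intro b'z) (use si(2)[of j] in \<open>simp add: up_iff\<close>)
    thus "?E x = 0" by simp
   qed
   thus ?thesis by simp
  qed
  note Es = Om_split[OF Ei(1)]
  have HC: "?H x - C j x = ?F x" if "x : cav" for x
   using Xcav[OF that] unfolding ps_def ps1_def ps2_def C_def Y_def Y1_def Y2_def by (simp add: scaleR_conv_of_real algebra_simps)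
  have ED: "?E x + ?F x = D j x" if "x : cav" for x
   using Xcav[OF that] unfolding D_def Ph2_def by (simp add: algebra_simps)
  have Fi: "sint cav ?F" "(SINT x:cav. ?F x) = (SINT x:cav. ?H x) - (SINT x:cav. C j x)"
  proof -
   show "sint cav ?F" by (rule set_integrable_eq[OF set_integral_diff(1)[OF W(2) LC(1)] HC])
   have "(SINT x:cav. ?H x - C j x) = (SINT x:cav. ?F x)" by (rule set_integral_eq) (rule HC)
   thus "(SINT x:cav. ?F x) = (SINT x:cav. ?H x) - (SINT x:cav. C j x)"
    using set_integral_diff(2)[OF W(2) LC(1)[of j]] by simp
  qed
  show "sint cav (D j)" by (rule set_integrable_eq[OF set_integral_add(1)[OF Es(1) Fi(1)] ED])
  have "(SINT x:cav. ?E x + ?F x) = (SINT x:cav. D j x)" by (rule set_integral_eq) (rule ED)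
  hence "(SINT x:cav. D j x) = (SINT x:cav. ?E x) + (SINT x:cav. ?F x)"
   using set_integral_add(2)[OF Es(1) Fi(1)] by simp
  thus "(SINT x:cav. D j x) = - (SINT x:Om. A j x) - (SINT x:cav. C j x)"
   using Es(3) up0 Ei(2) W(1) Fi(2) by simp
 qed
 \<comment> \<open>The slope of \<open>b j\<close> is of size 1 / si on a strip of height 2 si,
   where \<open>poincare_Ph\<close> bounds the norm of \<open>Ph\<close> by 2 si times that of
   \<open>Ph2\<close>. Hence \<open>D j\<close> is bounded by energies on a shrinking strip, which
   tend to 0.\<close>
 have Db: "cmod (SINT x:cav. D j x) <= 3/4 * (SINT x:P j. nsq (u2 x)) + 3 * (SINT x:P j. nsq (Ph2 x))" for j
 proof -
  have m: "min d (2 * si j) = 2 * si j" using si(2)[of j] by simp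
  have Pcav: "P j \<subseteq> cav" unfolding P_def m using si(2)[of j] by (auto simp: cav_iff in_open_box)
  have Pi: "sint (P j) (%x. nsq (u2 x))" "sint (P j) (%x. nsq (Ph x))"
   by (rule set_integrable_subset[OF _ _ Pcav]; use cav_energy in \<open>simp add: P_def\<close>)+
  have s2: "(si j)^2 > 0" using si(1)[of j] by simp
  let ?g = "%x. 3/4 * nsq (u2 x) + 3/4 / (si j)^2 * nsq (Ph x)"
  have gi: "sint (P j) ?g" by (intro set_integral_add set_integrable_mult_right Pi)
  have bd: "cmod (ind cav x *R D j x) <= ind (P j) x *R ?g x" for x
  proof (cases "x : cav \<and> b' j x ~= 0")
   case False
   hence z0: "ind cav x *R D j x = 0" by (auto simp: D_def)
   have "0 <= ind (P j) x *R ?g x" using s2 by (simp add: indicator_def)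
   thus ?thesis unfolding z0 norm_zero .
  next
   case True
   hence xP: "x : P j" using b'z[of j x] unfolding P_def m by (force simp: cav_iff in_open_box)
   have "cmod (D j x) <= 3/2 / si j * (cmod (u2 x) * cmod (Ph x))"
    unfolding D_def norm_mult norm_of_real by (intro mult_mono b'b Tb) (use si(1)[of j] in auto)
   also have "... = 3/4 * (2 * cmod (u2 x) * (cmod (Ph x) / si j))" using si(1)[of j] by simp
   also have "... <= 3/4 * (nsq (u2 x) + (cmod (Ph x) / si j)^2)"
    by (intro mult_left_mono sum_squares_bound) simp
   also have "... = ?g x" by (simp add: power_divide distrib_left)
   finally show ?thesis using xP True by simp
  qed
  have "cmod (SINT x:cav. D j x) <= (SINT x:P j. ?g x)"
   unfolding int_def
   by (rule Bochner_Integration.integral_norm_bound_integral[OF D(2)[unfolded sint_def] gi[unfolded sint_def] bd])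
  also have "... = 3/4 * (SINT x:P j. nsq (u2 x)) + 3/4 / (si j)^2 * (SINT x:P j. nsq (Ph x))"
   by (subst set_integral_add(2)) (intro set_integrable_mult_right Pi, intro set_integrable_mult_right Pi, simp only: set_integral_mult_right)
  also have "... <= 3/4 * (SINT x:P j. nsq (u2 x)) + 3/4 / (si j)^2 * ((2 * si j)^2 * (SINT x:P j. nsq (Ph2 x)))"
   using poincare_Ph[of "2 * si j"] si[of j] s2 unfolding P_def m by (intro add_left_mono mult_left_mono) auto
  also have "... = 3/4 * (SINT x:P j. nsq (u2 x)) + 3 * (SINT x:P j. nsq (Ph2 x))"
  proof -
   have "3/4 / q^2 * ((2 * q)^2 * y) = 3 * y" if "q^2 > 0" for q y :: real using that by (simp add: power_mult_distrib)
   from this[OF s2] show ?thesis by simp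
  qed
  finally show ?thesis .
 qed
 have "(%j. 3/4 * (SINT x:P j. nsq (u2 x)) + 3 * (SINT x:P j. nsq (Ph2 x))) ----> 3/4 * 0 + 3 * 0"
 proof -
  have l: "(%j. 2 * si j) ----> 0" using tendsto_mult[OF tendsto_const si0, of 2] by simp
  show ?thesis
   unfolding P_def by (intro tendsto_add tendsto_mult tendsto_const strip_small[OF l] cav_energy)
 qed
 hence B0: "(%j. 3/4 * (SINT x:P j. nsq (u2 x)) + 3 * (SINT x:P j. nsq (Ph2 x))) ----> 0" by simp
 have D0: "(%j. SINT x:cav. D j x) ----> 0"
  by (rule Lim_null_comparison[OF always_eventually[OF allI[OF Db]] B0])
 have "(%j. (SINT x:Om. A j x) + (SINT x:cav. C j x)) ----> - 0"
  using tendsto_minus[OF D0] unfolding D(1) by (simp add: add.commute)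
 moreover have "(%j. (SINT x:Om. A j x) + (SINT x:cav. C j x)) ----> (SINT x:Om. ?A x) + (SINT x:cav. source x)"
  by (intro tendsto_add LA(3) LC(3))
 ultimately have fin0: "(SINT x:Om. ?A x) + (SINT x:cav. source x) = 0"
  using LIMSEQ_unique by fastforce
 have Ae: "?A = (%x. of_real (radial kp x * energy_density x) + radial_term x)"
  unfolding energy_density_def radial_term_def
  by (rule ext) (simp only: of_real_mult of_real_diff of_real_add complex_norm_square mult.assoc)
 show "sint Om (%x. of_real (radial kp x * energy_density x) + radial_term x)"
  using LA(2) unfolding Ae .
 show "sint cav source" by (rule LC(2))
 show "(SINT x:Om. of_real (radial kp x * energy_density x) + radial_term x) = - (SINT x:cav. source x)"
  using fin0 unfolding Ae by (simp add: eq_neg_iff_add_eq_0)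
qed

end

section \<open>The scattered field in logarithmic polar coordinates\<close>

lemma polar_integral_real:
 fixes f :: "real^2 => real"
 assumes k: "0 < kp" and A: "open A"
 defines "U \<equiv> {z : upper_half_plane. ln (kp * norm z) : A}"
 assumes c: "continuous_on U f"
 shows "sint U f \<longleftrightarrow> sint (A \<times> {0<..<pi}) (%(t, p). (exp t / kp)^2 * f (pl kp t p))"
  and "(SINT z:U. f z) = (SINT z:A \<times> {0<..<pi}. (case z of (t, p) => (exp t / kp)^2 * f (pl kp t p)))"
proof -
 have c': "continuous_on {z : upper_half_plane. ln (kp * norm z) : A} (%z. complex_of_real (f z))"
  using c unfolding U_def by (intro continuous_intros)
 note P = polar_integral[OF k A c', folded U_def]
 have e1: "(%x. ind U x *R complex_of_real (f x)) = (%x. complex_of_real (ind U x *R f x))"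
  by (simp add: fun_eq_iff scaleR_conv_of_real)
 have e2: "(%z. ind (A \<times> {0<..<pi}) z *R (case z of (t, p) => (exp t / kp)^2 *R complex_of_real (f (pl kp t p)))) =
   (%z. complex_of_real (ind (A \<times> {0<..<pi}) z *R (case z of (t, p) => (exp t / kp)^2 * f (pl kp t p))))"
  by (rule ext) (simp add: scaleR_conv_of_real split: prod.split)
 show "sint U f \<longleftrightarrow> sint (A \<times> {0<..<pi}) (%(t, p). (exp t / kp)^2 * f (pl kp t p))"
  using P(2) unfolding sint_def e1 e2 complex_of_real_integrable_eq .
 have "complex_of_real (SINT z:U. f z) = of_real (SINT z:A \<times> {0<..<pi}. (case z of (t, p) => (exp t / kp)^2 * f (pl kp t p)))"
  using P(3) unfolding int_def e1 e2 integral_complex_of_real .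
 thus "(SINT z:U. f z) = (SINT z:A \<times> {0<..<pi}. (case z of (t, p) => (exp t / kp)^2 * f (pl kp t p)))"
  by (simp only: of_real_eq_iff)
qed

context cavity_solution begin

text \<open>The ramp inside \<open>h\<close> is only C^1, but above the axis \<open>h\<close> equals
  G; there the second derivatives of \<open>Ph\<close> are those of u minus the explicit ones of
  G.\<close>

definition Ph11 where "Ph11 x = partial 1 u1 x + of_real ((kp * sin th)^2) * gw kp th x"
definition Ph12 where "Ph12 x = partial 2 u1 x - \<i> * of_real (kp * sin th) * gw2 kp th x"
definition Ph21 where "Ph21 x = partial 1 u2 x - \<i> * of_real (kp * sin th) * gw2 kp th x"
definition Ph22 where "Ph22 x = partial 2 u2 x + of_real ((kp * cos th)^2) * gw kp th x"

lemma Ph_grad2: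
 assumes x: "x : up"
 shows "grad_at Ph1 (Ph11 x) (Ph12 x) x" "grad_at Ph2 (Ph21 x) (Ph22 x) x"
proof -
 have xO: "x : Om" using x subsets(2) by blast
 have 1: "grad_at (%x. u1 x - gw1 kp th x) (Ph11 x) (Ph12 x) x"
  using grad_at_diff[OF u_grad(2)[OF xO, of 1] gw_grad(2)] by (simp add: Ph11_def Ph12_def)
 have 2: "grad_at (%x. u2 x - gw2 kp th x) (Ph21 x) (Ph22 x) x"
  using grad_at_diff[OF u_grad(2)[OF xO, of 2] gw_grad(3)] by (simp add: Ph21_def Ph22_def)
 show "grad_at Ph1 (Ph11 x) (Ph12 x) x"
  by (rule grad_at_transform[OF 1 open_sets(3) x]) (simp add: Ph1_def h_up)
 show "grad_at Ph2 (Ph21 x) (Ph22 x) x"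
  by (rule grad_at_transform[OF 2 open_sets(3) x]) (simp add: Ph2_def h_up)
qed

lemma Ph_helmholtz:
 assumes x: "x : up" shows "Ph11 x + Ph22 x = - of_real (kp^2) * Ph x"
proof -
 have xO: "x : Om" using x subsets(2) by blast
 have "Ph11 x + Ph22 x = (partial 1 u1 x + partial 2 u2 x) - (- of_real ((kp * sin th)^2) * gw kp th x + - of_real ((kp * cos th)^2) * gw kp th x)"
  unfolding Ph11_def Ph22_def by simp
 also have "... = - of_real (kp^2) * (u x - gw kp th x)"
  unfolding helmholtz[OF xO] gw_helmholtz by (simp add: algebra_simps)
 finally show ?thesis using h_up(1)[OF x] by (simp add: Ph_def)
qed

lemma Ph_cont2: "continuous_on up Ph11" "continuous_on up Ph12" "continuous_on up Ph21" "continuous_on up Ph22"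
proof -
 have c: "continuous_on up (partial j (partial i u))" for i j
  by (rule continuous_on_subset[OF u_cont(3) subsets(2)])
 show "continuous_on up Ph11" "continuous_on up Ph12" "continuous_on up Ph21" "continuous_on up Ph22"
  unfolding Ph11_def[abs_def] Ph12_def[abs_def] Ph21_def[abs_def] Ph22_def[abs_def] by (intro continuous_intros c)+
qed

lemma Ph_cont_up: "continuous_on up Ph" "continuous_on up Ph1" "continuous_on up Ph2"
 by (rule continuous_on_subset[OF _ subsets(2)], rule Ph_cont)+

abbreviation cc where "cc t p \<equiv> exp t / kp * cos p"
abbreviation ss where "ss t p \<equiv> exp t / kp * sin p"

definition W where "W t p = Ph (pl kp t p)"
definition Wt where "Wt t p = cc t p *R Ph1 (pl kp t p) + ss t p *R Ph2 (pl kp t p)"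
definition Wp where "Wp t p = - ss t p *R Ph1 (pl kp t p) + cc t p *R Ph2 (pl kp t p)"
definition Wtt where "Wtt t p = (cc t p *R (cc t p *R Ph11 (pl kp t p) + ss t p *R Ph12 (pl kp t p)) + cc t p *R Ph1 (pl kp t p))
  + (ss t p *R (cc t p *R Ph21 (pl kp t p) + ss t p *R Ph22 (pl kp t p)) + ss t p *R Ph2 (pl kp t p))"
definition Wpp where "Wpp t p = (- ss t p *R (- ss t p *R Ph11 (pl kp t p) + cc t p *R Ph12 (pl kp t p)) + - cc t p *R Ph1 (pl kp t p))
  + (cc t p *R (- ss t p *R Ph21 (pl kp t p) + cc t p *R Ph22 (pl kp t p)) + - ss t p *R Ph2 (pl kp t p))"

lemma pl_up: "p : {0<..<pi} ==> pl kp t p : up"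
 by (rule pl_upper[OF kp])

lemma W_deriv:
 assumes p: "p : {0<..<pi}"
 shows "((%s. W s p) has_vector_derivative Wt t p) (at t)" "((%s. Wt s p) has_vector_derivative Wtt t p) (at t)"
  "((%s. W t s) has_vector_derivative Wp t p) (at p)" "((%s. Wp t s) has_vector_derivative Wpp t p) (at p)"
proof -
 have xO: "pl kp t p : Om" using pl_up[OF p] subsets(2) by blast
 note g = Ph_grad[OF xO] and g2 = Ph_grad2[OF pl_up[OF p, of t]]
 show "((%s. W s p) has_vector_derivative Wt t p) (at t)" "((%s. W t s) has_vector_derivative Wp t p) (at p)"
  unfolding W_def Wt_def Wp_def by (rule polar_deriv(1)[OF g], rule polar_deriv(2)[OF g])
 have dc: "((%s. cc s p) has_field_derivative cc t p) (at t)" "((%s. ss s p) has_field_derivative ss t p) (at t)"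
  by (rule DERIV_cmult_right[OF DERIV_cdivide[OF DERIV_exp]])+
 have dp: "((%s. cc t s) has_field_derivative - ss t p) (at p)" "((%s. - ss t s) has_field_derivative - cc t p) (at p)"
  using DERIV_cmult[OF DERIV_cos, of "exp t / kp" p] DERIV_minus[OF DERIV_cmult[OF DERIV_sin, of "exp t / kp" p]] by simp_all
 show "((%s. Wt s p) has_vector_derivative Wtt t p) (at t)"
  unfolding Wt_def Wtt_def
  by (rule has_vector_derivative_add[OF has_vector_derivative_scaleR[OF dc(1) polar_deriv(1)[OF g2(1)]] has_vector_derivative_scaleR[OF dc(2) polar_deriv(1)[OF g2(2)]]])
 have eq: "Wpp t p = (- ss t p *R (- ss t p *R Ph11 (pl kp t p) + cc t p *R Ph12 (pl kp t p)) + - cc t p *R Ph1 (pl kp t p))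
  + (cc t p *R (- ss t p *R Ph21 (pl kp t p) + cc t p *R Ph22 (pl kp t p)) + - ss t p *R Ph2 (pl kp t p))"
  by (rule Wpp_def)
 show "((%s. Wp t s) has_vector_derivative Wpp t p) (at p)"
  unfolding Wp_def eq
  by (rule has_vector_derivative_add[OF has_vector_derivative_scaleR[OF dp(2) polar_deriv(2)[OF g2(1)]] has_vector_derivative_scaleR[OF dp(1) polar_deriv(2)[OF g2(2)]]])
qed

lemma r_sq: "(cc t p)^2 + (ss t p)^2 = (exp t / kp)^2"
proof -
 have "(cc t p)^2 + (ss t p)^2 = (exp t / kp)^2 * ((cos p)^2 + (sin p)^2)" by (simp only: power_mult_distrib distrib_left)
 thus ?thesis by (simp only: sin_cos_squared_add2 mult_1_right)
qed

text \<open>The coordinates are conformal: mixed and first-order terms cancel in the sum, which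
  leaves r^2 times the Laplacian.\<close>

lemma W_pde:
 assumes p: "p : {0<..<pi}"
 shows "Wtt t p + Wpp t p + of_real ((exp t)^2) * W t p = 0"
proof -
 have gen: "(c *R (c *R a + s *R b) + c *R f) + (s *R (c *R g + s *R e) + s *R h)
   + ((- s *R (- s *R a + c *R b) + - c *R f) + (c *R (- s *R g + c *R e) + - s *R h)) = (c^2 + s^2) *R (a + e)"
  for a b e f g h :: complex and c s :: real
  by (simp add: scaleR_conv_of_real algebra_simps power2_eq_square)
 have "Wtt t p + Wpp t p = (exp t / kp)^2 *R (Ph11 (pl kp t p) + Ph22 (pl kp t p))"
  unfolding Wtt_def Wpp_def gen r_sq ..
 also have "... = - of_real ((exp t / kp)^2 * kp^2) * W t p"
  unfolding Ph_helmholtz[OF pl_up[OF p]] W_def by (simp add: scaleR_conv_of_real)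
 also have "(exp t / kp)^2 * kp^2 = (exp t)^2" using kp by (simp add: power_divide)
 finally show ?thesis by simp
qed

lemma pull_cont:
 assumes "continuous_on up f"
 shows "continuous_on (S \<times> {0<..<pi}) (%(t, p). f (pl kp t p))"
proof -
 have "continuous_on (S \<times> {0<..<pi}) (%z. f (case z of (t, p) => pl kp t p))"
  by (rule continuous_on_compose2[OF assms pl_cont]) (use pl_up in auto)
 thus ?thesis by (rule continuous_on_eq) auto
qed

lemma W_cont:
 "continuous_on (S \<times> {0<..<pi}) (%(t, p). W t p)" "continuous_on (S \<times> {0<..<pi}) (%(t, p). Wt t p)" "continuous_on (S \<times> {0<..<pi}) (%(t, p). Wp t p)"
 "continuous_on (S \<times> {0<..<pi}) (%(t, p). Wtt t p)" "continuous_on (S \<times> {0<..<pi}) (%(t, p). Wpp t p)"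
proof -
 note c = Ph_cont_up[THEN pull_cont, unfolded case_prod_beta] Ph_cont2[THEN pull_cont, unfolded case_prod_beta]
 have e: "continuous_on T (%z. cc (fst z) (snd z))" "continuous_on T (%z. ss (fst z) (snd z))" for T :: "(real \<times> real) set"
  unfolding divide_inverse by (intro continuous_intros)+
 show "continuous_on (S \<times> {0<..<pi}) (%(t, p). W t p)" "continuous_on (S \<times> {0<..<pi}) (%(t, p). Wt t p)" "continuous_on (S \<times> {0<..<pi}) (%(t, p). Wp t p)"
 "continuous_on (S \<times> {0<..<pi}) (%(t, p). Wtt t p)" "continuous_on (S \<times> {0<..<pi}) (%(t, p). Wpp t p)"
  unfolding W_def Wt_def Wp_def Wtt_def Wpp_def case_prod_beta
  by (intro continuous_on_add continuous_on_scaleR continuous_on_minus c e)+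
qed

text \<open>\<open>Wt\<close> and \<open>Wp\<close> arise from the gradient by a rotation and the
  factor r; multiplied by the Jacobian r^2, the density |grad Ph|^2 is therefore invariant.\<close>

lemma W_norms: "nsq (Wt t p) + nsq (Wp t p) = (exp t / kp)^2 * (nsq (Ph1 (pl kp t p)) + nsq (Ph2 (pl kp t p)))"
proof -
 have "nsq (c *R a + s *R b) + nsq (- s *R a + c *R b) = (c^2 + s^2) * (nsq a + nsq b)" for a b :: complex and c s :: real
  unfolding cmod_power2 by (simp add: power2_eq_square algebra_simps)
 thus ?thesis unfolding Wt_def Wp_def r_sq[symmetric, of t p] .
qed

text \<open>\<open>A\<close> may be unbounded below, so that the half disc down to the aperture is
  included; there the finite local energy of \<open>Ph\<close> is what guarantees
  integrability.\<close>

lemma polar_energy: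
 assumes A: "open A" "A \<subseteq> {..<B}"
 shows "sint (A \<times> {0<..<pi}) (%(t, p). nsq (Wt t p))" "sint (A \<times> {0<..<pi}) (%(t, p). nsq (Wp t p))"
  "sint (A \<times> {0<..<pi}) (%(t, p). (exp t)^2 * nsq (W t p))"
proof -
 let ?U = "{z : up. ln (kp * norm z) : A}"
 have U: "open ?U" by (rule polar_integral(1)[OF kp A(1) continuous_on_const])
 have sub: "?U \<subseteq> Om \<inter> ball 0 (exp B / kp)"
 proof
  fix z assume z: "z : ?U"
  hence n: "0 < norm z" by (auto simp: up_iff)
  have "ln (kp * norm z) < B" using z A(2) by auto
  hence "kp * norm z < exp B" using n kp by (metis exp_less_mono exp_ln mult_pos_pos)
  thus "z : Om \<inter> ball 0 (exp B / kp)" using z subsets(2) kp by (auto simp: less_divide_eq mult.commute)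
 qed
 have c: "continuous_on ?U (%x. nsq (Ph1 x) + nsq (Ph2 x))" "continuous_on ?U (%x. kp^2 * nsq (Ph x))"
  by (intro continuous_intros continuous_on_subset[OF Ph_cont_up(1)] continuous_on_subset[OF Ph_cont_up(2)] continuous_on_subset[OF Ph_cont_up(3)]; auto)+
 have i: "sint ?U (%x. nsq (Ph1 x) + nsq (Ph2 x))" "sint ?U (%x. kp^2 * nsq (Ph x))"
  by (rule set_integrable_subset[OF _ _ sub]; (intro set_integral_add set_integrable_mult_right Ph_energy)?; use U in simp)+
 have b: "sint (A \<times> {0<..<pi}) (%(t, p). nsq (Wt t p) + nsq (Wp t p))"
  using i(1) unfolding polar_integral_real(1)[OF kp A(1) c(1)] W_norms .
 have o: "open (A \<times> {0<..<pi})" using A(1) by (intro open_Times) auto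
 have m: "set_borel_measurable lborel (A \<times> {0<..<pi}) (%(t, p). nsq (Wt t p))" "set_borel_measurable lborel (A \<times> {0<..<pi}) (%(t, p). nsq (Wp t p))"
  unfolding case_prod_beta
  by (intro set_borel_measurable_open o continuous_intros W_cont[unfolded case_prod_beta])+
 show "sint (A \<times> {0<..<pi}) (%(t, p). nsq (Wt t p))"
  by (rule set_integrable_bound[OF b m(1)]) (auto intro!: AE_I2)
 show "sint (A \<times> {0<..<pi}) (%(t, p). nsq (Wp t p))"
  by (rule set_integrable_bound[OF b m(2)]) (auto intro!: AE_I2)
 have "(exp t / kp)^2 * (kp^2 * nsq (Ph (pl kp t p))) = (exp t)^2 * nsq (W t p)" for t p
  using kp by (simp add: power_divide W_def)
 thus "sint (A \<times> {0<..<pi}) (%(t, p). (exp t)^2 * nsq (W t p))"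
  using i(2) unfolding polar_integral_real(1)[OF kp A(1) c(2)] by (simp only:)
qed

lemma W_radiation:
 assumes e: "e > 0"
 shows "\<exists>T. \<forall>t\<ge>T. \<forall>p\<in>{0<..<pi}. cmod (Wt t p - \<i> * of_real (exp t) * W t p) <= e * exp (t / 2)"
proof -
 let ?v = "%x. u x - (u_inc kp th x + u_ref kp th x)"
 have s: "sommerfeld kp ?v" using sol by (simp add: pec_pmc_solution_def)
 define e' where "e' = e * sqrt kp"
 have e': "e' > 0" using e kp by (simp add: e'_def)
 have "\<forall>\<^sub>F x in inf at_infinity (principal up). dist (complex_of_real (sqrt (norm x)) * (dir_deriv ?v (sgn x) x - \<i> * complex_of_real kp * ?v x)) 0 < e'"
  using tendstoD[OF s[unfolded sommerfeld_def] e'] .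
 then obtain b where b: "!!x. norm x >= b ==> x : up ==> cmod (complex_of_real (sqrt (norm x)) * (dir_deriv ?v (sgn x) x - \<i> * complex_of_real kp * ?v x)) < e'"
  unfolding eventually_inf_principal eventually_at_infinity by auto
 show ?thesis
 proof (intro exI[of _ "ln (kp * max b 1)"] allI impI ballI)
  fix t p assume t: "ln (kp * max b 1) <= t" and p: "p : {0<..<pi}"
  let ?x = "pl kp t p" and ?r = "exp t / kp"
  have x: "?x : up" by (rule pl_up[OF p])
  hence xO: "?x : Om" using subsets(2) by blast
  have r: "?r > 0" using kp by simp
  have n: "norm ?x = ?r" by (rule norm_pl[OF kp])
  have "kp * max b 1 <= exp t" using t kp by (metis exp_le_cancel_iff exp_ln mult_pos_pos less_max_iff_disj zero_less_one)
  moreover have "kp * b <= kp * max b 1" using kp by (intro mult_left_mono) auto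
  ultimately have "kp * b <= exp t" by linarith
  hence "norm ?x >= b" unfolding n using kp by (simp add: le_divide_eq mult.commute)
  note bb = b[OF this x]
  have "grad_at ?v (u1 ?x - gw1 kp th ?x) (u2 ?x - gw2 kp th ?x) ?x"
   using grad_at_diff[OF u_grad(1)[OF xO] gw_grad(1)] unfolding gw_def[abs_def] .
  hence "dir_deriv ?v (sgn ?x) ?x = (sgn ?x $ 1) *R Ph1 ?x + (sgn ?x $ 2) *R Ph2 ?x"
   using h_up[OF x] by (simp only: dir_deriv_grad Ph1_def Ph2_def)
  moreover have "sgn ?x $ 1 = cc t p / ?r" "sgn ?x $ 2 = ss t p / ?r"
   unfolding sgn_div_norm n by (simp_all add: divide_inverse mult.commute)
  ultimately have "dir_deriv ?v (sgn ?x) ?x = (1 / ?r) *R Wt t p"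
   unfolding Wt_def by (simp add: scaleR_add_right divide_inverse mult.commute)
  moreover have "?v ?x = W t p" using h_up(1)[OF x] by (simp add: W_def Ph_def gw_def)
  moreover have "(1 / ?r) *R Wt t p - \<i> * complex_of_real kp * W t p = (1 / ?r) *R (Wt t p - \<i> * of_real (exp t) * W t p)"
   using kp r by (simp add: scaleR_conv_of_real field_simps)
  ultimately have L: "sqrt ?r * (1 / ?r * cmod (Wt t p - \<i> * of_real (exp t) * W t p)) < e'"
   using bb r kp unfolding n norm_mult by (simp only: norm_scaleR norm_of_real) (simp add: norm_mult)
  have eq: "sqrt ?r * (1 / ?r * y) = y / sqrt ?r" for y
  proof -
   have "q * (1 / (q * q) * y) = y / q" if "q > 0" for q :: real using that by simp
   from this[of "sqrt ?r"] show ?thesis using r by (simp only: real_sqrt_mult_self abs_of_pos real_sqrt_gt_zero)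
  qed
  have "cmod (Wt t p - \<i> * of_real (exp t) * W t p) < e' * sqrt ?r"
   using L unfolding eq pos_divide_less_eq[OF real_sqrt_gt_zero[OF r]] .
  also have "e' * sqrt ?r = e * exp (t / 2)"
  proof -
   have "sqrt (exp t) = exp (t / 2)" by (rule real_sqrt_unique) (simp_all add: power2_eq_square exp_add[symmetric])
   thus ?thesis using kp by (simp add: e'_def real_sqrt_divide)
  qed
  finally show "cmod (Wt t p - \<i> * of_real (exp t) * W t p) <= e * exp (t / 2)" by simp
 qed
qed

text \<open>At distance at least rr > ep from the origin, points of small height lie above the
  Neumann boundary, away from both corners, where \<open>u2\<close> is uniformly small; the vertical
  derivative of G is small with the height. The second conclusion covers the whole vertical segment
  below such a height.\<close>

lemma near_axis:
 assumes rr: "ep < rr" and e: "0 < e"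
 obtains m where "0 < m" "!!z. z : up ==> rr <= norm z ==> norm z <= R ==> z $ 2 < m ==> cmod (Ph2 z) < e"
  "!!z y. z : up ==> rr <= norm z ==> norm z <= R ==> z $ 2 < m ==> 0 < y ==> y < m ==> cmod (Ph2 (pt (z $ 1) y)) < e"
proof -
 define s where "s = (rr - ep) / 2"
 have s: "s > 0" using rr by (simp add: s_def)
 obtain r where r: "r > 0" "!!z. 0 < z $ 2 ==> z $ 2 < r ==> z $ 1 : {- R..- s} \<union> {ep + s..R} ==> cmod (u2 z) < e / 2"
  using neumann_top_uniform[of "e/2" s R] e s by auto
 define m where "m = min (min r s) (e / (4 * kp^2 + 1))"
 have k4: "4 * kp^2 + 1 > 0" using zero_le_power2[of kp] by linarith
 have m: "0 < m" "m <= r" "m <= s" "m <= e / (4 * kp^2 + 1)" using r(1) s e k4 by (auto simp: m_def)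
 have key: "cmod (Ph2 (pt (z $ 1) y)) < e"
  if z: "z : up" "rr <= norm z" "norm z <= R" "z $ 2 < m" and y: "0 < y" "y < m" for z y
 proof -
  have z2: "0 < z $ 2" using z(1) by (simp add: up_iff)
  have "norm z <= \<bar>z $ 1\<bar> + \<bar>z $ 2\<bar>" unfolding norm_pt by (rule sqrt_sum_squares_le_sum_abs)
  hence "rr - s <= \<bar>z $ 1\<bar>" using z z2 m by linarith
  moreover have "rr - s = ep + s" unfolding s_def by argo
  moreover have "\<bar>z $ 1\<bar> <= R" using component_le_norm_cart[of z 1] z(3) by simp
  ultimately have z1: "z $ 1 : {- R..- s} \<union> {ep + s..R}" using eps s by auto
  have "cmod (u2 (pt (z $ 1) y)) < e / 2" by (rule r(2)) (use z1 y m in auto)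
  moreover have "cmod (gw2 kp th (pt (z $ 1) y)) <= 2 * kp^2 * y"
   using gw_bounds(4)[OF kp, of th "pt (z $ 1) y"] y by simp
  moreover have "2 * kp^2 * y <= e / 2"
  proof -
   have "y * (4 * kp^2 + 1) <= e" using y m(4) k4 by (simp add: le_divide_eq) (smt (verit) mult_right_mono)
   hence "4 * kp^2 * y + y <= e" by (simp add: algebra_simps)
   thus ?thesis using y by simp
  qed
  moreover have "Ph2 (pt (z $ 1) y) = u2 (pt (z $ 1) y) - gw2 kp th (pt (z $ 1) y)"
   using h_up(3)[of "pt (z $ 1) y"] y by (simp add: Ph2_def up_iff)
  moreover have "f < e" if "a < e / 2" "b <= k" "k <= e / 2" "f <= a + b" for a b f k :: real using that by argo
  ultimately show ?thesis using norm_triangle_ineq4[of "u2 (pt (z $ 1) y)" "gw2 kp th (pt (z $ 1) y)"] by presburger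
 qed
 show ?thesis
 proof (rule that[OF m(1)])
  show "cmod (Ph2 z) < e" if "z : up" "rr <= norm z" "norm z <= R" "z $ 2 < m" for z
   using key[OF that, of "z $ 2"] that(1,4) unfolding pt_eta up_iff by blast
 qed (rule key)
qed

lemma pl_far:
 assumes "ln (kp * ep) < ah" "ah <= t" "t <= bt"
 shows "ep < exp ah / kp" "exp ah / kp <= norm (pl kp t p)" "norm (pl kp t p) <= exp bt / kp"
proof -
 have "kp * ep < exp ah" using assms(1) kp eps by (metis exp_less_mono exp_ln mult_pos_pos)
 thus "ep < exp ah / kp" using kp by (simp add: less_divide_eq mult.commute)
 show "exp ah / kp <= norm (pl kp t p)" "norm (pl kp t p) <= exp bt / kp"
  unfolding norm_pl[OF kp] using assms kp by (simp_all add: divide_right_mono)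
qed

text \<open>Above height m / 2 compactness gives a bound. Below it the vertical derivative is less
  than 1 by \<open>near_axis\<close>, so integrating along a vertical segment changes the value by
  at most m.\<close>

lemma W_bounded:
 assumes ah: "ln (kp * ep) < ah"
 shows "\<exists>B. \<forall>t\<in>{ah..bt}. \<forall>p\<in>{0<..<pi}. cmod (W t p) <= B"
proof (cases "ah <= bt")
 case False
 thus ?thesis by auto
next
 case True
 define R where "R = exp bt / kp"
 note far = pl_far[OF ah, where bt = bt, folded R_def]
 have rr: "ep < exp ah / kp" by (rule far(1)[OF order_refl True])
 obtain m where m: "0 < m" "!!z y. z : up ==> exp ah / kp <= norm z ==> norm z <= R ==> z $ 2 < m ==> 0 < y ==> y < m ==> cmod (Ph2 (pt (z $ 1) y)) < 1"
  using near_axis[OF rr zero_less_one, of R] by metis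
 let ?K = "cbox (pt (- R) (m/2)) (pt R (R + m)) :: (real^2) set"
 have "?K \<subseteq> up" using m(1) by (auto simp: in_box up_iff)
 hence "compact (Ph ` ?K)"
  by (intro compact_continuous_image continuous_on_subset[OF Ph_cont_up(1)] compact_cbox)
 then obtain B where B: "!!z. z : ?K ==> cmod (Ph z) <= B" using compact_imp_bounded bounded_iff by (metis imageI)
 have main: "cmod (Ph z) <= B + m" if z: "z : up" "exp ah / kp <= norm z" "norm z <= R" for z
 proof -
  have z1: "\<bar>z $ 1\<bar> <= R" "z $ 2 <= R" using component_le_norm_cart[of z 1] component_le_norm_cart[of z 2] z(3) by auto
  have z2: "0 < z $ 2" using z(1) by (simp add: up_iff)
  show ?thesis
  proof (cases "z $ 2 < m / 2")
   case False
   hence "z : ?K" using z1 m(1) by (auto simp: in_box)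
   thus ?thesis using B m(1) by fastforce
  next
   case True
   have zm: "z $ 2 < m" using True m(1) by linarith
   have K: "pt (z $ 1) (m/2) : ?K" using z1 m(1) z2 by (auto simp: in_box)
   let ?g = "%y. Ph2 (pt (z $ 1) y)"
   have inO: "pt (z $ 1) y : up" if "y : {z $ 2..m/2}" for y using that z2 by (simp add: up_iff)
   have d: "((%y. Ph (pt (z $ 1) y)) has_vector_derivative ?g y) (at y)" if "y : {z $ 2..m/2}" for y
    using grad_at_line(2)[OF Ph_grad] inO[OF that] subsets(2) by blast
   have c: "continuous_on {z $ 2..m/2} ?g"
    by (rule continuous_on_compose2[OF Ph_cont_up(3)]) (use inO in \<open>auto intro!: continuous_intros\<close>)
   have g1: "nsq (?g y) <= 1" if "y : {z $ 2..m/2}" for y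
    using m(2)[OF z zm, of y] that z2 m(1) by (auto intro!: power_le_one)
   have "integral {z $ 2..m/2} (%s. nsq (?g s)) <= integral {z $ 2..m/2} (%s. 1)"
    by (intro integral_le integrable_continuous_interval continuous_intros c g1)
   hence I: "integral {z $ 2..m/2} (%s. nsq (?g s)) <= m/2 - z $ 2" using True by simp
   have "nsq (Ph (pt (z $ 1) (m/2)) - Ph (pt (z $ 1) (z $ 2))) <= (m/2 - z $ 2) * integral {z $ 2..m/2} (%s. nsq (?g s))"
    by (rule sq_increment_cont[OF d c]) (use True in auto)
   also have "... <= (m/2 - z $ 2) * (m/2 - z $ 2)" using I True by (intro mult_left_mono) auto
   also have "... <= m^2" unfolding power2_eq_square using True z2 m(1) by (intro mult_mono) auto
   finally have "cmod (Ph (pt (z $ 1) (m/2)) - Ph z) <= m" unfolding pt_eta by (rule power2_le_imp_le) (use m(1) in simp)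
   thus ?thesis using B[OF K] norm_triangle_ineq2[of "Ph z" "Ph (pt (z $ 1) (m/2))"] by (simp add: norm_minus_commute)
  qed
 qed
 show ?thesis
 proof (intro exI[of _ "B + m"] ballI)
  fix t p assume "t : {ah..bt}" "p : {0<..<pi}"
  thus "cmod (W t p) <= B + m" unfolding W_def by (intro main pl_up far) auto
 qed
qed

text \<open>\<open>Wp\<close> is -r sin p Ph1 + r cos p Ph2. On edges of width et the sine is at
  most et, so the first term, divided by et, is the integral of a fixed integrable function over a
  shrinking set. The second is uniformly small by \<open>near_axis\<close>.\<close>

lemma W_neumann:
 assumes ah: "ln (kp * ep) < ah"
 shows "((%et. (SINT z:{ah<..<bt} \<times> edges et. (case z of (t, p) => cmod (Wp t p))) / et) \<longlongrightarrow> 0) (at_right 0)"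
proof (cases "ah < bt")
 case False
 hence "{ah<..<bt} = {}" by auto
 thus ?thesis by (simp add: int_def)
next
 case True
 define R where "R = exp bt / kp"
 have R: "R > 0" using kp by (simp add: R_def)
 note far = pl_far[OF ah, where bt = bt, folded R_def]
 have rr: "ep < exp ah / kp" by (rule far(1)[of bt]) (use True in auto)
 let ?A = "{ah<..<bt}" and ?D = "{0<..<pi}"
 define f where "f z = (case z of (t, p) => R * cmod (Ph1 (pl kp t p)))" for z
 have fi: "sint (?A \<times> ?D) f"
 proof -
  have o: "open (?A \<times> ?D)" "bounded (?A \<times> ?D)" by (intro open_Times bounded_Times; simp)+
  have one: "sint (?A \<times> ?D) (%_. R)" by (rule set_integrable_const) (use o in auto)
  define rr where "rr = exp ah / kp"
  have r0: "rr > 0" using kp by (simp add: rr_def)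
  have "sint (?A \<times> ?D) (%z. R + R / rr^2 * ((case z of (t, p) => nsq (Wt t p)) + (case z of (t, p) => nsq (Wp t p))))"
   by (intro set_integral_add set_integrable_mult_right one polar_energy[of _ bt]) auto
  thus ?thesis
  proof (rule set_integrable_bound)
   have "continuous_on (?A \<times> ?D) f"
    unfolding f_def[abs_def] using pull_cont[OF Ph_cont_up(2), of ?A] unfolding case_prod_beta by (intro continuous_intros)
   thus "set_borel_measurable lborel (?A \<times> ?D) f" by (rule set_borel_measurable_open[OF o(1)])
   show "AE z in lborel. z : ?A \<times> ?D \<longrightarrow> norm (f z) <= norm (R + R / rr^2 * ((case z of (t, p) => nsq (Wt t p)) + (case z of (t, p) => nsq (Wp t p))))"
   proof (intro AE_I2 impI, clarify)
    fix t p :: real assume tp: "t : ?A" "p : ?D"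
    let ?y = "cmod (Ph1 (pl kp t p))" and ?w = "nsq (Wt t p) + nsq (Wp t p)"
    have "rr <= exp t / kp" using tp kp by (simp add: rr_def divide_right_mono)
    hence "rr^2 <= (exp t / kp)^2" using r0 by (intro power_mono) auto
    hence "rr^2 * ?y^2 <= ?w" unfolding W_norms by (intro mult_mono) auto
    hence "?y^2 <= ?w / rr^2" using r0 by (simp add: le_divide_eq mult.commute)
    hence "R * ?y <= R * (1 + ?w / rr^2)"
     using R norm_le_sq[of "Ph1 (pl kp t p)"] by (intro mult_left_mono) auto
    thus "norm (f (t, p)) <= norm (R + R / rr^2 * ?w)"
     using R unfolding f_def by (simp add: distrib_left add_divide_distrib)
   qed
  qed
 qed
 define F where "F et = (SINT z:?A \<times> edges et. f z)" for et
 have f0: "f z >= 0" for z using R by (simp add: f_def split: prod.split)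
 show ?thesis
 proof (rule tendsto_at_right_sequentially[of 0 "pi/2"])
  show "0 < pi / 2" by simp
  fix S :: "nat => real" assume S: "!!n. 0 < S n" "!!n. S n < pi / 2" "S ----> 0"
  note ed = strip_edges(2)[OF S(1) less_imp_le[OF S(2)]] and E = strip_edges(3-5)[OF S(1) less_imp_le[OF S(2)], where ah = ah and bt = bt]
  have Fl: "(%n. F (S n)) ----> 0"
   unfolding F_def
  proof (rule set_integral_vanishing[OF fi])
   fix z assume "z : ?A \<times> ?D"
   hence "0 < min (snd z) (pi - snd z)" by auto
   hence "\<forall>\<^sub>F n in sequentially. S n < min (snd z) (pi - snd z)" using S(3) by (intro order_tendstoD)
   thus "\<forall>\<^sub>F n in sequentially. z \<notin> ?A \<times> edges (S n)"
    by eventually_elim (auto simp: edges_def)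
  qed (use E(1) ed in auto)
  let ?Q = "%n. (SINT z:?A \<times> edges (S n). (case z of (t, p) => cmod (Wp t p))) / S n"
  have Q0: "0 <= ?Q n" for n
   using S(1)[of n] by (intro divide_nonneg_pos set_integral_nonneg') auto
  show "?Q ----> 0"
  proof (rule tendstoI)
   fix e :: real assume e: "e > 0"
   \<comment> \<open>The edges have total width 2 et, so the term with \<open>Ph2\<close> adds at
     most 2 R (bt - ah) e' to the quotient; this choice makes it at most e / 2.\<close>
   define e' where "e' = e / (4 * R * (bt - ah) + 1)"
   have den: "4 * R * (bt - ah) + 1 > 0" using R True by (simp add: add_pos_pos)
   have e': "e' > 0" using e den by (simp add: e'_def)
   obtain m where m: "0 < m" "!!z. z : up ==> exp ah / kp <= norm z ==> norm z <= R ==> z $ 2 < m ==> cmod (Ph2 z) < e'"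
    using near_axis[OF rr e', of R] by metis
   have "\<forall>\<^sub>F n in sequentially. S n < m / R" using S(3) m(1) R by (intro order_tendstoD) auto
   moreover have "\<forall>\<^sub>F n in sequentially. F (S n) < e / 2" using Fl e by (intro order_tendstoD) auto
   ultimately show "\<forall>\<^sub>F n in sequentially. dist (?Q n) 0 < e"
   proof eventually_elim
    case (elim n)
    let ?et = "S n"
    have et: "0 < ?et" by (rule S(1))
    have sn: "0 < sin p \<and> sin p <= ?et" if p: "p : edges ?et" for p
    proof
     show "0 < sin p" using ed[of n] p by (intro sin_gt_zero) auto
     have "sin p <= p" "sin p <= pi - p" using ed[of n] p sin_x_le_x[of p] sin_x_le_x[of "pi - p"] by auto
     thus "sin p <= ?et" using p by (auto simp: edges_def)
    qed
    have Wb: "cmod (Wp t p) <= ?et * f (t, p) + R * e'" if tp: "t : ?A" "p : edges ?et" for t p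
    proof -
     have pD: "p : ?D" using tp(2) ed[of n] by blast
     have rR: "exp t / kp <= R" "0 < exp t / kp" using tp(1) kp by (simp_all add: R_def divide_right_mono)
     have s: "0 < sin p" "sin p <= ?et" using sn[OF tp(2)] by auto
     have "exp t / kp * sin p <= R * ?et" using rR s R by (intro mult_mono) auto
     also have "... < m" using elim(1) R by (simp add: less_divide_eq mult.commute)
     finally have y: "pl kp t p $ 2 < m" by simp
     have P2: "cmod (Ph2 (pl kp t p)) <= e'"
      using m(2)[OF pl_up[OF pD] far(2)[of t p] far(3)[of t p] y] tp(1) by simp
     have "cmod (Wp t p) <= \<bar>- ss t p\<bar> * cmod (Ph1 (pl kp t p)) + \<bar>cc t p\<bar> * cmod (Ph2 (pl kp t p))"
      unfolding Wp_def using norm_triangle_ineq[of "- ss t p *R Ph1 (pl kp t p)" "cc t p *R Ph2 (pl kp t p)"] by (simp only: norm_scaleR)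
     also have "\<bar>- ss t p\<bar> = ss t p" using rR s kp by (simp add: abs_mult)
     also have "ss t p * cmod (Ph1 (pl kp t p)) <= (R * ?et) * cmod (Ph1 (pl kp t p))"
      using rR s R by (intro mult_right_mono mult_mono) auto
     also have "\<bar>cc t p\<bar> * cmod (Ph2 (pl kp t p)) <= (R * 1) * e'"
     proof (intro mult_mono P2)
      show "\<bar>cc t p\<bar> <= R * 1" unfolding abs_mult using rR R by (intro mult_mono) auto
     qed (use R in auto)
     finally show ?thesis by (simp add: f_def mult_ac)
    qed
    have i: "sint (?A \<times> edges ?et) (%z. ?et * f z)" "sint (?A \<times> edges ?et) (%z. R * e')"
     by (intro set_integrable_mult_right set_integrable_subset[OF fi E(1)], use ed[of n] in blast)
      (rule set_integrable_const[OF E(1,2)])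
    have "(SINT z:?A \<times> edges ?et. (case z of (t, p) => cmod (Wp t p))) <= (SINT z:?A \<times> edges ?et. ?et * f z + R * e')"
     by (rule set_integral_mono_nonneg[OF set_integral_add(1)[OF i]]) (use Wb et R e' f0 in auto)
    also have "... = ?et * F ?et + (bt - ah) * (2 * ?et) * (R * e')"
     unfolding set_integral_add(2)[OF i] set_integral_mult_right F_def set_integrable_const(2)[OF E(1,2)] E(3)[OF less_imp_le[OF \<open>ah < bt\<close>]] by (simp only: mult_ac)
    finally have "?Q n <= F ?et + 2 * R * (bt - ah) * e'" unfolding pos_divide_le_eq[OF et] by (simp add: algebra_simps)
    moreover have "2 * R * (bt - ah) * e' <= e / 2"
     unfolding e'_def using den e by (simp add: field_simps)
    moreover have "q < e" if "q <= a + b" "b <= e / 2" "a < e / 2" for q a b :: real using that by argo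
    ultimately have "?Q n < e" using elim(2) by blast
    thus ?case using Q0[of n] by (simp only: dist_real_def diff_zero abs_of_nonneg)
   qed
  qed
 qed
qed

text \<open>The strip begins at ln (kp ep) because beyond radius ep both rays p = 0 and p = pi lie
  on the Neumann part of the boundary.\<close>

theorem strip: "strip_wave W Wt Wp Wtt Wpp (ln (kp * ep))"
proof (unfold_locales, goal_cases)
 case (12 ah bt) show ?case by (rule polar_energy(1)[of _ bt]) auto
next
 case (13 ah bt) show ?case by (rule polar_energy(2)[of _ bt]) auto
qed (rule W_deriv W_pde W_cont W_bounded W_neumann W_radiation; assumption)+

end

section \<open>Integration along rays and exponential weights\<close>

lemma set_Fubini_swap:
 fixes f :: "real => real => 'b::{banach, second_countable_topology}"
 assumes "sint (A \<times> B) (%(t, p). f t p)"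
 shows "AE p in lborel. p : B \<longrightarrow> sint A (%t. f t p)"
  and "sint B (%p. SINT t:A. f t p)"
  and "(SINT p:B. SINT t:A. f t p) = (SINT z:A \<times> B. (case z of (t, p) => f t p))"
proof -
 let ?F = "%(t, p). ind B p *R (ind A t *R f t p)"
 have eq: "(%z. ind (A \<times> B) z *R (case z of (t, p) => f t p)) = ?F"
  by (auto simp: fun_eq_iff indicator_def)
 have i: "integrable (lborel \<Otimes>\<^sub>M lborel) (%(t, p). ind B p *R (ind A t *R f t p))"
  using assms unfolding sint_def eq by (simp add: lborel_prod)
 show "AE p in lborel. p : B \<longrightarrow> sint A (%t. f t p)"
  using lborel_pair.AE_integrable_snd[OF i] by eventually_elim (auto simp: sint_def)
 have s: "(LINT t|lborel. ind B p *R (ind A t *R f t p)) = ind B p *R (SINT t:A. f t p)" for p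
  unfolding int_def integral_scaleR_right[symmetric] by simp
 show "sint B (%p. SINT t:A. f t p)"
  using lborel_pair.integrable_snd[OF i] unfolding s by (simp add: sint_def)
 show "(SINT p:B. SINT t:A. f t p) = (SINT z:A \<times> B. (case z of (t, p) => f t p))"
  using lborel_pair.integral_snd[OF i, unfolded s]
  unfolding int_def eq by (simp add: lborel_prod)
qed

lemma sq_increment_open:
 fixes f f' :: "real => complex"
 assumes f: "!!s. s : {x..y} ==> (f has_vector_derivative f' s) (at s)" and c: "continuous_on {x..y} f'" and xy: "x <= y" "{x<..<y} \<subseteq> S"
  and i: "sint S (%s. nsq (f' s))"
 shows "nsq (f y - f x) <= (y - x) * (SINT s:S. nsq (f' s))"
proof -
 have "continuous_on {x..y} (%s. nsq (f' s))" by (intro continuous_intros c)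
 note o = integral_open_box[OF this]
 have "integral {x..y} (%s. nsq (f' s)) <= (SINT s:S. nsq (f' s))"
  unfolding o(2)[symmetric] by (rule set_integral_mono_subset[OF o(1) i xy(2)]) simp_all
 from mult_left_mono[OF this, of "y - x"] sq_increment_cont[OF f c xy(1)] xy show ?thesis by fastforce
qed

lemma exp_integral:
 fixes b c :: real
 assumes c: "0 < c"
 shows "sint {..<b} (%t. exp (c * t))" "(SINT t:{..<b}. exp (c * t)) = exp (c * b) / c"
proof -
 let ?F = "%t. exp (c * t) / c"
 have d: "DERIV ?F x :> exp (c * x)" for x
  using DERIV_cdivide[OF DERIV_fun_exp[OF DERIV_cmult_Id[of c]], of c x] c by simp
 have l: "((%t. ?F t) \<longlongrightarrow> 0) at_bot"
 proof -
  have "filterlim (%t. c * t) at_bot at_bot" using c by (simp add: filterlim_tendsto_pos_mult_at_bot[OF tendsto_const] filterlim_ident)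
  from filterlim_compose[OF exp_at_bot this] have "((%t. exp (c * t)) \<longlongrightarrow> 0) at_bot" .
  from tendsto_divide[OF this tendsto_const[of c]] show ?thesis using c by simp
 qed
 have A: "((?F \<circ> real_of_ereal) \<longlongrightarrow> 0) (at_right (- \<infinity>))" using l by (simp add: ereal_tendsto_simps)
 have "(?F \<longlongrightarrow> ?F b) (at_left b)" using c by (intro tendsto_intros) auto
 hence B: "((?F \<circ> real_of_ereal) \<longlongrightarrow> ?F b) (at_left (ereal b))" by (simp add: ereal_tendsto_simps)
 have n: "AE x in lborel. - \<infinity> < ereal x \<longrightarrow> ereal x < ereal b \<longrightarrow> 0 <= exp (c * x)" by simp
 have ct: "isCont (%t. exp (c * t)) x" for x by simp
 have lt: "- \<infinity> < ereal b" by simp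
 note F = interval_integral_FTC_nonneg[OF lt d ct n A B]
 have e: "einterval (- \<infinity>) (ereal b) = {..<b}" by (auto simp: einterval_def)
 show "sint {..<b} (%t. exp (c * t))" using F(1) unfolding e .
 show "(SINT t:{..<b}. exp (c * t)) = exp (c * b) / c"
  using F(2) unfolding interval_lebesgue_integral_def e by simp
qed

lemma AE_fst_neq: "AE z in (lborel :: (real \<times> real) measure). fst z ~= c"
proof (rule AE_I')
 have "emeasure (lborel \<Otimes>\<^sub>M lborel) ({c} \<times> (UNIV :: real set)) = emeasure lborel {c} * emeasure lborel (UNIV :: real set)"
  by (rule lborel.emeasure_pair_measure_Times) auto
 hence "emeasure lborel ({c} \<times> (UNIV :: real set)) = 0" by (simp add: lborel_prod)
 moreover have "{c} \<times> (UNIV :: real set) : sets lborel" by (simp add: borel_closed closed_Times)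
 ultimately show "{c} \<times> (UNIV :: real set) : null_sets lborel" by (simp add: null_sets_def)
qed auto

lemma strip_split:
 fixes g :: "real \<times> real => complex"
 assumes i: "sint (UNIV \<times> D) g" and D: "open D" and z: "!!t p. t >= b ==> p : D ==> g (t, p) = 0"
 shows "(SINT z:UNIV \<times> D. g z) = (SINT z:{..<a} \<times> D. g z) + (SINT z:{a<..<b} \<times> D. g z)"
proof (rule set_integral_split(3)[OF i])
 show "AE x in lborel. x : UNIV \<times> D \<longrightarrow> x : {..<a} \<times> D \<or> x : {a<..<b} \<times> D \<or> g x = 0"
  using AE_fst_neq[of a] AE_fst_neq[of b]
 proof eventually_elim
  case (elim x)
  thus ?case using z[of "fst x" "snd x"] by (cases x, cases "b <= fst x") auto
 qed
qed (use D in \<open>auto intro!: borel_open open_Times\<close>)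

section \<open>Upper and lower bounds for thin cavities\<close>

text \<open>The two bounds put the cavity inside the ball of radius \<open>exp (-2) / kp\<close>,
  where the radial cutoff is 1. The second also puts the half disc of radius 4 ep into t < -4, so
  the strip covers t >= -4 with room to spare.\<close>

locale thin_cavity = cavity_solution +
 assumes small: "kp * d <= exp (-2) / 2" "kp * ep <= exp (-2) / 100"
begin

lemma exp_small: "exp (-2 :: real) <= 1/4" "exp (-4 :: real) <= 1/16" "exp (-8 :: real) <= 1/256" "exp (-2 :: real) / 100 < exp (-4)"
proof -
 have e: "2 <= exp (1 :: real)" using exp_ge_add_one_self[of 1] by simp
 have "exp (2 :: real) = exp 1 ^ 2" by (simp add: exp_of_nat_mult[symmetric])
 also have "... >= 2 ^ 2" using e by (intro power_mono) auto
 finally have 2: "4 <= exp (2 :: real)" by simp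
 thus 1: "exp (-2 :: real) <= 1/4" by (simp add: exp_minus inverse_eq_divide divide_le_eq)
 have m: "exp (-4 :: real) = exp (-2) * exp (-2)" "exp (-8 :: real) = exp (-4) * exp (-4)" by (simp_all add: exp_add[symmetric])
 show 4: "exp (-4 :: real) <= 1/16" unfolding m using mult_mono[OF 1 1] by simp
 show "exp (-8 :: real) <= 1/256" unfolding m(2) using mult_mono[OF 4 4] by simp
 have "exp (1 :: real) <= 3" by (rule exp_le)
 hence "exp (1 :: real) ^ 2 <= 3 ^ 2" by (intro power_mono) auto
 hence "exp (2 :: real) < 100" by (simp add: exp_of_nat_mult[symmetric])
 hence "1 / 100 < exp (- 2 :: real)" by (simp add: exp_minus inverse_eq_divide field_simps)
 hence "exp (-2 :: real) * (1 / 100) < exp (-2) * exp (-2)" by (intro mult_strict_left_mono) auto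
 thus "exp (-2 :: real) / 100 < exp (-4)" unfolding m(1) by simp
qed

lemma small_facts: "ep + d <= exp (-2) / kp" "ln (kp * ep) < -4" "kp * d <= 1/8" "kp * ep <= 1/400"
proof -
 have "a + b <= E" if "a <= E / 2" "b <= E / 100" "0 < E" for a b E :: real using that by argo
 from this[OF small exp_gt_zero] have "kp * ep + kp * d <= exp (-2)" by (simp only: add.commute)
 hence "kp * (ep + d) <= exp (-2)" by (simp add: distrib_left)
 thus "ep + d <= exp (-2) / kp" using kp by (simp add: le_divide_eq mult.commute)
 have "kp * ep < exp (-4)" using small(2) exp_small(4) by linarith
 hence "ln (kp * ep) < ln (exp (-4))" using kp eps by (subst ln_less_cancel_iff) auto
 thus "ln (kp * ep) < -4" by simp
 show "kp * d <= 1/8" using small(1) exp_small(1) by simp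
 show "kp * ep <= 1/400" using small(2) exp_small(1) by simp
qed

abbreviation "Dm \<equiv> {0<..<pi}"

definition K where "K = (SINT x:cav. nsq (Ph1 x)) + (SINT x:cav. nsq (Ph2 x))"
definition M where "M = (SINT x:cav. nsq (Ph x))"
text \<open>\<open>Et + Ep\<close> is the Dirichlet energy of \<open>Ph\<close> in the half disc of
  radius \<open>exp (-4) / kp\<close>, by conformal invariance, and \<open>Em\<close> is kp^2 times
  the squared L2 norm there.\<close>

definition Et where "Et = (SINT z:{..<-4} \<times> Dm. (case z of (t, p) => nsq (Wt t p)))"
definition Ep where "Ep = (SINT z:{..<-4} \<times> Dm. (case z of (t, p) => nsq (Wp t p)))"
definition Em where "Em = (SINT z:{..<-4} \<times> Dm. (case z of (t, p) => (exp t)^2 * nsq (W t p)))"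
definition w4 where "w4 = (SINT p:Dm. nsq (W (-4) p))"

lemma inner: "sint ({..<-4} \<times> Dm) (%(t, p). nsq (Wt t p))" "sint ({..<-4} \<times> Dm) (%(t, p). nsq (Wp t p))"
  "sint ({..<-4} \<times> Dm) (%(t, p). (exp t)^2 * nsq (W t p))"
 by (rule polar_energy[of _ "-4"]; simp)+

lemma nonneg: "0 <= K" "0 <= M" "0 <= Et" "0 <= Ep" "0 <= Em" "0 <= w4"
 unfolding K_def M_def Et_def Ep_def Em_def w4_def
 by (intro add_nonneg_nonneg set_integral_nonneg'; simp split: prod.split)+

lemma M_le: "M <= d^2 * K"
proof -
 have "M <= d^2 * (SINT x:cav. nsq (Ph2 x))"
  using poincare_Ph[OF d order_refl] unfolding M_def cav_box .
 also have "... <= d^2 * K"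
  using set_integral_nonneg'[of cav "%x. nsq (Ph1 x)" lborel] by (intro mult_left_mono) (simp_all add: K_def)
 finally show ?thesis .
qed

lemma w4_integrable: "sint Dm (%p. nsq (W (-4) p))"
proof -
 obtain B where B: "\<forall>t\<in>{-4..-4}. \<forall>p\<in>Dm. cmod (W t p) <= B" using W_bounded[OF small_facts(2), of "-4"] by blast
 have "sint Dm (%_. B^2)"
  by (rule set_integrable_const) auto
 thus ?thesis
 proof (rule set_integrable_bound)
  have "continuous_on Dm (%p. case (-4, p) of (t, p) => W t p)"
   by (rule continuous_on_compose2[OF W_cont(1)[of UNIV]]) (auto intro!: continuous_intros)
  hence c: "continuous_on Dm (%p. nsq (W (-4) p))" by (intro continuous_intros) simp
  show "set_borel_measurable lborel Dm (%p. nsq (W (-4) p))"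
   by (rule set_borel_measurable_open[OF _ c]) simp
  show "AE p in lborel. p : Dm \<longrightarrow> norm (nsq (W (-4) p)) <= norm (B^2)"
   using B by (intro AE_I2 impI) (simp add: power_mono)
 qed
qed

text \<open>Integrating \<open>Wt\<close> inwards from t = -4 along a ray, with Cauchy-Schwarz,
  gives growth linear in -4 - t, that is, logarithmic in the radius. The radial energy is finite on
  almost every ray.\<close>

lemma W_growth:
 "AE p in lborel. p : Dm \<longrightarrow> (\<forall>t\<le>-4. nsq (W t p) <= 2 * nsq (W (-4) p) + 2 * (-4 - t) * (SINT s:{..<-4}. nsq (Wt s p)))"
 using set_Fubini_swap(1)[OF inner(1)]
proof eventually_elim
 case (elim p)
 show ?case
 proof (intro impI allI)
  fix t :: real assume p: "p : Dm" and t: "t <= -4"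
  let ?J = "SINT s:{..<-4}. nsq (Wt s p)"
  have c: "continuous_on {t..-4} (%s. Wt s p)"
  proof -
   have "continuous_on {t..-4} (%s. case (s, p) of (t, p) => Wt t p)"
    by (rule continuous_on_compose2[OF W_cont(2)[of UNIV]]) (use p in \<open>auto intro!: continuous_intros\<close>)
   thus ?thesis by simp
  qed
  have "nsq (W (-4) p - W t p) <= (-4 - t) * ?J"
   by (rule sq_increment_open[where f = "%s. W s p" and f' = "%s. Wt s p", OF W_deriv(1)[OF p] c t]) (use elim p in auto)
  moreover have "nsq (W t p) <= 2 * nsq (W (-4) p) + 2 * nsq (W (-4) p - W t p)"
   using sq_add[of "W (-4) p" "W t p - W (-4) p"] by (simp add: norm_minus_commute)
  moreover have "2 * (-4 - t) * ?J = 2 * ((-4 - t) * ?J)" by (rule mult.assoc)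
  ultimately show "nsq (W t p) <= 2 * nsq (W (-4) p) + 2 * (-4 - t) * ?J" by linarith
 qed
qed

text \<open>Insert \<open>W_growth\<close> and bound -4 - t by exp (-4 - t), which turns the weight
  exp (2 t) into exp (-4) exp t. After integration both terms carry exp (-8), small enough for
  \<open>Em\<close> to be absorbed by \<open>w4\<close> and \<open>Et\<close>.\<close>

lemma Em_le: "Em <= exp (-8) * w4 + 2 * exp (-8) * Et"
proof -
 note Fm = set_Fubini_swap[OF inner(3)] and Ft = set_Fubini_swap[OF inner(1)]
 let ?J = "%p. SINT s:{..<-4}. nsq (Wt s p)"
 have "Em = (SINT p:Dm. SINT t:{..<-4}. (exp t)^2 * nsq (W t p))"
  unfolding Em_def by (rule Fm(3)[symmetric])
 also have "... <= (SINT p:Dm. exp (-8) * nsq (W (-4) p) + 2 * exp (-8) * ?J p)"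
 proof (rule set_integral_mono_AE[OF Fm(2)])
  show "sint Dm (%p. exp (-8) * nsq (W (-4) p) + 2 * exp (-8) * ?J p)"
   by (intro set_integral_add set_integrable_mult_right w4_integrable Ft(2))
  show "AE p\<in>Dm in lborel. (SINT t:{..<-4}. (exp t)^2 * nsq (W t p)) <= exp (-8) * nsq (W (-4) p) + 2 * exp (-8) * ?J p"
   using Fm(1) W_growth
  proof (eventually_elim, intro impI, goal_cases)
   case elim: (1 p)
   let ?a = "nsq (W (-4) p)"
   have J0: "?J p >= 0" by (rule set_integral_nonneg') simp
   note e2 = exp_integral[of 2 "-4"] and e1 = exp_integral[of 1 "-4"]
   let ?g = "%t. 2 * ?a * exp (2 * t) + 2 * ?J p * exp (-4) * exp (1 * t)"
   have gi: "sint {..<-4} ?g"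
    by (intro set_integral_add set_integrable_mult_right e1 e2) auto
   have "(SINT t:{..<-4}. (exp t)^2 * nsq (W t p)) <= (SINT t:{..<-4}. ?g t)"
   proof (rule set_integral_mono[OF _ gi])
    show "sint {..<-4} (%t. (exp t)^2 * nsq (W t p))" using elim by blast
    fix t :: real assume "t : {..<-4}"
    hence t: "t <= -4" by simp
    have e: "(exp t)^2 = exp (2 * t)" by (simp add: power2_eq_square exp_add[symmetric])
    have "exp (2 * t) * nsq (W t p) <= exp (2 * t) * (2 * ?a + 2 * (-4 - t) * ?J p)"
     using elim(2,5) t by (intro mult_left_mono) auto
    also have "... <= exp (2 * t) * (2 * ?a + 2 * exp (-4 - t) * ?J p)"
     using exp_ge_add_one_self[of "-4 - t"] J0 by (intro mult_left_mono add_left_mono mult_right_mono) auto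
    also have "... = 2 * ?a * exp (2 * t) + 2 * ?J p * (exp (2 * t) * exp (-4 - t))" by (simp add: distrib_left)
    also have "exp (2 * t) * exp (-4 - t) = exp (-4) * exp (1 * t)" by (simp add: exp_add[symmetric])
    finally show "(exp t)^2 * nsq (W t p) <= ?g t" unfolding e by (simp add: mult.assoc)
   qed
   also have "(SINT t:{..<-4}. ?g t) = 2 * ?a * (exp (2 * -4) / 2) + 2 * ?J p * exp (-4) * (exp (1 * -4) / 1)"
   proof (subst set_integral_add(2))
    show "sint {..<-4} (%t. 2 * ?a * exp (2 * t))" "sint {..<-4} (%t. 2 * ?J p * exp (-4) * exp (1 * t))"
     by (intro set_integrable_mult_right e1 e2; simp)+
   qed (simp only: set_integral_mult_right e1(2)[OF zero_less_one] e2(2)[OF zero_less_numeral])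
   also have "... = exp (-8) * ?a + 2 * exp (-8) * ?J p"
   proof -
    have "exp (-4 :: real) * exp (-4) = exp (-8)" by (simp add: exp_add[symmetric])
    thus ?thesis by (simp add: mult_ac)
   qed
   finally show ?case by simp
  qed
 qed
 also have "... = exp (-8) * w4 + 2 * exp (-8) * Et"
 proof (subst set_integral_add(2))
  show "sint Dm (%p. exp (-8) * nsq (W (-4) p))" "sint Dm (%p. 2 * exp (-8) * ?J p)"
   by (intro set_integrable_mult_right w4_integrable Ft(2))+
 qed (simp only: set_integral_mult_right Ft(3) w4_def Et_def)
 finally show ?thesis .
qed

end

text \<open>This is 1 + 9 K0 with \<open>K0\<close> expanded: 1 for the real part of the source, 9
  K0 for the flux, which is its imaginary part.\<close>

definition energy_const :: real where "energy_const = 1 + 18 * exp (exp 8 / 4)"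

lemma energy_const_ge: "1 <= energy_const"
 unfolding energy_const_def by simp

context thin_cavity begin

lemma box_const:
 assumes "a <= a'" "b <= b'"
 shows "sint (box (pt a b) (pt a' b')) (%_. c :: real)" "(SINT x:box (pt a b) (pt a' b'). c) = c * ((a' - a) * (b' - b))"
proof -
 have m: "measure lborel (box (pt a b) (pt a' b')) = (a' - a) * (b' - b)"
  using box_area[OF assms] by (simp add: measure_lborel_box_eq measure_lborel_cbox_eq)
 show "sint (box (pt a b) (pt a' b')) (%_. c)" by (rule set_integrable_const) auto
 show "(SINT x:box (pt a b) (pt a' b'). c) = c * ((a' - a) * (b' - b))"
  by (subst set_integrable_const(2)) (simp_all add: m)
qed

lemma cav_const: "sint cav (%_. c :: real)" "(SINT x:cav. c) = c * (ep * d)"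
 unfolding cav_box using box_const[of 0 ep "- d" "- d + d" c] eps d by simp_all

lemma radial_cav: "x : cav ==> radial kp x = 1 \<and> radial' i kp x = 0"
proof -
 assume x: "x : cav"
 hence "norm x < ep + d" using cav_ball by auto
 thus ?thesis using small_facts(1) x by (intro radial_props(5)[OF kp]) (auto simp: cav_iff)
qed

text \<open>The Dirichlet part is conformally invariant and kp^2 |Ph|^2 receives the weight exp (2
  t). The gradient of the cutoff is radial, so of the cutoff term only \<open>Wt\<close> survives,
  with the factor -step' (t + 2).\<close>

lemma polar_density:
 assumes p: "p : Dm"
 shows "(exp t / kp)^2 *R (of_real (radial kp (pl kp t p) * energy_density (pl kp t p)) + radial_term (pl kp t p)) =
  of_real (chi t * nsq (Wt t p)) + of_real (chi t * nsq (Wp t p)) - of_real (chi t * ((exp t)^2 * nsq (W t p)))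
   - step' (t + 2) *R (Wt t p * cnj (W t p))"
proof -
 let ?x = "pl kp t p" and ?r = "exp t / kp"
 have r: "?r > 0" using kp by simp
 have X: "radial kp ?x = chi t" unfolding radial_def chi_def ln_norm_pl[OF kp] ..
 have X': "radial' i kp ?x = - step' (t + 2) * (?x $ i / ?r^2)" for i
  unfolding radial'_def ln_norm_pl[OF kp] unfolding norm_pl[OF kp] ..
 have 1: "?r^2 * energy_density ?x = nsq (Wt t p) + nsq (Wp t p) - (exp t)^2 * nsq (W t p)"
 proof -
  have "?r^2 * kp^2 = (exp t)^2" using kp by (simp add: power_divide)
  hence "?r^2 * (kp^2 * nsq (Ph ?x)) = (exp t)^2 * nsq (W t p)" unfolding W_def by (simp only: mult.assoc[symmetric])
  thus ?thesis unfolding energy_density_def W_norms by (simp only: right_diff_distrib)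
 qed
 have gen: "R^2 *R ((of_real (- s * (a / R^2)) * f + of_real (- s * (b / R^2)) * g) * q) = - (s *R ((a *R f + b *R g) * q))"
  if "R > 0" for R s a b :: real and f g q :: complex
 proof -
  have "R^2 * (- s * (y / R^2)) = - s * y" for y using that by simp
  hence e: "of_real (R^2) * (of_real (- s * (y / R^2)) :: complex) = of_real (- s * y)" for y by (simp only: of_real_mult[symmetric])
  have "R^2 *R ((of_real (- s * (a / R^2)) * f + of_real (- s * (b / R^2)) * g) * q) =
    ((of_real (R^2) * of_real (- s * (a / R^2))) * f + (of_real (R^2) * of_real (- s * (b / R^2))) * g) * q"
   unfolding scaleR_conv_of_real by (simp only: distrib_left distrib_right mult.assoc)
  also have "... = - (s *R ((a *R f + b *R g) * q))"
   unfolding e by (simp add: scaleR_conv_of_real algebra_simps)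
  finally show ?thesis .
 qed
 have 2: "?r^2 *R radial_term ?x = - (step' (t + 2) *R (Wt t p * cnj (W t p)))"
  unfolding radial_term_def X' gen[OF r] Wt_def W_def pl_nth ..
 have "?r^2 *R complex_of_real (radial kp ?x * energy_density ?x) = of_real (chi t * (?r^2 * energy_density ?x))"
  unfolding X scaleR_conv_of_real of_real_mult[symmetric] by (simp only: mult_ac)
 also have "... = of_real (chi t * nsq (Wt t p)) + of_real (chi t * nsq (Wp t p)) - of_real (chi t * ((exp t)^2 * nsq (W t p)))"
  unfolding 1 by (simp only: of_real_add of_real_diff distrib_left right_diff_distrib)
 finally show ?thesis unfolding scaleR_add_right 2 by simp
qed

text \<open>Combine the real part of \<open>energy_identity\<close> with
  \<open>mode_inequality\<close>: the energies weighted by \<open>chi\<close> cancel, and a multiple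
  of Im S remains. The energy densities are real, so the imaginary part of the identity equates Im S
  with that of the source.\<close>

lemma energy_inequality:
 "K - kp^2 * M + (Et + Ep) / 2 + w4 / 16 <= energy_const * cmod (SINT x:cav. source x)"
proof -
 interpret sw: strip_wave W Wt Wp Wtt Wpp "ln (kp * ep)" by (rule strip)
 let ?A = "{-4<..<-1::real}"
 let ?f = "%x. of_real (radial kp x * energy_density x) + radial_term x"
 note EI = energy_identity[OF small_facts(1)]
 note sp = Om_split[OF EI(1)]
 let ?sg = "SINT x:cav. source x"
 define S where "S = strip_integral (%t. step' (t + 2)) (%t p. Wt t p * cnj (W t p))"
 define ot where "ot = strip_integral chi (%t p. nsq (Wt t p))"
 define op where "op = strip_integral chi (%t p. nsq (Wp t p))"
 define om where "om = strip_integral chi (%t p. (exp t)^2 * nsq (W t p))"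
 define ow where "ow = strip_integral chi (%t p. nsq (W t p))"
 note mode = sw.mode_inequality[OF small_facts(2), folded S_def ot_def op_def ow_def, unfolded integral_mpi, folded w4_def]
 have cavI: "(SINT x:cav. ?f x) = of_real (K - kp^2 * M)"
 proof -
  have "(SINT x:cav. ?f x) = (SINT x:cav. complex_of_real (energy_density x))"
   by (rule set_integral_eq) (simp add: radial_cav radial_term_def)
  also have "... = of_real (SINT x:cav. energy_density x)"
   by (rule set_integral_complex_of_real)
  also have "(SINT x:cav. energy_density x) = K - kp^2 * M"
   unfolding energy_density_def K_def M_def
   by (subst set_integral_diff(2), (intro set_integral_add set_integrable_mult_right cav_energy)+, subst set_integral_add(2), (intro cav_energy)+, simp)
  finally show ?thesis .
 qed
 have i3: "sint (?A \<times> Dm) (%(t, p). nsq (Wt t p))" "sint (?A \<times> Dm) (%(t, p). nsq (Wp t p))"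
  "sint (?A \<times> Dm) (%(t, p). (exp t)^2 * nsq (W t p))"
  by (rule polar_energy[of _ "-1"]; auto)+
 note chi_ok = chi_cont[of UNIV] chi_bounds(3)
 note oi = set_integrable_weight[OF i3(1) chi_ok] set_integrable_weight[OF i3(2) chi_ok] set_integrable_weight[OF i3(3) chi_ok]
 have AD: "open (?A \<times> Dm)" by (intro open_Times) auto
 have mW: "set_borel_measurable lborel (?A \<times> Dm) (%(t, p). nsq (W t p))"
  unfolding case_prod_beta by (intro set_borel_measurable_open AD continuous_intros W_cont[unfolded case_prod_beta])
 have iw: "sint (?A \<times> Dm) (%(t, p). nsq (W t p))"
 proof (rule set_integrable_bound[OF set_integrable_mult_right[OF i3(3), of "exp 8"] mW])
  have "nsq y <= exp 8 * ((exp t)^2 * nsq y)" if "t > -4" for t y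
  proof -
   have "1 <= exp (8 + 2 * t)" using that by simp
   also have "exp (8 + 2 * t) = exp 8 * (exp t)^2" by (simp add: power2_eq_square exp_add[symmetric])
   finally have "1 * nsq y <= exp 8 * (exp t)^2 * nsq y" by (intro mult_right_mono) auto
   thus ?thesis by (simp add: mult.assoc)
  qed
  thus "AE z in lborel. z : ?A \<times> Dm \<longrightarrow> norm (case z of (t, p) => nsq (W t p)) <= norm (exp 8 * (case z of (t, p) => (exp t)^2 * nsq (W t p)))"
   by (intro AE_I2) (auto split: prod.split)
 qed
 \<comment> \<open>Here the gain 7/16 of \<open>mode_ineq\<close> is spent: for t < -1 the Helmholtz
   weight exp (2 t) is at most exp (-2), which is below 7/16.\<close>
 have om_le: "om <= 7/16 * ow"
 proof -
  have "om <= (SINT z:?A \<times> Dm. 7/16 * (chi (fst z) *R (case z of (t, p) => nsq (W t p))))"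
   unfolding om_def
  proof (rule set_integral_mono[OF oi(3) set_integrable_mult_right[OF set_integrable_weight[OF iw chi_ok]]])
   fix z assume z: "z : ?A \<times> Dm"
   obtain t p where tp: "z = (t, p)" "t < -1" using z by auto
   have "(exp t)^2 = exp (2 * t)" by (simp add: power2_eq_square exp_add[symmetric])
   also have "... <= exp (-2)" using tp by simp
   also have "... <= 7/16" using exp_small(1) by simp
   finally have "(exp t)^2 * nsq (W t p) <= 7/16 * nsq (W t p)" by (intro mult_right_mono) auto
   hence "chi t * ((exp t)^2 * nsq (W t p)) <= chi t * (7/16 * nsq (W t p))"
    using chi_bounds(1)[of t] by (intro mult_left_mono)
   thus "chi (fst z) *R (case z of (t, p) => (exp t)^2 * nsq (W t p)) <= 7/16 * (chi (fst z) *R (case z of (t, p) => nsq (W t p)))"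
    unfolding tp(1) by simp
  qed
  also have "... = 7/16 * ow" unfolding ow_def by (rule set_integral_mult_right)
  finally show ?thesis .
 qed
 have upI: "(SINT x:up. ?f x) = of_real (Et + Ep - Em) + (of_real (ot + op - om) - S)"
 proof -
  let ?g = "%(t, p). (exp t / kp)^2 *R ?f (pl kp t p)"
  have up0: "0 \<notin> up" by (simp add: up_iff)
  have fc: "continuous_on up ?f"
   unfolding energy_density_def radial_term_def by (intro continuous_intros Ph_cont_up radial_cont[OF kp up0])
  have U: "{z : up. ln (kp * norm z) : UNIV} = up" by simp
  have c': "continuous_on {z : up. ln (kp * norm z) : UNIV} ?f" using fc by simp
  note P = polar_integral[OF kp open_UNIV c', unfolded U]
  have gi: "sint (UNIV \<times> Dm) ?g" using P(2) sp(2) by blast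
  have gz: "?g (t, p) = 0" if "-1 <= t" "p : Dm" for t p
   using polar_density[OF that(2), of t] that(1) chi_bounds(5)[of t] by simp
  have dec: "(SINT x:up. ?f x) = (SINT z:{..<-4} \<times> Dm. ?g z) + (SINT z:?A \<times> Dm. ?g z)"
   unfolding P(3) by (rule strip_split[OF gi _ gz]) simp_all
  have I1: "(SINT z:{..<-4} \<times> Dm. ?g z) = of_real (Et + Ep - Em)"
  proof -
   let ?e = "%z. (case z of (t, p) => nsq (Wt t p)) + (case z of (t, p) => nsq (Wp t p)) - (case z of (t, p) => (exp t)^2 * nsq (W t p))"
   have "(SINT z:{..<-4} \<times> Dm. ?g z) = (SINT z:{..<-4} \<times> Dm. complex_of_real (?e z))"
   proof (rule set_integral_eq)
    fix z :: "real \<times> real" assume "z : {..<-4} \<times> Dm"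
    then obtain t p where z: "z = (t, p)" "t < -4" "p : Dm" by auto
    thus "?g z = complex_of_real (?e z)" using polar_density[OF z(3), of t] chi_bounds(4)[of t] by simp
   qed
   also have "... = of_real (SINT z:{..<-4} \<times> Dm. ?e z)"
    by (rule set_integral_complex_of_real)
   also have "(SINT z:{..<-4} \<times> Dm. ?e z) = Et + Ep - Em"
    unfolding Et_def Ep_def Em_def
    by (subst set_integral_diff(2), (intro set_integral_add inner)+, subst set_integral_add(2), (intro inner)+, simp)
   finally show ?thesis .
  qed
  let ?o1 = "%z. chi (fst z) *R (case z of (t, p) => nsq (Wt t p))"
  let ?o2 = "%z. chi (fst z) *R (case z of (t, p) => nsq (Wp t p))"
  let ?o3 = "%z. chi (fst z) *R (case z of (t, p) => (exp t)^2 * nsq (W t p))"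
  let ?s = "%z. step' (fst z + 2) *R (case z of (t, p) => Wt t p * cnj (W t p))"
  have orI: "sint (?A \<times> Dm) (%z. ?o1 z + ?o2 z - ?o3 z)" by (intro set_integral_diff set_integral_add oi)
  have ocI: "sint (?A \<times> Dm) (%z. complex_of_real (?o1 z + ?o2 z - ?o3 z))"
  proof -
   have "(%z. ind (?A \<times> Dm) z *R complex_of_real (?o1 z + ?o2 z - ?o3 z)) = (%z. complex_of_real (ind (?A \<times> Dm) z *R (?o1 z + ?o2 z - ?o3 z)))"
    by (simp add: fun_eq_iff scaleR_conv_of_real)
   thus ?thesis using orI unfolding sint_def by (simp only: complex_of_real_integrable_eq)
  qed
  have gA: "?g z = complex_of_real (?o1 z + ?o2 z - ?o3 z) - ?s z" if "z : ?A \<times> Dm" for z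
  proof -
   obtain t p where z: "z = (t, p)" by force
   have p: "p : Dm" using that z by simp
   show ?thesis unfolding z using polar_density[OF p, of t] by (simp add: of_real_add of_real_diff)
  qed
  have gAi: "sint (?A \<times> Dm) ?g"
   by (rule set_integrable_subset[OF gi]) (use AD in auto)
  have sI: "sint (?A \<times> Dm) ?s"
   by (rule set_integrable_eq[OF set_integral_diff(1)[OF ocI gAi]]) (simp only: gA diff_diff_eq2 add_diff_cancel_left')
  have "(SINT z:?A \<times> Dm. ?g z) = (SINT z:?A \<times> Dm. complex_of_real (?o1 z + ?o2 z - ?o3 z) - ?s z)"
   by (rule set_integral_eq) (rule gA)
  also have "... = (SINT z:?A \<times> Dm. complex_of_real (?o1 z + ?o2 z - ?o3 z)) - S"
   unfolding S_def by (rule set_integral_diff(2)[OF ocI sI])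
  also have "(SINT z:?A \<times> Dm. complex_of_real (?o1 z + ?o2 z - ?o3 z)) = of_real (SINT z:?A \<times> Dm. ?o1 z + ?o2 z - ?o3 z)"
   by (rule set_integral_complex_of_real)
  also have "(SINT z:?A \<times> Dm. ?o1 z + ?o2 z - ?o3 z) = ot + op - om"
   unfolding ot_def op_def om_def
   using set_integral_diff(2)[OF set_integral_add(1)[OF oi(1,2)] oi(3)] set_integral_add(2)[OF oi(1,2)] by simp
  finally show ?thesis unfolding dec I1 by simp
 qed
 have eq: "of_real (K - kp^2 * M) + (of_real (Et + Ep - Em) + (of_real (ot + op - om) - S)) = - ?sg"
  using EI(3) sp(3) cavI upI by simp
 have re: "K - kp^2 * M + (Et + Ep - Em) + (ot + op - om) - Re S = - Re ?sg" using arg_cong[OF eq, of Re] by simp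
 have im: "Im S = Im ?sg" using arg_cong[OF eq, of Im] by simp
 have K0: "0 <= sw.K0" unfolding sw.K0_def by simp
 have "9 * sw.K0 * Im ?sg <= 9 * sw.K0 * cmod ?sg" using abs_Im_le_cmod[of ?sg] K0 by (intro mult_left_mono) auto
 moreover have "- Re ?sg <= cmod ?sg" using abs_Re_le_cmod[of ?sg] by linarith
 moreover have "energy_const * cmod ?sg = cmod ?sg + 9 * sw.K0 * cmod ?sg"
  unfolding energy_const_def sw.K0_def by (simp add: distrib_right)
 ultimately have "- Re ?sg + 9 * sw.K0 * Im S <= energy_const * cmod ?sg"
  unfolding im by linarith
 hence 1: "K - kp^2 * M + (Et + Ep - Em) + w4 / 8 <= energy_const * cmod ?sg"
  using mode(1) om_le re by linarith
 have "exp (-8) * w4 <= 1/256 * w4" "exp (-8) * Et <= 1/256 * Et"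
  using exp_small(3) nonneg by (intro mult_right_mono; simp)+
 hence "Em <= w4 / 16 + Et / 2" using Em_le nonneg by linarith
 moreover have "a + (et + ep) / 2 + w / 16 <= b" if "a + (et + ep - em) + w / 8 <= b" "em <= w / 16 + et / 2" "0 <= ep" for a et ep em w b :: real
  using that by argo
 ultimately show ?thesis using 1 nonneg(4) by blast
qed

lemma h_sq: "nsq (h1 x) <= 1 / d^2" "nsq (h2 x) <= 16 / d^2" "kp^2 * nsq (h x) <= 1 / d^2"
proof -
 have kpd: "kp <= 1 / (8 * d)" using small_facts(3) d by (simp add: le_divide_eq mult_ac)
 have k: "2 * kp <= 1 / d" using kpd d by (simp add: le_divide_eq)
 have "nsq (h1 x) <= (1 / d)^2" using h_bounds(2)[of x] k by (intro power_mono) auto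
 thus "nsq (h1 x) <= 1 / d^2" by (simp add: power_divide)
 have "2 * kp + 3 / d <= 4 / d" using k by simp
 hence "nsq (h2 x) <= (4 / d)^2" using h_bounds(3)[of x] by (intro power_mono) auto
 thus "nsq (h2 x) <= 16 / d^2" by (simp add: power_divide)
 have "kp * cmod (h x) <= kp * 2" using h_bounds(1)[of x] kp by (intro mult_left_mono) auto
 hence "kp * cmod (h x) <= 1 / d" using k by linarith
 hence "(kp * cmod (h x))^2 <= (1 / d)^2" using kp by (intro power_mono) auto
 thus "kp^2 * nsq (h x) <= 1 / d^2" by (simp add: power_divide power_mult_distrib)
qed

text \<open>The gradient of \<open>h\<close> and kp h are of size 1 / d on a cavity of area ep d, so
  the source costs a multiple of ep / d after a quarter of the cavity energy has been returned to
  the left side. The constants are 18 = 1 + 16 + 1 from \<open>h_sq\<close> and 288 = 16 * 18 from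
  the coefficient 1/16 of \<open>w4\<close>.\<close>

lemma energy_bound:
 "K <= 288 * energy_const^2 * (ep / d)" "Et + Ep <= 288 * energy_const^2 * (ep / d)" "w4 <= 288 * energy_const^2 * (ep / d)"
proof -
 let ?N = energy_const
 note N = energy_const_ge
 note hb = h_sq
 let ?g = "%x. 1/4 * nsq (Ph1 x) + 1/4 * nsq (Ph2 x) + kp^2 / 4 * nsq (Ph x) + 18 * ?N^2 / d^2"
 have gi: "sint cav ?g" by (intro set_integral_add set_integrable_mult_right cav_energy cav_const)
 have am: "?N * (a * b) <= 1/4 * b^2 + ?N^2 * a^2" for a b :: real
 proof -
  have "0 <= (b / 2 - ?N * a)^2" by simp
  thus ?thesis by (simp add: power2_eq_square algebra_simps)
 qed
 have sb: "cmod (?N *R source x) <= ?g x" for x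
 proof -
  have "cmod (source x) <= cmod (h1 x) * cmod (Ph1 x) + cmod (h2 x) * cmod (Ph2 x) + (kp * cmod (h x)) * (kp * cmod (Ph x))"
  proof -
   have "cmod (of_real (kp^2) * h x * cnj (Ph x)) = (kp * cmod (h x)) * (kp * cmod (Ph x))"
    unfolding norm_mult norm_of_real complex_mod_cnj abs_power2 by (simp add: power2_eq_square)
   moreover have "cmod (h1 x * cnj (Ph1 x) + h2 x * cnj (Ph2 x)) <= cmod (h1 x) * cmod (Ph1 x) + cmod (h2 x) * cmod (Ph2 x)"
    by (rule norm_triangle_le) (simp add: norm_mult)
   ultimately show ?thesis unfolding source_def by (intro norm_triangle_le_diff) linarith
  qed
  hence "?N * cmod (source x) <= ?N * (cmod (h1 x) * cmod (Ph1 x) + cmod (h2 x) * cmod (Ph2 x) + (kp * cmod (h x)) * (kp * cmod (Ph x)))"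
   using N by (intro mult_left_mono) auto
  also have "... = ?N * (cmod (h1 x) * cmod (Ph1 x)) + ?N * (cmod (h2 x) * cmod (Ph2 x)) + ?N * ((kp * cmod (h x)) * (kp * cmod (Ph x)))"
   by (simp only: distrib_left)
  also have "... <= (1/4 * nsq (Ph1 x) + ?N^2 * nsq (h1 x)) + (1/4 * nsq (Ph2 x) + ?N^2 * nsq (h2 x))
    + (1/4 * (kp * cmod (Ph x))^2 + ?N^2 * (kp * cmod (h x))^2)"
   by (intro add_mono am)
  also have "... = 1/4 * nsq (Ph1 x) + 1/4 * nsq (Ph2 x) + kp^2 / 4 * nsq (Ph x)
    + ?N^2 * (nsq (h1 x) + nsq (h2 x) + kp^2 * nsq (h x))"
   by (simp add: power_mult_distrib algebra_simps)
  also have "?N^2 * (nsq (h1 x) + nsq (h2 x) + kp^2 * nsq (h x)) <= ?N^2 * (1 / d^2 + 16 / d^2 + 1 / d^2)"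
   by (intro mult_left_mono add_mono hb) simp
  also have "?N^2 * (1 / d^2 + 16 / d^2 + 1 / d^2) = 18 * ?N^2 / d^2" by (simp add: add_divide_distrib[symmetric])
  finally show ?thesis using N by simp
 qed
 have "cmod (SINT x:cav. ?N *R source x) <= (SINT x:cav. ?g x)"
  by (rule set_integral_norm_le[OF set_integrable_scaleR_right[OF energy_identity(2)[OF small_facts(1)]] gi sb])
 also have "(SINT x:cav. ?g x) = K / 4 + kp^2 / 4 * M + 18 * ?N^2 / d^2 * (ep * d)"
 proof -
  note a = set_integrable_mult_right[OF cav_energy(5), of "1/4"] set_integrable_mult_right[OF cav_energy(6), of "1/4"]
   set_integrable_mult_right[OF cav_energy(4), of "kp^2 / 4"]
  show ?thesis
   using set_integral_add(2)[OF set_integral_add(1)[OF set_integral_add(1)[OF a(1,2)] a(3)] cav_const(1)[of "18 * ?N^2 / d^2"]]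
    set_integral_add(2)[OF set_integral_add(1)[OF a(1,2)] a(3)] set_integral_add(2)[OF a(1,2)]
   unfolding cav_const(2) set_integral_mult_right K_def M_def by simp
 qed
 also have "18 * ?N^2 / d^2 * (ep * d) = 18 * ?N^2 * (ep / d)" using d by (simp add: power2_eq_square)
 finally have src: "?N * cmod (SINT x:cav. source x) <= K / 4 + kp^2 / 4 * M + 18 * ?N^2 * (ep / d)"
  using N by simp
 \<comment> \<open>With \<open>kp * d <= 1/8\<close> the Poincare inequality makes the indefinite
   Helmholtz term of the cavity a small fraction of its Dirichlet energy.\<close>
 have "kp^2 * M <= 1/64 * K"
 proof -
  have "kp^2 * M <= kp^2 * (d^2 * K)" by (intro mult_left_mono M_le) simp
  also have "... = (kp * d)^2 * K" by (simp add: power_mult_distrib)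
  also have "... <= (1/8)^2 * K" using small_facts(3) kp d nonneg(1) by (intro mult_right_mono power_mono) auto
  finally show ?thesis by (simp add: power2_eq_square)
 qed
 hence fin: "K / 2 + (Et + Ep) / 2 + w4 / 16 <= 18 * ?N^2 * (ep / d)"
  using src energy_inequality nonneg(1) by linarith
 have n0: "0 <= ?N^2 * (ep / d)" using eps d by simp
 show "K <= 288 * ?N^2 * (ep / d)" "Et + Ep <= 288 * ?N^2 * (ep / d)" "w4 <= 288 * ?N^2 * (ep / d)"
 proof -
  have gen: "k <= 288 * X" "e <= 288 * X" "w <= 288 * X"
   if "k / 2 + e / 2 + w / 16 <= 18 * X" "0 <= k" "0 <= e" "0 <= w" "0 <= X" for k e w X :: real
   using that by argo+
  note g = gen[OF fin[unfolded mult.assoc] nonneg(1) add_nonneg_nonneg[OF nonneg(3,4)] nonneg(6) n0]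
  show "K <= 288 * ?N^2 * (ep / d)" "Et + Ep <= 288 * ?N^2 * (ep / d)" "w4 <= 288 * ?N^2 * (ep / d)"
   unfolding mult.assoc by (rule g(1), rule g(2), rule g(3))
 qed
qed

lemma u_bottom:
 assumes x: "0 < x" "x < ep"
 shows "((%y. u (pt x y)) \<longlongrightarrow> 0) (at_right (- d))"
proof -
 have p: "((%y. pt x y) \<longlongrightarrow> pt x (- d)) (at_right (- d))"
  using continuous_on_tendsto_compose[of UNIV "%y. pt x y" "%y. y" "- d" "at_right (- d)"]
  by (simp add: continuous_intros)
 have "isCont h (pt x (- d))" by (rule grad_at_continuous[OF h_grad])
 from isCont_tendsto_compose[OF this p] have "((%y. h (pt x y)) \<longlongrightarrow> h (pt x (- d))) (at_right (- d))" .
 moreover have "h (pt x (- d)) = 0" using ramp_props(6)[OF d, of "pt x (- d)"] by (simp add: h_def)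
 ultimately have "((%y. h (pt x y)) \<longlongrightarrow> 0) (at_right (- d))" by simp
 from tendsto_add[OF Ph_bottom[OF x] this] show ?thesis by (simp add: Ph_def)
qed

lemma poincare_u: "(SINT x:cav. nsq (u x)) <= d^2 * (SINT x:cav. nsq (u2 x))"
 unfolding cav_box
proof (rule poincare[OF d])
 fix z assume "z : box (pt 0 (- d)) (pt ep (- d + d))"
 thus "grad_at u (u1 z) (u2 z) z" using u_grad(1) subsets(1) unfolding cav_box by blast
next
 show "continuous_on (box (pt 0 (- d)) (pt ep (- d + d))) u2"
  using continuous_on_subset[OF u_cont(2) subsets(1)] unfolding cav_box .
 show "sint (box (pt 0 (- d)) (pt ep (- d + d))) (%z. nsq (u z))"
  "sint (box (pt 0 (- d)) (pt ep (- d + d))) (%z. nsq (u2 z))"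
  using cav_energy(1,3) unfolding cav_box by blast+
qed (rule u_bottom)

lemma cav_upper:
 "(SINT x:cav. nsq (u x)) <= 2 * M + 8 * (ep * d)"
 "(SINT x:cav. nsq (u1 x)) <= 2 * (SINT x:cav. nsq (Ph1 x)) + 2 * (ep / d)"
 "(SINT x:cav. nsq (u2 x)) <= 2 * (SINT x:cav. nsq (Ph2 x)) + 32 * (ep / d)"
proof -
 have gen: "(SINT x:cav. nsq (f x)) <= 2 * (SINT x:cav. nsq (g x)) + 2 * B * (ep * d)"
  if "sint cav (%x. nsq (f x))" "sint cav (%x. nsq (g x))"
   "!!x. f x = g x + k x" "!!x. nsq (k x) <= B" for f g k :: "real^2 => complex" and B
 proof -
  note i = set_integrable_mult_right[OF that(2), of 2]
  have "(SINT x:cav. nsq (f x)) <= (SINT x:cav. 2 * nsq (g x) + 2 * B)"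
  proof (rule set_integral_mono[OF that(1) set_integral_add(1)[OF i cav_const(1)]])
   fix x show "nsq (f x) <= 2 * nsq (g x) + 2 * B"
    unfolding that(3) using sq_add[of "g x" "k x"] that(4)[of x] by linarith
  qed
  also have "... = 2 * (SINT x:cav. nsq (g x)) + 2 * B * (ep * d)"
   unfolding set_integral_add(2)[OF i cav_const(1)] cav_const(2) set_integral_mult_right by simp
  finally show ?thesis .
 qed
 have e: "B / d^2 * (ep * d) = B * (ep / d)" for B using d by (simp add: power2_eq_square)
 have "nsq (h x) <= 2^2" for x using h_bounds(1)[of x] by (intro power_mono) auto
 thus "(SINT x:cav. nsq (u x)) <= 2 * M + 8 * (ep * d)"
  unfolding M_def using gen[OF cav_energy(1,4), of h 4] by (simp add: Ph_def)
 show "(SINT x:cav. nsq (u1 x)) <= 2 * (SINT x:cav. nsq (Ph1 x)) + 2 * (ep / d)"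
  using gen[OF cav_energy(2,5) _ h_sq(1)] e[of 2] by (simp add: Ph1_def)
 show "(SINT x:cav. nsq (u2 x)) <= 2 * (SINT x:cav. nsq (Ph2 x)) + 32 * (ep / d)"
  using gen[OF cav_energy(3,6) _ h_sq(2)] e[of 32] by (simp add: Ph2_def)
qed

text \<open>Thus the half disc of radius 4 ep about the origin, which contains the boxes above the
  aperture used below, lies in t < -4.\<close>

lemma near_aperture: "4 * (kp * ep) < exp (-4)"
proof -
 have "exp (1 :: real) ^ 2 <= 3 ^ 2" by (intro power_mono exp_le) auto
 hence "exp (2 :: real) < 25" by (simp add: exp_of_nat_mult[symmetric])
 hence "1 / 25 < exp (- 2 :: real)" by (simp add: exp_minus inverse_eq_divide field_simps)
 hence "exp (-2 :: real) * (1 / 25) < exp (-2) * exp (-2)" by (intro mult_strict_left_mono) auto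
 also have "exp (-2) * exp (-2) = exp (-4 :: real)" by (simp add: exp_add[symmetric])
 finally show ?thesis using small(2) by simp
qed

lemma norm_le_box: "0 < (z :: real^2) $ 1 ==> z $ 1 < ep ==> 0 < z $ 2 ==> z $ 2 < 3 * ep ==> norm z < 4 * ep"
 using sqrt_sum_squares_le_sum_abs[of "z $ 1" "z $ 2"] unfolding norm_pt by simp

lemma upper_box_energy: "(SINT x:box (pt 0 0) (pt ep (3 * ep)). nsq (Ph2 x)) <= Et + Ep"
proof -
 let ?A = "{..<-4::real}"
 let ?U = "{z : up. ln (kp * norm z) : ?A}"
 let ?e = "%x. nsq (Ph1 x) + nsq (Ph2 x)"
 have c: "continuous_on ?U ?e"
  by (intro continuous_intros continuous_on_subset[OF Ph_cont_up(2)] continuous_on_subset[OF Ph_cont_up(3)]; auto)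
 note P = polar_integral_real[OF kp open_lessThan c, unfolded W_norms[symmetric]]
 have cs: "(case z of (t, p) => nsq (Wt t p) + nsq (Wp t p)) = (case z of (t, p) => nsq (Wt t p)) + (case z of (t, p) => nsq (Wp t p))" for z
  by (simp split: prod.split)
 have ti: "sint (?A \<times> Dm) (%(t, p). nsq (Wt t p) + nsq (Wp t p))"
  unfolding cs by (rule set_integral_add(1)[OF inner(1,2)])
 have I: "(SINT x:?U. ?e x) = Et + Ep"
  unfolding P(2) Et_def Ep_def cs by (rule set_integral_add(2)[OF inner(1,2)])
 have i: "sint ?U ?e" using P(1) ti by blast
 have sub: "box (pt 0 0) (pt ep (3 * ep)) \<subseteq> ?U"
 proof
  fix z assume "z : box (pt 0 0) (pt ep (3 * ep))"
  hence z: "0 < z $ 1" "z $ 1 < ep" "0 < z $ 2" "z $ 2 < 3 * ep" by (auto simp: in_open_box)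
  hence n: "0 < norm z" by auto
  have "kp * norm z < kp * (4 * ep)" using norm_le_box[OF z] kp by (intro mult_strict_left_mono)
  hence "kp * norm z < exp (-4)" using near_aperture by simp
  hence "ln (kp * norm z) < ln (exp (-4))" using kp n by (subst ln_less_cancel_iff) auto
  thus "z : ?U" using z by (simp add: up_iff)
 qed
 have si: "sint (box (pt 0 0) (pt ep (3 * ep))) (%x. nsq (Ph2 x))"
 proof (rule set_integrable_subset[OF Ph_energy(3)[of "4 * ep"]])
  show "box (pt 0 0) (pt ep (3 * ep)) \<subseteq> Om \<inter> ball 0 (4 * ep)"
   using norm_le_box by (auto simp: in_open_box Om_iff)
 qed simp
 have "(SINT x:box (pt 0 0) (pt ep (3 * ep)). nsq (Ph2 x)) <= (SINT x:?U. ?e x)"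
  by (rule set_integral_mono_subset[OF si i sub]) simp_all
 thus ?thesis unfolding I .
qed

text \<open>The box lies in the half annulus 2 ep < r < 4 ep, of logarithmic width ln 2 <= 1. There
  the weight exp (2 t) is at most 16 (kp ep)^2, and \<open>W_growth\<close> contributes a factor 2
  and the logarithm -4 - ln (2 kp ep).\<close>

lemma upper_box_mass:
 "(SINT x:box (pt 0 (2 * ep)) (pt ep (3 * ep)). nsq (Ph x)) <= 32 * ep^2 * (w4 + (- 4 - ln (2 * kp * ep)) * Et)"
proof -
 define tu where "tu = ln (2 * kp * ep)"
 have k: "0 < 2 * kp * ep" using kp eps by simp
 have tu2: "tu + ln 2 = ln (4 * kp * ep)" 
 proof -
  have "ln (2 * (2 * kp * ep)) = ln 2 + ln (2 * kp * ep)" using k by (intro ln_mult_pos) auto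
  thus ?thesis by (simp add: tu_def mult.assoc)
 qed
 have tu4: "tu + ln 2 < -4"
 proof -
  have "4 * kp * ep < exp (-4)" using near_aperture by simp
  hence "ln (4 * kp * ep) < ln (exp (-4))" using k by (subst ln_less_cancel_iff) auto
  thus ?thesis unfolding tu2 by simp
 qed
 have l2: "0 <= ln (2::real)" "ln (2::real) <= 1" using ln_le_minus_one[of "2::real"] by auto
 let ?A = "{tu<..<tu + ln 2}"
 let ?U = "{z : up. ln (kp * norm z) : ?A}"
 let ?Q = "box (pt 0 (2 * ep)) (pt ep (3 * ep)) :: (real^2) set"
 let ?e = "%x. kp^2 * nsq (Ph x)"
 have c: "continuous_on ?U ?e" by (intro continuous_intros continuous_on_subset[OF Ph_cont_up(1)]) auto
 have e: "(exp t / kp)^2 * (kp^2 * nsq (Ph (pl kp t p))) = (exp t)^2 * nsq (W t p)" for t p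
  using kp by (simp add: power_divide W_def)
 note P = polar_integral_real[OF kp open_greaterThanLessThan c, unfolded e]
 have pi: "sint (?A \<times> Dm) (%(t, p). (exp t)^2 * nsq (W t p))"
  by (rule polar_energy(3)[of _ "tu + ln 2"]) auto
 have i: "sint ?U ?e" using P(1) pi by blast
 have sub: "?Q \<subseteq> ?U"
 proof
  fix z assume "z : ?Q"
  hence z: "0 < z $ 1" "z $ 1 < ep" "2 * ep < z $ 2" "z $ 2 < 3 * ep" by (auto simp: in_open_box)
  hence z2: "0 < z $ 2" using eps by linarith
  have "2 * ep < norm z" using z component_le_norm_cart[of z 2] by simp
  hence lo: "2 * kp * ep < kp * norm z" using kp by (simp add: mult.left_commute mult.commute)
  have hi: "kp * norm z < 4 * kp * ep" using norm_le_box[OF z(1,2) z2 z(4)] kp by simp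
  note n0 = less_trans[OF k lo]
  have "tu < ln (kp * norm z)" unfolding tu_def using ln_less_cancel_iff[OF k n0] lo by blast
  moreover have "ln (kp * norm z) < tu + ln 2" unfolding tu2 using ln_less_cancel_iff[OF n0 less_trans[OF n0 hi]] hi by blast
  ultimately show "z : ?U" using z2 by (simp add: up_iff)
 qed
 let ?J = "%p. SINT s:{..<-4}. nsq (Wt s p)"
 let ?R = "%p. 32 * (kp * ep)^2 * nsq (W (-4) p) + 32 * (kp * ep)^2 * (- 4 - tu) * ?J p"
 have si: "sint ?Q ?e" by (rule set_integrable_subset[OF i _ sub]) simp
 have "(SINT x:?Q. ?e x) <= (SINT x:?U. ?e x)"
  by (rule set_integral_mono_subset[OF si i sub]) simp_all
 also have "... = (SINT z:?A \<times> Dm. (case z of (t, p) => (exp t)^2 * nsq (W t p)))" by (rule P(2))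
 also have "... = (SINT p:Dm. SINT t:?A. (exp t)^2 * nsq (W t p))"
  by (rule set_Fubini_swap(3)[OF pi, symmetric])
 also have "... <= (SINT p:Dm. ?R p)"
 proof (rule set_integral_mono_AE[OF set_Fubini_swap(2)[OF pi]])
  show "sint Dm ?R"
   by (intro set_integral_add set_integrable_mult_right w4_integrable set_Fubini_swap(2)[OF inner(1)])
  show "AE p\<in>Dm in lborel. (SINT t:?A. (exp t)^2 * nsq (W t p)) <= ?R p"
   using set_Fubini_swap(1)[OF pi] W_growth
  proof (eventually_elim, intro impI, goal_cases)
   case elim: (1 p)
   have J0: "?J p >= 0" by (rule set_integral_nonneg') simp
   have "- 4 - tu >= 0" using tu4 l2 by linarith
   hence R0: "?R p >= 0" using J0 by (intro add_nonneg_nonneg mult_nonneg_nonneg) auto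
   have "(SINT t:?A. (exp t)^2 * nsq (W t p)) <= (SINT t:?A. ?R p)"
   proof (rule set_integral_mono)
    show "sint ?A (%t. (exp t)^2 * nsq (W t p))" using elim by blast
    show "sint ?A (%t. ?R p)"
     by (rule set_integrable_const) auto
    fix t assume t: "t : ?A"
    have "exp t <= exp (tu + ln 2)" using t by simp
    also have "... = 4 * kp * ep" unfolding tu2 using k by simp
    finally have "(exp t)^2 <= (4 * kp * ep)^2" by (intro power_mono) auto
    also have "... = 16 * (kp * ep)^2" by (simp add: power_mult_distrib)
    finally have E: "(exp t)^2 <= 16 * (kp * ep)^2" .
    have "nsq (W t p) <= 2 * nsq (W (-4) p) + 2 * (-4 - t) * ?J p" using elim(2,5) t tu4 by auto
    also have "... <= 2 * nsq (W (-4) p) + 2 * (-4 - tu) * ?J p"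
     using t J0 by (intro add_left_mono mult_right_mono) auto
    finally have "(exp t)^2 * nsq (W t p) <= 16 * (kp * ep)^2 * (2 * nsq (W (-4) p) + 2 * (-4 - tu) * ?J p)"
     using E by (intro mult_mono) auto
    also have "... = ?R p" by (simp add: distrib_left)
    finally show "(exp t)^2 * nsq (W t p) <= ?R p" .
   qed
   also have "... = ln 2 * ?R p" using l2 by (simp add: int_def)
   also have "... <= 1 * ?R p" using R0 l2 by (intro mult_right_mono) auto
   finally show ?case by simp
  qed
 qed
 also have "... = 32 * (kp * ep)^2 * w4 + 32 * (kp * ep)^2 * (- 4 - tu) * Et"
 proof (subst set_integral_add(2))
  show "sint Dm (%p. 32 * (kp * ep)^2 * nsq (W (-4) p))" "sint Dm (%p. 32 * (kp * ep)^2 * (- 4 - tu) * ?J p)"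
   by (intro set_integrable_mult_right w4_integrable set_Fubini_swap(2)[OF inner(1)])+
 qed (simp only: set_integral_mult_right set_Fubini_swap(3)[OF inner(1)] w4_def Et_def)
 also have "... = kp^2 * (32 * ep^2 * (w4 + (- 4 - tu) * Et))" by (simp add: power_mult_distrib algebra_simps)
 finally have "kp^2 * (SINT x:?Q. nsq (Ph x)) <= kp^2 * (32 * ep^2 * (w4 + (- 4 - tu) * Et))"
  by (simp only: set_integral_mult_right)
 moreover have "0 < kp^2" using kp by simp
 ultimately show ?thesis unfolding tu_def by (simp only: mult_le_cancel_left_pos)
qed

text \<open>The axis, a null set, divides the region. Below it lies the cavity; above it
  \<open>u2\<close> is \<open>Ph2\<close> plus the vertical derivative of G, which is at most 2 kp
  on a box of area 3 ep^2.\<close>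

lemma aperture_energy:
 assumes s: "0 < s" "s <= d"
 shows "(SINT x:box (pt 0 (- s)) (pt ep (3 * ep)). nsq (u2 x)) <= (SINT x:cav. nsq (u2 x)) + (2 * (Et + Ep) + 24 * kp^2 * ep^2)"
  and "sint (box (pt 0 (- s)) (pt ep (3 * ep))) (%x. nsq (u2 x))"
proof -
 let ?B = "box (pt 0 (- s)) (pt ep (3 * ep)) :: (real^2) set" and ?Q = "box (pt 0 0) (pt ep (3 * ep)) :: (real^2) set"
 have BO: "?B \<subseteq> Om \<inter> ball 0 (4 * ep + d)"
 proof
  fix z assume "z : ?B"
  hence z: "0 < z $ 1" "z $ 1 < ep" "- s < z $ 2" "z $ 2 < 3 * ep" by (auto simp: in_open_box)
  have "norm z <= \<bar>z $ 1\<bar> + \<bar>z $ 2\<bar>" unfolding norm_pt by (rule sqrt_sum_squares_le_sum_abs)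
  thus "z : Om \<inter> ball 0 (4 * ep + d)" using z s eps by (auto simp: Om_iff)
 qed
 have QB: "?Q \<subseteq> ?B" using s by (auto simp: in_open_box)
 show Bi: "sint ?B (%x. nsq (u2 x))" by (rule set_integrable_subset[OF energy(3) _ BO]) simp
 have Qi: "sint ?Q (%x. nsq (u2 x))" by (rule set_integrable_subset[OF Bi _ QB]) simp
 have Qp: "sint ?Q (%x. nsq (Ph2 x))"
  by (rule set_integrable_subset[OF set_integrable_subset[OF Ph_energy(3) _ BO] _ QB]) simp_all
 have Qc: "sint ?Q (%_. c)" "(SINT x:?Q. c) = c * (3 * ep^2)" for c :: real
  using box_const[of 0 ep 0 "3 * ep" c] eps by (simp_all add: power2_eq_square)
 have "(SINT x:?B. nsq (u2 x)) <= (LINT x|lborel. ind cav x *R (nsq (u2 x)) + ind ?Q x *R (nsq (u2 x)))"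
  unfolding int_def
 proof (rule integral_mono_AE)
  show "AE x in lborel. ind ?B x *R (nsq (u2 x)) <= ind cav x *R (nsq (u2 x)) + ind ?Q x *R (nsq (u2 x))"
   using axis_null
  proof eventually_elim
   case (elim x)
   hence "x : ?B ==> x : cav \<or> x : ?Q" using s by (auto simp: in_open_box cav_iff)
   thus ?case by (auto simp: indicator_def)
  qed
 qed (use Bi Qi cav_energy(3) in \<open>simp_all add: sint_def\<close>)
 also have "... = (SINT x:cav. nsq (u2 x)) + (SINT x:?Q. nsq (u2 x))"
  using Qi cav_energy(3) by (simp add: sint_def int_def)
 also have "(SINT x:?Q. nsq (u2 x)) <= (SINT x:?Q. 2 * nsq (Ph2 x) + 8 * kp^2)"
 proof (rule set_integral_mono[OF Qi set_integral_add(1)[OF set_integrable_mult_right[OF Qp] Qc(1)]])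
  fix x assume "x : ?Q"
  hence x: "x : up" by (simp add: in_open_box up_iff)
  have "u2 x = Ph2 x + h2 x" by (simp add: Ph2_def)
  moreover have "nsq (h2 x) <= (2 * kp)^2" unfolding h_up(3)[OF x] by (intro power_mono gw_bounds[OF kp]) simp
  ultimately show "nsq (u2 x) <= 2 * nsq (Ph2 x) + 8 * kp^2"
   using sq_add[of "Ph2 x" "h2 x"] by (simp add: power_mult_distrib)
 qed
 also have "(SINT x:?Q. 2 * nsq (Ph2 x) + 8 * kp^2) = 2 * (SINT x:?Q. nsq (Ph2 x)) + 8 * kp^2 * (3 * ep^2)"
  unfolding set_integral_add(2)[OF set_integrable_mult_right[OF Qp] Qc(1)] Qc(2) set_integral_mult_right by simp
 also have "... <= 2 * (Et + Ep) + 24 * kp^2 * ep^2" using upper_box_energy by simp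
 finally show "(SINT x:?B. nsq (u2 x)) <= (SINT x:cav. nsq (u2 x)) + (2 * (Et + Ep) + 24 * kp^2 * ep^2)" by simp
qed

lemma interval_const:
 fixes a b c :: real assumes "a <= b"
 shows "sint {a<..<b} (%_. c)" "(SINT x:{a<..<b}. c) = c * (b - a)"
 using set_integrable_const[of "{a<..<b}" c] assms by simp_all

text \<open>On a vertical segment from height z in (-s, 0) to height y in (2 ep, 3 ep) one has 1 <=
  |G| <= |Ph (y)| + |u (z)| + |u (y) - u (z)|, the last controlled by the energy of the segment.
  Squaring and integrating over y, z and the horizontal coordinate gives the claim, the factors 3
  coming from the square of three terms.\<close>

lemma trace_inequality:
 assumes s: "0 < s" "s <= d"
 shows "s * ep^2 <= 3 * s * (SINT x:box (pt 0 (2 * ep)) (pt ep (3 * ep)). nsq (Ph x))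
   + 3 * ep * (SINT x:cav. nsq (u x))
   + 3 * s * ep * (3 * ep + s) * (SINT x:box (pt 0 (- s)) (pt ep (3 * ep)). nsq (u2 x))"
proof -
 let ?X = "{0<..<ep}" and ?Y = "{2 * ep<..<3 * ep}" and ?Z = "{- s<..<0}" and ?T = "{- s<..<3 * ep}"
 let ?Q = "box (pt 0 (2 * ep)) (pt ep (3 * ep)) :: (real^2) set" and ?Cv = "box (pt 0 (- s)) (pt ep 0) :: (real^2) set" and ?B = "box (pt 0 (- s)) (pt ep (3 * ep)) :: (real^2) set"
 have QO: "?Q \<subseteq> Om \<inter> ball 0 (4 * ep)" using norm_le_box eps by (auto simp: in_open_box Om_iff)
 have BO: "?B \<subseteq> Om" using s by (auto simp: in_open_box Om_iff)
 have B0: "?Cv \<subseteq> cav" using s by (auto simp: in_open_box cav_iff)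
 have Qi: "sint ?Q (%x. nsq (Ph x))" by (rule set_integrable_subset[OF Ph_energy(1) _ QO]) simp
 have B0i: "sint ?Cv (%x. nsq (u x))" by (rule set_integrable_subset[OF cav_energy(1) _ B0]) simp
 note Bi = aperture_energy(2)[OF s]
 have cQ: "continuous_on ?Q (%x. nsq (Ph x))" by (intro continuous_intros continuous_on_subset[OF Ph_cont(1)]) (use QO in blast)
 have cB0: "continuous_on ?Cv (%x. nsq (u x))" by (intro continuous_intros continuous_on_subset[OF u_cont(1)]) (use B0 subsets(1) in blast)
 have cB: "continuous_on ?B (%x. nsq (u2 x))" by (intro continuous_intros continuous_on_subset[OF u_cont(2)]) (use BO in blast)
 note mQ = set_borel_measurable_open[OF open_box cQ] and mB0 = set_borel_measurable_open[OF open_box cB0] and mB = set_borel_measurable_open[OF open_box cB]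
 note FQ = set_Fubini[of ?X ?Y "%x y. nsq (Ph (pt x y))", OF Qi[unfolded box_pt_iff(1)[OF mQ]]]
 note F0 = set_Fubini[of ?X ?Z "%x y. nsq (u (pt x y))", OF B0i[unfolded box_pt_iff(1)[OF mB0]]]
 note FB = set_Fubini[of ?X ?T "%x y. nsq (u2 (pt x y))", OF Bi[unfolded box_pt_iff(1)[OF mB]]]
 let ?P = "%x. SINT y:?Y. nsq (Ph (pt x y))" and ?U = "%x. SINT y:?Z. nsq (u (pt x y))"
  and ?D = "%x. SINT y:?T. nsq (u2 (pt x y))"
 let ?L = "3 * ep + s"
 let ?rhs = "%x. 3 * s * ?P x + 3 * ep * ?U x + 3 * s * ep * ?L * ?D x"
 have rhsi: "sint ?X ?rhs" by (intro set_integral_add set_integrable_mult_right FQ(2) F0(2) FB(2))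
 have "(SINT x:?X. s * ep) <= (SINT x:?X. ?rhs x)"
 proof (rule set_integral_mono_AE[OF interval_const(1)[OF less_imp_le[OF eps]] rhsi])
  show "AE x\<in>?X in lborel. s * ep <= ?rhs x"
   using FQ(1) F0(1) FB(1)
  proof (eventually_elim, intro impI, goal_cases)
   case elim: (1 x)
   have i: "sint ?Y (%y. nsq (Ph (pt x y)))" "sint ?Z (%y. nsq (u (pt x y)))"
    "sint ?T (%y. nsq (u2 (pt x y)))" using elim by blast+
   have D0: "0 <= ?D x" by (rule set_integral_nonneg') simp
   have pw: "1 <= 3 * nsq (Ph (pt x y)) + (3 * nsq (u (pt x z)) + 3 * (?L * ?D x))" if y: "y : ?Y" and z: "z : ?Z" for y z
   proof -
    have inO: "pt x v : Om" if "v : {z..y}" for v using that z elim(7) s by (auto simp: Om_iff)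
    have dv: "((%v. u (pt x v)) has_vector_derivative u2 (pt x v)) (at v)" if "v : {z..y}" for v
     by (rule grad_at_line(2)[OF u_grad(1)[OF inO[OF that]]])
    have cv: "continuous_on {z..y} (%v. u2 (pt x v))"
     by (rule continuous_on_compose2[OF u_cont(2)]) (use inO in \<open>auto intro!: continuous_intros\<close>)
    have "nsq (u (pt x y) - u (pt x z)) <= (y - z) * ?D x"
     by (rule sq_increment_open[where f = "%v. u (pt x v)" and f' = "%v. u2 (pt x v)", OF dv cv _ _ i(3)]) (use y z eps in auto)
    also have "... <= ?L * ?D x" using y z D0 by (intro mult_right_mono) auto
    finally have 1: "nsq (u (pt x y) - u (pt x z)) <= ?L * ?D x" .
    have yu: "pt x y : up" using y eps by (simp add: up_iff)
    have "kp * \<bar>pt x y $ 2\<bar> <= 1"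
    proof -
     have "kp * y <= kp * (3 * ep)" using y kp by (intro mult_left_mono) auto
     also have "... <= 1" using small_facts(4) by simp
     finally show ?thesis using y eps by simp
    qed
    hence "1 <= cmod (gw kp th (pt x y))" by (rule gw_bounds(5)[OF kp])
    moreover have "gw kp th (pt x y) = (u (pt x y) - u (pt x z)) + u (pt x z) - Ph (pt x y)"
     using h_up(1)[OF yu] by (simp add: Ph_def)
    ultimately have "1 <= cmod (u (pt x y) - u (pt x z)) + cmod (u (pt x z)) + cmod (Ph (pt x y))"
     by (smt (verit) norm_triangle_ineq norm_triangle_ineq4)
    moreover have "1 <= 3 * c^2 + (3 * b^2 + 3 * a^2)" if "1 <= a + b + c" for a b c :: real
    proof -
     have "1^2 <= (a + b + c)^2" using that by (intro power_mono) auto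
     moreover have "0 <= (a - b)^2" "0 <= (b - c)^2" "0 <= (a - c)^2" by simp_all
     ultimately show ?thesis by (simp add: power2_eq_square algebra_simps)
    qed
    ultimately have "1 <= 3 * nsq (Ph (pt x y)) + (3 * nsq (u (pt x z)) + 3 * nsq (u (pt x y) - u (pt x z)))" by blast
    thus ?thesis using 1 by linarith
   qed
   have py: "ep <= 3 * ?P x + (3 * nsq (u (pt x z)) + 3 * (?L * ?D x)) * ep" if z: "z : ?Z" for z
   proof -
    let ?c = "3 * nsq (u (pt x z)) + 3 * (?L * ?D x)"
    have e: "2 * ep <= 3 * ep" using eps by simp
    note ic = interval_const[OF e]
    have "(SINT y:?Y. 1) <= (SINT y:?Y. 3 * nsq (Ph (pt x y)) + ?c)"
     by (rule set_integral_mono[OF ic(1) set_integral_add(1)[OF set_integrable_mult_right[OF i(1)] ic(1)]]) (rule pw[OF _ z])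
    thus ?thesis
     unfolding set_integral_add(2)[OF set_integrable_mult_right[OF i(1)] ic(1)] ic(2) set_integral_mult_right by simp
   qed
   have e: "- s <= 0" using s by simp
   note ic = interval_const[OF e]
   have iz: "sint ?Z (%z. 3 * ep * nsq (u (pt x z)))" by (intro set_integrable_mult_right i)
   have "(SINT z:?Z. ep) <= (SINT z:?Z. 3 * ep * nsq (u (pt x z)) + (3 * ?P x + 3 * (?L * ?D x) * ep))"
   proof (rule set_integral_mono[OF ic(1) set_integral_add(1)[OF iz ic(1)]])
    fix z assume "z : ?Z"
    from py[OF this] show "ep <= 3 * ep * nsq (u (pt x z)) + (3 * ?P x + 3 * (?L * ?D x) * ep)"
     by (simp add: algebra_simps)
   qed
   hence "ep * s <= 3 * ep * ?U x + (3 * ?P x + 3 * (?L * ?D x) * ep) * s"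
    unfolding set_integral_add(2)[OF iz ic(1)] ic(2) set_integral_mult_right by simp
   thus ?case by (simp add: algebra_simps)
  qed
 qed
 moreover have "(SINT x:?X. s * ep) = s * ep^2"
  using interval_const(2)[of 0 ep "s * ep"] eps by (simp add: power2_eq_square)
 moreover have "(SINT x:?X. ?rhs x) = 3 * s * (SINT x:?Q. nsq (Ph x)) + 3 * ep * (SINT x:?Cv. nsq (u x)) + 3 * s * ep * ?L * (SINT x:?B. nsq (u2 x))"
 proof -
  note a = set_integrable_mult_right[OF FQ(2), of "3 * s"] set_integrable_mult_right[OF F0(2), of "3 * ep"] set_integrable_mult_right[OF FB(2), of "3 * s * ep * ?L"]
  show ?thesis
   unfolding set_integral_add(2)[OF set_integral_add(1)[OF a(1,2)] a(3)] set_integral_add(2)[OF a(1,2)] set_integral_mult_right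
    FQ(3) F0(3) FB(3) box_pt_iff(2)[OF mQ] box_pt_iff(2)[OF mB0] box_pt_iff(2)[OF mB] ..
 qed
 moreover have "(SINT x:?Cv. nsq (u x)) <= (SINT x:cav. nsq (u x))"
  by (rule set_integral_mono_subset[OF B0i cav_energy(1) B0]) simp_all
 hence "3 * ep * (SINT x:?Cv. nsq (u x)) <= 3 * ep * (SINT x:cav. nsq (u x))"
  using eps by (intro mult_left_mono) auto
 ultimately show ?thesis by linarith
qed

end

section \<open>Absolute constants and the two-sided bounds in the cavity\<close>

definition C0 :: real where "C0 = 288 * energy_const^2"
text \<open>Fixes s = et0 * d in \<open>trace_inequality\<close>: the energy term is then at most
  \<open>6 * et0 * (4 * C0 + 33)\<close>, that is 1/4, of the left side.\<close>

definition et0 :: real where "et0 = 1 / (24 * (4 * C0 + 33))"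

lemma C0_pos: "0 < C0" "0 < et0" "et0 <= 1"
proof -
 show c: "0 < C0" unfolding C0_def using energy_const_ge by (simp add: zero_less_mult_iff)
 thus "0 < et0" "et0 <= 1" by (simp_all add: et0_def divide_le_eq)
qed

text \<open>For the lower bounds, two terms of \<open>trace_inequality\<close> take a quarter of its
  left side each, and the remaining half bounds the mass of u from below by a multiple of ep d
  because s is proportional to d. The Poincare inequality for u converts this into gradient energy
  of order ep / d.\<close>

theorem (in thin_cavity) cavity_bounds:
 assumes e1: "3 * ep <= et0 * d" and e2: "384 * (- 3 - ln (2 * kp * ep)) * C0 * (ep / d) <= 1"
 shows "et0 / 6 * (ep * d) <= (SINT x:cav. nsq (u x))" "(SINT x:cav. nsq (u x)) <= (2 * C0 + 34) * (ep * d)"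
  "et0 / 6 * (ep / d) <= (SINT x:cav. nsq (u1 x) + nsq (u2 x))"
  "(SINT x:cav. nsq (u1 x) + nsq (u2 x)) <= (2 * C0 + 34) * (ep / d)"
proof -
 let ?X = "ep / d"
 have X: "0 < ?X" using eps d by simp
 note E = energy_bound[folded C0_def]
 have Etp: "Et <= C0 * ?X" using E(2) nonneg(4) by linarith
 have Xd: "d^2 * ?X = ep * d" using d by (simp add: power2_eq_square)
 have "M <= d^2 * (C0 * ?X)" using M_le mult_left_mono[OF E(1), of "d^2"] by simp
 hence Mb: "M <= C0 * (ep * d)" using Xd by (simp only: mult.left_commute)
 have ed: "0 < ep * d" using eps d by simp
 show "(SINT x:cav. nsq (u x)) <= (2 * C0 + 34) * (ep * d)"
  using cav_upper(1) Mb ed by (simp add: distrib_right)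
 have gr: "(SINT x:cav. nsq (u1 x) + nsq (u2 x)) = (SINT x:cav. nsq (u1 x)) + (SINT x:cav. nsq (u2 x))"
  by (rule set_integral_add(2)[OF cav_energy(2,3)])
 show "(SINT x:cav. nsq (u1 x) + nsq (u2 x)) <= (2 * C0 + 34) * ?X"
  unfolding gr using cav_upper(2,3) E(1) unfolding K_def by (simp only: distrib_right; linarith)
 define s where "s = et0 * d"
 have s: "0 < s" "s <= d" "3 * ep <= s" using C0_pos d e1 by (simp_all add: s_def mult_le_cancel_right1)
 let ?IQ = "SINT x:box (pt 0 (2 * ep)) (pt ep (3 * ep)). nsq (Ph x)"
 let ?IU = "SINT x:cav. nsq (u x)"
 let ?IB = "SINT x:box (pt 0 (- s)) (pt ep (3 * ep)). nsq (u2 x)"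
 have se: "0 < s * ep^2" using s eps by simp
 \<comment> \<open>384 = 32 * 12: the factor 32 is that of \<open>upper_box_mass\<close>, and the
   claim amounts to an integral of at most ep^2 / 12. The summand -3 instead of -4 in
   \<open>e2\<close> accounts for \<open>w4\<close>.\<close>
 have IQ: "3 * s * ?IQ <= s * ep^2 / 4"
 proof -
  have l: "- 4 - ln (2 * kp * ep) >= 0"
  proof -
   have k: "0 < kp * ep" using kp eps by simp
   have "2 * kp * ep < exp (-4)" using near_aperture k by simp
   moreover have "0 < 2 * kp * ep" using kp eps by simp
   ultimately have "ln (2 * kp * ep) < ln (exp (-4))" using ln_less_cancel_iff[OF _ exp_gt_zero] by blast
   thus ?thesis by simp
  qed
  have "w4 + (- 4 - ln (2 * kp * ep)) * Et <= C0 * ?X + (- 4 - ln (2 * kp * ep)) * (C0 * ?X)"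
   by (intro add_mono E(3) mult_left_mono Etp l)
  also have "... = (- 3 - ln (2 * kp * ep)) * C0 * ?X" by (simp add: algebra_simps)
  also have "... <= 1 / 384"
  proof -
   have "y <= 1 / 384" if "384 * y <= 1" for y :: real using that by simp
   from this[OF e2[unfolded mult.assoc]] show ?thesis unfolding mult.assoc .
  qed
  finally have "32 * ep^2 * (w4 + (- 4 - ln (2 * kp * ep)) * Et) <= 32 * ep^2 * (1 / 384)" by (intro mult_left_mono) auto
  hence "?IQ <= ep^2 / 12" using upper_box_mass by simp
  hence "3 * s * ?IQ <= 3 * s * (ep^2 / 12)" using s by (intro mult_left_mono) auto
  thus ?thesis by simp
 qed
 have IB: "?IB <= (4 * C0 + 33) * ?X"
 proof -
  have "24 * kp^2 * ep^2 <= ?X"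
  proof -
   have "24 * ((kp * d) * (kp * ep)) <= 24 * (1/8 * (1/400))"
    using small_facts(3,4) kp d eps by (intro mult_left_mono mult_mono) auto
   also have "24 * (1/8 * (1/400)) <= (1 :: real)" by simp
   finally have "24 * ((kp * d) * (kp * ep)) * ?X <= 1 * ?X" by (rule mult_right_mono) (rule less_imp_le[OF X])
   moreover have "24 * ((kp * d) * (kp * ep)) * ?X = 24 * kp^2 * ep^2" using d by (simp add: power2_eq_square)
   ultimately show ?thesis by simp
  qed
  moreover have "(SINT x:cav. nsq (u2 x)) <= 2 * (C0 * ?X) + 32 * ?X"
  proof -
   have "0 <= (SINT x:cav. nsq (Ph1 x))"
    by (rule set_integral_nonneg') simp
   thus ?thesis using cav_upper(3) E(1) unfolding K_def by linarith
  qed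
  moreover have "b <= (4 * c + 33) * x" if "k <= x" "q <= 2 * (c * x) + 32 * x" "b <= q + (2 * e + k)" "e <= c * x" for b c x k q e :: real
   using that by (simp add: algebra_simps)
  ultimately show ?thesis using aperture_energy(1)[OF s(1,2)] E(2) by blast
 qed
 have IB2: "3 * s * ep * (3 * ep + s) * ?IB <= s * ep^2 / 4"
 proof -
  have "3 * s * ep * (3 * ep + s) * ?IB <= 3 * s * ep * (2 * s) * ((4 * C0 + 33) * ?X)"
  proof (intro mult_mono IB mult_left_mono)
   show "0 <= ?IB" by (rule set_integral_nonneg') simp
  qed (use s eps C0_pos in auto)
  also have "... = s * ep^2 * (6 * (et0 * (4 * C0 + 33)))" using d by (simp add: s_def power2_eq_square)
  also have "et0 * (4 * C0 + 33) = 1 / 24" using C0_pos(1) by (simp add: et0_def)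
  finally show ?thesis by simp
 qed
 have "a <= 2 * y" if "a <= q + y + b" "q <= a / 4" "b <= a / 4" for a q y b :: real using that by argo
 from this[OF trace_inequality[OF s(1,2)] IQ IB2] have "s * ep^2 <= 2 * (3 * ep * ?IU)" .
 hence "ep * (s * ep) <= ep * (6 * ?IU)" by (simp add: power2_eq_square algebra_simps)
 hence "s * ep <= 6 * ?IU" using eps by (simp only: mult_le_cancel_left_pos)
 thus lo: "et0 / 6 * (ep * d) <= ?IU" by (simp add: s_def mult_ac)
 have "et0 / 6 * (ep * d) <= d^2 * (SINT x:cav. nsq (u2 x))" using lo poincare_u by linarith
 hence "d^2 * (et0 / 6 * ?X) <= d^2 * (SINT x:cav. nsq (u2 x))"
  unfolding mult.left_commute[of "d^2" "et0 / 6"] Xd .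
 moreover have "0 < d^2" using d by simp
 ultimately have "et0 / 6 * ?X <= (SINT x:cav. nsq (u2 x))" by (simp only: mult_le_cancel_left_pos)
 moreover have "0 <= (SINT x:cav. nsq (u1 x))"
  by (rule set_integral_nonneg') simp
 ultimately show "et0 / 6 * ?X <= (SINT x:cav. nsq (u1 x) + nsq (u2 x))" unfolding gr by linarith
qed

section \<open>The enhancement factors\<close>

lemma norm_vec3: "(norm (vector [a, b, c] :: complex^3))^2 = nsq a + nsq b + nsq c"
 unfolding norm_vec_def L2_set_def by (simp add: sum_3 vector_3)

lemma L2_H_field: "L2_norm_on S (H_field u) = sqrt (SINT x:S. nsq (u x))"
 unfolding L2_norm_on_def H_field_def norm_vec3 by simp

lemma planar_curl_H_field: "planar_curl (H_field u) x = vector [partial 2 u x, - partial 1 u x, 0]"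
proof -
 have "(%y. H_field u y $ 3) = u" "(%y. H_field u y $ 2) = (%_. 0)" "(%y. H_field u y $ 1) = (%_. 0)"
  by (simp_all add: H_field_def fun_eq_iff vector_3)
 moreover have "dir_deriv (%_. 0) v x = 0" for v by (simp add: dir_deriv_def)
 ultimately show ?thesis unfolding planar_curl_def by simp
qed

text \<open>The electric field is a constant times the gradient rotated by a right angle; the
  constant cancels in \<open>Q_E\<close>.\<close>

lemma L2_E_field:
 "L2_norm_on S (E_field cu et u) = cmod (1 / (- \<i> * complex_of_real (cu * et))) * sqrt (SINT x:S. nsq (partial 1 u x) + nsq (partial 2 u x))"
proof -
 let ?c = "1 / (- \<i> * complex_of_real (cu * et))"
 have "(norm (E_field cu et u x))^2 = nsq ?c * (nsq (partial 1 u x) + nsq (partial 2 u x))" for x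
 proof -
  have "E_field cu et u x = vector [?c * partial 2 u x, ?c * (- partial 1 u x), ?c * 0]"
   unfolding E_field_def planar_curl_H_field by (simp add: vec_eq_iff forall_3 vector_3)
  thus ?thesis by (simp only: norm_vec3 norm_mult) (simp add: power_mult_distrib algebra_simps)
 qed
 thus ?thesis
  unfolding L2_norm_on_def by (simp only: set_integral_mult_right real_sqrt_mult real_sqrt_abs abs_norm_cancel)
qed

lemma u_inc_partial: "partial 1 (u_inc kp th) x = \<i> * of_real (kp * sin th) * u_inc kp th x"
 "partial 2 (u_inc kp th) x = \<i> * of_real (- (kp * cos th)) * u_inc kp th x"
 unfolding u_inc_pw by (rule partial_grad[OF pw_grad])+

lemma u_inc_grad_sq: "nsq (partial 1 (u_inc kp th) x) + nsq (partial 2 (u_inc kp th) x) = kp^2"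
proof -
 have "cmod (u_inc kp th x) = 1" unfolding u_inc_pw by (rule norm_pw)
 hence "nsq (partial 1 (u_inc kp th) x) + nsq (partial 2 (u_inc kp th) x) = (kp * sin th)^2 + (kp * cos th)^2"
  unfolding u_inc_partial norm_mult norm_of_real norm_ii by (simp add: power_mult_distrib)
 also have "... = kp^2 * ((sin th)^2 + (cos th)^2)" by (simp only: power_mult_distrib distrib_left)
 finally show ?thesis by (simp only: sin_cos_squared_add mult_1_right)
qed

text \<open>Since |u_inc| = 1 and |grad u_inc| = kp, the incident norms squared are ep d and kp^2 ep
  d. The first matches the size of the mass of u; against the gradient energy of order ep / d the
  second leaves 1 / (kp d).\<close>

lemma (in thin_cavity) enhancement_bounds:
 assumes e: "3 * ep <= et0 * d" "384 * (- 3 - ln (2 * kp * ep)) * C0 * (ep / d) <= 1" and pos: "0 < cu" "0 < et"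
 shows "sqrt (et0 / 6) <= Q_H ep d kp th u" "Q_H ep d kp th u <= sqrt (2 * C0 + 34)"
  "sqrt (et0 / 6) / (kp * d) <= Q_E cu et ep d kp th u" "Q_E cu et ep d kp th u <= sqrt (2 * C0 + 34) / (kp * d)"
proof -
 note B = cavity_bounds[OF e]
 let ?IU = "SINT x:cav. nsq (u x)" and ?IG = "SINT x:cav. nsq (u1 x) + nsq (u2 x)"
 have ed: "0 < ep * d" using eps d by simp
 have H: "Q_H ep d kp th u = sqrt (?IU / (ep * d))"
 proof -
  have "cmod (u_inc kp th x) = 1" for x unfolding u_inc_pw by (rule norm_pw)
  thus ?thesis unfolding Q_H_def L2_H_field by (simp add: cav_const(2) real_sqrt_divide)
 qed
 show "sqrt (et0 / 6) <= Q_H ep d kp th u" "Q_H ep d kp th u <= sqrt (2 * C0 + 34)"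
  unfolding H real_sqrt_le_iff pos_le_divide_eq[OF ed] pos_divide_le_eq[OF ed] by (rule B)+
 have X: "0 < ep / d" and kd: "0 < kp * d" using eps d kp by simp_all
 have E: "Q_E cu et ep d kp th u = sqrt (?IG / (ep / d)) / (kp * d)"
 proof -
  have c: "cmod (1 / (- \<i> * complex_of_real (cu * et))) ~= 0" using pos by simp
  have "Q_E cu et ep d kp th u = sqrt ?IG / sqrt (kp^2 * (ep * d))"
   unfolding Q_E_def L2_E_field u_inc_grad_sq cav_const(2) using c by (rule mult_divide_mult_cancel_left)
  also have "... = sqrt (?IG / (kp^2 * (ep * d)))" by (simp only: real_sqrt_divide)
  also have "?IG / (kp^2 * (ep * d)) = ?IG / (ep / d) / (kp * d)^2" using d by (simp add: power2_eq_square)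
  also have "sqrt (?IG / (ep / d) / (kp * d)^2) = sqrt (?IG / (ep / d)) / (kp * d)"
   unfolding real_sqrt_divide[of _ "(kp * d)^2"] real_sqrt_abs abs_of_pos[OF kd] ..
  finally show ?thesis .
 qed
 show "sqrt (et0 / 6) / (kp * d) <= Q_E cu et ep d kp th u" "Q_E cu et ep d kp th u <= sqrt (2 * C0 + 34) / (kp * d)"
  unfolding E by (intro divide_right_mono less_imp_le[OF kd]; unfold real_sqrt_le_iff pos_le_divide_eq[OF X] pos_divide_le_eq[OF X]; rule B)+
qed

text \<open>ep ln ep tends to 0 with ep for fixed kp and d, so the logarithmic loss near the
  aperture is eventually harmless.\<close>

lemma threshold_exists:
 fixes kp d :: real
 assumes "0 < kp" "0 < d"
 shows "\<exists>ep\<^sub>0>0. \<forall>ep. 0 < ep \<and> ep < ep\<^sub>0 \<longrightarrow> kp * ep <= exp (-2) / 100 \<and> 3 * ep <= et0 * d \<and> 384 * (- 3 - ln (2 * kp * ep)) * C0 * (ep / d) <= 1"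
proof -
 have l: "((%ep. (- 3 - ln (2 * kp * ep)) * ep) \<longlongrightarrow> 0) (at_right 0)" using assms by real_asymp
 from tendsto_mult[OF this tendsto_const[of "384 * C0 / d"]]
 have "((%ep. 384 * (- 3 - ln (2 * kp * ep)) * C0 * (ep / d)) \<longlongrightarrow> 0) (at_right 0)" by (simp add: mult_ac)
 hence "\<forall>\<^sub>F ep in at_right 0. 384 * (- 3 - ln (2 * kp * ep)) * C0 * (ep / d) < 1" by (rule order_tendstoD) simp
 then obtain b where b: "b > 0" "!!ep. 0 < ep ==> ep < b ==> 384 * (- 3 - ln (2 * kp * ep)) * C0 * (ep / d) < 1"
  unfolding eventually_at_right_field by auto
 define e where "e = min b (min (exp (-2) / 100 / kp) (et0 * d / 3))"
 have "e > 0" using b(1) assms C0_pos by (simp add: e_def)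
 moreover have "kp * ep <= exp (-2) / 100 \<and> 3 * ep <= et0 * d \<and> 384 * (- 3 - ln (2 * kp * ep)) * C0 * (ep / d) <= 1"
  if ep: "0 < ep" "ep < e" for ep
 proof (intro conjI)
  have "ep <= exp (-2) / 100 / kp" using ep by (simp add: e_def)
  thus "kp * ep <= exp (-2) / 100" using assms(1) by (simp add: pos_le_divide_eq mult.commute)
  show "3 * ep <= et0 * d" using ep by (simp add: e_def)
  show "384 * (- 3 - ln (2 * kp * ep)) * C0 * (ep / d) <= 1" using b(2)[OF ep(1)] ep(2) by (simp add: e_def less_imp_le)
 qed
 ultimately show ?thesis by blast
qed

theorem theorem2p8:
  "\<exists>\<delta>>0. \<exists>C\<^sub>1>0. \<exists>C\<^sub>2>0. \<forall>\<kappa>>0. \<forall>d>0. d / wavelength \<kappa> < \<delta> \<longrightarrow>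
     (\<exists>\<epsilon>\<^sub>0>0. \<forall>\<epsilon>. 0 < \<epsilon> \<and> \<epsilon> < \<epsilon>\<^sub>0 \<longrightarrow>
       (\<forall>\<theta> \<omega> \<eta> u. - pi / 2 < \<theta> \<and> \<theta> < pi / 2 \<and> 0 < \<omega> \<and> 0 < \<eta> \<and> pec_pmc_solution \<epsilon> d \<kappa> \<theta> u \<longrightarrow>
          C\<^sub>1 * (wavelength \<kappa> / d) \<le> Q_E \<omega> \<eta> \<epsilon> d \<kappa> \<theta> u \<and>
          Q_E \<omega> \<eta> \<epsilon> d \<kappa> \<theta> u \<le> C\<^sub>2 * (wavelength \<kappa> / d) \<and>
          C\<^sub>1 \<le> Q_H \<epsilon> d \<kappa> \<theta> u \<and>
          Q_H \<epsilon> d \<kappa> \<theta> u \<le> C\<^sub>2))"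
proof -
 define c1 where "c1 = sqrt (et0 / 6)"
 define c2 where "c2 = sqrt (2 * C0 + 34)"
 have c: "0 < c1" "0 < c2" using C0_pos by (simp_all add: c1_def c2_def)
 \<comment> \<open>1 / (kp d) is wavelength / d divided by 2 pi. One pair of constants has to serve
   both factors, so the lower one is divided by 2 pi and the upper one is kept.\<close>
 have pi1: "1 <= 2 * pi" using pi_ge_two by simp
 \<comment> \<open>d / wavelength is kp d / (2 pi), so the threshold
   \<open>exp (-2) / (4 * pi)\<close> is the bound \<open>exp (-2) / 2\<close> on kp d in
   \<open>thin_cavity\<close>.\<close>
 have main: "c1 / (2 * pi) * (wavelength \<kappa> / d) <= Q_E \<omega> \<eta> \<epsilon> d \<kappa> \<theta> u \<and> Q_E \<omega> \<eta> \<epsilon> d \<kappa> \<theta> u <= c2 * (wavelength \<kappa> / d)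
   \<and> c1 / (2 * pi) <= Q_H \<epsilon> d \<kappa> \<theta> u \<and> Q_H \<epsilon> d \<kappa> \<theta> u <= c2"
  if "0 < \<kappa>" "0 < d" and dl: "d / wavelength \<kappa> < exp (-2) / (4 * pi)" and \<epsilon>: "0 < \<epsilon>"
   and th: "\<kappa> * \<epsilon> <= exp (-2) / 100 \<and> 3 * \<epsilon> <= et0 * d \<and> 384 * (- 3 - ln (2 * \<kappa> * \<epsilon>)) * C0 * (\<epsilon> / d) <= 1"
   and pos: "0 < \<omega>" "0 < \<eta>" and sol: "pec_pmc_solution \<epsilon> d \<kappa> \<theta> u" for \<kappa> d \<epsilon> \<theta> \<omega> \<eta> u
 proof -
  have "d / wavelength \<kappa> = \<kappa> * d / (2 * pi)" by (simp add: wavelength_def mult.commute)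
  hence "\<kappa> * d <= exp (-2) / 2" using dl by (simp add: divide_less_eq)
  then interpret thin_cavity \<epsilon> d \<kappa> \<theta> u
   using that by unfold_locales auto
  note E = enhancement_bounds[OF _ _ pos, folded c1_def c2_def]
  have w: "x / (\<kappa> * d) = x / (2 * pi) * (wavelength \<kappa> / d)" for x
   by (simp add: wavelength_def)
  have "x / (2 * pi) <= x" if "0 < x" for x using that pi1 by (simp add: divide_le_eq mult_le_cancel_left1)
  note le = this[OF c(1)] this[OF c(2)]
  have wp: "0 < wavelength \<kappa> / d" using that by (simp add: wavelength_def)
  have "c2 / (2 * pi) * (wavelength \<kappa> / d) <= c2 * (wavelength \<kappa> / d)" using le(2) wp by (intro mult_right_mono) auto
  thus ?thesis using E[unfolded w] th le(1) by force
 qed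
 have c': "0 < exp (-2) / (4 * pi)" "0 < c1 / (2 * pi)" using c by simp_all
 show ?thesis
 proof (rule exI[of _ "exp (-2) / (4 * pi)"], rule conjI[OF c'(1)], rule exI[of _ "c1 / (2 * pi)"], rule conjI[OF c'(2)],
   rule exI[of _ c2], rule conjI[OF c(2)], intro allI impI)
  fix \<kappa> d :: real assume kd: "0 < \<kappa>" "0 < d" "d / wavelength \<kappa> < exp (-2) / (4 * pi)"
  obtain e where e: "e > 0" "!!\<epsilon>. 0 < \<epsilon> ==> \<epsilon> < e ==> \<kappa> * \<epsilon> <= exp (-2) / 100 \<and> 3 * \<epsilon> <= et0 * d \<and> 384 * (- 3 - ln (2 * \<kappa> * \<epsilon>)) * C0 * (\<epsilon> / d) <= 1"
   using threshold_exists[OF kd(1,2)] by blast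
  show "\<exists>\<epsilon>\<^sub>0>0. \<forall>\<epsilon>. 0 < \<epsilon> \<and> \<epsilon> < \<epsilon>\<^sub>0 \<longrightarrow>
    (\<forall>\<theta> \<omega> \<eta> u. - pi / 2 < \<theta> \<and> \<theta> < pi / 2 \<and> 0 < \<omega> \<and> 0 < \<eta> \<and> pec_pmc_solution \<epsilon> d \<kappa> \<theta> u \<longrightarrow>
     c1 / (2 * pi) * (wavelength \<kappa> / d) <= Q_E \<omega> \<eta> \<epsilon> d \<kappa> \<theta> u \<and>
     Q_E \<omega> \<eta> \<epsilon> d \<kappa> \<theta> u <= c2 * (wavelength \<kappa> / d) \<and>
     c1 / (2 * pi) <= Q_H \<epsilon> d \<kappa> \<theta> u \<and> Q_H \<epsilon> d \<kappa> \<theta> u <= c2)"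
  proof (rule exI[of _ e], rule conjI[OF e(1)], intro allI impI)
   fix \<epsilon> \<theta> \<omega> \<eta> :: real and u
   assume \<epsilon>: "0 < \<epsilon> \<and> \<epsilon> < e"
    and a: "- pi / 2 < \<theta> \<and> \<theta> < pi / 2 \<and> 0 < \<omega> \<and> 0 < \<eta> \<and> pec_pmc_solution \<epsilon> d \<kappa> \<theta> u"
   show "c1 / (2 * pi) * (wavelength \<kappa> / d) <= Q_E \<omega> \<eta> \<epsilon> d \<kappa> \<theta> u \<and> Q_E \<omega> \<eta> \<epsilon> d \<kappa> \<theta> u <= c2 * (wavelength \<kappa> / d)
    \<and> c1 / (2 * pi) <= Q_H \<epsilon> d \<kappa> \<theta> u \<and> Q_H \<epsilon> d \<kappa> \<theta> u <= c2"
    by (rule main[OF kd]) (use \<epsilon> a e(2) in auto)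
  qed
 qed
qed

end
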